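(* Let $J=(J_t)_{t\ge0}$ be a continuous-time Markov chain on $E=\{1,\dots,N\}$, and let $(X,J)$ be a Markov modulated risk process \[X_t=x+\int_0^t p_{J_u}\,\mathrm d u-\sum_{k=1}^{N_t}C_k-\sum_{T_k\le t}C_k^{(J_{T_k-},J_{T_k})}.\] Here $p_i>0$ are premium rates, $N$ is a Markov modulated Poisson process with intensity $\lambda_i$ while $J=i$, claims arriving while $J=i$ have distribution $F_C^{(i)}$ on $[0,\infty)$, and jumps $i\to j$ of $J$ produce extra claims with distribution $F_C^{(ij)}$ on $[0,\infty)$. Assume the net profit condition $\mathbb E_{0,i}X_1>0$ for all $i\in E$. Let $T^C_0=0<T^C_1<T^C_2<\dots$ be the successive jump epochs of $X$ (claim arrivals and jumps of $J$). Let $J^C_k=J_{T^C_k}$ be the embedded discrete-time Markov chain, with stationary distribution $\pi=(\pi_i)$. Let $\xi_k=X_{T^C_{k-1}}-X_{T^C_k}$. Assume that, conditionally on the past, the law of $\xi_k$ depends only on $J^C_{k-1}=i$, and denote it by $F_\xi^{(i)}$. Assume $F_\xi^{(i)}$ has finite mean $a_i$, and set $\overline a=-\sum_{i\in E}\pi_ia_i$, which is positive. Suppose there exist a distribution $F$ on $\mathbb R$ with finite mean and constants $c_i\ge0$ such that: - (D1) $\overline{F_\xi^{(i)}}(x)\le\overline F(x)$ for all $x\in\mathbb R$ and $i\in E$; - (D2) $\overline{F_\xi^{(i)\mathrm I}}(x)\sim c_i\overline{F^{\mathrm I}}(x)$ as $x\to\infty$, for $i\in E$; - (D3) $F^{\mathrm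 I}\in\mathcal S$. Let $C_S=\sum_{i\in E}c_i\pi_i$. Fix $\zeta>0$ and let \[\tau^\zeta=\inf\{t>0:\ t-\sup\{s<t:X_s\ge0\}\ge\zeta,\ X_t<0\}.\] Then for each $i\in E$, \[\lim_{x\to\infty}\frac{\mathbb P_{x,i}(\tau^\zeta<+\infty)}{\overline{F^{\mathrm I}}(x)}=\frac{C_S}{\overline a}.\]
   Context: $\mathbb P_{x,i}$ denotes the law given $X_0=x$, $J_0=i$. For a distribution $G$ on $\mathbb R$, $\overline G(x)=1-G(x)$. For $G$ with finite mean, the integrated tail distribution $G^{\mathrm I}$ is defined by \[\overline{G^{\mathrm I}}(x)=\min\Big(1,\int_x^\infty\overline G(z)\,\mathrm d z\Big).\] $\mathcal S$ is the class of subexponential distributions: distributions $G$ on $[0,\infty)$ with $\overline{G^{*2}}(x)/\overline G(x)\to2$ as $x\to\infty$, where $G^{*2}$ is the two-fold convolution. The notation $f\sim g$ means $f(x)/g(x)\to1$ as $x\to\infty$. *)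

theory Defs
  imports "HOL-Probability.Probability"
begin

definition ccdf :: "real measure \<Rightarrow> real \<Rightarrow> real" where
  "ccdf G x = measure G {x<..}"

definition int_tail :: "real measure \<Rightarrow> real \<Rightarrow> real" where
  "int_tail G x = min 1 (LBINT z:{x..}. ccdf G z)"

definition int_tail_dist :: "real measure \<Rightarrow> real measure" where
  "int_tail_dist G = interval_measure (\<lambda>x. 1 - int_tail G x)"

definition subexponential :: "real measure \<Rightarrow> bool" where
  "subexponential G \<longleftrightarrow> real_distribution G \<and> measure G {..<0} = 0 \<and>
     ((\<lambda>x. ccdf (G \<star> G) x / ccdf G x) \<longlongrightarrow> 2) at_top"

text \<open>State space E = {1..N}.  From state i the process jumps to j with rate jrate i j:
  for j = i this is a claim arrival of the modulated Poisson process (rate lam i),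
  for j <> i it is a jump of the environment J (rate q i j), accompanied by an extra claim.\<close>
definition jrate :: "(nat \<Rightarrow> nat \<Rightarrow> real) \<Rightarrow> (nat \<Rightarrow> real) \<Rightarrow> nat \<Rightarrow> nat \<Rightarrow> real" where
  "jrate q lam i j = (if i = j then lam i else q i j)"

definition totrate :: "nat \<Rightarrow> (nat \<Rightarrow> nat \<Rightarrow> real) \<Rightarrow> (nat \<Rightarrow> real) \<Rightarrow> nat \<Rightarrow> real" where
  "totrate N q lam i = (\<Sum>j\<in>{1..N}. jrate q lam i j)"

definition emb_prob :: "nat \<Rightarrow> (nat \<Rightarrow> nat \<Rightarrow> real) \<Rightarrow> (nat \<Rightarrow> real) \<Rightarrow> nat \<Rightarrow> nat \<Rightarrow> real" where
  "emb_prob N q lam i j = jrate q lam i j / totrate N q lam i"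

definition claim_dist :: "(nat \<Rightarrow> real measure) \<Rightarrow> (nat \<Rightarrow> nat \<Rightarrow> real measure) \<Rightarrow> nat \<Rightarrow> nat \<Rightarrow> real measure" where
  "claim_dist FC FCJ i j = (if i = j then FC i else FCJ i j)"

text \<open>Skeleton: S k = T^C_k - T^C_(k-1) (k >= 1), Jc k = J^C_k, U k = claim paid at T^C_k (k >= 1).\<close>
definition jump_time :: "(nat \<Rightarrow> 'w \<Rightarrow> real) \<Rightarrow> nat \<Rightarrow> 'w \<Rightarrow> real" where
  "jump_time S k \<omega> = (\<Sum>m\<in>{1..k}. S m \<omega>)"

definition njumps :: "(nat \<Rightarrow> 'w \<Rightarrow> real) \<Rightarrow> real \<Rightarrow> 'w \<Rightarrow> nat" where
  "njumps S t \<omega> = card {k. 1 \<le> k \<and> jump_time S k \<omega> \<le> t}"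

definition Jproc :: "(nat \<Rightarrow> 'w \<Rightarrow> nat) \<Rightarrow> (nat \<Rightarrow> 'w \<Rightarrow> real) \<Rightarrow> real \<Rightarrow> 'w \<Rightarrow> nat" where
  "Jproc Jc S t \<omega> = Jc (njumps S t \<omega>) \<omega>"

definition Xproc :: "(nat \<Rightarrow> real) \<Rightarrow> (nat \<Rightarrow> 'w \<Rightarrow> nat) \<Rightarrow> (nat \<Rightarrow> 'w \<Rightarrow> real) \<Rightarrow>
    (nat \<Rightarrow> 'w \<Rightarrow> real) \<Rightarrow> real \<Rightarrow> real \<Rightarrow> 'w \<Rightarrow> real" where
  "Xproc p Jc S U x t \<omega> =
     x + integral {0..t} (\<lambda>u. p (Jproc Jc S u \<omega>)) - (\<Sum>k\<in>{1..njumps S t \<omega>}. U k \<omega>)"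

definition xi :: "(nat \<Rightarrow> real) \<Rightarrow> (nat \<Rightarrow> 'w \<Rightarrow> nat) \<Rightarrow> (nat \<Rightarrow> 'w \<Rightarrow> real) \<Rightarrow>
    (nat \<Rightarrow> 'w \<Rightarrow> real) \<Rightarrow> nat \<Rightarrow> 'w \<Rightarrow> real" where
  "xi p Jc S U k \<omega> = Xproc p Jc S U 0 (jump_time S (k - 1) \<omega>) \<omega> - Xproc p Jc S U 0 (jump_time S k \<omega>) \<omega>"

definition xi_dist :: "(nat \<Rightarrow> 'w measure) \<Rightarrow> (nat \<Rightarrow> real) \<Rightarrow> (nat \<Rightarrow> 'w \<Rightarrow> nat) \<Rightarrow>
    (nat \<Rightarrow> 'w \<Rightarrow> real) \<Rightarrow> (nat \<Rightarrow> 'w \<Rightarrow> real) \<Rightarrow> nat \<Rightarrow> real measure" where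
  "xi_dist Pr p Jc S U i = distr (Pr i) borel (xi p Jc S U 1)"

text \<open>tau^zeta = inf {t > 0 : t - sup{s < t : X_s >= 0} >= zeta, X_t < 0}  (inf {} = +inf, sup {} = -inf).\<close>
definition tau_zeta :: "(nat \<Rightarrow> real) \<Rightarrow> (nat \<Rightarrow> 'w \<Rightarrow> nat) \<Rightarrow> (nat \<Rightarrow> 'w \<Rightarrow> real) \<Rightarrow>
    (nat \<Rightarrow> 'w \<Rightarrow> real) \<Rightarrow> real \<Rightarrow> real \<Rightarrow> 'w \<Rightarrow> ereal" where
  "tau_zeta p Jc S U \<zeta> x \<omega> =
     Inf {ereal t | t. 0 < t \<and>
            ereal t - (SUP s\<in>{s. 0 \<le> s \<and> s < t \<and> 0 \<le> Xproc p Jc S U x s \<omega>}. ereal s) \<ge> ereal \<zeta> \<and>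
            Xproc p Jc S U x t \<omega> < 0}"

text \<open>The law of the skeleton under P_(.,i): J^C_0 = i, and the finite-dimensional
  distributions are those of the Markov chain in which, from state j, the holding time is
  Exp(totrate j), independently the next state is j' with probability emb_prob j j', and
  the claim paid at the jump has law claim_dist j j'.\<close>
definition mmrp_law :: "nat \<Rightarrow> (nat \<Rightarrow> nat \<Rightarrow> real) \<Rightarrow> (nat \<Rightarrow> real) \<Rightarrow> (nat \<Rightarrow> real measure) \<Rightarrow>
    (nat \<Rightarrow> nat \<Rightarrow> real measure) \<Rightarrow> (nat \<Rightarrow> 'w measure) \<Rightarrow> (nat \<Rightarrow> 'w \<Rightarrow> nat) \<Rightarrow>
    (nat \<Rightarrow> 'w \<Rightarrow> real) \<Rightarrow> (nat \<Rightarrow> 'w \<Rightarrow> real) \<Rightarrow> bool" where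
  "mmrp_law N q lam FC FCJ Pr Jc S U \<longleftrightarrow>
     (\<forall>i\<in>{1..N}. \<forall>n (js :: nat \<Rightarrow> nat) (A :: nat \<Rightarrow> real set) (B :: nat \<Rightarrow> real set).
        (\<forall>k. A k \<in> sets borel \<and> B k \<in> sets borel) \<and> (\<forall>k\<in>{1..n}. js k \<in> {1..N}) \<longrightarrow>
        prob_space.prob (Pr i) {\<omega> \<in> space (Pr i). Jc 0 \<omega> = i \<and>
             (\<forall>k\<in>{1..n}. Jc k \<omega> = js k \<and> S k \<omega> \<in> A k \<and> U k \<omega> \<in> B k)}
        = (let j = js(0 := i) in
             \<Prod>k\<in>{1..n}. emb_prob N q lam (j (k - 1)) (j k)
                * measure (density lborel (exponential_density (totrate N q lam (j (k - 1))))) (A k)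
                * measure (claim_dist FC FCJ (j (k - 1)) (j k)) (B k)))"

definition stationary_dist :: "nat \<Rightarrow> (nat \<Rightarrow> nat \<Rightarrow> real) \<Rightarrow> (nat \<Rightarrow> real) \<Rightarrow> bool" where
  "stationary_dist N Pm \<pi> \<longleftrightarrow> (\<forall>i\<in>{1..N}. 0 \<le> \<pi> i) \<and> (\<Sum>i\<in>{1..N}. \<pi> i) = 1 \<and>
     (\<forall>j\<in>{1..N}. (\<Sum>i\<in>{1..N}. \<pi> i * Pm i j) = \<pi> j)"

end

theory Submission
  imports Defs
begin

text \<open>
  Up to a shift of the initial capital by \<open>\<zeta>\<close> times the largest premium rate, which is
  negligible because \<open>int_tail F\<close> is long-tailed, ruin means that the Markov modulated random walk of the
  increments \<open>\<xi>\<close> exceeds \<open>x\<close>. Let \<open>\<Psi> j x\<close> be the probability of this from state \<open>j\<close>.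
  The stationary average of the drift of the primitives of \<open>\<Psi> j\<close> under one step of the walk is constant
  in \<open>x \<ge> 0\<close>, and its limit at infinity vanishes; hence it is zero. Dividing this identity by
  \<open>int_tail F\<close> and evaluating it along points where \<open>\<Psi> / int_tail F\<close> is close to its upper
  (lower) limit \<open>s\<close> gives \<open>abar * s \<le> CS\<close> (\<open>\<ge>\<close>): the one-step equation carries
  near-extremality from a state to its successors, hence to all states charged by \<open>\<pi>\<close>, and
  subexponentiality controls the middle part of the convolution integrals.
\<close>


text \<open>The one-step equation for \<open>Psi\<close> does not determine the constant: the tails
  of the increments are of smaller order than \<open>int_tail F\<close>, so at that scale it only
  says that the ratio is an average of itself. Passing to primitives turns these tails into
  integrated tails, which \<open>D2\<close> controls, and brings in the means of the increments.
  Domination in the limit requires \<open>Psi / int_tail F\<close> to be bounded, which is not known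
  beforehand; the upper comparison is therefore run first along record values of the ratio, divided
  by the record, where the source term disappears and \<open>abar \<le> 0\<close> would follow. The
  chain is not assumed irreducible. Uniqueness of the stationary law takes the place of this: it
  makes every nonempty closed set of states carry all of \<open>\<pi>\<close>, and near-extremality
  is shown to hold on such a set. Positivity of \<open>abar\<close> is derived from the net profit
  condition at time 1, by counting the sojourns completed by then. Since the probability spaces need
  not be complete, measurability of the ruin event is proved on all paths, including those with
  accumulating epochs.\<close>

text \<open>Pratt's form of dominated convergence: the majorants may vary as long as their integrals
  converge too. Ratios such as \<open>G (x - u) / G x\<close> have no evident fixed integrable
  majorant, but subexponentiality yields the limit of their integrals. The proof clips
  \<open>f n\<close> to the band between \<open>- k\<close> and \<open>k\<close>; what is clipped
  off is at most \<open>g n - min (g n) k\<close>, whose integral vanishes.\<close>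

lemma generalized_dominated_convergence:
  fixes f g :: "nat \<Rightarrow> 'a \<Rightarrow> real"
  assumes [measurable]: "\<And>n. f n \<in> borel_measurable M" "h \<in> borel_measurable M"
    and ig: "\<And>n. integrable M (g n)" and ik: "integrable M k"
    and le: "\<And>n x. x \<in> space M \<Longrightarrow> \<bar>f n x\<bar> \<le> g n x"
    and fh: "\<And>x. x \<in> space M \<Longrightarrow> (\<lambda>n. f n x) \<longlonglongrightarrow> h x"
    and gk: "\<And>x. x \<in> space M \<Longrightarrow> (\<lambda>n. g n x) \<longlonglongrightarrow> k x"
    and lim: "(\<lambda>n. \<integral>x. g n x \<partial>M) \<longlonglongrightarrow> (\<integral>x. k x \<partial>M)"
  shows "(\<lambda>n. \<integral>x. f n x \<partial>M) \<longlonglongrightarrow> (\<integral>x. h x \<partial>M)"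
proof -
  have [measurable]: "g n \<in> borel_measurable M" "k \<in> borel_measurable M" for n
    using ig ik by auto
  have hk: "\<bar>h x\<bar> \<le> k x" if "x \<in> space M" for x
    by (rule LIMSEQ_le[OF tendsto_rabs[OF fh[OF that]] gk[OF that]]) (use le[OF that] in auto)
  have k0: "0 \<le> k x" if "x \<in> space M" for x using hk[OF that] by linarith
  define c where "c n x = max (- k x) (min (k x) (f n x))" for n x
  have [measurable]: "c n \<in> borel_measurable M" for n unfolding c_def by measurable
  have ck: "\<bar>c n x\<bar> \<le> k x" if "x \<in> space M" for n x
    using k0[OF that] unfolding c_def by auto
  have if': "integrable M (f n)" for n
    by (rule Bochner_Integration.integrable_bound[OF ig[of n]])
       (use le in \<open>auto intro!: AE_I2 intro: order_trans[OF le]\<close>)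
  have ic: "integrable M (c n)" for n
    by (rule Bochner_Integration.integrable_bound[OF ik])
       (use ck in \<open>auto intro!: AE_I2 intro: order_trans[OF ck]\<close>)
  have cl: "(\<lambda>n. \<integral>x. c n x \<partial>M) \<longlonglongrightarrow> (\<integral>x. h x \<partial>M)"
  proof (rule integral_dominated_convergence[OF _ _ ik])
    show "AE x in M. (\<lambda>n. c n x) \<longlonglongrightarrow> h x"
    proof (rule AE_I2)
      fix x assume x: "x \<in> space M"
      have "(\<lambda>n. c n x) \<longlonglongrightarrow> max (- k x) (min (k x) (h x))"
        unfolding c_def by (intro tendsto_intros fh x)
      then show "(\<lambda>n. c n x) \<longlonglongrightarrow> h x" using hk[OF x] by (auto simp: max_def min_def abs_le_iff split: if_splits)
    qed
  qed (use ck in auto)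
  define m where "m n x = min (g n x) (k x)" for n x
  have [measurable]: "m n \<in> borel_measurable M" for n unfolding m_def by measurable
  have g0: "0 \<le> g n x" if "x \<in> space M" for n x using le[OF that, of n] by linarith
  have mb: "\<bar>m n x\<bar> \<le> k x" if "x \<in> space M" for n x
    using k0[OF that] g0[OF that, of n] unfolding m_def by auto
  have im: "integrable M (m n)" for n
    by (rule Bochner_Integration.integrable_bound[OF ik])
       (use mb in \<open>auto intro!: AE_I2 intro: order_trans[OF mb]\<close>)
  have ml: "(\<lambda>n. \<integral>x. m n x \<partial>M) \<longlonglongrightarrow> (\<integral>x. k x \<partial>M)"
  proof (rule integral_dominated_convergence[OF _ _ ik])
    show "AE x in M. (\<lambda>n. m n x) \<longlonglongrightarrow> k x"
    proof (rule AE_I2)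
      fix x assume x: "x \<in> space M"
      have "(\<lambda>n. m n x) \<longlonglongrightarrow> min (k x) (k x)"
        unfolding m_def by (intro tendsto_intros gk x)
      then show "(\<lambda>n. m n x) \<longlonglongrightarrow> k x" by simp
    qed
  qed (use mb in auto)
  have d0: "(\<lambda>n. (\<integral>x. g n x \<partial>M) - (\<integral>x. m n x \<partial>M)) \<longlonglongrightarrow> 0"
    using tendsto_diff[OF lim ml] by simp
  have "\<bar>(\<integral>x. f n x \<partial>M) - (\<integral>x. c n x \<partial>M)\<bar> \<le> (\<integral>x. g n x \<partial>M) - (\<integral>x. m n x \<partial>M)" for n
  proof -
    have "\<bar>(\<integral>x. f n x \<partial>M) - (\<integral>x. c n x \<partial>M)\<bar> = \<bar>\<integral>x. f n x - c n x \<partial>M\<bar>"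
      using if' ic by simp
    also have "\<dots> \<le> (\<integral>x. \<bar>f n x - c n x\<bar> \<partial>M)" by (rule integral_abs_bound)
    also have "\<dots> \<le> (\<integral>x. g n x - m n x \<partial>M)"
    proof (rule integral_mono)
      show "\<bar>f n x - c n x\<bar> \<le> g n x - m n x" if "x \<in> space M" for x
        using le[OF that, of n] k0[OF that] unfolding c_def m_def by (auto simp: max_def min_def)
    qed (use if' ic ig im in auto)
    also have "\<dots> = (\<integral>x. g n x \<partial>M) - (\<integral>x. m n x \<partial>M)" using ig im by simp
    finally show ?thesis .
  qed
  then have "(\<lambda>n. (\<integral>x. f n x \<partial>M) - (\<integral>x. c n x \<partial>M)) \<longlonglongrightarrow> 0"
    by (intro Lim_null_comparison[OF _ d0]) auto
  from tendsto_add[OF this cl] show ?thesis by simp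
qed

section \<open>Integrated tails\<close>

lemma ccdf_nonneg: "0 \<le> ccdf M x" by (simp add: ccdf_def)

lemma (in finite_borel_measure) ccdf_antimono: "x \<le> y \<Longrightarrow> ccdf M y \<le> ccdf M x"
  unfolding ccdf_def by (intro finite_measure_mono) auto

lemma borel_measurable_antimono:
  fixes f :: "real \<Rightarrow> real"
  assumes "\<And>x y. x \<le> y \<Longrightarrow> f y \<le> f x"
  shows "f \<in> borel_measurable borel"
proof -
  have "mono (\<lambda>x. - f x)" using assms by (auto simp: mono_def)
  then have "(\<lambda>x. - (- f x)) \<in> borel_measurable borel"
    by (intro borel_measurable_uminus borel_measurable_mono)
  then show ?thesis by simp
qed

lemma (in finite_borel_measure) ccdf_measurable[measurable]: "ccdf M \<in> borel_measurable borel"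
  by (rule borel_measurable_antimono) (rule ccdf_antimono)

lemma (in real_distribution) ccdf_le_1: "ccdf M x \<le> 1"
  unfolding ccdf_def by simp

lemma (in real_distribution) cdf_eq_ccdf: "cdf M x = 1 - ccdf M x"
proof -
  have "{x<..} = space M - {..x}" by auto
  then show ?thesis using prob_compl[of "{..x}"] unfolding cdf_def ccdf_def by simp
qed

text \<open>Tonelli on the region \<open>x \<le> z < u\<close>: integrating out \<open>u\<close>
  gives the tail, integrating out \<open>z\<close> gives the length of an interval.\<close>

lemma (in finite_borel_measure) nn_integral_ccdf:
  "(\<integral>\<^sup>+z. indicator {x..} z * ennreal (ccdf M z) \<partial>lborel) = (\<integral>\<^sup>+u. ennreal (max 0 (u - x)) \<partial>M)"
proof -
  interpret pair_sigma_finite M lborel ..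
  note M_is_borel[measurable_cong]
  define k :: "real \<Rightarrow> real \<Rightarrow> ennreal" where "k u z = (if x \<le> z \<and> z < u then 1 else 0)" for u z
  have [measurable]: "(\<lambda>(u, z). k u z) \<in> borel_measurable (M \<Otimes>\<^sub>M lborel)"
    unfolding k_def by measurable
  have *: "indicator {x..} z * ennreal (ccdf M z) = (\<integral>\<^sup>+u. k u z \<partial>M)" for z
  proof (cases "x \<le> z")
    case True
    have "(\<integral>\<^sup>+u. k u z \<partial>M) = (\<integral>\<^sup>+u. indicator {z<..} u \<partial>M)"
      by (intro nn_integral_cong) (use True in \<open>simp add: k_def indicator_def\<close>)
    then show ?thesis using True by (simp add: emeasure_eq_measure ccdf_def)
  next
    case False
    then show ?thesis by (simp add: k_def)
  qed
  have "(\<integral>\<^sup>+z. indicator {x..} z * ennreal (ccdf M z) \<partial>lborel) = (\<integral>\<^sup>+z. (\<integral>\<^sup>+u. k u z \<partial>M) \<partial>lborel)"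
    by (simp only: *)
  also have "\<dots> = (\<integral>\<^sup>+u. (\<integral>\<^sup>+z. k u z \<partial>lborel) \<partial>M)"
    by (rule Fubini') measurable
  also have "\<dots> = (\<integral>\<^sup>+u. ennreal (max 0 (u - x)) \<partial>M)"
  proof (intro nn_integral_cong)
    fix u
    have "(\<integral>\<^sup>+z. k u z \<partial>lborel) = (\<integral>\<^sup>+z. indicator {x..<u} z \<partial>lborel)"
      by (intro nn_integral_cong) (simp add: k_def indicator_def)
    also have "\<dots> = ennreal (max 0 (u - x))" by (cases "x \<le> u") (auto simp: max_def)
    finally show "(\<integral>\<^sup>+z. k u z \<partial>lborel) = ennreal (max 0 (u - x))" .
  qed
  finally show ?thesis .
qed

text \<open>The integrated tail before it is cut at 1. Unlike \<open>int_tail\<close> it depends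
  linearly on the measure, so it passes through the mixture over the successor state.\<close>

definition tail_integral :: "real measure \<Rightarrow> real \<Rightarrow> real" where
  "tail_integral G x = (LBINT z:{x..}. ccdf G z)"

lemma int_tail_eq_min: "int_tail G x = min 1 (tail_integral G x)"
  by (simp add: int_tail_def tail_integral_def)

context
  fixes M :: "real measure"
  assumes M: "real_distribution M" and iM: "integrable M (\<lambda>x. x)"
begin

interpretation real_distribution M by (rule M)

lemma integrable_positive_part: "integrable M (\<lambda>u. max 0 (u - x))"
  using iM by (intro Bochner_Integration.integrable_max) auto

lemma tail_integral_eq: "tail_integral M x = (\<integral>u. max 0 (u - x) \<partial>M)"
  and set_integrable_ccdf: "set_integrable lborel {x..} (ccdf M)"
proof -
  have eq: "(\<integral>\<^sup>+z. ennreal (indicator {x..} z * ccdf M z) \<partial>lborel) = (\<integral>\<^sup>+u. ennreal (max 0 (u - x)) \<partial>M)"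
    using nn_integral_ccdf[of x]
    by (subst (asm) nn_integral_cong[of _ _ "\<lambda>z. ennreal (indicator {x..} z * ccdf M z)"])
       (auto split: split_indicator)
  also have "\<dots> = ennreal (\<integral>u. max 0 (u - x) \<partial>M)"
    by (rule nn_integral_eq_integral[OF integrable_positive_part]) auto
  finally have e: "(\<integral>\<^sup>+z. ennreal (indicator {x..} z * ccdf M z) \<partial>lborel) = ennreal (\<integral>u. max 0 (u - x) \<partial>M)" .
  show "set_integrable lborel {x..} (ccdf M)"
    unfolding set_integrable_def
    by (rule integrableI_nonneg) (auto simp: e ccdf_nonneg)
  show "tail_integral M x = (\<integral>u. max 0 (u - x) \<partial>M)"
    unfolding tail_integral_def set_lebesgue_integral_def
    by (subst integral_eq_nn_integral) (auto simp: e ccdf_nonneg)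
qed

lemma tail_integral_nonneg: "0 \<le> tail_integral M x"
  unfolding tail_integral_eq by (rule integral_nonneg_AE) auto

lemma tail_integral_antimono: "x \<le> y \<Longrightarrow> tail_integral M y \<le> tail_integral M x"
  unfolding tail_integral_eq by (rule integral_mono) (auto intro: integrable_positive_part)

lemma tail_integral_lipschitz:
  assumes "x \<le> y" shows "tail_integral M x \<le> tail_integral M y + (y - x)"
proof -
  have "tail_integral M x \<le> (\<integral>u. max 0 (u - y) + (y - x) \<partial>M)"
    unfolding tail_integral_eq
    by (rule integral_mono) (use assms in \<open>auto intro!: integrable_positive_part\<close>)
  also have "\<dots> = tail_integral M y + (y - x)"
    unfolding tail_integral_eq using integrable_positive_part[of y] prob_space by simp
  finally show ?thesis .
qed

lemma tail_integral_at_top: "(tail_integral M \<longlongrightarrow> 0) at_top"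
proof (rule tendsto_at_topI_sequentially)
  fix X :: "nat \<Rightarrow> real" assume X: "filterlim X at_top sequentially"
  then have ev: "eventually (\<lambda>n. 0 \<le> X n) sequentially" by (simp add: filterlim_at_top)
  have "(\<lambda>n. \<integral>u. max 0 (u - max 0 (X n)) \<partial>M) \<longlonglongrightarrow> (\<integral>u. 0 \<partial>M)"
  proof (rule integral_dominated_convergence[where w="\<lambda>u. \<bar>u\<bar>"])
    show "AE u in M. (\<lambda>n. max 0 (u - max 0 (X n))) \<longlonglongrightarrow> 0"
    proof (rule AE_I2)
      fix u
      have "eventually (\<lambda>n. u \<le> X n) sequentially" using X by (simp add: filterlim_at_top)
      then have "eventually (\<lambda>n. max 0 (u - max 0 (X n)) = 0) sequentially" by eventually_elim auto
      then show "(\<lambda>n. max 0 (u - max 0 (X n))) \<longlonglongrightarrow> 0" by (rule tendsto_eventually)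
    qed
    show "integrable M (\<lambda>u. \<bar>u\<bar>)" using iM by (rule integrable_abs)
    show "AE u in M. norm (max 0 (u - max 0 (X n))) \<le> \<bar>u\<bar>" for n
      by (rule AE_I2) (simp add: max_def)
  qed simp_all
  moreover have "eventually (\<lambda>n. (\<integral>u. max 0 (u - max 0 (X n)) \<partial>M) = tail_integral M (X n)) sequentially"
    using ev by eventually_elim (simp add: tail_integral_eq max_absorb2)
  ultimately show "(\<lambda>n. tail_integral M (X n)) \<longlonglongrightarrow> 0"
    by (auto intro: Lim_transform_eventually)
qed

text \<open>A decreasing tail is at most its mean over the preceding unit interval; this is how
  pointwise tails are bounded by integrated ones.\<close>

lemma ccdf_le_tail_integral_diff: "ccdf M z \<le> tail_integral M (z - 1) - tail_integral M z"
proof -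
  have "ccdf M z = (\<integral>u. indicator {z<..} u \<partial>M)" unfolding ccdf_def by simp
  also have "\<dots> \<le> (\<integral>u. max 0 (u - (z - 1)) - max 0 (u - z) \<partial>M)"
    by (rule integral_mono)
       (auto intro!: integrable_positive_part Bochner_Integration.integrable_diff split: split_indicator
         simp: integrable_real_indicator emeasure_eq_measure)
  also have "\<dots> = tail_integral M (z - 1) - tail_integral M z"
    unfolding tail_integral_eq using integrable_positive_part[of "z-1"] integrable_positive_part[of z] by simp
  finally show ?thesis .
qed

text \<open>It makes the cut at 1 active far to the left, so that \<open>1 - int_tail\<close>
  vanishes there, as a distribution function must.\<close>

lemma tail_integral_ge_mean: "(\<integral>u. u \<partial>M) - x \<le> tail_integral M x"
proof -
  have "(\<integral>u. u \<partial>M) - x = (\<integral>u. u - x \<partial>M)" using iM prob_space by simp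
  also have "\<dots> \<le> tail_integral M x" unfolding tail_integral_eq
    by (rule integral_mono) (use iM in \<open>auto intro: integrable_positive_part\<close>)
  finally show ?thesis .
qed

lemma isCont_tail_integral: "isCont (tail_integral M) x"
proof -
  have "\<bar>tail_integral M y - tail_integral M x\<bar> \<le> \<bar>y - x\<bar>" for y
    using tail_integral_lipschitz[of x y] tail_integral_lipschitz[of y x]
      tail_integral_antimono[of x y] tail_integral_antimono[of y x] by (cases "x \<le> y") auto
  then have "((\<lambda>y. tail_integral M y - tail_integral M x) \<longlongrightarrow> 0) (at x)"
    by (intro Lim_null_comparison[OF _ tendsto_rabs_zero[OF LIM_zero[OF tendsto_ident_at]]] always_eventually) auto
  then show ?thesis unfolding isCont_def by (rule LIM_zero_cancel)
qed

end


section \<open>Analytic consequences of subexponentiality of the integrated tail\<close>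

locale subexponential_tail =
  fixes F :: "real measure"
  assumes F_dist: "real_distribution F" and F_mean: "integrable F (\<lambda>x. x)"
    and F_subexp: "subexponential (int_tail_dist F)"
begin

sublocale F: real_distribution F by (rule F_dist)

abbreviation "I \<equiv> tail_integral F"
abbreviation "G \<equiv> int_tail F"
abbreviation "Fb \<equiv> ccdf F"

lemmas I_nonneg = tail_integral_nonneg[OF F_dist F_mean]
lemmas I_antimono = tail_integral_antimono[OF F_dist F_mean]
lemmas I_lipschitz = tail_integral_lipschitz[OF F_dist F_mean]
lemmas I_at_top = tail_integral_at_top[OF F_dist F_mean]
lemmas Fb_integrable = set_integrable_ccdf[OF F_dist F_mean]

lemma G_def': "G x = min 1 (I x)" by (rule int_tail_eq_min)

lemma G_le_1: "G x \<le> 1" by (simp add: G_def')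

lemma G_antimono: "x \<le> y \<Longrightarrow> G y \<le> G x"
  using I_antimono[of x y] by (simp add: G_def')

lemma G_measurable[measurable]: "G \<in> borel_measurable borel"
  by (rule borel_measurable_antimono) (rule G_antimono)

lemma cdf_int_tail_dist: "cdf (int_tail_dist F) x = 1 - G x"
proof -
  have "cdf (interval_measure (\<lambda>x. 1 - G x)) = (\<lambda>x. 1 - G x)"
  proof (rule cdf_interval_measure)
  show "1 - G x \<le> 1 - G y" if "x \<le> y" for x y using G_antimono[OF that] by simp
  have G_eq: "G = (\<lambda>x. min 1 (I x))" by (simp add: fun_eq_iff G_def')
  show "continuous (at_right a) (\<lambda>x. 1 - G x)" for a
    unfolding G_eq
    by (rule continuous_at_imp_continuous_at_within,
        intro continuous_diff continuous_const continuous_min isCont_tail_integral F_dist F_mean)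
  have "eventually (\<lambda>x. 1 - G x = 0) at_bot"
    using eventually_le_at_bot[of "(\<integral>u. u \<partial>F) - 1"]
  proof eventually_elim
    case (elim x)
    then show ?case using tail_integral_ge_mean[OF F_dist F_mean, of x] by (simp add: G_def')
  qed
  then show "((\<lambda>x. 1 - G x) \<longlongrightarrow> 0) at_bot" by (rule tendsto_eventually)
  qed
  then show ?thesis unfolding int_tail_dist_def by metis
qed

lemma int_tail_dist_real: "real_distribution (int_tail_dist F)"
  using F_subexp by (simp add: subexponential_def)

lemma ccdf_int_tail_dist: "ccdf (int_tail_dist F) x = G x"
  using real_distribution.cdf_eq_ccdf[OF int_tail_dist_real, of x] cdf_int_tail_dist[of x] by simp

text \<open>Subexponentiality includes that the law lives on the half-line, so its distribution
  function vanishes at negative points. This is a hidden lower bound on the positive part of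
  \<open>F\<close>.\<close>

lemma G_eq_1_neg: assumes "x < 0" shows "1 \<le> I x"
proof -
  interpret B: real_distribution "int_tail_dist F" by (rule int_tail_dist_real)
  have "cdf (int_tail_dist F) x \<le> measure (int_tail_dist F) {..<0}"
    unfolding cdf_def by (rule B.finite_measure_mono) (use assms in auto)
  then have "1 - G x \<le> 0" using F_subexp by (simp add: cdf_int_tail_dist subexponential_def)
  then show ?thesis by (simp add: G_def')
qed

lemma I_0: "1 \<le> I 0"
proof (rule field_le_epsilon)
  fix e :: real assume "0 < e"
  then show "1 \<le> I 0 + e" using G_eq_1_neg[of "-e"] I_lipschitz[of "-e" 0] by simp
qed

lemma ex_x0: "\<exists>x0\<ge>0. I x0 = 1"
proof -
  have "eventually (\<lambda>x. I x < 1) at_top" using order_tendstoD(2)[OF I_at_top] by simp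
  then obtain b where b: "I b < 1" "0 \<le> b"
    using eventually_conj[OF _ eventually_ge_at_top[of 0]] by (metis (mono_tags, lifting) eventually_happens trivial_limit_at_top_linorder)
  have "continuous_on {0..b} I"
    by (intro continuous_at_imp_continuous_on ballI isCont_tail_integral F_dist F_mean)
  from IVT2'[of I b 1 0] this b I_0 show ?thesis by auto
qed

text \<open>The point where the cut at 1 stops acting: \<open>G\<close> is 1 up to \<open>x0\<close>
  and equals \<open>I\<close> from there on.\<close>

definition x0 where "x0 = (SOME x. 0 \<le> x \<and> I x = 1)"

lemma x0: "0 \<le> x0" "I x0 = 1"
  using someI_ex[OF ex_x0[unfolded Bex_def]] ex_x0 unfolding x0_def by (metis (mono_tags, lifting) someI_ex)+

lemma G_eq_I: "x0 \<le> x \<Longrightarrow> G x = I x"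
  using I_antimono[of x0 x] x0 by (simp add: G_def')

lemma G_eq_1: "x \<le> x0 \<Longrightarrow> G x = 1"
  using I_antimono[of x x0] x0 by (simp add: G_def')

text \<open>The Lebesgue density of the integrated tail law; the indicator accounts for the cut at
  1.\<close>

definition fB where "fB z = indicator {x0<..} z * Fb z"

lemma fB_nonneg: "0 \<le> fB z" by (simp add: fB_def ccdf_nonneg)

lemma fB_le: "fB z \<le> Fb z" by (simp add: fB_def ccdf_nonneg split: split_indicator)

lemma fB_measurable[measurable]: "fB \<in> borel_measurable borel" unfolding fB_def by measurable

lemma I_Ioi: "(LBINT z:{x<..}. Fb z) = I x"
  unfolding tail_integral_def set_lebesgue_integral_def
proof (rule integral_cong_AE)
  show "AE z in lborel. indicator {x<..} z *\<^sub>R Fb z = indicator {x..} z *\<^sub>R Fb z"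
    using AE_lborel_singleton[of x] by eventually_elim (simp add: indicator_def)
qed measurable

lemma Fb_integrable_Ioi: "set_integrable lborel {x<..} Fb"
  by (rule set_integrable_subset[OF Fb_integrable[of x]]) auto

lemma fB_integrable: "integrable lborel fB"
  using Fb_integrable_Ioi[of x0] unfolding fB_def set_integrable_def by simp

lemma integral_fB: "(LBINT z:{x<..}. fB z) = G x"
proof -
  have "(LBINT z:{x<..}. fB z) = (LBINT z:{max x x0<..}. Fb z)"
    unfolding fB_def set_lebesgue_integral_def
    by (intro Bochner_Integration.integral_cong refl) (auto split: split_indicator)
  also have "\<dots> = G x" unfolding I_Ioi
    using G_eq_I[of x] G_eq_1[of x] x0 by (cases "x \<le> x0") (auto simp: max_def)
  finally show ?thesis .
qed

text \<open>Equal tails determine the law. In density form the convolution becomes an integral over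
  the line that can be split at chosen points.\<close>

lemma int_tail_dist_eq_density: "int_tail_dist F = density lborel (\<lambda>z. ennreal (fB z))" (is "_ = ?B")
proof -
  have em: "emeasure ?B {x<..} = ennreal (G x)" for x
  proof -
    have "emeasure ?B {x<..} = (\<integral>\<^sup>+z. ennreal (fB z) * indicator {x<..} z \<partial>lborel)"
      by (rule emeasure_density) auto
    also have "\<dots> = (\<integral>\<^sup>+z. ennreal (indicator {x<..} z * fB z) \<partial>lborel)"
      by (intro nn_integral_cong) (auto split: split_indicator)
    also have "\<dots> = ennreal (LBINT z:{x<..}. fB z)"
      unfolding set_lebesgue_integral_def
      by (subst nn_integral_eq_integral)
         (use integrable_mult_indicator[OF _ fB_integrable, of "{x<..}"] in \<open>auto simp: fB_nonneg\<close>)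
    finally show ?thesis by (simp only: integral_fB)
  qed
  have "emeasure ?B UNIV = (\<integral>\<^sup>+z. ennreal (fB z) * indicator UNIV z \<partial>lborel)"
    by (rule emeasure_density) auto
  also have "\<dots> = (\<integral>\<^sup>+z. ennreal (fB z) * indicator {x0<..} z \<partial>lborel)"
    by (intro nn_integral_cong) (auto simp: fB_def split: split_indicator)
  also have "\<dots> = emeasure ?B {x0<..}" by (rule emeasure_density[symmetric]) auto
  finally have U: "emeasure ?B UNIV = 1" using em[of x0] x0 by (simp add: G_eq_I)
  interpret prob_space ?B by standard (use U in simp)
  interpret B: real_distribution ?B by standard auto
  have "ccdf ?B x = G x" for x
    using em[of x] by (simp add: ccdf_def measure_def G_def' I_nonneg)
  then have "cdf (int_tail_dist F) = cdf ?B"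
    by (simp add: fun_eq_iff cdf_int_tail_dist B.cdf_eq_ccdf)
  then show ?thesis by (intro cdf_unique int_tail_dist_real B.real_distribution_axioms)
qed

lemma G_nonneg: "0 \<le> G x" by (simp add: G_def' I_nonneg)

lemma convolution_tail:
  "ccdf (int_tail_dist F \<star> int_tail_dist F) x = (\<integral>b. fB b * G (x - b) \<partial>lborel)"
proof -
  let ?B = "int_tail_dist F"
  interpret B: real_distribution ?B by (rule int_tail_dist_real)
  have "emeasure (?B \<star> ?B) {x<..} = (\<integral>\<^sup>+b. emeasure ?B {a. a + b \<in> {x<..}} \<partial>?B)"
    by (rule convolution_emeasure) (auto intro: B.finite_measure_axioms)
  also have "\<dots> = (\<integral>\<^sup>+b. ennreal (G (x - b)) \<partial>?B)"
  proof (rule nn_integral_cong)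
    fix b
    have "{a. a + b \<in> {x<..}} = {x - b<..}" by auto
    then show "emeasure ?B {a. a + b \<in> {x<..}} = ennreal (G (x - b))"
      using ccdf_int_tail_dist[of "x - b"] by (simp add: B.emeasure_eq_measure ccdf_def)
  qed
  also have "\<dots> = (\<integral>\<^sup>+b. ennreal (fB b) * ennreal (G (x - b)) \<partial>lborel)"
    unfolding int_tail_dist_eq_density by (rule nn_integral_density) auto
  also have "\<dots> = (\<integral>\<^sup>+b. ennreal (fB b * G (x - b)) \<partial>lborel)"
    by (simp add: ennreal_mult fB_nonneg G_nonneg)
  also have "\<dots> = ennreal (\<integral>b. fB b * G (x - b) \<partial>lborel)"
    by (intro nn_integral_eq_integral Bochner_Integration.integrable_bound[OF fB_integrable])
       (auto simp: fB_nonneg G_nonneg G_le_1 abs_mult intro!: mult_left_le)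
  finally show ?thesis
    unfolding ccdf_def measure_def by (simp add: integral_nonneg_AE fB_nonneg G_nonneg)
qed

lemma fBG_integrable: "integrable lborel (\<lambda>b. fB b * G (x - b))"
  by (rule Bochner_Integration.integrable_bound[OF fB_integrable])
     (auto simp: fB_nonneg G_nonneg G_le_1 abs_mult intro!: mult_left_le)

lemma conv_ratio: "((\<lambda>x. (\<integral>b. fB b * G (x - b) \<partial>lborel) / G x) \<longlongrightarrow> 2) at_top"
  using F_subexp unfolding subexponential_def convolution_tail ccdf_int_tail_dist by simp

text \<open>Division by zero yields 0, so a tail that vanished somewhere would make the ratio in the
  definition of subexponentiality eventually 0 instead of converging to 2.\<close>

lemma G_pos: "0 < G x"
proof (rule ccontr)
  assume "\<not> 0 < G x"
  then have z: "G x = 0" using G_nonneg[of x] by simp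
  have "eventually (\<lambda>y. (\<integral>b. fB b * G (y - b) \<partial>lborel) / G y = 0) at_top"
    using eventually_ge_at_top[of x]
  proof eventually_elim
    case (elim y)
    then show ?case using G_antimono[of x y] G_nonneg[of y] z by simp
  qed
  then have "((\<lambda>x. (\<integral>b. fB b * G (x - b) \<partial>lborel) / G x) \<longlongrightarrow> 0) at_top" by (rule tendsto_eventually)
  with conv_ratio have "(2::real) = 0" by (intro tendsto_unique[OF trivial_limit_at_top_linorder])
  then show False by simp
qed

lemma G_at_top: "(G \<longlongrightarrow> 0) at_top"
proof -
  have "((\<lambda>x. min 1 (I x)) \<longlongrightarrow> min 1 0) at_top" by (intro tendsto_intros I_at_top)
  then show ?thesis by (simp add: G_def'[abs_def])
qed

text \<open>The classical step from subexponential to long-tailed. The convolution is split at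
  \<open>y\<close> and \<open>x\<close>, and \<open>G (x - b)\<close> is bounded below by
  \<open>G x\<close>, \<open>G (x - y)\<close> and 1 on the three ranges. The resulting lower bound
  on the convolution ratio, solved for \<open>G (x - y) / G x\<close>, is an upper bound that tends
  to 1.\<close>

lemma G_long_tailed_nonneg:
  assumes y: "0 \<le> y" shows "((\<lambda>x. G (x - y) / G x) \<longlongrightarrow> 1) at_top"
proof -
  let ?K = "\<lambda>x. \<integral>b. fB b * G (x - b) \<partial>lborel"
  show ?thesis
  proof (rule tendsto_sandwich[where f="\<lambda>_. 1" and h="\<lambda>x. (?K x / G x - 2 + G y) / (G y - G x)"])
  have "((\<lambda>x. (?K x / G x - 2 + G y) / (G y - G x)) \<longlongrightarrow> (2 - 2 + G y) / (G y - 0)) at_top"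
    by (intro tendsto_intros conv_ratio G_at_top) (use G_pos[of y] in simp)
  then show "((\<lambda>x. (?K x / G x - 2 + G y) / (G y - G x)) \<longlongrightarrow> 1) at_top" using G_pos[of y] by simp
  show "eventually (\<lambda>x. 1 \<le> G (x - y) / G x) at_top"
    using G_antimono y G_pos by (intro always_eventually allI) (simp add: le_divide_eq_1)
  have "eventually (\<lambda>x. G x < G y) at_top" using order_tendstoD(2)[OF G_at_top G_pos] .
  then show "eventually (\<lambda>x. G (x - y) / G x \<le> (?K x / G x - 2 + G y) / (G y - G x)) at_top"
    using eventually_gt_at_top[of y]
  proof eventually_elim
    case (elim x)
    have ind: "integrable lborel (\<lambda>b. indicator A b * fB b)" if "A \<in> sets lborel" for A
      using integrable_mult_indicator[OF that fB_integrable] by simp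
    have tot: "(\<integral>b. fB b \<partial>lborel) = 1"
      using integral_fB[of x0] x0 G_eq_1[of x0] unfolding set_lebesgue_integral_def fB_def by (simp add: mult.assoc[symmetric] flip: indicator_inter_arith)
    have c1: "(\<integral>b. indicator {z<..} b * fB b \<partial>lborel) = G z" for z
      using integral_fB[of z] unfolding set_lebesgue_integral_def by simp
    \<comment> \<open>The step function with values \<open>G x\<close>, \<open>G (x - y)\<close> and
      1 on the three ranges, times the density, arranged as a combination of functions whose
      integrals are values of \<open>G\<close>.\<close>
    define h where "h b = G x * fB b + (1 - G x) * (indicator {x<..} b * fB b)
        + (G (x - y) - G x) * (indicator {y<..} b * fB b) - (G (x - y) - G x) * (indicator {x<..} b * fB b)" for b
    have "(\<integral>b. h b \<partial>lborel) = G x + (1 - G x) * G x + (G (x - y) - G x) * G y - (G (x - y) - G x) * G x"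
      unfolding h_def using ind[of "{x<..}"] ind[of "{y<..}"] fB_integrable by (simp add: tot c1)
    moreover have "(\<integral>b. h b \<partial>lborel) \<le> ?K x"
    proof (rule integral_mono)
      show "integrable lborel h"
        unfolding h_def using ind[of "{x<..}"] ind[of "{y<..}"] fB_integrable by simp
      show "integrable lborel (\<lambda>b. fB b * G (x - b))" by (rule fBG_integrable)
      fix b
      consider "b \<le> x0" | "x0 < b" "b \<le> y" | "x0 < b" "y < b" "b \<le> x" | "x0 < b" "x < b" by linarith
      then show "h b \<le> fB b * G (x - b)"
      proof cases
        case 1 then show ?thesis by (simp add: h_def fB_def)
      next
        case 2
        then have g: "G x \<le> G (x - b)" using x0 by (intro G_antimono) auto
        then show ?thesis using 2 elim mult_right_mono[OF g fB_nonneg[of b]] by (simp add: h_def mult.commute)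
      next
        case 3
        then have g: "G (x - y) \<le> G (x - b)" by (intro G_antimono) auto
        then show ?thesis using 3 elim mult_right_mono[OF g fB_nonneg[of b]] by (simp add: h_def algebra_simps)
      next
        case 4
        then have "G (x - b) = 1" using x0 by (intro G_eq_1) auto
        then show ?thesis using 4 elim by (simp add: h_def algebra_simps)
      qed
    qed
    ultimately have "G x * 2 + G (x - y) * (G y - G x) - G x * G y \<le> ?K x" by (simp add: algebra_simps)
    then have "(G x * 2 + G (x - y) * (G y - G x) - G x * G y) / G x \<le> ?K x / G x"
      using G_pos[of x] by (intro divide_right_mono) auto
    then have "2 + G (x - y) / G x * (G y - G x) - G y \<le> ?K x / G x"
      using G_pos[of x] by (simp add: field_simps)
    then show ?case using elim by (simp add: pos_le_divide_eq algebra_simps)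
  qed
  qed (rule tendsto_const)
qed

lemma G_long_tailed: "((\<lambda>x. G (x + y) / G x) \<longlongrightarrow> 1) at_top"
proof (cases "y \<le> 0")
  case True
  then show ?thesis using G_long_tailed_nonneg[of "- y"] by simp
next
  case False
  have "filterlim (\<lambda>x::real. x + y) at_top at_top"
    using filterlim_tendsto_add_at_top[OF tendsto_const[of y] filterlim_ident] by (simp add: add.commute)
  then have "((\<lambda>x. G ((x + y) - y) / G (x + y)) \<longlongrightarrow> 1) at_top"
    using False by (intro filterlim_compose[OF G_long_tailed_nonneg[of y]]) auto
  from tendsto_inverse[OF this] show ?thesis by simp
qed

text \<open>Compared with the convolution tail, the range beyond \<open>x\<close> (worth exactly
  \<open>G x\<close>) is removed, and the range from 0 to \<open>x0\<close>, where the density was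
  cut to 0, is restored with asymptotic weight \<open>I 0 - 1\<close>; hence the limit
  \<open>2 - 1 + (I 0 - 1)\<close>.\<close>

lemma integral_Fb_G: 
  "((\<lambda>x. (LBINT u:{0..x}. Fb u * G (x - u)) / G x) \<longlongrightarrow> I 0) at_top"
proof -
  let ?K = "\<lambda>x. \<integral>b. fB b * G (x - b) \<partial>lborel"
  let ?L = "\<lambda>x. LBINT u:{0..x0}. Fb u * G (x - u)"
  have s0: "set_integrable lborel {0..} (\<lambda>u. Fb u * G (x - u))" for x
    by (rule set_integrable_bound[OF Fb_integrable[of 0]])
       (auto simp: set_borel_measurable_def ccdf_nonneg G_nonneg G_le_1 abs_mult intro!: mult_left_le)
  have eq: "eventually (\<lambda>x. ?K x / G x - 1 + ?L x / G x = (LBINT u:{0..x}. Fb u * G (x - u)) / G x) at_top"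
    using eventually_gt_at_top[of x0]
  proof eventually_elim
    case (elim x)
    have "?K x = (LBINT u:{x0<..x} \<union> {x<..}. Fb u * G (x - u))"
      unfolding fB_def set_lebesgue_integral_def
      by (intro Bochner_Integration.integral_cong) (use elim in \<open>auto split: split_indicator\<close>)
    also have "\<dots> = (LBINT u:{x0<..x}. Fb u * G (x - u)) + (LBINT u:{x<..}. Fb u * G (x - u))"
      by (rule set_integral_Un) (use elim x0 in \<open>auto intro!: set_integrable_subset[OF s0[of x]]\<close>)
    also have "(LBINT u:{x<..}. Fb u * G (x - u)) = (LBINT u:{x<..}. Fb u)"
      by (rule set_lebesgue_integral_cong) (use x0 in \<open>auto simp: G_eq_1\<close>)
    also have "\<dots> = G x" using elim by (simp add: I_Ioi G_eq_I)
    finally have K: "?K x = (LBINT u:{x0<..x}. Fb u * G (x - u)) + G x" .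
    have "{0..x} = {0..x0} \<union> {x0<..x}" using elim x0 by auto
    moreover have "(LBINT u:{0..x0} \<union> {x0<..x}. Fb u * G (x - u)) = ?L x + (LBINT u:{x0<..x}. Fb u * G (x - u))"
      by (rule set_integral_Un) (use x0 in \<open>auto intro!: set_integrable_subset[OF s0[of x]]\<close>)
    ultimately show ?case using K G_pos[of x] by (simp add: field_simps)
  qed
  \<comment> \<open>On this bounded range \<open>G (x - u) / G x\<close> is eventually at most 2, by
    monotonicity in \<open>u\<close> and long-tailedness at the shift \<open>x0\<close>.\<close>
  have "((\<lambda>x. LBINT u:{0..x0}. Fb u * G (x - u) / G x) \<longlongrightarrow> (LBINT u:{0..x0}. Fb u * 1)) at_top"
    unfolding set_lebesgue_integral_def
  proof (rule integral_dominated_convergence_at_top[where w="\<lambda>u. 2 * (indicator {0..x0} u * Fb u)"])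
    show "integrable lborel (\<lambda>u. 2 * (indicator {0..x0} u * Fb u))"
      using set_integrable_subset[OF Fb_integrable[of 0], of "{0..x0}"] by (auto simp: set_integrable_def)
    have ev: "eventually (\<lambda>x. G (x + - x0) / G x < 2) at_top" by (rule order_tendstoD(2)[OF G_long_tailed]) simp
    show "\<forall>\<^sub>F x in at_top. AE u in lborel. norm (indicator {0..x0} u *\<^sub>R (Fb u * G (x - u) / G x)) \<le> 2 * (indicator {0..x0} u * Fb u)"
      using ev
    proof eventually_elim
      case (elim x)
      show ?case
      proof (rule AE_I2)
        fix u
        show "norm (indicator {0..x0} u *\<^sub>R (Fb u * G (x - u) / G x)) \<le> 2 * (indicator {0..x0} u * Fb u)"
        proof (cases "u \<in> {0..x0}")
          case True
          then have "G (x - u) / G x \<le> G (x - x0) / G x" using G_pos[of x]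
            by (intro divide_right_mono G_antimono) auto
          then have "G (x - u) / G x \<le> 2" using elim by simp
          from mult_left_mono[OF this ccdf_nonneg[of F u]] show ?thesis
            using True G_pos[of x] G_nonneg[of "x - u"] by (simp add: ccdf_nonneg abs_mult)
        qed simp
      qed
    qed
    show "AE u in lborel. ((\<lambda>x. indicator {0..x0} u *\<^sub>R (Fb u * G (x - u) / G x)) \<longlongrightarrow> indicator {0..x0} u *\<^sub>R (Fb u * 1)) at_top"
    proof (rule AE_I2)
      fix u
      have "((\<lambda>x. indicator {0..x0} u *\<^sub>R (Fb u * (G (x + - u) / G x))) \<longlongrightarrow> indicator {0..x0} u *\<^sub>R (Fb u * 1)) at_top"
        by (intro tendsto_intros G_long_tailed)
      then show "((\<lambda>x. indicator {0..x0} u *\<^sub>R (Fb u * G (x - u) / G x)) \<longlongrightarrow> indicator {0..x0} u *\<^sub>R (Fb u * 1)) at_top"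
        by simp
    qed
  qed measurable
  moreover have "(LBINT u:{0..x0}. Fb u * 1) = I 0 - 1"
  proof -
    have "{0..} = {0..x0} \<union> {x0<..}" using x0 by auto
    moreover have "(LBINT u:{0..x0} \<union> {x0<..}. Fb u) = (LBINT u:{0..x0}. Fb u) + (LBINT u:{x0<..}. Fb u)"
      by (rule set_integral_Un) (use x0 in \<open>auto intro!: set_integrable_subset[OF Fb_integrable[of 0]]\<close>)
    ultimately have "I 0 = (LBINT u:{0..x0}. Fb u) + I x0" by (simp add: I_Ioi tail_integral_def)
    then show ?thesis using x0 by simp
  qed
  moreover have "(LBINT u:{0..x0}. Fb u * G (x - u) / G x) = ?L x / G x" for x
    by (simp add: set_lebesgue_integral_def)
  ultimately have L: "((\<lambda>x. ?L x / G x) \<longlongrightarrow> I 0 - 1) at_top" by simp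
  have "((\<lambda>x. ?K x / G x - 1 + ?L x / G x) \<longlongrightarrow> 2 - 1 + (I 0 - 1)) at_top"
    by (intro tendsto_intros conv_ratio L)
  then have "((\<lambda>x. ?K x / G x - 1 + ?L x / G x) \<longlongrightarrow> I 0) at_top" by simp
  then show ?thesis using eq by (rule Lim_transform_eventually)
qed

lemma Fb_le_G: "Fb z \<le> G (z - 1)"
  using ccdf_le_tail_integral_diff[OF F_dist F_mean, of z] I_nonneg[of z] F.ccdf_le_1[of z] by (simp add: G_def')

text \<open>Long-tailedness makes the increment of \<open>I\<close> over a unit interval negligible
  against \<open>G\<close>, and the pointwise tail is below that increment.\<close>

lemma Fb_small: "((\<lambda>x. Fb (x + y) / G x) \<longlongrightarrow> 0) at_top"
proof (rule tendsto_sandwich[where f="\<lambda>_. 0" and h="\<lambda>x. G (x + (y - 1)) / G x - G (x + y) / G x"])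
  have "eventually (\<lambda>x. x0 \<le> x + y - 1) at_top"
    using eventually_ge_at_top[of "x0 - y + 1"] by eventually_elim simp
  then show "eventually (\<lambda>x. Fb (x + y) / G x \<le> G (x + (y - 1)) / G x - G (x + y) / G x) at_top"
  proof eventually_elim
    case (elim x)
    have "Fb (x + y) \<le> G (x + (y - 1)) - G (x + y)"
      using elim ccdf_le_tail_integral_diff[OF F_dist F_mean, of "x + y"]
      by (simp add: G_eq_I algebra_simps)
    from divide_right_mono[OF this G_nonneg[of x]] show ?case by (simp add: diff_divide_distrib)
  qed
  have "((\<lambda>x. G (x + (y - 1)) / G x - G (x + y) / G x) \<longlongrightarrow> 1 - 1) at_top"
    by (intro tendsto_diff G_long_tailed)
  then show "((\<lambda>x. G (x + (y - 1)) / G x - G (x + y) / G x) \<longlongrightarrow> 0) at_top" by simp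
qed (auto simp: ccdf_nonneg G_nonneg)

text \<open>Pointwise the integrand vanishes by \<open>Fb_small\<close>. The varying majorant
  replaces the second tail by \<open>G\<close> taken one unit further left, and its integral
  converges by \<open>integral_Fb_G\<close>; the last unit before \<open>X n\<close> lies outside
  the range of that integral and is bounded by an increment of \<open>I\<close>.\<close>

lemma integral_Fb_fB:
  assumes X: "filterlim X at_top sequentially"
  shows "(\<lambda>n. (LBINT u:{0..}. Fb u * fB (X n - u)) / G (X n)) \<longlonglongrightarrow> 0"
proof -
  define g where "g n u = indicator {0..X n - 1} u * (Fb u * G (X n - 1 - u)) / G (X n)
      + indicator {X n - 1<..X n} u * indicator {0..} u * Fb u / G (X n)" for n u
  have ev: "eventually (\<lambda>n. c \<le> X n) sequentially" for c using X by (simp add: filterlim_at_top)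
  have X1: "filterlim (\<lambda>n. X n - 1) at_top sequentially"
    using filterlim_tendsto_add_at_top[OF tendsto_const[of "-1"] X] by simp
  have ii: "integrable lborel (\<lambda>u. indicator A u * Fb u)" if "A \<in> sets borel" "A \<subseteq> {0..}" for A
    using set_integrable_subset[OF Fb_integrable[of 0], of A] that by (simp add: set_integrable_def)
  have i1: "integrable lborel (\<lambda>u. indicator {0..X n - 1} u * (Fb u * G (X n - 1 - u)) / G (X n))" for n
    by (intro Bochner_Integration.integrable_divide Bochner_Integration.integrable_bound[OF ii[of "{0..X n - 1}"]])
       (auto simp: ccdf_nonneg G_nonneg G_le_1 abs_mult intro!: mult_left_le split: split_indicator)
  have i2: "integrable lborel (\<lambda>u. indicator {X n - 1<..X n} u * indicator {0..} u * Fb u / G (X n))" for n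
    using ii[of "{X n - 1<..X n} \<inter> {0..}"] by (auto simp: indicator_inter_arith)
  have "(\<lambda>n. \<integral>u. indicator {0..} u * (Fb u * fB (X n - u)) / G (X n) \<partial>lborel) \<longlonglongrightarrow> (\<integral>u. 0 \<partial>(lborel :: real measure))"
  proof (rule generalized_dominated_convergence[where g=g and k="\<lambda>u. indicator {0..} u * Fb u"])
    show "integrable lborel (\<lambda>u. indicator {0..} u * Fb u)" by (rule ii) auto
    show "integrable lborel (g n)" for n unfolding g_def by (intro Bochner_Integration.integrable_add i1 i2)
    fix u :: real
    show "\<bar>indicator {0..} u * (Fb u * fB (X n - u)) / G (X n)\<bar> \<le> g n u" for n
    proof -
      have pos: "0 < G (X n)" by (rule G_pos)
      consider "u < 0" | "0 \<le> u" "u \<le> X n - 1" | "0 \<le> u" "X n - 1 < u" "u \<le> X n" | "X n < u" "0 \<le> u" by linarith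
      then show ?thesis
      proof cases
        case 1 then show ?thesis by (simp add: g_def)
      next
        case 2
        have "fB (X n - u) \<le> G (X n - 1 - u)"
          using fB_le[of "X n - u"] Fb_le_G[of "X n - u"] by (simp add: algebra_simps)
        then have "Fb u * fB (X n - u) / G (X n) \<le> Fb u * G (X n - 1 - u) / G (X n)"
          using pos by (intro divide_right_mono mult_left_mono ccdf_nonneg) auto
        then show ?thesis using 2 pos by (simp add: g_def ccdf_nonneg fB_nonneg abs_mult)
      next
        case 3
        have "Fb u * fB (X n - u) / G (X n) \<le> Fb u * 1 / G (X n)"
          using pos fB_le[of "X n - u"] F.ccdf_le_1[of "X n - u"]
          by (intro divide_right_mono mult_left_mono ccdf_nonneg) auto
        then show ?thesis using 3 pos by (simp add: g_def ccdf_nonneg fB_nonneg abs_mult)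
      next
        case 4
        then have "fB (X n - u) = 0" using x0 by (simp add: fB_def)
        then show ?thesis using pos by (simp add: g_def ccdf_nonneg G_nonneg)
      qed
    qed
    have "(\<lambda>n. indicator {0..} u * Fb u * (Fb (X n + - u) / G (X n))) \<longlonglongrightarrow> indicator {0..} u * Fb u * 0"
      by (intro tendsto_intros filterlim_compose[OF Fb_small X])
    then have lim: "(\<lambda>n. indicator {0..} u * Fb u * (Fb (X n + - u) / G (X n))) \<longlonglongrightarrow> 0" by simp
    show "(\<lambda>n. indicator {0..} u * (Fb u * fB (X n - u)) / G (X n)) \<longlonglongrightarrow> 0"
    proof (rule Lim_null_comparison[OF _ lim], rule always_eventually, rule allI)
      fix n
      have "Fb u * fB (X n - u) / G (X n) \<le> Fb u * Fb (X n - u) / G (X n)"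
        by (intro divide_right_mono mult_left_mono ccdf_nonneg fB_le G_nonneg)
      then show "norm (indicator {0..} u * (Fb u * fB (X n - u)) / G (X n)) \<le> indicator {0..} u * Fb u * (Fb (X n + - u) / G (X n))"
        by (auto simp: abs_mult ccdf_nonneg fB_nonneg G_nonneg split: split_indicator)
    qed
    show "(\<lambda>n. g n u) \<longlonglongrightarrow> indicator {0..} u * Fb u"
    proof (cases "0 \<le> u")
      case True
      have "(\<lambda>n. Fb u * (G (X n + (- 1 - u)) / G (X n))) \<longlonglongrightarrow> Fb u * 1"
        by (intro tendsto_intros filterlim_compose[OF G_long_tailed X])
      moreover have "eventually (\<lambda>n. Fb u * (G (X n + (- 1 - u)) / G (X n)) = g n u) sequentially"
        using ev[of "u + 1"] by eventually_elim (use True in \<open>simp add: g_def algebra_simps\<close>)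
      ultimately show ?thesis using True by (auto intro: Lim_transform_eventually)
    next
      case False
      then have "g n u = 0" for n by (simp add: g_def)
      then show ?thesis using False by simp
    qed
  next
    have A: "(\<lambda>n. ((LBINT u:{0..X n - 1}. Fb u * G (X n - 1 - u)) / G (X n - 1)) * (G (X n + - 1) / G (X n))
        + (G (X n + - 1) / G (X n) - 1)) \<longlonglongrightarrow> I 0 * 1 + (1 - 1)"
      by (intro tendsto_intros filterlim_compose[OF G_long_tailed X] filterlim_compose[OF integral_Fb_G X1])
    have "eventually (\<lambda>n. ((LBINT u:{0..X n - 1}. Fb u * G (X n - 1 - u)) / G (X n - 1)) * (G (X n + - 1) / G (X n))
        + (G (X n + - 1) / G (X n) - 1) = (\<integral>u. g n u \<partial>lborel)) sequentially"
      using ev[of "x0 + 1"]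
    proof eventually_elim
      case (elim n)
      have "(\<integral>u. g n u \<partial>lborel) = (\<integral>u. indicator {0..X n - 1} u * (Fb u * G (X n - 1 - u)) / G (X n) \<partial>lborel)
          + (\<integral>u. indicator {X n - 1<..X n} u * indicator {0..} u * Fb u / G (X n) \<partial>lborel)"
        unfolding g_def using i1 i2 by (rule Bochner_Integration.integral_add)
      also have "(\<integral>u. indicator {X n - 1<..X n} u * indicator {0..} u * Fb u / G (X n) \<partial>lborel)
         = (\<integral>u. (indicator {X n - 1<..} u * Fb u - indicator {X n<..} u * Fb u) / G (X n) \<partial>lborel)"
        by (intro Bochner_Integration.integral_cong) (use elim x0 in \<open>auto split: split_indicator\<close>)
      also have "\<dots> = (I (X n - 1) - I (X n)) / G (X n)"
      proof -
        have "integrable lborel (\<lambda>u. indicator {X n - 1<..} u * Fb u)"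
          by (rule ii) (use elim x0 in auto)
        moreover have "integrable lborel (\<lambda>u. indicator {X n<..} u * Fb u)"
          by (rule ii) (use elim x0 in auto)
        ultimately show ?thesis
          using I_Ioi[of "X n - 1"] I_Ioi[of "X n"] by (simp add: set_lebesgue_integral_def)
      qed
      also have "\<dots> = G (X n - 1) / G (X n) - 1"
        using elim G_pos[of "X n"] by (simp add: G_eq_I diff_divide_distrib)
      finally show ?case using G_pos[of "X n - 1"] by (simp add: set_lebesgue_integral_def)
    qed
    then have "(\<lambda>n. \<integral>u. g n u \<partial>lborel) \<longlonglongrightarrow> I 0" using A by (auto intro: Lim_transform_eventually)
    then show "(\<lambda>n. \<integral>u. g n u \<partial>lborel) \<longlonglongrightarrow> (\<integral>u. indicator {0..} u * Fb u \<partial>lborel)"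
      by (simp add: tail_integral_def set_lebesgue_integral_def)
  qed measurable
  then show ?thesis by (simp add: set_lebesgue_integral_def)
qed

text \<open>An upward jump whose tail is dominated by that of \<open>F\<close> changes
  \<open>G\<close> only to lower order: the gain is an integral of the density \<open>fB\<close>,
  Tonelli converts the law of the jump into its tail, and \<open>integral_Fb_fB\<close> applies. The
  factor \<open>a\<close> will be a transition probability, since only the mixture over successors
  is dominated by \<open>F\<close>.\<close>

lemma integral_G_shift:
  assumes H: "real_distribution H" and a: "0 < a" and dom: "\<And>t. a * ccdf H t \<le> Fb t"
    and X: "filterlim X at_top sequentially"
  shows "(\<lambda>n. (\<integral>u. G (X n - max u 0) \<partial>H) / G (X n)) \<longlonglongrightarrow> 1"
proof -
  interpret H: real_distribution H by (rule H)
  note H.M_is_borel[measurable_cong]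
  interpret pair_sigma_finite H lborel ..
  have key: "(\<integral>u. G (x - max u 0) \<partial>H) \<le> G x + (1 / a) * (LBINT u:{0..}. Fb u * fB (x - u))" for x
  proof -
    \<comment> \<open>Integrating \<open>k u t\<close> over \<open>t\<close> gives the gain
      \<open>G (x - max u 0) - G x\<close>; integrating it over \<open>u\<close> gives the density
      times the tail of \<open>H\<close>.\<close>
    define k :: "real \<Rightarrow> real \<Rightarrow> real" where "k u t = (if 0 \<le> t \<and> t < u then fB (x - t) else 0)" for u t
    have [measurable]: "(\<lambda>(u, t). k u t) \<in> borel_measurable (H \<Otimes>\<^sub>M lborel)"
      unfolding k_def by measurable
    have fx: "integrable lborel (\<lambda>t. fB (x - t))"
      using lborel_integrable_real_affine[OF fB_integrable, of "-1" x] by simp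
    have inner: "(\<integral>\<^sup>+t. ennreal (k u t) \<partial>lborel) = ennreal (G (x - max u 0) - G x)" for u
    proof -
      have "(\<integral>\<^sup>+t. ennreal (k u t) \<partial>lborel) = (\<integral>\<^sup>+t. ennreal (indicator {0..<max u 0} t * fB (x - t)) \<partial>lborel)"
        by (intro nn_integral_cong) (auto simp: k_def split: split_indicator)
      also have "\<dots> = (\<integral>\<^sup>+z. ennreal (indicator {x - max u 0<..x} z * fB z) \<partial>lborel)"
      proof -
        have *: "indicator {0..<max u 0} t * fB (x - t) = indicator {x - max u 0<..x} (x + -1 * t) * fB (x + -1 * t)" for t
          by (auto split: split_indicator)
        show ?thesis unfolding *
          by (subst nn_integral_real_affine[where c="-1" and t=x and f="\<lambda>z. ennreal (indicator {x - max u 0<..x} z * fB z)"]) auto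
      qed
      also have "\<dots> = ennreal (\<integral>z. indicator {x - max u 0<..x} z * fB z \<partial>lborel)"
        by (rule nn_integral_eq_integral)
           (use integrable_mult_indicator[OF _ fB_integrable, of "{x - max u 0<..x}"] in \<open>auto simp: fB_nonneg\<close>)
      also have "(\<integral>z. indicator {x - max u 0<..x} z * fB z \<partial>lborel)
         = (\<integral>z. indicator {x - max u 0<..} z * fB z - indicator {x<..} z * fB z \<partial>lborel)"
        by (intro Bochner_Integration.integral_cong) (auto split: split_indicator)
      also have "\<dots> = G (x - max u 0) - G x"
        using integral_fB[of x] integral_fB[of "x - max u 0"]
          integrable_mult_indicator[OF _ fB_integrable, of "{x<..}"]
          integrable_mult_indicator[OF _ fB_integrable, of "{x - max u 0<..}"]
        by (simp add: set_lebesgue_integral_def)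
      finally show ?thesis .
    qed
    have "(\<integral>\<^sup>+u. ennreal (G (x - max u 0) - G x) \<partial>H) = (\<integral>\<^sup>+u. (\<integral>\<^sup>+t. ennreal (k u t) \<partial>lborel) \<partial>H)"
      by (simp only: inner)
    also have "\<dots> = (\<integral>\<^sup>+t. (\<integral>\<^sup>+u. ennreal (k u t) \<partial>H) \<partial>lborel)"
      by (rule Fubini'[symmetric]) measurable
    also have "\<dots> \<le> (\<integral>\<^sup>+t. ennreal ((1 / a) * (indicator {0..} t * (Fb t * fB (x - t)))) \<partial>lborel)"
    proof (rule nn_integral_mono)
      fix t
      have "(\<integral>\<^sup>+u. ennreal (k u t) \<partial>H) = (\<integral>\<^sup>+u. ennreal (indicator {0..} t * fB (x - t)) * indicator {t<..} u \<partial>H)"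
        by (intro nn_integral_cong) (auto simp: k_def split: split_indicator)
      also have "\<dots> = ennreal (indicator {0..} t * fB (x - t) * ccdf H t)"
        by (subst nn_integral_cmult_indicator)
           (auto simp: H.emeasure_eq_measure ccdf_def ennreal_mult fB_nonneg)
      also have "\<dots> \<le> ennreal ((1 / a) * (indicator {0..} t * (Fb t * fB (x - t))))"
      proof (rule ennreal_leI)
        have "ccdf H t \<le> Fb t / a" using dom[of t] a by (simp add: pos_le_divide_eq mult.commute)
        from mult_left_mono[OF this, of "indicator {0..} t * fB (x - t)"]
        show "indicator {0..} t * fB (x - t) * ccdf H t \<le> (1 / a) * (indicator {0..} t * (Fb t * fB (x - t)))"
          by (simp add: fB_nonneg mult_ac)
      qed
      finally show "(\<integral>\<^sup>+u. ennreal (k u t) \<partial>H) \<le> ennreal ((1 / a) * (indicator {0..} t * (Fb t * fB (x - t))))" .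
    qed
    also have "\<dots> = ennreal (\<integral>t. (1 / a) * (indicator {0..} t * (Fb t * fB (x - t))) \<partial>lborel)"
    proof (rule nn_integral_eq_integral)
      have "integrable lborel (\<lambda>t. indicator {0..} t * (Fb t * fB (x - t)))"
        by (rule Bochner_Integration.integrable_bound[OF fx])
           (auto simp: ccdf_nonneg fB_nonneg abs_mult F.ccdf_le_1 split: split_indicator intro!: mult_left_le_one_le)
      then show "integrable lborel (\<lambda>t. (1 / a) * (indicator {0..} t * (Fb t * fB (x - t))))" by simp
    qed (use a in \<open>auto simp: ccdf_nonneg fB_nonneg\<close>)
    finally have nn: "(\<integral>\<^sup>+u. ennreal (G (x - max u 0) - G x) \<partial>H) \<le> ennreal ((1 / a) * (LBINT u:{0..}. Fb u * fB (x - u)))"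
      by (simp add: set_lebesgue_integral_def)
    have iG: "integrable H (\<lambda>u. G (x - max u 0))"
      by (rule H.integrable_const_bound[where B=1]) (auto simp: G_nonneg G_le_1)
    have ge: "0 \<le> G (x - max u 0) - G x" for u using G_antimono[of "x - max u 0" x] by simp
    have "ennreal (\<integral>u. G (x - max u 0) - G x \<partial>H) = (\<integral>\<^sup>+u. ennreal (G (x - max u 0) - G x) \<partial>H)"
      using iG ge by (intro nn_integral_eq_integral[symmetric]) auto
    then have "ennreal (\<integral>u. G (x - max u 0) - G x \<partial>H) \<le> ennreal ((1 / a) * (LBINT u:{0..}. Fb u * fB (x - u)))"
      using nn by simp
    moreover have "0 \<le> (1 / a) * (LBINT u:{0..}. Fb u * fB (x - u))"
      using a by (auto simp: set_lebesgue_integral_def ccdf_nonneg fB_nonneg intro!: integral_nonneg_AE)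
    ultimately have "(\<integral>u. G (x - max u 0) - G x \<partial>H) \<le> (1 / a) * (LBINT u:{0..}. Fb u * fB (x - u))"
      by (simp only: ennreal_le_iff)
    then show ?thesis using iG H.prob_space by simp
  qed
  show ?thesis
  proof (rule tendsto_sandwich[where f="\<lambda>_. 1" and h="\<lambda>n. 1 + (1 / a) * ((LBINT u:{0..}. Fb u * fB (X n - u)) / G (X n))"])
    show "eventually (\<lambda>n. (\<integral>u. G (X n - max u 0) \<partial>H) / G (X n) \<le> 1 + (1 / a) * ((LBINT u:{0..}. Fb u * fB (X n - u)) / G (X n))) sequentially"
    proof (intro always_eventually allI)
      fix n
      from divide_right_mono[OF key[of "X n"] G_nonneg[of "X n"]]
      show "(\<integral>u. G (X n - max u 0) \<partial>H) / G (X n) \<le> 1 + (1 / a) * ((LBINT u:{0..}. Fb u * fB (X n - u)) / G (X n))"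
        using G_pos[of "X n"] by (simp add: add_divide_distrib)
    qed
    show "eventually (\<lambda>n. 1 \<le> (\<integral>u. G (X n - max u 0) \<partial>H) / G (X n)) sequentially"
    proof (intro always_eventually allI)
      fix n
      have "(\<integral>u. G (X n) \<partial>H) \<le> (\<integral>u. G (X n - max u 0) \<partial>H)"
        by (rule integral_mono)
           (auto intro!: G_antimono H.integrable_const_bound[where B=1] simp: G_nonneg G_le_1)
      then have "G (X n) \<le> (\<integral>u. G (X n - max u 0) \<partial>H)" using H.prob_space by simp
      then show "1 \<le> (\<integral>u. G (X n - max u 0) \<partial>H) / G (X n)" using G_pos[of "X n"] by (simp add: le_divide_eq_1)
    qed
    have "(\<lambda>n. 1 + (1 / a) * ((LBINT u:{0..}. Fb u * fB (X n - u)) / G (X n))) \<longlonglongrightarrow> 1 + (1 / a) * 0"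
      by (intro tendsto_intros integral_Fb_fB X)
    then show "(\<lambda>n. 1 + (1 / a) * ((LBINT u:{0..}. Fb u * fB (X n - u)) / G (X n))) \<longlonglongrightarrow> 1" by simp
  qed (rule tendsto_const)
qed

end


declare One_nat_def [simp del]

section \<open>Finite Markov chains\<close>

lemma finite_convergent_subsequence:
  fixes f :: "nat \<Rightarrow> nat \<Rightarrow> real"
  assumes "finite C" and b: "\<And>n j. f n j \<in> {0..1}"
  shows "\<exists>r. strict_mono r \<and> (\<forall>j\<in>C. convergent (\<lambda>n. f (r n) j))"
  using assms(1)
proof (induction C rule: finite_induct)
  case empty
  show ?case by (intro exI[of _ id]) (auto simp: strict_mono_def)
next
  case (insert a C)
  then obtain r where r: "strict_mono r" "\<forall>j\<in>C. convergent (\<lambda>n. f (r n) j)" by auto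
  have "seq_compact {0..1::real}" by (simp add: compact_imp_seq_compact)
  then obtain l s where s: "strict_mono s" "((\<lambda>n. f (r n) a) \<circ> s) \<longlonglongrightarrow> l"
    using b by (metis (mono_tags, lifting) seq_compactE)
  show ?case
  proof (intro exI conjI ballI)
    show "strict_mono (r \<circ> s)" using r s by (simp add: strict_mono_o)
    fix j assume "j \<in> insert a C"
    then show "convergent (\<lambda>n. f ((r \<circ> s) n) j)"
    proof
      assume "j = a"
      then show ?thesis using s(2) by (auto simp: convergent_def o_def)
    next
      assume "j \<in> C"
      then have "convergent ((\<lambda>n. f (r n) j) \<circ> s)" using r(2) s(1) by (intro convergent_subseq_convergent) auto
      then show ?thesis by (simp add: o_def)
    qed
  qed
qed

text \<open>Krylov-Bogoliubov: Cesaro averages of the laws of the chain started at \<open>i0\<close>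
  are invariant up to a telescoping error of order \<open>1 / n\<close>, so the limit along a
  convergent subsequence is invariant.\<close>

lemma stochastic_matrix_stationary:
  fixes P :: "nat \<Rightarrow> nat \<Rightarrow> real"
  assumes fin: "finite C" and ne: "C \<noteq> {}"
    and P0: "\<And>i j. i \<in> C \<Longrightarrow> j \<in> C \<Longrightarrow> 0 \<le> P i j"
    and P1: "\<And>i. i \<in> C \<Longrightarrow> (\<Sum>j\<in>C. P i j) = 1"
  shows "\<exists>\<nu>. (\<forall>j\<in>C. 0 \<le> \<nu> j) \<and> (\<Sum>j\<in>C. \<nu> j) = 1 \<and> (\<forall>j\<in>C. (\<Sum>i\<in>C. \<nu> i * P i j) = \<nu> j)"
proof -
  obtain i0 where i0: "i0 \<in> C" using ne by auto
  define \<mu> where "\<mu> = rec_nat (\<lambda>j. if j = i0 then 1 else (0::real)) (\<lambda>_ m j. \<Sum>i\<in>C. m i * P i j)"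
  have mu0: "\<mu> 0 = (\<lambda>j. if j = i0 then 1 else 0)" and muS: "\<mu> (Suc k) = (\<lambda>j. \<Sum>i\<in>C. \<mu> k i * P i j)" for k
    by (simp_all add: \<mu>_def)
  have nn: "\<forall>j\<in>C. 0 \<le> \<mu> k j" for k
    by (induction k) (auto simp: mu0 muS intro!: sum_nonneg mult_nonneg_nonneg P0)
  have s1: "(\<Sum>j\<in>C. \<mu> k j) = 1" for k
  proof (induction k)
    case 0 then show ?case using i0 fin by (simp add: mu0)
  next
    case (Suc k)
    have "(\<Sum>j\<in>C. \<mu> (Suc k) j) = (\<Sum>i\<in>C. \<Sum>j\<in>C. \<mu> k i * P i j)" unfolding muS by (rule sum.swap)
    also have "\<dots> = (\<Sum>i\<in>C. \<mu> k i)" by (simp add: P1 flip: sum_distrib_left)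
    finally show ?case using Suc by simp
  qed
  have le1: "\<mu> k j \<le> 1" if "j \<in> C" for k j
    using member_le_sum[of j C "\<mu> k"] that nn fin s1 by auto
  \<comment> \<open>Set to 0 off \<open>C\<close>, because the subsequence lemma asks for values in
    \<open>{0..1}\<close> at every index.\<close>
  define a where "a n j = (if j \<in> C then (\<Sum>k<Suc n. \<mu> k j) / real (Suc n) else 0)" for n j
  have a01: "a n j \<in> {0..1}" for n j
  proof (cases "j \<in> C")
    case True
    have "(\<Sum>k<Suc n. \<mu> k j) \<le> (\<Sum>k<Suc n. 1)" by (intro sum_mono le1 True)
    moreover have "0 \<le> (\<Sum>k<Suc n. \<mu> k j)" by (intro sum_nonneg) (use nn True in auto)
    ultimately show ?thesis using True by (simp add: a_def divide_le_eq_1)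
  qed (simp add: a_def)
  obtain r where r: "strict_mono r" "\<forall>j\<in>C. convergent (\<lambda>n. a (r n) j)"
    using finite_convergent_subsequence[OF fin, of a] a01 by auto
  define \<nu> where "\<nu> j = lim (\<lambda>n. a (r n) j)" for j
  have lim: "(\<lambda>n. a (r n) j) \<longlonglongrightarrow> \<nu> j" if "j \<in> C" for j
    using r(2) that by (simp add: \<nu>_def convergent_LIMSEQ_iff)
  have as: "(\<Sum>j\<in>C. a n j) = 1" for n
  proof -
    have "(\<Sum>j\<in>C. a n j) = (\<Sum>j\<in>C. (\<Sum>k<Suc n. \<mu> k j)) / real (Suc n)" by (simp add: a_def flip: sum_divide_distrib)
    also have "(\<Sum>j\<in>C. (\<Sum>k<Suc n. \<mu> k j)) = (\<Sum>k<Suc n. \<Sum>j\<in>C. \<mu> k j)" by (rule sum.swap)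
    finally show ?thesis by (simp add: s1 del: sum.lessThan_Suc)
  qed
  have step: "(\<Sum>i\<in>C. a n i * P i j) - a n j = (\<mu> (Suc n) j - \<mu> 0 j) / real (Suc n)" if "j \<in> C" for n j
  proof -
    have "(\<Sum>i\<in>C. a n i * P i j) = (\<Sum>i\<in>C. \<Sum>k<Suc n. \<mu> k i * P i j) / real (Suc n)"
      by (simp add: a_def sum_distrib_right flip: sum_divide_distrib del: sum.lessThan_Suc)
    also have "(\<Sum>i\<in>C. \<Sum>k<Suc n. \<mu> k i * P i j) = (\<Sum>k<Suc n. \<mu> (Suc k) j)"
      unfolding muS by (rule sum.swap)
    finally have "(\<Sum>i\<in>C. a n i * P i j) - a n j = ((\<Sum>k<Suc n. \<mu> (Suc k) j) - (\<Sum>k<Suc n. \<mu> k j)) / real (Suc n)"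
      using that by (simp add: a_def diff_divide_distrib del: sum.lessThan_Suc)
    also have "(\<Sum>k<Suc n. \<mu> (Suc k) j) - (\<Sum>k<Suc n. \<mu> k j) = \<mu> (Suc n) j - \<mu> 0 j"
      using sum_lessThan_telescope[of "\<lambda>k. \<mu> k j" "Suc n"] by (simp add: sum_subtractf del: sum.lessThan_Suc)
    finally show ?thesis .
  qed
  have inv: "(\<Sum>i\<in>C. \<nu> i * P i j) = \<nu> j" if j: "j \<in> C" for j
  proof -
    have "(\<lambda>n. (\<Sum>i\<in>C. a (r n) i * P i j) - a (r n) j) \<longlonglongrightarrow> (\<Sum>i\<in>C. \<nu> i * P i j) - \<nu> j"
      by (intro tendsto_intros lim j)
    moreover have "(\<lambda>n. (\<Sum>i\<in>C. a (r n) i * P i j) - a (r n) j) \<longlonglongrightarrow> 0"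
    proof (rule Lim_null_comparison)
      have "(\<lambda>n. 2 * inverse (real (Suc n))) \<longlonglongrightarrow> 2 * 0" by (intro tendsto_intros LIMSEQ_inverse_real_of_nat)
      then have "((\<lambda>n. 2 * inverse (real (Suc n))) \<circ> r) \<longlonglongrightarrow> 0" using r(1) by (intro LIMSEQ_subseq_LIMSEQ) auto
      then show "(\<lambda>n. 2 * inverse (real (Suc (r n)))) \<longlonglongrightarrow> 0" by (simp add: o_def)
      show "eventually (\<lambda>n. norm ((\<Sum>i\<in>C. a (r n) i * P i j) - a (r n) j) \<le> 2 * inverse (real (Suc (r n)))) sequentially"
      proof (intro always_eventually allI)
        fix n
        have "\<bar>\<mu> (Suc (r n)) j - \<mu> 0 j\<bar> \<le> 2"
          using nn[of "Suc (r n)"] nn[of 0] le1[OF j, of "Suc (r n)"] le1[OF j, of 0] j by (force simp: abs_le_iff)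
        then show "norm ((\<Sum>i\<in>C. a (r n) i * P i j) - a (r n) j) \<le> 2 * inverse (real (Suc (r n)))"
          unfolding step[OF j]
          using mult_right_mono[of "\<bar>\<mu> (Suc (r n)) j - \<mu> 0 j\<bar>" 2 "inverse (real (Suc (r n)))"]
          by (simp add: divide_inverse abs_mult)
      qed
    qed
    ultimately have "(\<Sum>i\<in>C. \<nu> i * P i j) - \<nu> j = 0" by (rule LIMSEQ_unique)
    then show ?thesis by simp
  qed
  have "0 \<le> \<nu> j" if "j \<in> C" for j
    using LIMSEQ_le_const[OF lim[OF that], of 0] a01 by auto
  moreover have "(\<Sum>j\<in>C. \<nu> j) = 1"
  proof -
    have "(\<lambda>n. \<Sum>j\<in>C. a (r n) j) \<longlonglongrightarrow> (\<Sum>j\<in>C. \<nu> j)" by (intro tendsto_sum lim)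
    then show ?thesis by (simp add: as LIMSEQ_const_iff)
  qed
  ultimately show ?thesis using inv by blast
qed

text \<open>A closed set carries a stationary law of its own, which extended by 0 is stationary for
  the whole chain and hence equals \<open>\<pi>\<close> by uniqueness. This takes the role that
  irreducibility would have.\<close>

lemma unique_stationary_vanishes_off_closed:
  fixes P :: "nat \<Rightarrow> nat \<Rightarrow> real"
  assumes P0: "\<And>i j. i \<in> {1..N} \<Longrightarrow> j \<in> {1..N} \<Longrightarrow> 0 \<le> P i j"
    and P1: "\<And>i. i \<in> {1..N} \<Longrightarrow> (\<Sum>j\<in>{1..N}. P i j) = 1"
    and uniq: "\<And>\<nu>. stationary_dist N P \<nu> \<Longrightarrow> (\<forall>j\<in>{1..N}. \<nu> j = \<pi> j)"
    and C: "C \<subseteq> {1..N}" "C \<noteq> {}" and closed: "\<And>i j. i \<in> C \<Longrightarrow> j \<in> {1..N} \<Longrightarrow> 0 < P i j \<Longrightarrow> j \<in> C"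
    and j: "j \<in> {1..N}" "j \<notin> C"
  shows "\<pi> j = 0"
proof -
  have z: "P i k = 0" if "i \<in> C" "k \<in> {1..N} - C" for i k
    using closed[of i k] P0[of i k] that C by force
  have fin: "finite C" using C finite_subset by blast
  have "(\<Sum>k\<in>C. P i k) = 1" if "i \<in> C" for i
  proof -
    have "(\<Sum>k\<in>{1..N}. P i k) = (\<Sum>k\<in>C. P i k)"
      by (rule sum.mono_neutral_right) (use C z that in auto)
    then show ?thesis using P1[of i] C that by auto
  qed
  then obtain \<nu> where nu: "\<forall>j\<in>C. 0 \<le> \<nu> j" "(\<Sum>j\<in>C. \<nu> j) = 1" "\<forall>j\<in>C. (\<Sum>i\<in>C. \<nu> i * P i j) = \<nu> j"
    using stochastic_matrix_stationary[OF fin C(2), of P] P0 C(1) by blast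
  define \<nu>' where "\<nu>' k = (if k \<in> C then \<nu> k else 0)" for k
  have sumC: "(\<Sum>k\<in>{1..N}. \<nu>' k * h k) = (\<Sum>k\<in>C. \<nu> k * h k)" for h
    by (rule sum.mono_neutral_cong_right) (use C in \<open>auto simp: \<nu>'_def\<close>)
  have "stationary_dist N P \<nu>'"
    unfolding stationary_dist_def
  proof (intro conjI ballI)
    show "0 \<le> \<nu>' i" for i using nu by (simp add: \<nu>'_def)
    show "(\<Sum>i\<in>{1..N}. \<nu>' i) = 1" using sumC[of "\<lambda>_. 1"] nu by simp
    show "(\<Sum>i\<in>{1..N}. \<nu>' i * P i k) = \<nu>' k" if "k \<in> {1..N}" for k
      unfolding sumC using nu z that by (auto simp: \<nu>'_def intro!: sum.neutral)
  qed
  from bspec[OF uniq[OF this] j(1)] show ?thesis using j(2) by (simp add: \<nu>'_def)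
qed

section \<open>Primitives of monotone functions\<close>

text \<open>An oriented integral, so that levels left of 0 are covered too; it enters the argument
  through its increments.\<close>

definition prim :: "(real \<Rightarrow> real) \<Rightarrow> real \<Rightarrow> real" where
  "prim \<phi> x = (LBINT z=ereal 0..ereal x. \<phi> z)"

text \<open>The class in which all exceedance probabilities live, stable under averaging over a
  jump. No limit at infinity is prescribed, because the vanishing of \<open>Psi\<close> there has to
  be proved.\<close>

definition unit_antimono :: "(real \<Rightarrow> real) \<Rightarrow> bool" where
  "unit_antimono \<phi> \<longleftrightarrow> (\<forall>x. 0 \<le> \<phi> x \<and> \<phi> x \<le> 1) \<and> (\<forall>x y. x \<le> y \<longrightarrow> \<phi> y \<le> \<phi> x)"

lemma integrable_indicator_Icc: "integrable lborel (indicator {a..b::real} :: real \<Rightarrow> real)"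
  by (rule integrable_real_indicator) (auto simp: emeasure_lborel_Icc_eq)

context
  fixes \<phi> :: "real \<Rightarrow> real"
  assumes ua: "unit_antimono \<phi>"
begin

lemma ua_bounds: "0 \<le> \<phi> x" "\<phi> x \<le> 1" using ua by (auto simp: unit_antimono_def)

lemma ua_mono: "x \<le> y \<Longrightarrow> \<phi> y \<le> \<phi> x" using ua by (auto simp: unit_antimono_def)

lemma ua_measurable: "\<phi> \<in> borel_measurable borel"
  by (rule borel_measurable_antimono) (rule ua_mono)

lemma ua_set_integrable: "set_integrable lborel {a..b} \<phi>"
proof -
  note [measurable] = ua_measurable
  show ?thesis unfolding set_integrable_def
  proof (rule Bochner_Integration.integrable_bound[OF integrable_indicator_Icc[of a b]])
    show "AE x in lborel. norm (indicator {a..b} x *\<^sub>R \<phi> x) \<le> norm (indicator {a..b} x :: real)"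
      by (rule AE_I2) (simp add: ua_bounds indicator_def)
  qed measurable
qed

lemma prim_diff: assumes "a \<le> b" shows "prim \<phi> b - prim \<phi> a = (LBINT z:{a..b}. \<phi> z)"
proof -
  have "(LBINT z=ereal 0..ereal a. \<phi> z) + (LBINT z=ereal a..ereal b. \<phi> z) = (LBINT z=ereal 0..ereal b. \<phi> z)"
  proof (rule interval_integral_sum)
    have e: "min (ereal 0) (min (ereal a) (ereal b)) = ereal (min 0 (min a b))"
      "max (ereal 0) (max (ereal a) (ereal b)) = ereal (max 0 (max a b))" by (auto simp: min_def max_def)
    show "interval_lebesgue_integrable lborel (min (ereal 0) (min (ereal a) (ereal b))) (max (ereal 0) (max (ereal a) (ereal b))) \<phi>"
      unfolding e interval_lebesgue_integrable_def einterval_eq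
      by (auto intro!: set_integrable_subset[OF ua_set_integrable[of "min 0 (min a b)" "max 0 (max a b)"]])
  qed
  then show ?thesis unfolding prim_def using interval_integral_Icc[OF assms, of \<phi>] by simp
qed

lemma prim_bounds:
  assumes "a \<le> b"
  shows "\<phi> b * (b - a) \<le> prim \<phi> b - prim \<phi> a" "prim \<phi> b - prim \<phi> a \<le> \<phi> a * (b - a)"
proof -
  have s: "set_integrable lborel {a..b} (\<lambda>_. c)" for c :: real by (simp add: set_integrable_def integrable_indicator_Icc)
  have c: "(LBINT z:{a..b}. c) = c * (b - a)" for c :: real
    using assms by (simp add: set_lebesgue_integral_def)
  show "\<phi> b * (b - a) \<le> prim \<phi> b - prim \<phi> a"
    unfolding prim_diff[OF assms] c[symmetric] by (intro set_integral_mono s ua_set_integrable) (auto intro: ua_mono)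
  show "prim \<phi> b - prim \<phi> a \<le> \<phi> a * (b - a)"
    unfolding prim_diff[OF assms] c[symmetric] by (intro set_integral_mono s ua_set_integrable) (auto intro: ua_mono)
qed

lemma prim_mono: "a \<le> b \<Longrightarrow> prim \<phi> a \<le> prim \<phi> b"
  using prim_bounds(1)[of a b] ua_bounds(1)[of b] by (smt (verit) mult_nonneg_nonneg)

lemma prim_measurable: "prim \<phi> \<in> borel_measurable borel"
  by (rule borel_measurable_mono) (auto simp: mono_def intro: prim_mono)

lemma prim_lipschitz: "\<bar>prim \<phi> b - prim \<phi> a\<bar> \<le> \<bar>b - a\<bar>"
proof -
  have *: "\<bar>prim \<phi> b - prim \<phi> a\<bar> \<le> b - a" if "a \<le> b" for a b
    using prim_bounds(2)[OF that] prim_mono[OF that] mult_right_mono[OF ua_bounds(2)[of a], of "b - a"] that by simp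
  show ?thesis using *[of a b] *[of b a] by (cases "a \<le> b") auto
qed

lemma prim_increment_bounds:
  "min (\<phi> x * u) (\<phi> (x - u) * u) \<le> prim \<phi> x - prim \<phi> (x - u)"
  "prim \<phi> x - prim \<phi> (x - u) \<le> max (\<phi> x * u) (\<phi> (x - u) * u)"
proof -
  have "\<phi> x * u \<le> prim \<phi> x - prim \<phi> (x - u) \<and> prim \<phi> x - prim \<phi> (x - u) \<le> \<phi> (x - u) * u"
  proof (cases "0 \<le> u")
    case True
    then show ?thesis using prim_bounds[of "x - u" x] by simp
  next
    case False
    then show ?thesis using prim_bounds[of x "x - u"] by simp
  qed
  then show "min (\<phi> x * u) (\<phi> (x - u) * u) \<le> prim \<phi> x - prim \<phi> (x - u)"
    "prim \<phi> x - prim \<phi> (x - u) \<le> max (\<phi> x * u) (\<phi> (x - u) * u)"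
    by (auto intro: min.coboundedI1 max.coboundedI2)
qed

lemma prim_increment_tendsto:
  assumes X: "filterlim X at_top sequentially" and g: "(\<phi> \<longlongrightarrow> g) at_top"
  shows "(\<lambda>n. prim \<phi> (X n) - prim \<phi> (X n - u)) \<longlonglongrightarrow> g * u"
proof (rule tendsto_sandwich[OF always_eventually always_eventually])
  show "\<forall>n. min (\<phi> (X n) * u) (\<phi> (X n - u) * u) \<le> prim \<phi> (X n) - prim \<phi> (X n - u)"
    using prim_increment_bounds(1) by blast
  show "\<forall>n. prim \<phi> (X n) - prim \<phi> (X n - u) \<le> max (\<phi> (X n) * u) (\<phi> (X n - u) * u)"
    using prim_increment_bounds(2) by blast
  have Xu: "filterlim (\<lambda>n. X n - u) at_top sequentially"
    using filterlim_tendsto_add_at_top[OF tendsto_const[of "-u"] X] by simp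
  note l = filterlim_compose[OF g X] filterlim_compose[OF g Xu]
  have "(\<lambda>n. min (\<phi> (X n) * u) (\<phi> (X n - u) * u)) \<longlonglongrightarrow> min (g * u) (g * u)" by (intro tendsto_intros l)
  then show "(\<lambda>n. min (\<phi> (X n) * u) (\<phi> (X n - u) * u)) \<longlonglongrightarrow> g * u" by simp
  have "(\<lambda>n. max (\<phi> (X n) * u) (\<phi> (X n - u) * u)) \<longlonglongrightarrow> max (g * u) (g * u)" by (intro tendsto_intros l)
  then show "(\<lambda>n. max (\<phi> (X n) * u) (\<phi> (X n - u) * u)) \<longlonglongrightarrow> g * u" by simp
qed

text \<open>The integral over levels of an averaged function becomes an averaged increment of its
  primitive. This links the one-step operator with the drift functional \<open>D\<close>.\<close>

lemma prim_Fubini: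
  assumes H: "real_distribution H" and "x \<le> A"
  shows "(LBINT z:{x..A}. (\<integral>u. \<phi> (z - u) \<partial>H)) = (\<integral>u. prim \<phi> (A - u) - prim \<phi> (x - u) \<partial>H)"
proof -
  interpret H: real_distribution H by (rule H)
  note H.M_is_borel[measurable_cong] and ua_measurable[measurable]
  interpret pair_sigma_finite H lborel ..
  have [measurable]: "(\<lambda>(u, z). indicator {x..A} z * \<phi> (z - u)) \<in> borel_measurable (H \<Otimes>\<^sub>M lborel)" by measurable
  have int: "integrable (H \<Otimes>\<^sub>M lborel) (\<lambda>(u, z). indicator {x..A} z * \<phi> (z - u))"
  proof (rule integrableI_bounded_set[where A="UNIV \<times> {x..A}" and B=1])
    show "emeasure (H \<Otimes>\<^sub>M lborel) (UNIV \<times> {x..A}) < \<infinity>"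
      by (subst lborel.emeasure_pair_measure_Times) (auto simp: H.emeasure_eq_measure ennreal_mult_less_top emeasure_lborel_Icc_eq)
  qed (auto simp: ua_bounds indicator_def intro!: AE_I2)
  have "(LBINT z:{x..A}. (\<integral>u. \<phi> (z - u) \<partial>H)) = (\<integral>z. (\<integral>u. indicator {x..A} z * \<phi> (z - u) \<partial>H) \<partial>lborel)"
    by (simp add: set_lebesgue_integral_def)
  also have "\<dots> = (\<integral>u. (\<integral>z. indicator {x..A} z * \<phi> (z - u) \<partial>lborel) \<partial>H)"
    using Fubini_integral[OF int] by simp
  also have "\<dots> = (\<integral>u. prim \<phi> (A - u) - prim \<phi> (x - u) \<partial>H)"
  proof (intro Bochner_Integration.integral_cong refl)
    fix u
    have "(\<integral>z. indicator {x..A} z * \<phi> (z - u) \<partial>lborel) = (\<integral>z. indicator {x - u..A - u} z * \<phi> z \<partial>lborel)"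
      by (subst lborel_integral_real_affine[where c=1 and t="- u"])
         (auto intro!: Bochner_Integration.integral_cong split: split_indicator)
    also have "\<dots> = prim \<phi> (A - u) - prim \<phi> (x - u)"
      using assms by (subst prim_diff) (auto simp: set_lebesgue_integral_def)
    finally show "(\<integral>z. indicator {x..A} z * \<phi> (z - u) \<partial>lborel) = prim \<phi> (A - u) - prim \<phi> (x - u)" .
  qed
  finally show ?thesis .
qed

end

lemma prim_tendsto:
  assumes ua: "\<And>n. unit_antimono (f n)" and ul: "unit_antimono \<phi>" and lim: "\<And>x. (\<lambda>n. f n x) \<longlonglongrightarrow> \<phi> x"
  shows "(\<lambda>n. prim (f n) b - prim (f n) a) \<longlonglongrightarrow> prim \<phi> b - prim \<phi> a"
proof -
  have *: "(\<lambda>n. prim (f n) b - prim (f n) a) \<longlonglongrightarrow> prim \<phi> b - prim \<phi> a" if "a \<le> b" for a b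
    unfolding prim_diff[OF ua that] prim_diff[OF ul that] set_lebesgue_integral_def
  proof (rule integral_dominated_convergence[where w="indicator {a..b}"])
    have [measurable]: "f n \<in> borel_measurable borel" "\<phi> \<in> borel_measurable borel" for n
      by (rule ua_measurable[OF ua], rule ua_measurable[OF ul])
    show "(\<lambda>x. indicator {a..b} x *\<^sub>R f n x) \<in> borel_measurable lborel"
      "(\<lambda>x. indicator {a..b} x *\<^sub>R \<phi> x) \<in> borel_measurable lborel" for n by measurable
    show "integrable lborel (indicator {a..b} :: real \<Rightarrow> real)" by (rule integrable_indicator_Icc)
    show "AE x in lborel. (\<lambda>n. indicator {a..b} x *\<^sub>R f n x) \<longlonglongrightarrow> indicator {a..b} x *\<^sub>R \<phi> x"
      by (intro AE_I2 tendsto_intros lim)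
    show "AE x in lborel. norm (indicator {a..b} x *\<^sub>R f n x) \<le> indicator {a..b} x" for n
      by (rule AE_I2) (auto simp: ua_bounds[OF ua] split: split_indicator)
  qed
  show ?thesis
  proof (cases "a \<le> b")
    case False
    then show ?thesis using tendsto_minus[OF *[of b a]] by simp
  qed (rule *)
qed

lemma ua_shift_integrable:
  assumes "unit_antimono \<phi>" and H: "real_distribution H"
  shows "integrable H (\<lambda>u. \<phi> (x - u))"
proof -
  interpret H: real_distribution H by (rule H)
  note [measurable] = ua_measurable[OF assms(1)]
  show ?thesis by (rule H.integrable_const_bound[where B=1]) (auto simp: ua_bounds[OF assms(1)])
qed

lemma ua_shift_integral:
  assumes ua: "unit_antimono \<phi>" and H: "real_distribution H"
  shows "unit_antimono (\<lambda>x. \<integral>u. \<phi> (x - u) \<partial>H)"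
  unfolding unit_antimono_def
proof (intro conjI allI impI)
  interpret H: real_distribution H by (rule H)
  fix x y :: real
  show "0 \<le> (\<integral>u. \<phi> (x - u) \<partial>H)" by (rule integral_nonneg_AE) (auto simp: ua_bounds[OF ua])
  have "(\<integral>u. \<phi> (x - u) \<partial>H) \<le> (\<integral>u. 1 \<partial>H)"
    by (rule integral_mono) (auto simp: ua_bounds[OF ua] intro: ua_shift_integrable[OF ua H])
  then show "(\<integral>u. \<phi> (x - u) \<partial>H) \<le> 1" using H.prob_space by simp
  show "(\<integral>u. \<phi> (y - u) \<partial>H) \<le> (\<integral>u. \<phi> (x - u) \<partial>H)" if "x \<le> y"
    by (rule integral_mono) (use that in \<open>auto intro: ua_shift_integrable[OF ua H] ua_mono[OF ua]\<close>)
qed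

lemma ua_shift_integral_tendsto:
  assumes ua: "\<And>n. unit_antimono (f n)" "unit_antimono \<phi>" and H: "real_distribution H"
    and lim: "\<And>x. (\<lambda>n. f n x) \<longlonglongrightarrow> \<phi> x"
  shows "(\<lambda>n. \<integral>u. f n (x - u) \<partial>H) \<longlonglongrightarrow> (\<integral>u. \<phi> (x - u) \<partial>H)"
proof (rule integral_dominated_convergence[where w="\<lambda>_. 1"])
  interpret H: real_distribution H by (rule H)
  have [measurable]: "f n \<in> borel_measurable borel" "\<phi> \<in> borel_measurable borel" for n
    by (rule ua_measurable[OF ua(1)], rule ua_measurable[OF ua(2)])
  show "(\<lambda>u. f n (x - u)) \<in> borel_measurable H" "(\<lambda>u. \<phi> (x - u)) \<in> borel_measurable H" for n by simp_all
  show "integrable H (\<lambda>_. 1::real)" by simp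
  show "AE u in H. (\<lambda>n. f n (x - u)) \<longlonglongrightarrow> \<phi> (x - u)" by (intro AE_I2 lim)
  show "AE u in H. norm (f n (x - u)) \<le> 1" for n by (rule AE_I2) (simp add: ua_bounds[OF ua(1)])
qed

lemma ua_shift_integral_at_top:
  assumes ua: "unit_antimono \<phi>" and H: "real_distribution H" and g: "(\<phi> \<longlongrightarrow> g) at_top"
  shows "((\<lambda>x. \<integral>u. \<phi> (x - u) \<partial>H) \<longlongrightarrow> g) at_top"
proof (rule tendsto_at_topI_sequentially)
  interpret H: real_distribution H by (rule H)
  note [measurable] = ua_measurable[OF ua]
  fix X :: "nat \<Rightarrow> real" assume X: "filterlim X at_top sequentially"
  have "(\<lambda>n. \<integral>u. \<phi> (X n - u) \<partial>H) \<longlonglongrightarrow> (\<integral>u. g \<partial>H)"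
  proof (rule integral_dominated_convergence[where w="\<lambda>_. 1"])
    show "(\<lambda>u. \<phi> (X n - u)) \<in> borel_measurable H" for n by simp
    show "AE u in H. (\<lambda>n. \<phi> (X n - u)) \<longlonglongrightarrow> g"
    proof (rule AE_I2)
      fix u
      have "filterlim (\<lambda>n. X n - u) at_top sequentially"
        using filterlim_tendsto_add_at_top[OF tendsto_const[of "-u"] X] by simp
      then show "(\<lambda>n. \<phi> (X n - u)) \<longlonglongrightarrow> g" by (rule filterlim_compose[OF g])
    qed
    show "AE u in H. norm (\<phi> (X n - u)) \<le> 1" for n by (rule AE_I2) (simp add: ua_bounds[OF ua])
  qed simp_all
  then show "(\<lambda>n. \<integral>u. \<phi> (X n - u) \<partial>H) \<longlonglongrightarrow> g" using H.prob_space by simp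
qed

lemma ua_has_limit:
  assumes ua: "unit_antimono \<phi>" shows "(\<phi> \<longlongrightarrow> Inf (range \<phi>)) at_top"
proof (rule decreasing_tendsto)
  have bdd: "bdd_below (range \<phi>)" by (rule bdd_belowI2[of _ 0]) (rule ua_bounds(1)[OF ua])
  show "eventually (\<lambda>x. Inf (range \<phi>) \<le> \<phi> x) at_top"
    by (intro always_eventually allI cInf_lower bdd) auto
  fix x assume "Inf (range \<phi>) < x"
  then obtain y where y: "\<phi> y < x" using cInf_lessD[of "range \<phi>" x] by auto
  show "eventually (\<lambda>z. \<phi> z < x) at_top"
    using eventually_ge_at_top[of y]
  proof eventually_elim
    case (elim z)
    then show ?case using ua_mono[OF ua, of y z] y by simp
  qed
qed

lemma prim_increment_integrable:
  assumes ua: "unit_antimono \<phi>" and H: "real_distribution H" and m: "integrable H (\<lambda>u. u)"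
  shows "integrable H (\<lambda>u. prim \<phi> a - prim \<phi> (x - u))"
proof -
  interpret H: real_distribution H by (rule H)
  note [measurable] = prim_measurable[OF ua]
  show ?thesis
  proof (rule Bochner_Integration.integrable_bound)
    show "integrable H (\<lambda>u. \<bar>a - x\<bar> + \<bar>u\<bar>)" using integrable_abs[OF m] by simp
    show "(\<lambda>u. prim \<phi> a - prim \<phi> (x - u)) \<in> borel_measurable H" by simp
    show "AE u in H. norm (prim \<phi> a - prim \<phi> (x - u)) \<le> norm (\<bar>a - x\<bar> + \<bar>u\<bar>)"
    proof (rule AE_I2)
      fix u show "norm (prim \<phi> a - prim \<phi> (x - u)) \<le> norm (\<bar>a - x\<bar> + \<bar>u\<bar>)"
        using prim_lipschitz[OF ua, of a "x - u"] by auto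
    qed
  qed
qed

section \<open>The maximum of the modulated walk\<close>

text \<open>Increments are indexed by both end states because the claim depends on the transition.
  The tail hypotheses concern only the mixture over the successor, and they use the uncut
  \<open>tail_integral\<close>, in which that mixture is linear.\<close>

locale modulated_walk = subexponential_tail F for F +
  fixes N :: nat and P :: "nat \<Rightarrow> nat \<Rightarrow> real" and H :: "nat \<Rightarrow> nat \<Rightarrow> real measure"
    and \<pi> :: "nat \<Rightarrow> real" and c :: "nat \<Rightarrow> real"
  assumes P0: "\<And>i j. i \<in> {1..N} \<Longrightarrow> j \<in> {1..N} \<Longrightarrow> 0 \<le> P i j"
    and P1: "\<And>i. i \<in> {1..N} \<Longrightarrow> (\<Sum>j\<in>{1..N}. P i j) = 1"
    and H_dist: "\<And>i j. i \<in> {1..N} \<Longrightarrow> j \<in> {1..N} \<Longrightarrow> real_distribution (H i j)"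
    and H_mean: "\<And>i j. i \<in> {1..N} \<Longrightarrow> j \<in> {1..N} \<Longrightarrow> integrable (H i j) (\<lambda>u. u)"
    and stat: "stationary_dist N P \<pi>"
    and uniq: "\<And>\<nu>. stationary_dist N P \<nu> \<Longrightarrow> (\<forall>j\<in>{1..N}. \<nu> j = \<pi> j)"
    and dom: "\<And>i x. i \<in> {1..N} \<Longrightarrow> (\<Sum>j\<in>{1..N}. P i j * ccdf (H i j) x) \<le> ccdf F x"
    and tails: "\<And>i. i \<in> {1..N} \<Longrightarrow>
      ((\<lambda>x. (\<Sum>j\<in>{1..N}. P i j * tail_integral (H i j) x) / int_tail F x) \<longlongrightarrow> c i) at_top"
    and drift: "0 < - (\<Sum>i\<in>{1..N}. \<pi> i * (\<Sum>j\<in>{1..N}. P i j * (\<integral>u. u \<partial>H i j)))"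
begin

abbreviation "E \<equiv> {1..N}"

text \<open>First-step analysis for the event that the walk exceeds \<open>x\<close>; below 0 the
  event has already happened, whence the value 1.\<close>

definition step :: "(nat \<Rightarrow> real \<Rightarrow> real) \<Rightarrow> nat \<Rightarrow> real \<Rightarrow> real" where
  "step \<phi> i x = (if x < 0 then 1 else \<Sum>j\<in>E. P i j * (\<integral>u. \<phi> j (x - u) \<partial>H i j))"

text \<open>The probability, from state \<open>i\<close>, that the walk exceeds \<open>x\<close> at
  one of the times 0 to \<open>n\<close>; at time 0 its position is 0.\<close>

primrec psi :: "nat \<Rightarrow> nat \<Rightarrow> real \<Rightarrow> real" where
  "psi 0 = (\<lambda>i x. if x < 0 then 1 else 0)"
| "psi (Suc n) = step (psi n)"

lemma \<pi>_nonneg: "i \<in> E \<Longrightarrow> 0 \<le> \<pi> i" and \<pi>_sum: "(\<Sum>i\<in>E. \<pi> i) = 1"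
  and \<pi>_inv: "j \<in> E \<Longrightarrow> (\<Sum>i\<in>E. \<pi> i * P i j) = \<pi> j"
  using stat by (auto simp: stationary_dist_def)

lemma E_ne: "E \<noteq> {}" using \<pi>_sum by force

lemma stationary_sum: "(\<Sum>i\<in>E. \<pi> i * (\<Sum>j\<in>E. P i j * h j)) = (\<Sum>j\<in>E. \<pi> j * h j)"
proof -
  have "(\<Sum>i\<in>E. \<pi> i * (\<Sum>j\<in>E. P i j * h j)) = (\<Sum>i\<in>E. \<Sum>j\<in>E. \<pi> i * P i j * h j)"
    by (simp add: sum_distrib_left mult.assoc)
  also have "\<dots> = (\<Sum>j\<in>E. \<Sum>i\<in>E. \<pi> i * P i j * h j)" by (rule sum.swap)
  also have "\<dots> = (\<Sum>j\<in>E. \<pi> j * h j)" by (simp add: \<pi>_inv flip: sum_distrib_right)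
  finally show ?thesis .
qed

lemma ua_step:
  assumes ua: "\<And>j. j \<in> E \<Longrightarrow> unit_antimono (\<phi> j)" and i: "i \<in> E"
  shows "unit_antimono (step \<phi> i)"
proof -
  let ?S = "\<lambda>x. \<Sum>j\<in>E. P i j * (\<integral>u. \<phi> j (x - u) \<partial>H i j)"
  have u: "unit_antimono (\<lambda>x. \<integral>u. \<phi> j (x - u) \<partial>H i j)" if "j \<in> E" for j
    by (rule ua_shift_integral[OF ua[OF that] H_dist[OF i that]])
  have s0: "0 \<le> ?S x" for x
    by (intro sum_nonneg mult_nonneg_nonneg P0 i) (use ua_bounds(1)[OF u] in auto)
  have s1: "?S x \<le> 1" for x
  proof -
    have "?S x \<le> (\<Sum>j\<in>E. P i j * 1)"
      by (intro sum_mono mult_left_mono P0 i) (use ua_bounds(2)[OF u] in auto)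
    then show ?thesis using P1[OF i] by simp
  qed
  have sm: "?S y \<le> ?S x" if "x \<le> y" for x y
    by (intro sum_mono mult_left_mono P0 i) (use ua_mono[OF u] that in auto)
  show ?thesis unfolding unit_antimono_def step_def using s0 s1 sm by auto
qed

lemma ua_psi: "i \<in> E \<Longrightarrow> unit_antimono (psi n i)"
proof (induction n arbitrary: i)
  case 0 then show ?case by (auto simp: unit_antimono_def)
next
  case (Suc n) then show ?case using ua_step[of "psi n" i] by simp
qed

lemma psi_neg: "x < 0 \<Longrightarrow> psi n i x = 1"
  by (cases n) (auto simp: step_def)

lemma step_mono:
  assumes "\<And>j. j \<in> E \<Longrightarrow> unit_antimono (\<phi> j)" "\<And>j. j \<in> E \<Longrightarrow> unit_antimono (\<phi>' j)"
    and "\<And>j x. j \<in> E \<Longrightarrow> \<phi> j x \<le> \<phi>' j x" and i: "i \<in> E"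
  shows "step \<phi> i x \<le> step \<phi>' i x"
proof -
  have "(\<integral>u. \<phi> j (x - u) \<partial>H i j) \<le> (\<integral>u. \<phi>' j (x - u) \<partial>H i j)" if "j \<in> E" for j
    by (rule integral_mono) (use assms that in \<open>auto intro!: ua_shift_integrable H_dist\<close>)
  then show ?thesis unfolding step_def by (auto intro!: sum_mono mult_left_mono P0 i)
qed

lemma psi_Suc_ge: "i \<in> E \<Longrightarrow> psi n i x \<le> psi (Suc n) i x"
proof (induction n arbitrary: i x)
  case 0
  then show ?case using ua_bounds(1)[OF ua_psi[of i "Suc 0"], of x] psi_neg[of x "Suc 0" i] by auto
next
  case (Suc n)
  have "step (psi n) i x \<le> step (psi (Suc n)) i x"
    by (rule step_mono) (use Suc in \<open>auto intro: ua_psi simp del: psi.simps\<close>)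
  then show ?case by simp
qed

definition Psi where "Psi i x = lim (\<lambda>n. psi n i x)"

lemma psi_tendsto: assumes "i \<in> E" shows "(\<lambda>n. psi n i x) \<longlonglongrightarrow> Psi i x"
proof -
  have "incseq (\<lambda>n. psi n i x)" using psi_Suc_ge[OF assms] by (rule incseq_SucI)
  moreover have "\<forall>n. psi n i x \<le> 1" using ua_bounds(2)[OF ua_psi[OF assms]] by blast
  ultimately obtain L where "(\<lambda>n. psi n i x) \<longlonglongrightarrow> L" using incseq_convergent by metis
  then show ?thesis unfolding Psi_def by (simp add: limI)
qed

lemma ua_Psi: assumes "i \<in> E" shows "unit_antimono (Psi i)"
  unfolding unit_antimono_def
proof (intro conjI allI impI)
  note u = ua_psi[OF assms]
  show "0 \<le> Psi i x" "Psi i x \<le> 1" for x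
    using LIMSEQ_le_const[OF psi_tendsto[OF assms]] LIMSEQ_le_const2[OF psi_tendsto[OF assms]] ua_bounds[OF u] by blast+
  show "Psi i y \<le> Psi i x" if "x \<le> y" for x y
    by (rule LIMSEQ_le[OF psi_tendsto[OF assms] psi_tendsto[OF assms]]) (use ua_mono[OF u that] in auto)
qed

lemma Psi_neg: "i \<in> E \<Longrightarrow> x < 0 \<Longrightarrow> Psi i x = 1"
  using psi_tendsto[of i x] by (simp add: psi_neg LIMSEQ_const_iff)

lemma Psi_step: assumes i: "i \<in> E" shows "step Psi i x = Psi i x"
proof -
  have "(\<lambda>n. step (psi n) i x) \<longlonglongrightarrow> step Psi i x"
  proof (cases "x < 0")
    case False
    have "(\<lambda>n. \<Sum>j\<in>E. P i j * (\<integral>u. psi n j (x - u) \<partial>H i j)) \<longlonglongrightarrow> (\<Sum>j\<in>E. P i j * (\<integral>u. Psi j (x - u) \<partial>H i j))"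
      by (intro tendsto_intros ua_shift_integral_tendsto ua_psi ua_Psi H_dist i psi_tendsto)
    then show ?thesis using False by (simp add: step_def)
  qed (simp add: step_def)
  moreover have "(\<lambda>n. step (psi n) i x) \<longlonglongrightarrow> Psi i x"
    using LIMSEQ_Suc[OF psi_tendsto[OF i]] by simp
  ultimately show ?thesis by (rule LIMSEQ_unique)
qed

text \<open>The kernel here is that of the free walk: unlike in \<open>step\<close>, the value 1
  below 0 is not imposed, so \<open>D\<close> matches the one-step equation only at levels
  \<open>x \<ge> 0\<close>.\<close>

definition D :: "(nat \<Rightarrow> real \<Rightarrow> real) \<Rightarrow> real \<Rightarrow> real" where
  "D \<phi> x = (\<Sum>i\<in>E. \<pi> i * (\<Sum>j\<in>E. P i j * (\<integral>u. prim (\<phi> j) x - prim (\<phi> j) (x - u) \<partial>H i j)))"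

text \<open>By \<open>prim_Fubini\<close> the change of \<open>D\<close> between two levels is an
  integral of one-step averages minus values at the successors, and stationarity of
  \<open>\<pi>\<close> turns the average over successors into one over the present state. What
  remains is the defect of the one-step equation, so \<open>D\<close> is constant for a fixed
  point.\<close>

lemma D_diff:
  assumes ua: "\<And>j. j \<in> E \<Longrightarrow> unit_antimono (\<phi> j)" and x: "0 \<le> x" "x \<le> A"
  shows "D \<phi> x - D \<phi> A = (\<Sum>i\<in>E. \<pi> i * ((LBINT z:{x..A}. step \<phi> i z) - (LBINT z:{x..A}. \<phi> i z)))"
proof -
  have inner: "(\<Sum>j\<in>E. P i j * (\<integral>u. prim (\<phi> j) x - prim (\<phi> j) (x - u) \<partial>H i j))
      - (\<Sum>j\<in>E. P i j * (\<integral>u. prim (\<phi> j) A - prim (\<phi> j) (A - u) \<partial>H i j))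
      = (LBINT z:{x..A}. step \<phi> i z) - (\<Sum>j\<in>E. P i j * (LBINT z:{x..A}. \<phi> j z))" if i: "i \<in> E" for i
  proof -
    have one: "(\<integral>u. prim (\<phi> j) x - prim (\<phi> j) (x - u) \<partial>H i j) - (\<integral>u. prim (\<phi> j) A - prim (\<phi> j) (A - u) \<partial>H i j)
       = (LBINT z:{x..A}. (\<integral>u. \<phi> j (z - u) \<partial>H i j)) - (LBINT z:{x..A}. \<phi> j z)" if j: "j \<in> E" for j
    proof -
      interpret H: real_distribution "H i j" by (rule H_dist[OF i j])
      note I = prim_increment_integrable[OF ua[OF j] H_dist[OF i j] H_mean[OF i j]]
      have "(\<integral>u. prim (\<phi> j) (A - u) - prim (\<phi> j) (x - u) \<partial>H i j)
        = (\<integral>u. (prim (\<phi> j) x - prim (\<phi> j) (x - u)) - (prim (\<phi> j) A - prim (\<phi> j) (A - u)) + (prim (\<phi> j) A - prim (\<phi> j) x) \<partial>H i j)"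
        by (intro Bochner_Integration.integral_cong) auto
      also have "\<dots> = (\<integral>u. prim (\<phi> j) x - prim (\<phi> j) (x - u) \<partial>H i j)
          - (\<integral>u. prim (\<phi> j) A - prim (\<phi> j) (A - u) \<partial>H i j) + (prim (\<phi> j) A - prim (\<phi> j) x)"
        unfolding Bochner_Integration.integral_diff[OF I I, symmetric]
        using Bochner_Integration.integral_add[OF Bochner_Integration.integrable_diff[OF I[of x x] I[of A A]], of "\<lambda>_. prim (\<phi> j) A - prim (\<phi> j) x"] H.prob_space
        by simp
      finally show ?thesis
        unfolding prim_Fubini[OF ua[OF j] H_dist[OF i j] x(2)] prim_diff[OF ua[OF j] x(2), symmetric] by simp
    qed
    have "(LBINT z:{x..A}. step \<phi> i z) = (LBINT z:{x..A}. (\<Sum>j\<in>E. P i j * (\<integral>u. \<phi> j (z - u) \<partial>H i j)))"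
      by (rule set_lebesgue_integral_cong) (use x in \<open>auto simp: step_def\<close>)
    also have "\<dots> = (\<Sum>j\<in>E. P i j * (LBINT z:{x..A}. (\<integral>u. \<phi> j (z - u) \<partial>H i j)))"
    proof -
      have "integrable lborel (\<lambda>z. indicator {x..A} z * (\<integral>u. \<phi> j (z - u) \<partial>H i j))" if "j \<in> E" for j
        using ua_set_integrable[OF ua_shift_integral[OF ua[OF that] H_dist[OF i that]], of x A] by (simp add: set_integrable_def)
      then show ?thesis
        unfolding set_lebesgue_integral_def
        by (subst Bochner_Integration.integral_mult_right_zero[symmetric] Bochner_Integration.integral_sum[symmetric])+
           (auto intro!: Bochner_Integration.integral_cong simp: sum_distrib_left mult_ac)
    qed
    finally have S: "(LBINT z:{x..A}. step \<phi> i z) = (\<Sum>j\<in>E. P i j * (LBINT z:{x..A}. (\<integral>u. \<phi> j (z - u) \<partial>H i j)))" .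
    show ?thesis unfolding S sum_subtractf[symmetric] right_diff_distrib[symmetric]
      by (intro sum.cong refl) (simp add: one)
  qed
  have "D \<phi> x - D \<phi> A = (\<Sum>i\<in>E. \<pi> i * ((LBINT z:{x..A}. step \<phi> i z) - (\<Sum>j\<in>E. P i j * (LBINT z:{x..A}. \<phi> j z))))"
  proof -
    let ?S = "\<lambda>x i. \<Sum>j\<in>E. P i j * (\<integral>u. prim (\<phi> j) x - prim (\<phi> j) (x - u) \<partial>H i j)"
    have "D \<phi> x - D \<phi> A = (\<Sum>i\<in>E. \<pi> i * (?S x i - ?S A i))"
      unfolding D_def by (simp only: right_diff_distrib sum_subtractf)
    also have "\<dots> = (\<Sum>i\<in>E. \<pi> i * ((LBINT z:{x..A}. step \<phi> i z) - (\<Sum>j\<in>E. P i j * (LBINT z:{x..A}. \<phi> j z))))"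
      by (intro sum.cong refl) (simp only: inner)
    finally show ?thesis .
  qed
  also have "\<dots> = (\<Sum>i\<in>E. \<pi> i * (LBINT z:{x..A}. step \<phi> i z)) - (\<Sum>i\<in>E. \<pi> i * (\<Sum>j\<in>E. P i j * (LBINT z:{x..A}. \<phi> j z)))"
    by (simp add: right_diff_distrib sum_subtractf)
  also have "\<dots> = (\<Sum>i\<in>E. \<pi> i * ((LBINT z:{x..A}. step \<phi> i z) - (LBINT z:{x..A}. \<phi> i z)))"
    unfolding stationary_sum by (simp add: right_diff_distrib sum_subtractf)
  finally show ?thesis .
qed

text \<open>Where \<open>\<phi> j\<close> is nearly constant its primitive is nearly linear, and the
  drift becomes the limit value times the mean jump. The jump size is an integrable majorant because
  primitives are 1-Lipschitz.\<close>

lemma D_tendsto_at_top: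
  assumes ua: "\<And>j. j \<in> E \<Longrightarrow> unit_antimono (\<phi> j)" and g: "\<And>j. j \<in> E \<Longrightarrow> (\<phi> j \<longlongrightarrow> g j) at_top"
    and X: "filterlim X at_top sequentially"
  shows "(\<lambda>n. D \<phi> (X n)) \<longlonglongrightarrow> (\<Sum>i\<in>E. \<pi> i * (\<Sum>j\<in>E. P i j * (g j * (\<integral>u. u \<partial>H i j))))"
  unfolding D_def
proof (intro tendsto_sum tendsto_mult tendsto_const)
  fix i j assume i: "i \<in> E" and j: "j \<in> E"
  interpret H: real_distribution "H i j" by (rule H_dist[OF i j])
  note [measurable] = prim_measurable[OF ua[OF j]]
  have "(\<lambda>n. \<integral>u. prim (\<phi> j) (X n) - prim (\<phi> j) (X n - u) \<partial>H i j) \<longlonglongrightarrow> (\<integral>u. g j * u \<partial>H i j)"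
  proof (rule integral_dominated_convergence)
    show "integrable (H i j) (\<lambda>u. \<bar>u\<bar>)" using H_mean[OF i j] by (rule integrable_abs)
    show "(\<lambda>u. g j * u) \<in> borel_measurable (H i j)" by simp
    show "(\<lambda>u. prim (\<phi> j) (X n) - prim (\<phi> j) (X n - u)) \<in> borel_measurable (H i j)" for n by simp
    show "AE u in H i j. (\<lambda>n. prim (\<phi> j) (X n) - prim (\<phi> j) (X n - u)) \<longlonglongrightarrow> g j * u"
      by (intro AE_I2 prim_increment_tendsto ua j X g)
    show "AE u in H i j. norm (prim (\<phi> j) (X n) - prim (\<phi> j) (X n - u)) \<le> \<bar>u\<bar>" for n
      using prim_lipschitz[OF ua[OF j], of "X n"] by (intro AE_I2) (metis (no_types) cancel_ab_semigroup_add_class.diff_right_commute diff_self diff_zero minus_diff_eq real_norm_def abs_minus_commute diff_0 add_diff_cancel_left' diff_add_cancel)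
  qed
  then show "(\<lambda>n. \<integral>u. prim (\<phi> j) (X n) - prim (\<phi> j) (X n - u) \<partial>H i j) \<longlonglongrightarrow> g j * (\<integral>u. u \<partial>H i j)"
    by simp
qed

lemma psi_at_top: "i \<in> E \<Longrightarrow> (psi n i \<longlongrightarrow> 0) at_top"
proof (induction n arbitrary: i)
  case 0
  have "eventually (\<lambda>x::real. (if x < 0 then 1 else (0::real)) = 0) at_top"
    using eventually_ge_at_top[of 0] by eventually_elim auto
  then show ?case by (auto intro: tendsto_eventually)
next
  case (Suc n)
  have "((\<lambda>x. \<Sum>j\<in>E. P i j * (\<integral>u. psi n j (x - u) \<partial>H i j)) \<longlongrightarrow> (\<Sum>j\<in>E. P i j * 0)) at_top"
    by (intro tendsto_intros ua_shift_integral_at_top ua_psi H_dist Suc)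
  moreover have "eventually (\<lambda>x. (\<Sum>j\<in>E. P i j * (\<integral>u. psi n j (x - u) \<partial>H i j)) = psi (Suc n) i x) at_top"
    using eventually_ge_at_top[of 0] by eventually_elim (simp add: step_def)
  ultimately show ?case by (auto intro: Lim_transform_eventually)
qed

lemma real_at_top: "filterlim (\<lambda>n. real n + x) at_top sequentially"
  using filterlim_tendsto_add_at_top[OF tendsto_const[of x] filterlim_real_sequentially] by (simp add: add.commute)

text \<open>With a finite horizon exceedance vanishes at infinity, so \<open>D\<close> tends to 0
  there; since the probabilities grow with the horizon, \<open>D\<close> decreases in the level
  towards that limit.\<close>

lemma D_psi_nonneg: assumes x: "0 \<le> x" shows "0 \<le> D (psi n) x"
proof -
  have "(\<lambda>m. D (psi n) (real m + x)) \<longlonglongrightarrow> (\<Sum>i\<in>E. \<pi> i * (\<Sum>j\<in>E. P i j * (0 * (\<integral>u. u \<partial>H i j))))"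
    by (intro D_tendsto_at_top ua_psi psi_at_top real_at_top)
  then have l: "(\<lambda>m. D (psi n) (real m + x)) \<longlonglongrightarrow> 0" by simp
  have "D (psi n) (real m + x) \<le> D (psi n) x" for m
  proof -
    have "0 \<le> (\<Sum>i\<in>E. \<pi> i * ((LBINT z:{x..real m + x}. step (psi n) i z) - (LBINT z:{x..real m + x}. psi n i z)))"
    proof (intro sum_nonneg mult_nonneg_nonneg)
      fix i assume i: "i \<in> E"
      show "0 \<le> \<pi> i" by (rule \<pi>_nonneg[OF i])
      have "(LBINT z:{x..real m + x}. psi n i z) \<le> (LBINT z:{x..real m + x}. psi (Suc n) i z)"
        by (intro set_integral_mono ua_set_integrable ua_psi i psi_Suc_ge)
      then show "0 \<le> (LBINT z:{x..real m + x}. step (psi n) i z) - (LBINT z:{x..real m + x}. psi n i z)" by simp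
    qed
    then show ?thesis using D_diff[of "psi n" x "real m + x"] ua_psi x by simp
  qed
  then show ?thesis by (intro LIMSEQ_le_const2[OF l]) auto
qed

lemma D_Psi_nonneg: assumes x: "0 \<le> x" shows "0 \<le> D Psi x"
proof -
  have "(\<lambda>n. D (psi n) x) \<longlonglongrightarrow> D Psi x"
    unfolding D_def
  proof (intro tendsto_sum tendsto_mult tendsto_const)
    fix i j assume i: "i \<in> E" and j: "j \<in> E"
    interpret H: real_distribution "H i j" by (rule H_dist[OF i j])
    have [measurable]: "prim (psi n j) \<in> borel_measurable borel" "prim (Psi j) \<in> borel_measurable borel" for n
      by (rule prim_measurable[OF ua_psi[OF j]], rule prim_measurable[OF ua_Psi[OF j]])
    show "(\<lambda>n. \<integral>u. prim (psi n j) x - prim (psi n j) (x - u) \<partial>H i j) \<longlonglongrightarrow> (\<integral>u. prim (Psi j) x - prim (Psi j) (x - u) \<partial>H i j)"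
    proof (rule integral_dominated_convergence)
      show "integrable (H i j) (\<lambda>u. \<bar>u\<bar>)" using H_mean[OF i j] by (rule integrable_abs)
      show "(\<lambda>u. prim (psi n j) x - prim (psi n j) (x - u)) \<in> borel_measurable (H i j)"
        "(\<lambda>u. prim (Psi j) x - prim (Psi j) (x - u)) \<in> borel_measurable (H i j)" for n by simp_all
      show "AE u in H i j. (\<lambda>n. prim (psi n j) x - prim (psi n j) (x - u)) \<longlonglongrightarrow> prim (Psi j) x - prim (Psi j) (x - u)"
        by (intro AE_I2 prim_tendsto ua_psi ua_Psi j psi_tendsto)
      show "AE u in H i j. norm (prim (psi n j) x - prim (psi n j) (x - u)) \<le> \<bar>u\<bar>" for n
      proof (rule AE_I2)
        fix u show "norm (prim (psi n j) x - prim (psi n j) (x - u)) \<le> \<bar>u\<bar>"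
          using prim_lipschitz[OF ua_psi[OF j, of n], of x "x - u"] by simp
      qed
    qed
  qed
  then show ?thesis by (rule LIMSEQ_le_const) (use D_psi_nonneg[OF x] in auto)
qed

lemma D_Psi_const: assumes "0 \<le> x" "x \<le> A" shows "D Psi x = D Psi A"
proof -
  have "step Psi i = Psi i" if "i \<in> E" for i using Psi_step[OF that] by auto
  then show ?thesis using D_diff[of Psi x A] ua_Psi assms by simp
qed

lemma vanishes_off_closed:
  assumes "C \<subseteq> E" "C \<noteq> {}" "\<And>i j. i \<in> C \<Longrightarrow> j \<in> E \<Longrightarrow> 0 < P i j \<Longrightarrow> j \<in> C" "j \<in> E" "j \<notin> C"
  shows "\<pi> j = 0"
  by (rule unique_stationary_vanishes_off_closed[of N P \<pi> C j, OF P0 P1 uniq]) (use assms in auto)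

text \<open>The limits \<open>g\<close> of \<open>Psi\<close> at infinity are harmonic, so the set
  where \<open>g\<close> attains its maximum \<open>m\<close> is closed and carries
  \<open>\<pi>\<close>. Hence the constant value of \<open>D Psi\<close> is \<open>- m\<close> times
  the positive drift, and \<open>D Psi \<ge> 0\<close>, inherited from finite horizons, leaves only
  \<open>m = 0\<close>.\<close>

lemma Psi_at_top: assumes "i \<in> E" shows "(Psi i \<longlongrightarrow> 0) at_top"
  and D_Psi_zero: "\<And>x. 0 \<le> x \<Longrightarrow> D Psi x = 0"
proof -
  define g where "g j = Inf (range (Psi j))" for j
  have g: "(Psi j \<longlongrightarrow> g j) at_top" if "j \<in> E" for j
    unfolding g_def by (rule ua_has_limit[OF ua_Psi[OF that]])
  have harm: "g j = (\<Sum>k\<in>E. P j k * g k)" if j: "j \<in> E" for j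
  proof -
    have "((\<lambda>x. \<Sum>k\<in>E. P j k * (\<integral>u. Psi k (x - u) \<partial>H j k)) \<longlongrightarrow> (\<Sum>k\<in>E. P j k * g k)) at_top"
      by (intro tendsto_intros ua_shift_integral_at_top ua_Psi H_dist j g)
    moreover have "eventually (\<lambda>x. (\<Sum>k\<in>E. P j k * (\<integral>u. Psi k (x - u) \<partial>H j k)) = Psi j x) at_top"
      using eventually_ge_at_top[of 0] 
    proof eventually_elim
      case (elim x)
      then show ?case using Psi_step[OF j, of x] by (simp add: step_def)
    qed
    ultimately have "(Psi j \<longlongrightarrow> (\<Sum>k\<in>E. P j k * g k)) at_top" by (rule Lim_transform_eventually)
    then show ?thesis using g[OF j] by (intro tendsto_unique[OF trivial_limit_at_top_linorder])
  qed
  have g0: "0 \<le> g j" if "j \<in> E" for j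
    by (rule tendsto_lowerbound[OF g[OF that]]) (auto simp: ua_bounds[OF ua_Psi[OF that]])
  define m where "m = Max (g ` E)"
  define C where "C = {j\<in>E. g j = m}"
  have gm: "g j \<le> m" if "j \<in> E" for j unfolding m_def using that by simp
  have "m \<in> g ` E" unfolding m_def using E_ne by (intro Max_in) auto
  then have C: "C \<noteq> {}" "C \<subseteq> E" unfolding C_def by auto
  have closed: "k \<in> C" if j: "j \<in> C" and k: "k \<in> E" and p: "0 < P j k" for j k
  proof -
    have jE: "j \<in> E" and gj: "g j = m" using j by (auto simp: C_def)
    have "(\<Sum>l\<in>E. P j l * (m - g l)) = m * (\<Sum>l\<in>E. P j l) - (\<Sum>l\<in>E. P j l * g l)"
      by (simp add: right_diff_distrib sum_subtractf sum_distrib_left mult.commute)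
    then have "(\<Sum>l\<in>E. P j l * (m - g l)) = 0" using P1[OF jE] harm[OF jE] gj by simp
    then have "P j k * (m - g k) = 0"
      by (subst (asm) sum_nonneg_eq_0_iff) (use k P0[OF jE] gm in auto)
    then show ?thesis using p k by (simp add: C_def)
  qed
  have off: "\<pi> j = 0" if "j \<in> E" "j \<notin> C" for j
    by (rule vanishes_off_closed[of C j]) (use C closed that in blast)+
  have "(\<Sum>i\<in>E. \<pi> i * (\<Sum>j\<in>E. P i j * (g j * (\<integral>u. u \<partial>H i j))))
      = (\<Sum>i\<in>E. m * (\<pi> i * (\<Sum>j\<in>E. P i j * (\<integral>u. u \<partial>H i j))))"
  proof (rule sum.cong[OF refl])
    fix i assume i: "i \<in> E"
    show "\<pi> i * (\<Sum>j\<in>E. P i j * (g j * (\<integral>u. u \<partial>H i j))) = m * (\<pi> i * (\<Sum>j\<in>E. P i j * (\<integral>u. u \<partial>H i j)))"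
    proof (cases "i \<in> C")
      case True
      have "P i j * (g j * (\<integral>u. u \<partial>H i j)) = m * (P i j * (\<integral>u. u \<partial>H i j))" if j: "j \<in> E" for j
      proof (cases "P i j = 0")
        case False
        then have "j \<in> C" using closed[OF True j] P0[OF i j] by simp
        then show ?thesis by (simp add: C_def)
      qed simp
      then have "(\<Sum>j\<in>E. P i j * (g j * (\<integral>u. u \<partial>H i j))) = m * (\<Sum>j\<in>E. P i j * (\<integral>u. u \<partial>H i j))"
        unfolding sum_distrib_left by (intro sum.cong refl)
      then show ?thesis by simp
    qed (use off[OF i] in simp)
  qed
  also have "\<dots> = - m * (- (\<Sum>i\<in>E. \<pi> i * (\<Sum>j\<in>E. P i j * (\<integral>u. u \<partial>H i j))))"
    by (simp flip: sum_distrib_left)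
  finally have eq: "(\<Sum>i\<in>E. \<pi> i * (\<Sum>j\<in>E. P i j * (g j * (\<integral>u. u \<partial>H i j)))) = - m * (- (\<Sum>i\<in>E. \<pi> i * (\<Sum>j\<in>E. P i j * (\<integral>u. u \<partial>H i j))))" .
  have lim: "(\<lambda>n. D Psi (real n + x)) \<longlonglongrightarrow> - m * (- (\<Sum>i\<in>E. \<pi> i * (\<Sum>j\<in>E. P i j * (\<integral>u. u \<partial>H i j))))" for x
    unfolding eq[symmetric] by (intro D_tendsto_at_top ua_Psi g real_at_top)
  have val: "D Psi x = - m * (- (\<Sum>i\<in>E. \<pi> i * (\<Sum>j\<in>E. P i j * (\<integral>u. u \<partial>H i j))))" if "0 \<le> x" for x
  proof -
    have "D Psi (real n + x) = D Psi x" for n using D_Psi_const[OF that, of "real n + x"] by simp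
    then show ?thesis using lim[of x] by (simp add: LIMSEQ_const_iff)
  qed
  have "0 \<le> m" using gm g0 E_ne by (meson all_not_in_conv order_trans)
  moreover have "m \<le> 0"
  proof (rule ccontr)
    assume "\<not> m \<le> 0"
    then have "D Psi 0 < 0" using val[of 0] mult_pos_pos[OF _ drift, of m] by simp
    then show False using D_Psi_nonneg[of 0] by simp
  qed
  ultimately have m0: "m = 0" by simp
  then show "D Psi x = 0" if "0 \<le> x" for x using val[OF that] by simp
  show "(Psi i \<longlongrightarrow> 0) at_top" using g[OF assms] g0[OF assms] gm[OF assms] m0 by simp
qed

end


section \<open>Auxiliary facts on laws, upper limits and subsequences\<close>

lemma ex_measure_atMost_pos:
  assumes "real_distribution H" shows "\<exists>K\<ge>0. 0 < measure H {..K}"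
proof -
  interpret real_distribution H by fact
  have "eventually (\<lambda>K. 0 < cdf H K) at_top" by (rule order_tendstoD(1)[OF cdf_lim_at_top_prob]) simp
  then have "eventually (\<lambda>K. 0 \<le> K \<and> 0 < cdf H K) at_top"
    using eventually_ge_at_top[of 0] by eventually_elim simp
  then show ?thesis unfolding cdf_def using eventually_happens'[OF trivial_limit_at_top_linorder] by blast
qed

lemma ex_measure_atLeast_pos:
  assumes "real_distribution H" shows "\<exists>K\<ge>0. 0 < measure H {-K..}"
proof -
  interpret real_distribution H by fact
  have "eventually (\<lambda>K. cdf H K < 1) at_bot" by (rule order_tendstoD(2)[OF cdf_lim_at_bot]) simp
  then have "eventually (\<lambda>K. K \<le> 0 \<and> cdf H K < 1) at_bot"
    using eventually_le_at_bot[of 0] by eventually_elim simp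
  then obtain K where K: "K \<le> 0" "cdf H K < 1"
    using eventually_happens'[OF trivial_limit_at_bot_linorder] by blast
  have "ccdf H K \<le> measure H {K..}" unfolding ccdf_def by (rule finite_measure_mono) auto
  then show ?thesis using K cdf_eq_ccdf[of K] by (intro exI[of _ "-K"]) auto
qed

text \<open>Here \<open>s\<close> is the upper limit at infinity, obtained as the infimum of the
  eventual upper bounds; beyond each \<open>n\<close> the function comes within
  \<open>1 / (n + 1)\<close> of it.\<close>

lemma sup_along_sequence:
  fixes f :: "real \<Rightarrow> real"
  assumes b: "\<And>x. \<bar>f x\<bar> \<le> C"
  shows "\<exists>s y. filterlim y at_top sequentially \<and> (\<lambda>n. f (y n)) \<longlonglongrightarrow> s
    \<and> (\<forall>e>0. eventually (\<lambda>x. f x < s + e) at_top)"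
proof -
  define A where "A = {a. eventually (\<lambda>x. f x \<le> a) at_top}"
  have "f x \<le> C" for x using b[of x] by linarith
  then have "C \<in> A" unfolding A_def by simp
  then have ne: "A \<noteq> {}" by auto
  have bdd: "bdd_below A"
  proof (rule bdd_belowI[of _ "- C"])
    fix a assume "a \<in> A"
    then obtain x where "f x \<le> a" unfolding A_def
      using eventually_happens'[OF trivial_limit_at_top_linorder] by blast
    then show "- C \<le> a" using b[of x] by linarith
  qed
  define s where "s = Inf A"
  have up: "eventually (\<lambda>x. f x < s + e) at_top" if "0 < e" for e
  proof -
    have "Inf A < s + e" using that s_def by simp
    then obtain a where "a \<in> A" "a < s + e" using cInf_lessD[OF ne] by blast
    then show ?thesis unfolding A_def by (auto elim: eventually_mono)
  qed
  have "\<exists>y\<ge>real n. s - 1 / real (Suc n) < f y" for n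
  proof (rule ccontr)
    assume "\<not> ?thesis"
    then have "\<And>y. real n \<le> y \<Longrightarrow> f y \<le> s - 1 / real (Suc n)" by (meson not_less)
    then have "eventually (\<lambda>x. f x \<le> s - 1 / real (Suc n)) at_top"
      by (intro eventually_mono[OF eventually_ge_at_top[of "real n"]])
    then have "s \<le> s - 1 / real (Suc n)" unfolding s_def by (intro cInf_lower bdd) (simp add: A_def s_def)
    then show False by simp
  qed
  then obtain y where y: "\<And>n. real n \<le> y n" "\<And>n. s - 1 / real (Suc n) < f (y n)" by metis
  have ft: "filterlim y at_top sequentially"
    by (rule filterlim_at_top_mono[OF filterlim_real_sequentially]) (use y in auto)
  have "(\<lambda>n. f (y n)) \<longlonglongrightarrow> s"
  proof (rule order_tendstoI)
    fix a assume "a < s"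
    have "(\<lambda>n. s - inverse (real (Suc n))) \<longlonglongrightarrow> s - 0" by (intro tendsto_intros LIMSEQ_inverse_real_of_nat)
    then have "eventually (\<lambda>n. a < s - inverse (real (Suc n))) sequentially" using \<open>a < s\<close> by (intro order_tendstoD(1)) auto
    then show "eventually (\<lambda>n. a < f (y n)) sequentially"
    proof eventually_elim
      case (elim n) then show ?case using y(2)[of n] by (simp add: inverse_eq_divide)
    qed
  next
    fix a assume "s < a"
    then show "eventually (\<lambda>n. f (y n) < a) sequentially"
      using filterlim_iff[THEN iffD1, OF ft, rule_format, OF up[of "a - s"]] by simp
  qed
  then show ?thesis using ft up by blast
qed

lemma constant_subsequence:
  fixes j :: "nat \<Rightarrow> 'a"
  assumes "finite A" "\<And>n. j n \<in> A"
  shows "\<exists>i. i \<in> A \<and> (\<exists>r::nat\<Rightarrow>nat. strict_mono r \<and> (\<forall>n. j (r n) = i))"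
proof -
  have "\<exists>i\<in>A. infinite {n\<in>UNIV. j n = i}"
    using pigeonhole_infinite[of "UNIV :: nat set" j] assms
    by (metis (mono_tags, lifting) Collect_cong UNIV_I assms finite_subset image_subsetI infinite_UNIV_nat pigeonhole_infinite_rel)
  then obtain i where i: "i \<in> A" "infinite {n. j n = i}" by auto
  obtain r :: "nat \<Rightarrow> nat" where "strict_mono r" "\<And>n. r n \<in> {n. j n = i}" using infinite_enumerate[OF i(2)] by blast
  then show ?thesis using i by auto
qed

section \<open>Profiles of the exceedance probabilities along a sequence of levels\<close>

context modulated_walk
begin

definition CS where "CS = (\<Sum>j\<in>E. c j * \<pi> j)"
definition abar where "abar = - (\<Sum>i\<in>E. \<pi> i * (\<Sum>j\<in>E. P i j * (\<integral>u. u \<partial>H i j)))"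

lemma abar_pos: "0 < abar" using drift by (simp add: abar_def)

lemma dom_pair: assumes "i \<in> E" "j \<in> E" shows "P i j * ccdf (H i j) t \<le> Fb t"
proof -
  have "P i j * ccdf (H i j) t \<le> (\<Sum>j\<in>E. P i j * ccdf (H i j) t)"
    by (rule member_le_sum) (use assms P0 in \<open>auto simp: ccdf_nonneg\<close>)
  then show ?thesis using dom[OF assms(1), of t] by linarith
qed

lemma Psi_eq: assumes "i \<in> E" "0 \<le> x" shows "Psi i x = (\<Sum>j\<in>E. P i j * (\<integral>u. Psi j (x - u) \<partial>H i j))"
  using Psi_step[OF assms(1), of x] assms(2) by (simp add: step_def)

abbreviation TI where "TI i j \<equiv> tail_integral (H i j)"

lemma mean_split:
  assumes "i \<in> E" "j \<in> E"
  shows "(\<integral>u. u \<partial>H i j) = TI i j 0 - (\<integral>u. max 0 (- u) \<partial>H i j)"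
    and neg_part_integrable: "integrable (H i j) (\<lambda>u. max 0 (- u))"
proof -
  note m = H_mean[OF assms]
  show i: "integrable (H i j) (\<lambda>u. max 0 (- u))" using m by (intro Bochner_Integration.integrable_max) auto
  have ip: "integrable (H i j) (\<lambda>u. max 0 (u - 0))" by (rule integrable_positive_part[OF H_dist[OF assms] m])
  have "(\<integral>u. u \<partial>H i j) = (\<integral>u. max 0 (u - 0) - max 0 (- u) \<partial>H i j)"
    by (intro Bochner_Integration.integral_cong) auto
  also have "\<dots> = TI i j 0 - (\<integral>u. max 0 (- u) \<partial>H i j)"
    unfolding tail_integral_eq[OF H_dist[OF assms] m] by (rule Bochner_Integration.integral_diff[OF ip i])
  finally show "(\<integral>u. u \<partial>H i j) = TI i j 0 - (\<integral>u. max 0 (- u) \<partial>H i j)" .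
qed

lemma tails_sum:
  assumes X: "filterlim X at_top sequentially"
  shows "(\<lambda>n. (\<Sum>i\<in>E. \<pi> i * (\<Sum>j\<in>E. P i j * TI i j (X n))) / G (X n)) \<longlonglongrightarrow> CS"
proof -
  have A: "(\<lambda>n. \<Sum>i\<in>E. \<pi> i * ((\<Sum>j\<in>E. P i j * TI i j (X n)) / G (X n))) \<longlonglongrightarrow> (\<Sum>i\<in>E. \<pi> i * c i)"
    by (intro tendsto_intros filterlim_compose[OF tails X])
  have B: "(\<Sum>i\<in>E. \<pi> i * ((\<Sum>j\<in>E. P i j * TI i j (X n)) / G (X n)))
      = (\<Sum>i\<in>E. \<pi> i * (\<Sum>j\<in>E. P i j * TI i j (X n))) / G (X n)" for n
    by (subst sum_divide_distrib) (simp only: times_divide_eq_right)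
  have "(\<Sum>i\<in>E. \<pi> i * c i) = CS" unfolding CS_def by (intro sum.cong refl) (rule mult.commute)
  with A[unfolded B] show ?thesis by (simp only:)
qed

text \<open>With w n = 1 the profile r compares Psi with G at the points y n; with w n the record values of Psi / G,
  for which om = 0, it shows that Psi / G is bounded.\<close>

context
  fixes y w :: "nat \<Rightarrow> real" and om s :: real
  assumes y: "filterlim y at_top sequentially" and w: "\<And>n. 0 < w n" and om: "(\<lambda>n. 1 / w n) \<longlonglongrightarrow> om"
    and s: "0 \<le> s"
begin

definition r where "r j n v = Psi j (y n + v) / (w n * G (y n))"

lemma wG: "0 < w n * G (y n)" using w G_pos by simp

lemma r_nonneg: "j \<in> E \<Longrightarrow> 0 \<le> r j n v"
  unfolding r_def using wG[of n] ua_bounds(1)[OF ua_Psi] by (simp add: less_imp_le)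

lemma r_mono: "j \<in> E \<Longrightarrow> v \<le> v' \<Longrightarrow> r j n v' \<le> r j n v"
  unfolding r_def using wG[of n] by (intro divide_right_mono ua_mono[OF ua_Psi]) auto

lemma y_shift: "filterlim (\<lambda>n. y n + v) at_top sequentially"
  using filterlim_tendsto_add_at_top[OF tendsto_const[of v] y] by (simp add: add.commute)

lemma y_ge: "eventually (\<lambda>n. 0 \<le> y n + v) sequentially"
  using y_shift[of v] by (simp add: filterlim_at_top)

lemma G_shift: "(\<lambda>n. G (y n + v) / G (y n)) \<longlonglongrightarrow> 1"
  by (rule filterlim_compose[OF G_long_tailed y])

lemma r_measurable: "j \<in> E \<Longrightarrow> (\<lambda>u. r j n (v - u)) \<in> borel_measurable borel"
proof -
  assume "j \<in> E"
  then have [measurable]: "Psi j \<in> borel_measurable borel" by (intro ua_measurable ua_Psi)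
  show ?thesis unfolding r_def by measurable
qed

lemma r_integrable: assumes "i \<in> E" "j \<in> E" shows "integrable (H i j) (\<lambda>u. r j n (v - u))"
proof -
  have "integrable (H i j) (\<lambda>u. Psi j (y n + v - u))" by (intro ua_shift_integrable ua_Psi H_dist assms)
  then show ?thesis unfolding r_def by (simp add: algebra_simps)
qed

lemma r_eq: assumes "i \<in> E" "0 \<le> y n + v" shows "r i n v = (\<Sum>j\<in>E. P i j * (\<integral>u. r j n (v - u) \<partial>H i j))"
proof -
  have "r i n v = (\<Sum>j\<in>E. P i j * (\<integral>u. Psi j (y n + v - u) \<partial>H i j)) / (w n * G (y n))"
    unfolding r_def using Psi_eq[OF assms] by simp
  also have "\<dots> = (\<Sum>j\<in>E. P i j * (\<integral>u. r j n (v - u) \<partial>H i j))"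
    by (simp add: sum_divide_distrib r_def algebra_simps)
  finally show ?thesis .
qed

lemma tails_scaled: "(\<lambda>n. (\<Sum>i\<in>E. \<pi> i * (\<Sum>j\<in>E. P i j * TI i j (y n + v))) / (w n * G (y n))) \<longlonglongrightarrow> om * CS"
proof -
  have A: "(\<lambda>n. (1 / w n) * ((\<Sum>i\<in>E. \<pi> i * (\<Sum>j\<in>E. P i j * TI i j (y n + v))) / G (y n + v) * (G (y n + v) / G (y n)))) \<longlonglongrightarrow> om * (CS * 1)"
    by (intro tendsto_mult om tails_sum y_shift G_shift)
  have B: "(1 / w n) * ((\<Sum>i\<in>E. \<pi> i * (\<Sum>j\<in>E. P i j * TI i j (y n + v))) / G (y n + v) * (G (y n + v) / G (y n)))
     = (\<Sum>i\<in>E. \<pi> i * (\<Sum>j\<in>E. P i j * TI i j (y n + v))) / (w n * G (y n))" for n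
    using G_pos[of "y n + v"] by simp
  show ?thesis using A[unfolded B] by (simp only: mult_1_right)
qed

subsection \<open>Upper profiles\<close>

context
  fixes C :: real
  assumes bound: "\<And>j n z. j \<in> E \<Longrightarrow> z \<le> y n \<Longrightarrow> Psi j z \<le> C * w n * G z"
    and excess: "\<And>j v. j \<in> E \<Longrightarrow> (\<lambda>n. max 0 (r j n v - s)) \<longlonglongrightarrow> 0"
begin

lemma r_bound: assumes "j \<in> E" "v \<le> 0" shows "r j n v \<le> C * (G (y n + v) / G (y n))"
proof -
  have "r j n v \<le> C * w n * G (y n + v) / (w n * G (y n))"
    unfolding r_def using wG[of n] assms by (intro divide_right_mono bound) auto
  then show ?thesis using w[of n] by simp
qed

text \<open>Upward jumps lead to levels far left of \<open>y n\<close>, where the profile is not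
  bounded uniformly in \<open>n\<close>. There \<open>bound\<close> dominates it by
  \<open>C * (G (y n + v - max u 0) / G (y n))\<close>, whose integrals converge by
  \<open>integral_G_shift\<close>, so the pointwise vanishing of the excess carries over to the
  integral.\<close>

lemma excess_integral:
  assumes i: "i \<in> E" and j: "j \<in> E" and p: "0 < P i j" and v: "v \<le> 0"
  shows "(\<lambda>n. \<integral>u. max 0 (r j n (v - u) - s) \<partial>H i j) \<longlonglongrightarrow> 0"
proof -
  interpret H: real_distribution "H i j" by (rule H_dist[OF i j])
  have [measurable]: "(\<lambda>u. r j n (v - u)) \<in> borel_measurable borel" for n by (rule r_measurable[OF j])
  have "(\<lambda>n. \<integral>u. max 0 (r j n (v - u) - s) \<partial>H i j) \<longlonglongrightarrow> (\<integral>u. 0 \<partial>H i j)"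
  proof (rule generalized_dominated_convergence[where g="\<lambda>n u. C * (G (y n + v - max u 0) / G (y n))" and k="\<lambda>_. C"])
    show "integrable (H i j) (\<lambda>u. C * (G (y n + v - max u 0) / G (y n)))" for n
      by (intro integrable_mult_right Bochner_Integration.integrable_divide H.integrable_const_bound[where B=1])
         (auto simp: G_nonneg G_le_1)
    show "\<bar>max 0 (r j n (v - u) - s)\<bar> \<le> C * (G (y n + v - max u 0) / G (y n))" for n u
    proof -
      have "max 0 (r j n (v - u) - s) \<le> r j n (v - u)" using s r_nonneg[OF j, of n "v - u"] by simp
      also have "\<dots> \<le> r j n (v - max u 0)" by (rule r_mono[OF j]) simp
      also have "\<dots> \<le> C * (G (y n + (v - max u 0)) / G (y n))" by (rule r_bound[OF j]) (use v in simp)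
      finally show ?thesis by (simp add: algebra_simps)
    qed
    show "(\<lambda>n. max 0 (r j n (v - u) - s)) \<longlonglongrightarrow> 0" for u by (rule excess[OF j])
    show "(\<lambda>n. C * (G (y n + v - max u 0) / G (y n))) \<longlonglongrightarrow> C" for u
      using tendsto_mult[OF tendsto_const[of C] G_shift[of "v - max u 0"]] by (simp add: algebra_simps)
    have "(\<lambda>n. C * ((\<integral>u. G (y n + v - max u 0) \<partial>H i j) / G (y n + v) * (G (y n + v) / G (y n)))) \<longlonglongrightarrow> C * (1 * 1)"
      by (intro tendsto_mult tendsto_const G_shift integral_G_shift[OF H_dist[OF i j] p dom_pair[OF i j] y_shift])
    moreover have "C * ((\<integral>u. G (y n + v - max u 0) \<partial>H i j) / G (y n + v) * (G (y n + v) / G (y n)))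
       = (\<integral>u. C * (G (y n + v - max u 0) / G (y n)) \<partial>H i j)" for n
      using G_pos[of "y n + v"] by simp
    moreover have "(\<integral>u. C \<partial>H i j) = C" using H.prob_space by simp
    ultimately show "(\<lambda>n. \<integral>u. C * (G (y n + v - max u 0) / G (y n)) \<partial>H i j) \<longlonglongrightarrow> (\<integral>u. C \<partial>H i j)"
      by (simp only: mult_1_right)
  qed simp_all
  then show ?thesis by simp
qed

text \<open>An average that tends to \<open>s\<close> while its excess over \<open>s\<close>
  vanishes cannot leave a deficit of fixed weight. The offset moves only to the left and so stays
  where \<open>bound\<close> applies.\<close>

lemma upper_propagate:
  assumes i: "i \<in> E" and j: "j \<in> E" and p: "0 < P i j" and v: "v \<le> 0"
    and lim: "(\<lambda>n. r i n v) \<longlonglongrightarrow> s"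
  shows "\<exists>v'\<le>0. (\<lambda>n. r j n v') \<longlonglongrightarrow> s"
proof -
  \<comment> \<open>Jumps of size at most \<open>K\<close> have positive probability, and for them
    monotonicity bounds the profile of \<open>j\<close> by its value at \<open>v - K\<close>; so
    this value has weight at least \<open>q\<close> in the average.\<close>
  obtain K where K: "0 \<le> K" "0 < measure (H i j) {..K}" using ex_measure_atMost_pos[OF H_dist[OF i j]] by blast
  define q where "q = P i j * measure (H i j) {..K}"
  have q: "0 < q" using p K by (simp add: q_def)
  define ex where "ex k n = (\<integral>u. max 0 (r k n (v - u) - s) \<partial>H i k)" for k n
  have im: "integrable (H i k) (\<lambda>u. max 0 (r k n (v - u) - s))" if k: "k \<in> E" for k n
  proof -
    interpret H: real_distribution "H i k" by (rule H_dist[OF i k])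
    show ?thesis using r_integrable[OF i k] by (intro Bochner_Integration.integrable_max) auto
  qed
  have le: "(\<integral>u. r k n (v - u) \<partial>H i k) \<le> s + ex k n" if k: "k \<in> E" for k n
  proof -
    interpret H: real_distribution "H i k" by (rule H_dist[OF i k])
    have "(\<integral>u. r k n (v - u) \<partial>H i k) \<le> (\<integral>u. s + max 0 (r k n (v - u) - s) \<partial>H i k)"
      by (rule integral_mono) (use r_integrable[OF i k] im[OF k] in auto)
    then show ?thesis using im[OF k] H.prob_space by (simp add: ex_def)
  qed
  have lej: "(\<integral>u. r j n (v - u) \<partial>H i j) \<le> s + ex j n + measure (H i j) {..K} * (r j n (v - K) - s)" for n
  proof -
    interpret H: real_distribution "H i j" by (rule H_dist[OF i j])
    have "(\<integral>u. r j n (v - u) \<partial>H i j) \<le> (\<integral>u. (s + max 0 (r j n (v - u) - s)) + indicator {..K} u * (r j n (v - K) - s) \<partial>H i j)"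
    proof (rule integral_mono)
      show "r j n (v - u) \<le> (s + max 0 (r j n (v - u) - s)) + indicator {..K} u * (r j n (v - K) - s)" for u
        using r_mono[OF j, of "v - K" "v - u" n] by (auto simp: indicator_def)
      show "integrable (H i j) (\<lambda>u. (s + max 0 (r j n (v - u) - s)) + indicator {..K} u * (r j n (v - K) - s))"
        using im[OF j] by (intro Bochner_Integration.integrable_add integrable_mult_left) (auto simp: H.emeasure_eq_measure)
    qed (rule r_integrable[OF i j])
    also have "\<dots> = s + ex j n + measure (H i j) {..K} * (r j n (v - K) - s)"
      using im[OF j] H.prob_space by (simp add: ex_def H.emeasure_eq_measure)
    finally show ?thesis .
  qed
  have main: "r i n v \<le> s + (\<Sum>k\<in>E. P i k * ex k n) + q * (r j n (v - K) - s)" if "0 \<le> y n + v" for n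
  proof -
    have "r i n v \<le> (\<Sum>k\<in>E. P i k * (s + ex k n) + (if k = j then q * (r j n (v - K) - s) else 0))"
      unfolding r_eq[OF i that]
    proof (rule sum_mono)
      fix k assume k: "k \<in> E"
      show "P i k * (\<integral>u. r k n (v - u) \<partial>H i k) \<le> P i k * (s + ex k n) + (if k = j then q * (r j n (v - K) - s) else 0)"
        using mult_left_mono[OF le[OF k, of n] P0[OF i k]] mult_left_mono[OF lej[of n] P0[OF i j]]
        by (auto simp: q_def algebra_simps)
    qed
    also have "\<dots> = (\<Sum>k\<in>E. P i k * s) + (\<Sum>k\<in>E. P i k * ex k n) + q * (r j n (v - K) - s)"
      using j by (simp add: sum.distrib distrib_left)
    also have "(\<Sum>k\<in>E. P i k * s) = s" using P1[OF i] by (simp flip: sum_distrib_right)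
    finally show ?thesis .
  qed
  have exl: "(\<lambda>n. \<Sum>k\<in>E. P i k * ex k n) \<longlonglongrightarrow> (\<Sum>k\<in>E. 0)"
  proof (rule tendsto_sum)
    fix k assume k: "k \<in> E"
    show "(\<lambda>n. P i k * ex k n) \<longlonglongrightarrow> 0"
    proof (cases "P i k = 0")
      case False
      then have "0 < P i k" using P0[OF i k] by simp
      from tendsto_mult[OF tendsto_const[of "P i k"] excess_integral[OF i k this v]]
      show ?thesis by (simp add: ex_def)
    qed simp
  qed
  have "(\<lambda>n. r j n (v - K)) \<longlonglongrightarrow> s"
  proof (rule tendsto_sandwich)
    show "eventually (\<lambda>n. s + (r i n v - s - (\<Sum>k\<in>E. P i k * ex k n)) / q \<le> r j n (v - K)) sequentially"
      using y_ge[of v]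
    proof eventually_elim
      case (elim n)
      from main[OF elim] q show ?case by (simp add: field_simps)
    qed
    have "(\<lambda>n. s + (r i n v - s - (\<Sum>k\<in>E. P i k * ex k n)) / q) \<longlonglongrightarrow> s + (s - s - (\<Sum>k\<in>E. 0)) / q"
      using q by (intro tendsto_intros lim exl) auto
    then show "(\<lambda>n. s + (r i n v - s - (\<Sum>k\<in>E. P i k * ex k n)) / q) \<longlonglongrightarrow> s" by simp
    show "eventually (\<lambda>n. r j n (v - K) \<le> s + max 0 (r j n (v - K) - s)) sequentially"
      by (intro always_eventually allI) (simp add: max_def)
    show "(\<lambda>n. s + max 0 (r j n (v - K) - s)) \<longlonglongrightarrow> s"
      using tendsto_add[OF tendsto_const[of s] excess[OF j]] by simp
  qed
  then show ?thesis using v K by (intro exI[of _ "v - K"]) auto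
qed

lemma upper_leftwards:
  assumes j: "j \<in> E" and lim: "(\<lambda>n. r j n v) \<longlonglongrightarrow> s" and v': "v' \<le> v"
  shows "(\<lambda>n. r j n v') \<longlonglongrightarrow> s"
proof (rule tendsto_sandwich[OF _ _ lim])
  show "eventually (\<lambda>n. r j n v \<le> r j n v') sequentially" using r_mono[OF j v'] by auto
  show "eventually (\<lambda>n. r j n v' \<le> s + max 0 (r j n v' - s)) sequentially"
    by (intro always_eventually allI) (simp add: max_def)
  show "(\<lambda>n. s + max 0 (r j n v' - s)) \<longlonglongrightarrow> s"
    using tendsto_add[OF tendsto_const[of s] excess[OF j]] by simp
qed

text \<open>Tonelli writes the increment of the primitive over an upward jump as an integral against
  the tail of the jump. The range \<open>t > x\<close> sees \<open>Psi = 1\<close> and yields the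
  source term \<open>TI i j x\<close>; the range up to \<open>x\<close> is the middle part of the
  convolution.\<close>

lemma positive_part_formula:
  assumes i: "i \<in> E" and j: "j \<in> E" and x: "0 \<le> x"
  shows "(\<integral>u. prim (Psi j) x - prim (Psi j) (x - max u 0) \<partial>H i j)
    = (LBINT t:{0..x}. Psi j (x - t) * ccdf (H i j) t) + TI i j x"
proof -
  interpret H: real_distribution "H i j" by (rule H_dist[OF i j])
  note H.M_is_borel[measurable_cong]
  interpret pair_sigma_finite "H i j" lborel ..
  note ua = ua_Psi[OF j]
  have [measurable]: "Psi j \<in> borel_measurable borel" "prim (Psi j) \<in> borel_measurable borel"
    by (rule ua_measurable[OF ua], rule prim_measurable[OF ua])
  define k :: "real \<Rightarrow> real \<Rightarrow> real" where "k u t = (if 0 \<le> t \<and> t < u then Psi j (x - t) else 0)" for u t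
  have [measurable]: "(\<lambda>(u, t). k u t) \<in> borel_measurable (H i j \<Otimes>\<^sub>M lborel)" unfolding k_def by measurable
  have nn: "0 \<le> prim (Psi j) x - prim (Psi j) (x - max u 0)" for u
    using prim_mono[OF ua, of "x - max u 0" x] by simp
  have inner: "(\<integral>\<^sup>+t. ennreal (k u t) \<partial>lborel) = ennreal (prim (Psi j) x - prim (Psi j) (x - max u 0))" for u
  proof -
    have "(\<integral>\<^sup>+t. ennreal (k u t) \<partial>lborel) = (\<integral>\<^sup>+t. ennreal (indicator {0..<max u 0} t * Psi j (x - t)) \<partial>lborel)"
      by (intro nn_integral_cong) (auto simp: k_def indicator_def)
    also have "\<dots> = (\<integral>\<^sup>+t. ennreal (indicator {0..max u 0} t * Psi j (x - t)) \<partial>lborel)"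
    proof (rule nn_integral_cong_AE)
      show "AE t in lborel. ennreal (indicator {0..<max u 0} t * Psi j (x - t)) = ennreal (indicator {0..max u 0} t * Psi j (x - t))"
        using AE_lborel_singleton[of "max u 0"] by eventually_elim (auto simp: indicator_def)
    qed
    also have "\<dots> = (\<integral>\<^sup>+z. ennreal (indicator {x - max u 0..x} z * Psi j z) \<partial>lborel)"
    proof -
      have *: "indicator {0..max u 0} t * Psi j (x - t) = indicator {x - max u 0..x} (x + -1 * t) * Psi j (x + -1 * t)" for t
        by (auto simp: indicator_def)
      show ?thesis unfolding *
        by (subst nn_integral_real_affine[where c="-1" and t=x and f="\<lambda>z. ennreal (indicator {x - max u 0..x} z * Psi j z)"]) auto
    qed
    also have "\<dots> = ennreal (\<integral>z. indicator {x - max u 0..x} z * Psi j z \<partial>lborel)"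
      by (rule nn_integral_eq_integral)
         (use ua_set_integrable[OF ua, of "x - max u 0" x] in \<open>auto simp: set_integrable_def ua_bounds[OF ua]\<close>)
    also have "(\<integral>z. indicator {x - max u 0..x} z * Psi j z \<partial>lborel) = prim (Psi j) x - prim (Psi j) (x - max u 0)"
      by (subst prim_diff[OF ua]) (auto simp: set_lebesgue_integral_def)
    finally show ?thesis .
  qed
  define h where "h t = indicator {0..} t * (Psi j (x - t) * ccdf (H i j) t)" for t
  have h0: "0 \<le> h t" for t by (simp add: h_def ua_bounds[OF ua] ccdf_nonneg)
  have [measurable]: "h \<in> borel_measurable borel" unfolding h_def by measurable
  have inner2: "(\<integral>\<^sup>+u. ennreal (k u t) \<partial>H i j) = ennreal (h t)" for t
  proof -
    have "(\<integral>\<^sup>+u. ennreal (k u t) \<partial>H i j) = (\<integral>\<^sup>+u. ennreal (indicator {0..} t * Psi j (x - t)) * indicator {t<..} u \<partial>H i j)"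
      by (intro nn_integral_cong) (auto simp: k_def indicator_def)
    also have "\<dots> = ennreal (h t)"
      by (subst nn_integral_cmult_indicator)
         (auto simp: H.emeasure_eq_measure ccdf_def ennreal_mult ua_bounds[OF ua] h_def mult_ac)
    finally show ?thesis .
  qed
  have ih: "integrable lborel h"
  proof (rule Bochner_Integration.integrable_bound)
    show "integrable lborel (\<lambda>t. indicator {0..} t * ccdf (H i j) t)"
      using set_integrable_ccdf[OF H_dist[OF i j] H_mean[OF i j], of 0] by (simp add: set_integrable_def)
    show "AE t in lborel. norm (h t) \<le> norm (indicator {0..} t * ccdf (H i j) t)"
      by (rule AE_I2) (auto simp: h_def abs_mult ccdf_nonneg ua_bounds[OF ua] indicator_def intro!: mult_left_le_one_le)
  qed simp
  have "ennreal (\<integral>u. prim (Psi j) x - prim (Psi j) (x - max u 0) \<partial>H i j) = (\<integral>\<^sup>+u. ennreal (prim (Psi j) x - prim (Psi j) (x - max u 0)) \<partial>H i j)"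
  proof (rule nn_integral_eq_integral[symmetric])
    show "integrable (H i j) (\<lambda>u. prim (Psi j) x - prim (Psi j) (x - max u 0))"
    proof (rule Bochner_Integration.integrable_bound[OF integrable_abs[OF H_mean[OF i j]]])
      show "AE u in H i j. norm (prim (Psi j) x - prim (Psi j) (x - max u 0)) \<le> norm \<bar>u\<bar>"
      proof (rule AE_I2)
        fix u show "norm (prim (Psi j) x - prim (Psi j) (x - max u 0)) \<le> norm \<bar>u\<bar>"
          using prim_lipschitz[OF ua, of x "x - max u 0"] by (auto simp: max_def split: if_splits)
      qed
    qed simp
  qed (use nn in auto)
  also have "\<dots> = (\<integral>\<^sup>+u. (\<integral>\<^sup>+t. ennreal (k u t) \<partial>lborel) \<partial>H i j)" by (simp only: inner)
  also have "\<dots> = (\<integral>\<^sup>+t. (\<integral>\<^sup>+u. ennreal (k u t) \<partial>H i j) \<partial>lborel)" by (rule Fubini'[symmetric]) measurable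
  also have "\<dots> = ennreal (\<integral>t. h t \<partial>lborel)"
    unfolding inner2 by (rule nn_integral_eq_integral[OF ih]) (use h0 in auto)
  finally have "(\<integral>u. prim (Psi j) x - prim (Psi j) (x - max u 0) \<partial>H i j) = (\<integral>t. h t \<partial>lborel)"
  proof (subst (asm) ennreal_inj)
    show "0 \<le> (\<integral>u. prim (Psi j) x - prim (Psi j) (x - max u 0) \<partial>H i j)"
      by (rule Bochner_Integration.integral_nonneg) (rule nn)
    show "0 \<le> (\<integral>t. h t \<partial>lborel)" by (rule Bochner_Integration.integral_nonneg) (rule h0)
  qed
  also have "\<dots> = (LBINT t:{0..x} \<union> {x<..}. Psi j (x - t) * ccdf (H i j) t)"
    unfolding set_lebesgue_integral_def h_def by (intro Bochner_Integration.integral_cong) (use x in \<open>auto simp: indicator_def\<close>)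
  also have "\<dots> = (LBINT t:{0..x}. Psi j (x - t) * ccdf (H i j) t) + (LBINT t:{x<..}. Psi j (x - t) * ccdf (H i j) t)"
  proof -
    have "set_integrable lborel {0..} (\<lambda>t. Psi j (x - t) * ccdf (H i j) t)"
      using ih unfolding h_def set_integrable_def by simp
    then show ?thesis
      by (intro set_integral_Un) (use x in \<open>auto elim!: set_integrable_subset\<close>)
  qed
  also have "(LBINT t:{x<..}. Psi j (x - t) * ccdf (H i j) t) = TI i j x"
    unfolding tail_integral_def set_lebesgue_integral_def
  proof (rule integral_cong_AE)
    show "AE t in lborel. indicator {x<..} t *\<^sub>R (Psi j (x - t) * ccdf (H i j) t) = indicator {x..} t *\<^sub>R ccdf (H i j) t"
      using AE_lborel_singleton[of x] by eventually_elim (auto simp: indicator_def Psi_neg[OF j])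
  qed measurable
  finally show ?thesis .
qed

text \<open>\<open>bound\<close> and \<open>dom_pair\<close> give the majorant
  \<open>Fb t * G (y n + v - t) / G (y n)\<close> up to a constant, and \<open>integral_Fb_G\<close>
  supplies the limit of its integral.\<close>

lemma middle_part_limit:
  assumes i: "i \<in> E" and j: "j \<in> E" and p: "0 < P i j" and v: "v \<le> 0"
    and lim: "\<And>v'. v' \<le> v \<Longrightarrow> (\<lambda>n. r j n v') \<longlonglongrightarrow> s"
  shows "(\<lambda>n. (LBINT t:{0..y n + v}. Psi j (y n + v - t) * ccdf (H i j) t) / (w n * G (y n))) \<longlonglongrightarrow> s * TI i j 0"
proof -
  interpret H: real_distribution "H i j" by (rule H_dist[OF i j])
  have ru: "(\<lambda>u. r j n (v - u)) \<in> borel_measurable borel" for n by (rule r_measurable[OF j])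
  note [measurable] = ru
  define f where "f n t = indicator {0..y n + v} t * (r j n (v - t) * ccdf (H i j) t)" for n t
  define g where "g n t = C / P i j * (indicator {0..y n + v} t * (Fb t * G (y n + v - t)) / G (y n))" for n t
  have F0: "integrable lborel (\<lambda>t. indicator {0..} t * Fb t)"
    using Fb_integrable[of 0] by (simp add: set_integrable_def)
  have ig: "integrable lborel (g n)" for n
    unfolding g_def
  proof (intro integrable_mult_right Bochner_Integration.integrable_divide)
    show "integrable lborel (\<lambda>t. indicator {0..y n + v} t * (Fb t * G (y n + v - t)))"
      by (rule Bochner_Integration.integrable_bound[OF F0])
         (auto simp: ccdf_nonneg G_nonneg G_le_1 abs_mult indicator_def intro!: AE_I2 mult_left_le)
  qed
  have "(\<lambda>n. \<integral>t. f n t \<partial>lborel) \<longlonglongrightarrow> (\<integral>t. indicator {0..} t * (s * ccdf (H i j) t) \<partial>lborel)"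
  proof (rule generalized_dominated_convergence[where g=g and k="\<lambda>t. C / P i j * (indicator {0..} t * Fb t)"])
    show "f n \<in> borel_measurable lborel" for n unfolding f_def by measurable
    show "integrable lborel (g n)" for n by (rule ig)
    show "integrable lborel (\<lambda>t. C / P i j * (indicator {0..} t * Fb t))" using F0 by simp
    show "\<bar>f n t\<bar> \<le> g n t" for n t
    proof (cases "t \<in> {0..y n + v}")
      case True
      have "r j n (v - t) * ccdf (H i j) t \<le> (C * (G (y n + (v - t)) / G (y n))) * (Fb t / P i j)"
      proof (rule mult_mono)
        show rb: "r j n (v - t) \<le> C * (G (y n + (v - t)) / G (y n))" by (rule r_bound[OF j]) (use v True in auto)
        show "ccdf (H i j) t \<le> Fb t / P i j" using dom_pair[OF i j, of t] p by (simp add: pos_le_divide_eq mult.commute)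
        show "0 \<le> C * (G (y n + (v - t)) / G (y n))" using r_nonneg[OF j, of n "v - t"] rb by linarith
      qed (rule ccdf_nonneg)
      then show ?thesis using True r_nonneg[OF j] by (simp add: f_def g_def abs_mult ccdf_nonneg algebra_simps)
    qed (simp add: f_def g_def)
    show "(\<lambda>n. f n t) \<longlonglongrightarrow> indicator {0..} t * (s * ccdf (H i j) t)" for t
    proof (cases "0 \<le> t")
      case True
      have "(\<lambda>n. r j n (v - t) * ccdf (H i j) t) \<longlonglongrightarrow> s * ccdf (H i j) t" by (intro tendsto_intros lim) (use True in simp)
      moreover have "eventually (\<lambda>n. r j n (v - t) * ccdf (H i j) t = f n t) sequentially"
        using y_ge[of "v - t"] by eventually_elim (use True in \<open>simp add: f_def\<close>)
      ultimately show ?thesis using True by (auto intro: Lim_transform_eventually)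
    qed (simp add: f_def)
    show "(\<lambda>n. g n t) \<longlonglongrightarrow> C / P i j * (indicator {0..} t * Fb t)" for t
    proof (cases "0 \<le> t")
      case True
      have "(\<lambda>n. C / P i j * (Fb t * (G (y n + (v - t)) / G (y n)))) \<longlonglongrightarrow> C / P i j * (Fb t * 1)"
        by (intro tendsto_mult tendsto_const G_shift)
      moreover have "eventually (\<lambda>n. C / P i j * (Fb t * (G (y n + (v - t)) / G (y n))) = g n t) sequentially"
        using y_ge[of "v - t"] by eventually_elim (use True in \<open>simp add: g_def algebra_simps\<close>)
      ultimately show ?thesis using True by (auto intro: Lim_transform_eventually)
    qed (simp add: g_def)
    have "(\<lambda>n. C / P i j * ((LBINT u:{0..y n + v}. Fb u * G (y n + v - u)) / G (y n + v) * (G (y n + v) / G (y n)))) \<longlonglongrightarrow> C / P i j * (I 0 * 1)"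
      by (intro tendsto_mult tendsto_const G_shift filterlim_compose[OF integral_Fb_G y_shift])
    moreover have "C / P i j * ((LBINT u:{0..y n + v}. Fb u * G (y n + v - u)) / G (y n + v) * (G (y n + v) / G (y n))) = (\<integral>t. g n t \<partial>lborel)" for n
      using G_pos[of "y n + v"] by (simp add: g_def set_lebesgue_integral_def)
    moreover have "(\<integral>t. C / P i j * (indicator {0..} t * Fb t) \<partial>lborel) = C / P i j * I 0"
      by (simp add: tail_integral_def set_lebesgue_integral_def)
    ultimately show "(\<lambda>n. \<integral>t. g n t \<partial>lborel) \<longlonglongrightarrow> (\<integral>t. C / P i j * (indicator {0..} t * Fb t) \<partial>lborel)"
      by (simp only: mult_1_right)
  qed measurable
  moreover have "(\<integral>t. f n t \<partial>lborel) = (LBINT t:{0..y n + v}. Psi j (y n + v - t) * ccdf (H i j) t) / (w n * G (y n))" for n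
  proof -
    have "(\<integral>t. f n t \<partial>lborel) = (\<integral>t. indicator {0..y n + v} t *\<^sub>R (Psi j (y n + v - t) * ccdf (H i j) t) / (w n * G (y n)) \<partial>lborel)"
      by (intro Bochner_Integration.integral_cong) (auto simp: f_def r_def algebra_simps)
    then show ?thesis by (simp add: set_lebesgue_integral_def)
  qed
  moreover have "(\<integral>t. indicator {0..} t * (s * ccdf (H i j) t) \<partial>lborel) = s * TI i j 0"
  proof -
    have "(\<integral>t. indicator {0..} t * (s * ccdf (H i j) t) \<partial>lborel) = (\<integral>t. s * (indicator {0..} t * ccdf (H i j) t) \<partial>lborel)"
      by (intro Bochner_Integration.integral_cong) auto
    then show ?thesis by (simp add: tail_integral_def set_lebesgue_integral_def)
  qed
  ultimately show ?thesis by simp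
qed

text \<open>The identity \<open>D Psi = 0\<close> is divided by \<open>w n * G (y n)\<close>. Upward
  jumps contribute \<open>s * TI i j 0\<close> and the source \<open>om * CS\<close>. Downward jumps
  lead to larger levels, where the profile is only known to be asymptotically at most
  \<open>s\<close>, so they are counted up to a depth \<open>d\<close>, which tends to infinity at
  the end. States outside the closed set \<open>Z\<close> have stationary weight 0.\<close>

lemma upper_conclusion:
  assumes i0: "i0 \<in> E" and lim0: "(\<lambda>n. r i0 n 0) \<longlonglongrightarrow> s"
  shows "abar * s \<le> om * CS"
proof -
  define Z where "Z = {j\<in>E. \<exists>v\<le>0. (\<lambda>n. r j n v) \<longlonglongrightarrow> s}"
  have Z: "Z \<subseteq> E" "Z \<noteq> {}" using i0 lim0 unfolding Z_def by auto
  have closed: "j \<in> Z" if "i \<in> Z" "j \<in> E" "0 < P i j" for i j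
    using upper_propagate[of i j] that unfolding Z_def by blast
  have off: "\<pi> j = 0" if "j \<in> E" "j \<notin> Z" for j
    by (rule vanishes_off_closed[of Z j]) (use Z closed that in blast)+
  have "\<forall>j\<in>Z. \<exists>v. v \<le> 0 \<and> (\<lambda>n. r j n v) \<longlonglongrightarrow> s" unfolding Z_def by auto
  from bchoice[OF this] obtain vz where vz: "\<And>j. j \<in> Z \<Longrightarrow> vz j \<le> 0 \<and> (\<lambda>n. r j n (vz j)) \<longlonglongrightarrow> s"
    by auto
  have finZ: "finite Z" using Z finite_subset by blast
  \<comment> \<open>A common offset for all states of \<open>Z\<close>: profiles that tend to
    \<open>s\<close> do so further left as well.\<close>
  define v0 where "v0 = Min (vz ` Z)"
  have v0: "v0 \<le> vz j" if "j \<in> Z" for j unfolding v0_def using finZ that by simp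
  have v00: "v0 \<le> 0" using Z v0 vz by (meson all_not_in_conv order_trans)
  have limZ: "(\<lambda>n. r j n v) \<longlonglongrightarrow> s" if "j \<in> Z" "v \<le> v0" for j v
    using upper_leftwards[of j "vz j" v] vz[OF that(1)] v0[OF that(1)] that Z by auto
  define mm where "mm d i j = (\<integral>u. min (max 0 (- u)) d \<partial>H i j)" for d i j
  have main: "0 \<le> (\<Sum>i\<in>E. \<pi> i * (\<Sum>j\<in>E. P i j * (s * TI i j 0 - s * mm d i j))) + om * CS" if d: "0 \<le> d" for d
  proof -
    \<comment> \<open>Starting \<open>d\<close> to the left of \<open>v0\<close>, a downward jump
      truncated at \<open>d\<close> stays at offsets up to \<open>v0\<close>, where the profile is
      still close to \<open>s\<close>.\<close>
    define v where "v = v0 - d"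
    have v: "v \<le> v0" "v \<le> 0" using d v00 by (auto simp: v_def)
    define A where "A n i j = (LBINT t:{0..y n + v}. Psi j (y n + v - t) * ccdf (H i j) t) / (w n * G (y n))" for n i j
    have "(\<lambda>n. (\<Sum>i\<in>E. \<pi> i * (\<Sum>j\<in>E. P i j * (A n i j - r j n v0 * mm d i j)))
        + (\<Sum>i\<in>E. \<pi> i * (\<Sum>j\<in>E. P i j * TI i j (y n + v))) / (w n * G (y n)))
      \<longlonglongrightarrow> (\<Sum>i\<in>E. \<pi> i * (\<Sum>j\<in>E. P i j * (s * TI i j 0 - s * mm d i j))) + om * CS"
    proof (intro tendsto_add tendsto_sum tails_scaled)
      fix i assume i: "i \<in> E"
      show "(\<lambda>n. \<pi> i * (\<Sum>j\<in>E. P i j * (A n i j - r j n v0 * mm d i j))) \<longlonglongrightarrow> \<pi> i * (\<Sum>j\<in>E. P i j * (s * TI i j 0 - s * mm d i j))"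
      proof (cases "i \<in> Z")
        case True
        show ?thesis
        proof (rule tendsto_mult[OF tendsto_const], rule tendsto_sum)
          fix j assume j: "j \<in> E"
          show "(\<lambda>n. P i j * (A n i j - r j n v0 * mm d i j)) \<longlonglongrightarrow> P i j * (s * TI i j 0 - s * mm d i j)"
          proof (cases "P i j = 0")
            case False
            then have p: "0 < P i j" using P0[OF i j] by simp
            then have jZ: "j \<in> Z" using closed[OF True j] by simp
            have "(\<lambda>n. A n i j) \<longlonglongrightarrow> s * TI i j 0"
              unfolding A_def by (rule middle_part_limit[OF i j p v(2)]) (use limZ[OF jZ] v in auto)
            then show ?thesis by (intro tendsto_intros limZ jZ) auto
          qed simp
        qed
      qed (use off[OF i] in simp)
    qed
    moreover have "eventually (\<lambda>n. 0 \<le> (\<Sum>i\<in>E. \<pi> i * (\<Sum>j\<in>E. P i j * (A n i j - r j n v0 * mm d i j)))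
        + (\<Sum>i\<in>E. \<pi> i * (\<Sum>j\<in>E. P i j * TI i j (y n + v))) / (w n * G (y n))) sequentially"
      using y_ge[of v]
    proof eventually_elim
      case (elim n)
      let ?x = "y n + v" and ?W = "w n * G (y n)"
      have pair: "(\<integral>u. prim (Psi j) ?x - prim (Psi j) (?x - u) \<partial>H i j)
          \<le> (A n i j - r j n v0 * mm d i j) * ?W + TI i j ?x" if i: "i \<in> E" and j: "j \<in> E" for i j
      proof -
        interpret H: real_distribution "H i j" by (rule H_dist[OF i j])
        note ua = ua_Psi[OF j]
        have [measurable]: "prim (Psi j) \<in> borel_measurable borel" by (rule prim_measurable[OF ua])
        have i1: "integrable (H i j) (\<lambda>u. prim (Psi j) ?x - prim (Psi j) (?x - max u 0))"
        proof (rule Bochner_Integration.integrable_bound[OF integrable_abs[OF H_mean[OF i j]]])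
          show "AE u in H i j. norm (prim (Psi j) ?x - prim (Psi j) (?x - max u 0)) \<le> norm \<bar>u\<bar>"
          proof (rule AE_I2)
            fix u show "norm (prim (Psi j) ?x - prim (Psi j) (?x - max u 0)) \<le> norm \<bar>u\<bar>"
              using prim_lipschitz[OF ua, of ?x "?x - max u 0"] by (auto simp: max_def split: if_splits)
          qed
        qed simp
        have i2: "integrable (H i j) (\<lambda>u. min (max 0 (- u)) d)"
          using neg_part_integrable[OF i j] by (intro Bochner_Integration.integrable_min) auto
        have "(\<integral>u. prim (Psi j) ?x - prim (Psi j) (?x - u) \<partial>H i j)
          \<le> (\<integral>u. (prim (Psi j) ?x - prim (Psi j) (?x - max u 0)) - Psi j (?x + d) * min (max 0 (- u)) d \<partial>H i j)"
        proof (rule integral_mono)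
          show "integrable (H i j) (\<lambda>u. prim (Psi j) ?x - prim (Psi j) (?x - u))"
            by (rule prim_increment_integrable[OF ua H_dist[OF i j] H_mean[OF i j]])
          show "integrable (H i j) (\<lambda>u. (prim (Psi j) ?x - prim (Psi j) (?x - max u 0)) - Psi j (?x + d) * min (max 0 (- u)) d)"
            by (intro Bochner_Integration.integrable_diff i1 integrable_mult_right i2)
          fix u
          show "prim (Psi j) ?x - prim (Psi j) (?x - u) \<le> (prim (Psi j) ?x - prim (Psi j) (?x - max u 0)) - Psi j (?x + d) * min (max 0 (- u)) d"
          proof (cases "0 \<le> u")
            case False
            define l where "l = min (- u) d"
            have l: "0 \<le> l" "l \<le> - u" "l \<le> d" using False d by (auto simp: l_def)
            have "Psi j (?x + d) * l \<le> Psi j (?x + l) * l" by (intro mult_right_mono ua_mono[OF ua]) (use l in auto)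
            also have "\<dots> \<le> prim (Psi j) (?x + l) - prim (Psi j) ?x"
              using prim_bounds(1)[OF ua, of ?x "?x + l"] l by simp
            also have "prim (Psi j) (?x + l) \<le> prim (Psi j) (?x - u)" by (rule prim_mono[OF ua]) (use l in auto)
            finally show ?thesis using False by (simp add: l_def max_def)
          qed (use d in \<open>simp add: max_def min_def\<close>)
        qed
        also have "\<dots> = ((LBINT t:{0..?x}. Psi j (?x - t) * ccdf (H i j) t) + TI i j ?x) - Psi j (?x + d) * mm d i j"
          unfolding positive_part_formula[OF i j elim, symmetric] mm_def
          using i1 i2 by (subst Bochner_Integration.integral_diff) auto
        also have "\<dots> = (A n i j - r j n v0 * mm d i j) * ?W + TI i j ?x"
        proof -
          have "r j n v0 * ?W = Psi j (?x + d)" using w[of n] G_pos[of "y n"] by (simp add: r_def v_def)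
          moreover have "A n i j * ?W = (LBINT t:{0..?x}. Psi j (?x - t) * ccdf (H i j) t)" using w[of n] G_pos[of "y n"] by (simp add: A_def)
          ultimately show ?thesis by (simp add: left_diff_distrib)
        qed
        finally show ?thesis .
      qed
      have "0 = D Psi ?x" using D_Psi_zero[OF i0 elim] by simp
      also have "\<dots> \<le> (\<Sum>i\<in>E. \<pi> i * (\<Sum>j\<in>E. P i j * ((A n i j - r j n v0 * mm d i j) * ?W + TI i j ?x)))"
        unfolding D_def by (intro sum_mono mult_left_mono pair P0 \<pi>_nonneg)
      also have "\<dots> = (\<Sum>i\<in>E. \<pi> i * (\<Sum>j\<in>E. P i j * (A n i j - r j n v0 * mm d i j))) * ?W
          + (\<Sum>i\<in>E. \<pi> i * (\<Sum>j\<in>E. P i j * TI i j ?x))"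
        by (simp add: distrib_left sum.distrib sum_distrib_right mult.assoc)
      finally have "0 / ?W \<le> ((\<Sum>i\<in>E. \<pi> i * (\<Sum>j\<in>E. P i j * (A n i j - r j n v0 * mm d i j))) * ?W
          + (\<Sum>i\<in>E. \<pi> i * (\<Sum>j\<in>E. P i j * TI i j ?x))) / ?W"
        using wG[of n] by (intro divide_right_mono) auto
      then show ?case using w[of n] G_pos[of "y n"] by (simp add: add_divide_distrib)
    qed
    ultimately show ?thesis by (rule tendsto_lowerbound) simp
  qed
  have "(\<lambda>n. (\<Sum>i\<in>E. \<pi> i * (\<Sum>j\<in>E. P i j * (s * TI i j 0 - s * mm (real n) i j))) + om * CS)
     \<longlonglongrightarrow> (\<Sum>i\<in>E. \<pi> i * (\<Sum>j\<in>E. P i j * (s * TI i j 0 - s * (\<integral>u. max 0 (- u) \<partial>H i j)))) + om * CS"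
  proof (intro tendsto_add tendsto_sum tendsto_mult tendsto_diff tendsto_const)
    fix i j assume i: "i \<in> E" and j: "j \<in> E"
    interpret H: real_distribution "H i j" by (rule H_dist[OF i j])
    show "(\<lambda>n. mm (real n) i j) \<longlonglongrightarrow> (\<integral>u. max 0 (- u) \<partial>H i j)"
      unfolding mm_def
    proof (rule integral_dominated_convergence)
      show "integrable (H i j) (\<lambda>u. max 0 (- u))" by (rule neg_part_integrable[OF i j])
      show "AE u in H i j. (\<lambda>n. min (max 0 (- u)) (real n)) \<longlonglongrightarrow> max 0 (- u)"
      proof (rule AE_I2)
        fix u
        have "eventually (\<lambda>n. max 0 (- u) \<le> real n) sequentially"
          using filterlim_real_sequentially by (simp add: filterlim_at_top)
        then have "eventually (\<lambda>n. min (max 0 (- u)) (real n) = max 0 (- u)) sequentially" by eventually_elim simp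
        then show "(\<lambda>n. min (max 0 (- u)) (real n)) \<longlonglongrightarrow> max 0 (- u)" by (rule tendsto_eventually)
      qed
      show "AE u in H i j. norm (min (max 0 (- u)) (real n)) \<le> max 0 (- u)" for n
        by (rule AE_I2) auto
    qed simp_all
  qed
  then have "0 \<le> (\<Sum>i\<in>E. \<pi> i * (\<Sum>j\<in>E. P i j * (s * TI i j 0 - s * (\<integral>u. max 0 (- u) \<partial>H i j)))) + om * CS"
    by (rule tendsto_lowerbound) (use main in auto)
  also have "(\<Sum>i\<in>E. \<pi> i * (\<Sum>j\<in>E. P i j * (s * TI i j 0 - s * (\<integral>u. max 0 (- u) \<partial>H i j))))
      = (\<Sum>i\<in>E. \<pi> i * (\<Sum>j\<in>E. P i j * (s * (\<integral>u. u \<partial>H i j))))"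
    by (intro sum.cong refl arg_cong2[where f="(*)"]) (simp add: mean_split right_diff_distrib)
  also have "\<dots> = - (abar * s)"
    by (simp add: abar_def sum_distrib_right sum_distrib_left mult_ac)
  finally show ?thesis by simp
qed

end

subsection \<open>Lower profiles\<close>

context
  assumes deficit: "\<And>j v. j \<in> E \<Longrightarrow> (\<lambda>n. max 0 (s - r j n v)) \<longlonglongrightarrow> 0"
begin

lemma lower_rightwards:
  assumes j: "j \<in> E" and lim: "(\<lambda>n. r j n v) \<longlonglongrightarrow> s" and v': "v \<le> v'"
  shows "(\<lambda>n. r j n v') \<longlonglongrightarrow> s"
proof (rule tendsto_sandwich[OF _ _ _ lim])
  show "eventually (\<lambda>n. r j n v' \<le> r j n v) sequentially" using r_mono[OF j v'] by auto
  show "eventually (\<lambda>n. s - max 0 (s - r j n v') \<le> r j n v') sequentially"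
    by (intro always_eventually allI) (simp add: max_def)
  show "(\<lambda>n. s - max 0 (s - r j n v')) \<longlonglongrightarrow> s"
    using tendsto_diff[OF tendsto_const[of s] deficit[OF j]] by simp
qed

text \<open>The mirror image of \<open>upper_propagate\<close>. Deficits below \<open>s\<close> are
  bounded by \<open>s\<close> because profiles are nonnegative, so dominated convergence with a
  constant majorant suffices and the offset may move right freely.\<close>

lemma lower_propagate:
  assumes i: "i \<in> E" and j: "j \<in> E" and p: "0 < P i j" and lim: "(\<lambda>n. r i n v) \<longlonglongrightarrow> s"
  shows "\<exists>v'. (\<lambda>n. r j n v') \<longlonglongrightarrow> s"
proof -
  obtain K where K: "0 \<le> K" "0 < measure (H i j) {-K..}" using ex_measure_atLeast_pos[OF H_dist[OF i j]] by blast
  define q where "q = P i j * measure (H i j) {-K..}"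
  have q: "0 < q" using p K by (simp add: q_def)
  define ex where "ex k n = (\<integral>u. max 0 (s - r k n (v - u)) \<partial>H i k)" for k n
  have im: "integrable (H i k) (\<lambda>u. max 0 (s - r k n (v - u)))" if k: "k \<in> E" for k n
  proof -
    interpret H: real_distribution "H i k" by (rule H_dist[OF i k])
    show ?thesis using r_integrable[OF i k] by (intro Bochner_Integration.integrable_max) auto
  qed
  have le: "s - ex k n \<le> (\<integral>u. r k n (v - u) \<partial>H i k)" if k: "k \<in> E" for k n
  proof -
    interpret H: real_distribution "H i k" by (rule H_dist[OF i k])
    have "(\<integral>u. s - max 0 (s - r k n (v - u)) \<partial>H i k) \<le> (\<integral>u. r k n (v - u) \<partial>H i k)"
      by (rule integral_mono) (use r_integrable[OF i k] im[OF k] in auto)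
    then show ?thesis using im[OF k] H.prob_space by (simp add: ex_def)
  qed
  have lej: "s - ex j n + measure (H i j) {-K..} * (r j n (v + K) - s) \<le> (\<integral>u. r j n (v - u) \<partial>H i j)" for n
  proof -
    interpret H: real_distribution "H i j" by (rule H_dist[OF i j])
    have "s - ex j n + measure (H i j) {-K..} * (r j n (v + K) - s)
      = (\<integral>u. (s - max 0 (s - r j n (v - u))) + indicator {-K..} u * (r j n (v + K) - s) \<partial>H i j)"
      using im[OF j] H.prob_space by (simp add: ex_def H.emeasure_eq_measure)
    also have "\<dots> \<le> (\<integral>u. r j n (v - u) \<partial>H i j)"
    proof (rule integral_mono)
      show "(s - max 0 (s - r j n (v - u))) + indicator {-K..} u * (r j n (v + K) - s) \<le> r j n (v - u)" for u
        using r_mono[OF j, of "v - u" "v + K" n] by (auto simp: indicator_def)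
      show "integrable (H i j) (\<lambda>u. (s - max 0 (s - r j n (v - u))) + indicator {-K..} u * (r j n (v + K) - s))"
        using im[OF j] by (intro Bochner_Integration.integrable_add integrable_mult_left) (auto simp: H.emeasure_eq_measure)
    qed (rule r_integrable[OF i j])
    finally show ?thesis .
  qed
  have main: "s - (\<Sum>k\<in>E. P i k * ex k n) + q * (r j n (v + K) - s) \<le> r i n v" if "0 \<le> y n + v" for n
  proof -
    have "(\<Sum>k\<in>E. P i k * (s - ex k n) + (if k = j then q * (r j n (v + K) - s) else 0)) \<le> r i n v"
      unfolding r_eq[OF i that]
    proof (rule sum_mono)
      fix k assume k: "k \<in> E"
      show "P i k * (s - ex k n) + (if k = j then q * (r j n (v + K) - s) else 0) \<le> P i k * (\<integral>u. r k n (v - u) \<partial>H i k)"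
        using mult_left_mono[OF le[OF k, of n] P0[OF i k]] mult_left_mono[OF lej[of n] P0[OF i j]]
        by (auto simp: q_def algebra_simps)
    qed
    moreover have "(\<Sum>k\<in>E. P i k * (s - ex k n) + (if k = j then q * (r j n (v + K) - s) else 0))
        = (\<Sum>k\<in>E. P i k * s) - (\<Sum>k\<in>E. P i k * ex k n) + q * (r j n (v + K) - s)"
      using j by (simp add: sum.distrib right_diff_distrib sum_subtractf)
    moreover have "(\<Sum>k\<in>E. P i k * s) = s" using P1[OF i] by (simp flip: sum_distrib_right)
    ultimately show ?thesis by simp
  qed
  have exl: "(\<lambda>n. \<Sum>k\<in>E. P i k * ex k n) \<longlonglongrightarrow> (\<Sum>k\<in>E. P i k * 0)"
  proof (intro tendsto_sum tendsto_mult tendsto_const)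
    fix k assume k: "k \<in> E"
    interpret H: real_distribution "H i k" by (rule H_dist[OF i k])
    have [measurable]: "(\<lambda>u. r k n (v - u)) \<in> borel_measurable borel" for n by (rule r_measurable[OF k])
    have "(\<lambda>n. ex k n) \<longlonglongrightarrow> (\<integral>u. 0 \<partial>H i k)"
      unfolding ex_def
    proof (rule integral_dominated_convergence[where w="\<lambda>_. s"])
      show "AE u in H i k. (\<lambda>n. max 0 (s - r k n (v - u))) \<longlonglongrightarrow> 0" by (intro AE_I2 deficit k)
      show "AE u in H i k. norm (max 0 (s - r k n (v - u))) \<le> s" for n
      proof (rule AE_I2)
        fix u show "norm (max 0 (s - r k n (v - u))) \<le> s" using s r_nonneg[OF k, of n "v - u"] by simp
      qed
    qed simp_all
    then show "(\<lambda>n. ex k n) \<longlonglongrightarrow> 0" by simp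
  qed
  have "(\<lambda>n. r j n (v + K)) \<longlonglongrightarrow> s"
  proof (rule tendsto_sandwich[where f="\<lambda>n. s - max 0 (s - r j n (v + K))"
        and h="\<lambda>n. s + (r i n v - s + (\<Sum>k\<in>E. P i k * ex k n)) / q"])
    show "eventually (\<lambda>n. r j n (v + K) \<le> s + (r i n v - s + (\<Sum>k\<in>E. P i k * ex k n)) / q) sequentially"
      using y_ge[of v]
    proof eventually_elim
      case (elim n)
      from main[OF elim] q show ?case by (simp add: field_simps)
    qed
    have "(\<lambda>n. s + (r i n v - s + (\<Sum>k\<in>E. P i k * ex k n)) / q) \<longlonglongrightarrow> s + (s - s + (\<Sum>k\<in>E. P i k * 0)) / q"
      using q by (intro tendsto_intros lim exl) auto
    then show "(\<lambda>n. s + (r i n v - s + (\<Sum>k\<in>E. P i k * ex k n)) / q) \<longlonglongrightarrow> s" by simp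
    show "eventually (\<lambda>n. s - max 0 (s - r j n (v + K)) \<le> r j n (v + K)) sequentially"
      by (intro always_eventually allI) (simp add: max_def)
    show "(\<lambda>n. s - max 0 (s - r j n (v + K))) \<longlonglongrightarrow> s"
      using tendsto_diff[OF tendsto_const[of s] deficit[OF j]] by simp
  qed
  then show ?thesis by blast
qed

lemma prim_Psi_neg: assumes j: "j \<in> E" and a: "a \<le> 0" shows "prim (Psi j) 0 - prim (Psi j) a = - a"
proof -
  have "prim (Psi j) 0 - prim (Psi j) a = (\<integral>z. indicator {a..0} z *\<^sub>R Psi j z \<partial>lborel)"
    unfolding prim_diff[OF ua_Psi[OF j] a] set_lebesgue_integral_def ..
  also have "\<dots> = (\<integral>z. indicator {a..0} z *\<^sub>R 1 \<partial>lborel)"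
  proof (rule integral_cong_AE)
    note [measurable] = ua_measurable[OF ua_Psi[OF j]]
    show "(\<lambda>z. indicator {a..0} z *\<^sub>R Psi j z) \<in> borel_measurable lborel" by measurable
    show "AE z in lborel. indicator {a..0} z *\<^sub>R Psi j z = indicator {a..0} z *\<^sub>R 1"
      using AE_lborel_singleton[of 0] by eventually_elim (auto simp: indicator_def Psi_neg[OF j])
  qed simp
  also have "\<dots> = - a" using a by simp
  finally show ?thesis .
qed

text \<open>Monotonicity alone settles the middle range here: an upward jump
  \<open>u \<le> x\<close> gains at least \<open>Psi j x * u\<close>, and a downward jump loses at
  most \<open>Psi j x * \<bar>u\<bar>\<close>. The overshoot beyond \<open>x\<close> is kept
  exactly, with slope 1 below level 0, and becomes the source term.\<close>

lemma lower_conclusion: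
  assumes i0: "i0 \<in> E" and lim0: "(\<lambda>n. r i0 n 0) \<longlonglongrightarrow> s"
  shows "om * CS \<le> abar * s"
proof -
  define Z where "Z = {j\<in>E. \<exists>v. (\<lambda>n. r j n v) \<longlonglongrightarrow> s}"
  have Z: "Z \<subseteq> E" "Z \<noteq> {}" using i0 lim0 unfolding Z_def by auto
  have closed: "j \<in> Z" if "i \<in> Z" "j \<in> E" "0 < P i j" for i j
    using lower_propagate[of i j] that unfolding Z_def by blast
  have off: "\<pi> j = 0" if "j \<in> E" "j \<notin> Z" for j
    by (rule vanishes_off_closed[of Z j]) (use Z closed that in blast)+
  have "\<forall>j\<in>Z. \<exists>v. (\<lambda>n. r j n v) \<longlonglongrightarrow> s" unfolding Z_def by auto
  from bchoice[OF this] obtain vz where vz: "\<And>j. j \<in> Z \<Longrightarrow> (\<lambda>n. r j n (vz j)) \<longlonglongrightarrow> s"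
    by auto
  have finZ: "finite Z" using Z finite_subset by blast
  \<comment> \<open>Lower extremality spreads to the right, so the largest offset serves all states
    of \<open>Z\<close>.\<close>
  define v where "v = Max (vz ` Z)"
  have v: "vz j \<le> v" if "j \<in> Z" for j unfolding v_def using finZ that by simp
  have limZ: "(\<lambda>n. r j n v) \<longlonglongrightarrow> s" if "j \<in> Z" for j
    using lower_rightwards[of j "vz j" v] vz[OF that] v[OF that] that Z by auto
  have "(\<lambda>n. (\<Sum>i\<in>E. \<pi> i * (\<Sum>j\<in>E. P i j * (r j n v * ((\<integral>u. u \<partial>H i j) - TI i j (y n + v)))))
        + (\<Sum>i\<in>E. \<pi> i * (\<Sum>j\<in>E. P i j * TI i j (y n + v))) / (w n * G (y n)))
      \<longlonglongrightarrow> (\<Sum>i\<in>E. \<pi> i * (\<Sum>j\<in>E. P i j * (s * ((\<integral>u. u \<partial>H i j) - 0)))) + om * CS"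
  proof (intro tendsto_add tendsto_sum tails_scaled)
    fix i assume i: "i \<in> E"
    show "(\<lambda>n. \<pi> i * (\<Sum>j\<in>E. P i j * (r j n v * ((\<integral>u. u \<partial>H i j) - TI i j (y n + v)))))
        \<longlonglongrightarrow> \<pi> i * (\<Sum>j\<in>E. P i j * (s * ((\<integral>u. u \<partial>H i j) - 0)))"
    proof (cases "i \<in> Z")
      case True
      show ?thesis
      proof (rule tendsto_mult[OF tendsto_const], rule tendsto_sum)
        fix j assume j: "j \<in> E"
        show "(\<lambda>n. P i j * (r j n v * ((\<integral>u. u \<partial>H i j) - TI i j (y n + v)))) \<longlonglongrightarrow> P i j * (s * ((\<integral>u. u \<partial>H i j) - 0))"
        proof (cases "P i j = 0")
          case False
          then have p: "0 < P i j" using P0[OF i j] by simp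
          then have jZ: "j \<in> Z" using closed[OF True j] by simp
          show ?thesis
            by (intro tendsto_mult tendsto_const tendsto_diff limZ jZ
                filterlim_compose[OF tail_integral_at_top[OF H_dist[OF i j] H_mean[OF i j]] y_shift])
        qed simp
      qed
    qed (use off[OF i] in simp)
  qed
  moreover have "eventually (\<lambda>n. (\<Sum>i\<in>E. \<pi> i * (\<Sum>j\<in>E. P i j * (r j n v * ((\<integral>u. u \<partial>H i j) - TI i j (y n + v)))))
        + (\<Sum>i\<in>E. \<pi> i * (\<Sum>j\<in>E. P i j * TI i j (y n + v))) / (w n * G (y n)) \<le> 0) sequentially"
    using y_ge[of v]
  proof eventually_elim
    case (elim n)
    let ?x = "y n + v" and ?W = "w n * G (y n)"
    have pair: "r j n v * ((\<integral>u. u \<partial>H i j) - TI i j ?x) * ?W + TI i j ?x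
        \<le> (\<integral>u. prim (Psi j) ?x - prim (Psi j) (?x - u) \<partial>H i j)" if i: "i \<in> E" and j: "j \<in> E" for i j
    proof -
      interpret H: real_distribution "H i j" by (rule H_dist[OF i j])
      note ua = ua_Psi[OF j]
      have ip: "integrable (H i j) (\<lambda>u. max 0 (u - ?x))" by (rule integrable_positive_part[OF H_dist[OF i j] H_mean[OF i j]])
      have "r j n v * ((\<integral>u. u \<partial>H i j) - TI i j ?x) * ?W + TI i j ?x = Psi j ?x * ((\<integral>u. u \<partial>H i j) - TI i j ?x) + TI i j ?x"
        using w[of n] G_pos[of "y n"] by (simp add: r_def)
      also have "\<dots> = (\<integral>u. Psi j ?x * (u - max 0 (u - ?x)) + max 0 (u - ?x) \<partial>H i j)"
        unfolding tail_integral_eq[OF H_dist[OF i j] H_mean[OF i j]] using ip H_mean[OF i j] by simp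
      also have "\<dots> \<le> (\<integral>u. prim (Psi j) ?x - prim (Psi j) (?x - u) \<partial>H i j)"
      proof (rule integral_mono)
        show "integrable (H i j) (\<lambda>u. Psi j ?x * (u - max 0 (u - ?x)) + max 0 (u - ?x))"
          using ip H_mean[OF i j] by simp
        show "integrable (H i j) (\<lambda>u. prim (Psi j) ?x - prim (Psi j) (?x - u))"
          by (rule prim_increment_integrable[OF ua H_dist[OF i j] H_mean[OF i j]])
        fix u
        show "Psi j ?x * (u - max 0 (u - ?x)) + max 0 (u - ?x) \<le> prim (Psi j) ?x - prim (Psi j) (?x - u)"
        proof (cases "u \<le> ?x")
          case True
          then show ?thesis
            using prim_bounds(1)[OF ua, of "?x - u" ?x] prim_bounds(2)[OF ua, of ?x "?x - u"]
            by (cases "0 \<le> u") (auto simp: max_def)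
        next
          case False
          then show ?thesis
            using prim_bounds(1)[OF ua elim] prim_Psi_neg[OF j, of "?x - u"] by simp
        qed
      qed
      finally show ?thesis .
    qed
    have "(\<Sum>i\<in>E. \<pi> i * (\<Sum>j\<in>E. P i j * (r j n v * ((\<integral>u. u \<partial>H i j) - TI i j ?x)))) * ?W
          + (\<Sum>i\<in>E. \<pi> i * (\<Sum>j\<in>E. P i j * TI i j ?x))
        = (\<Sum>i\<in>E. \<pi> i * (\<Sum>j\<in>E. P i j * (r j n v * ((\<integral>u. u \<partial>H i j) - TI i j ?x) * ?W + TI i j ?x)))"
      by (simp add: distrib_left sum.distrib sum_distrib_right mult.assoc)
    also have "\<dots> \<le> D Psi ?x"
      unfolding D_def by (intro sum_mono mult_left_mono pair P0 \<pi>_nonneg)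
    also have "\<dots> = 0" by (rule D_Psi_zero[OF i0 elim])
    finally have "((\<Sum>i\<in>E. \<pi> i * (\<Sum>j\<in>E. P i j * (r j n v * ((\<integral>u. u \<partial>H i j) - TI i j ?x)))) * ?W
          + (\<Sum>i\<in>E. \<pi> i * (\<Sum>j\<in>E. P i j * TI i j ?x))) / ?W \<le> 0 / ?W"
      using wG[of n] by (intro divide_right_mono) auto
    then show ?case using w[of n] G_pos[of "y n"] by (simp add: add_divide_distrib)
  qed
  ultimately have "(\<Sum>i\<in>E. \<pi> i * (\<Sum>j\<in>E. P i j * (s * ((\<integral>u. u \<partial>H i j) - 0)))) + om * CS \<le> 0"
    by (rule tendsto_upperbound) simp
  moreover have "(\<Sum>i\<in>E. \<pi> i * (\<Sum>j\<in>E. P i j * (s * ((\<integral>u. u \<partial>H i j) - 0)))) = - (abar * s)"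
    by (simp add: abar_def sum_distrib_right sum_distrib_left mult_ac)
  ultimately show ?thesis by simp
qed

end

end

section \<open>Boundedness of the ratio and its limit\<close>

definition R where "R j x = Psi j x / G x"

lemma R_nonneg: "j \<in> E \<Longrightarrow> 0 \<le> R j x"
  unfolding R_def using ua_bounds(1)[OF ua_Psi] G_nonneg by simp

lemma R_le: assumes "j \<in> E" "z \<le> x" shows "R j z \<le> 1 / G x"
proof -
  have "Psi j z / G z \<le> 1 / G z" using ua_bounds(2)[OF ua_Psi[OF assms(1)]] G_nonneg by (intro divide_right_mono) auto
  also have "\<dots> \<le> 1 / G x" using G_antimono[OF assms(2)] G_pos[of x] G_pos[of z] by (simp add: frac_le)
  finally show ?thesis by (simp add: R_def)
qed

text \<open>If the ratio were unbounded, it could be divided by its running supremum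
  \<open>S n\<close>. Near-record points tend to infinity since the ratio is bounded on every left
  half-line, and the rescaled profile satisfies the hypotheses of the upper comparison with
  \<open>s = 1\<close> and \<open>om = 0\<close>, which gives \<open>abar \<le> 0\<close>.\<close>

lemma ratio_bounded: "\<exists>C. \<forall>j\<in>E. \<forall>x. R j x \<le> C"
proof (rule ccontr)
  assume "\<not> ?thesis"
  then have "\<forall>n::nat. \<exists>z. \<exists>j\<in>E. real (Suc n) < R j z" by (meson not_le)
  then obtain z where z: "\<And>n. \<exists>j\<in>E. real (Suc n) < R j (z n)" by metis
  define A where "A n = {R k x | k x. k \<in> E \<and> x \<le> z n}" for n
  define S where "S n = Sup (A n)" for n
  have bdd: "bdd_above (A n)" for n
    by (rule bdd_aboveI[of _ "1 / G (z n)"]) (auto simp: A_def intro: R_le)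
  have up: "R k x \<le> S n" if "k \<in> E" "x \<le> z n" for k x n
    unfolding S_def by (rule cSup_upper[OF _ bdd]) (use that in \<open>auto simp: A_def\<close>)
  have S1: "real (Suc n) < S n" for n using z[of n] up[of _ "z n" n] by force
  \<comment> \<open>The factor tends to 1, so the rescaled near-records tend to 1; with
    \<open>n + 2\<close> it is at least one half from the start, which is enough to drive
    \<open>x n\<close> to infinity.\<close>
  have "\<exists>x j. j \<in> E \<and> x \<le> z n \<and> (1 - 1 / real (n + 2)) * S n < R j x" for n
  proof -
    have "(1 - 1 / real (n + 2)) * S n < 1 * S n"
      by (rule mult_strict_right_mono) (use S1[of n] in auto)
    then have "(1 - 1 / real (n + 2)) * S n < Sup (A n)" by (simp add: S_def)
    moreover have "A n \<noteq> {}" using z[of n] unfolding A_def by blast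
    ultimately show ?thesis using less_cSupE[of _ "A n"] unfolding A_def by blast
  qed
  then obtain x j where xj: "\<And>n. j n \<in> E" "\<And>n. x n \<le> z n" "\<And>n. (1 - 1 / real (n + 2)) * S n < R (j n) (x n)" by metis
  obtain i where i: "i \<in> E" and ex\<rho>: "\<exists>\<rho>::nat\<Rightarrow>nat. strict_mono \<rho> \<and> (\<forall>n. j (\<rho> n) = i)"
    using constant_subsequence[of E j, OF finite_atLeastAtMost xj(1)] by blast
  obtain \<rho> :: "nat \<Rightarrow> nat" where "strict_mono \<rho> \<and> (\<forall>n. j (\<rho> n) = i)" using ex\<rho> ..
  then have \<rho>: "strict_mono \<rho>" "\<And>n. j (\<rho> n) = i" by simp_all
  have big: "real (Suc n) / 2 \<le> R (j n) (x n)" for n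
  proof -
    have "(1 / 2) * real (Suc n) \<le> (1 - 1 / real (n + 2)) * S n"
      by (intro mult_mono) (use S1[of n] in \<open>auto simp: field_simps\<close>)
    from le_less_trans[OF this xj(3)[of n]] show ?thesis by simp
  qed
  have xt: "filterlim x at_top sequentially"
    unfolding filterlim_at_top
  proof
    fix B
    have "eventually (\<lambda>n. 2 / G B < real n) sequentially"
      using filterlim_real_sequentially by (simp add: filterlim_at_top_dense)
    then have "eventually (\<lambda>n. 2 / G B < real (Suc n)) sequentially"
      by eventually_elim simp
    then show "eventually (\<lambda>n. B \<le> x n) sequentially"
    proof eventually_elim
      case (elim n)
      show ?case
      proof (rule ccontr)
        assume "\<not> B \<le> x n"
        then have "R (j n) (x n) \<le> 1 / G B" by (intro R_le xj) auto
        then show False using big[of n] elim by simp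
      qed
    qed
  qed
  define y where "y = x \<circ> \<rho>"
  define w where "w = S \<circ> \<rho>"
  have y: "filterlim y at_top sequentially"
    unfolding y_def o_def by (rule filterlim_compose[OF xt filterlim_subseq[OF \<rho>(1)]])
  have w1: "1 \<le> w n" for n using S1[of "\<rho> n"] by (simp add: w_def)
  then have w0: "0 < w n" for n by (meson less_le_trans zero_less_one)
  have om: "(\<lambda>n. 1 / w n) \<longlonglongrightarrow> 0"
  proof -
    have "(\<lambda>n. 1 / S n) \<longlonglongrightarrow> 0"
    proof (rule Lim_null_comparison[OF _ LIMSEQ_inverse_real_of_nat])
      show "eventually (\<lambda>n. norm (1 / S n) \<le> inverse (real (Suc n))) sequentially"
      proof (intro always_eventually allI)
        fix n
        have "1 / S n \<le> 1 / real (Suc n)" using S1[of n] by (intro frac_le) auto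
        then show "norm (1 / S n) \<le> inverse (real (Suc n))" using S1[of n] by (simp add: inverse_eq_divide)
      qed
    qed
    from LIMSEQ_subseq_LIMSEQ[OF this \<rho>(1)] show ?thesis by (simp add: w_def o_def)
  qed
  have bound: "Psi k a \<le> 1 * w n * G a" if "k \<in> E" "a \<le> y n" for k n a
  proof -
    have "R k a \<le> w n" using up[OF that(1), of a "\<rho> n"] that xj(2)[of "\<rho> n"] by (simp add: w_def y_def)
    then show ?thesis using G_pos[of a] by (simp add: R_def pos_divide_le_eq)
  qed
  note rr = r_def[OF y w0 om zero_le_one]
  have gs: "(\<lambda>n. G (y n + v) / G (y n)) \<longlonglongrightarrow> 1" for v
    by (rule filterlim_compose[OF G_long_tailed y])
  have excess: "(\<lambda>n. max 0 (r y w k n v - 1)) \<longlonglongrightarrow> 0" if k: "k \<in> E" for k v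
  proof -
    have le: "r y w k n v \<le> G (y n + min v 0) / G (y n)" for n
    proof -
      have "Psi k (y n + v) \<le> Psi k (y n + min v 0)" by (rule ua_mono[OF ua_Psi[OF k]]) simp
      also have "\<dots> \<le> w n * G (y n + min v 0)" using bound[OF k, of "y n + min v 0" n] by simp
      finally have "Psi k (y n + v) / (w n * G (y n)) \<le> w n * G (y n + min v 0) / (w n * G (y n))"
        using w0[of n] G_pos[of "y n"] by (intro divide_right_mono) auto
      then show ?thesis using w0[of n] by (simp add: rr)
    qed
    have "(\<lambda>n. max 0 (G (y n + min v 0) / G (y n) - 1)) \<longlonglongrightarrow> max 0 (1 - 1)" by (intro tendsto_intros gs)
    then have l: "(\<lambda>n. max 0 (G (y n + min v 0) / G (y n) - 1)) \<longlonglongrightarrow> 0" by simp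
    show ?thesis
    proof (rule Lim_null_comparison[OF always_eventually l], rule allI)
      fix n show "norm (max 0 (r y w k n v - 1)) \<le> max 0 (G (y n + min v 0) / G (y n) - 1)"
        using le[of n] by simp
    qed
  qed
  have lim0: "(\<lambda>n. r y w i n 0) \<longlonglongrightarrow> 1"
  proof (rule tendsto_sandwich[where f="\<lambda>n. 1 - inverse (real (Suc (\<rho> n)))" and h="\<lambda>_. 1"])
    show "eventually (\<lambda>n. r y w i n 0 \<le> 1) sequentially"
    proof (intro always_eventually allI)
      fix n
      show "r y w i n 0 \<le> 1" using bound[OF i, of "y n" n] w0[of n] G_pos[of "y n"] by (simp add: rr divide_le_eq_1)
    qed
    show "eventually (\<lambda>n. 1 - inverse (real (Suc (\<rho> n))) \<le> r y w i n 0) sequentially"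
    proof (intro always_eventually allI)
      fix n
      let ?m = "\<rho> n"
      have "1 - inverse (real (Suc ?m)) \<le> 1 - 1 / real (?m + 2)" by (simp add: inverse_eq_divide frac_le)
      also have "\<dots> \<le> R i (y n) / w n"
        using xj(3)[of ?m] \<rho>(2)[of n] w0[of n] by (simp add: w_def y_def pos_le_divide_eq)
      also have "\<dots> = r y w i n 0" by (simp add: rr R_def)
      finally show "1 - inverse (real (Suc ?m)) \<le> r y w i n 0" .
    qed
    have "(\<lambda>n. inverse (real (Suc (\<rho> n)))) \<longlonglongrightarrow> 0"
      using LIMSEQ_subseq_LIMSEQ[OF LIMSEQ_inverse_real_of_nat \<rho>(1)] by (simp add: o_def)
    from tendsto_diff[OF tendsto_const[of 1] this] show "(\<lambda>n. 1 - inverse (real (Suc (\<rho> n)))) \<longlonglongrightarrow> 1" by simp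
  qed simp
  have "abar * 1 \<le> 0 * CS"
    by (rule upper_conclusion[OF y w0 om zero_le_one bound excess i lim0])
  then show False using abar_pos by simp
qed

lemma Max_ratio_attained: "\<exists>j\<in>E. Max ((\<lambda>j. R j x) ` E) = R j x" and Min_ratio_attained: "\<exists>j\<in>E. Min ((\<lambda>j. R j x) ` E) = R j x"
  using Max_in[of "(\<lambda>j. R j x) ` E"] Min_in[of "(\<lambda>j. R j x) ` E"] E_ne by fastforce+

text \<open>The sign \<open>\<sigma>\<close> treats the upper limit of the maximum over states and
  the lower limit of the minimum in one argument. A subsequence on which one fixed state
  \<open>i\<close> attains the extremum provides the starting point for propagation.\<close>

lemma ratio_sequence:
  fixes \<sigma> :: real and m :: "real \<Rightarrow> real"
  assumes \<sigma>: "\<sigma> = 1 \<or> \<sigma> = -1" and att: "\<And>x. \<exists>j\<in>E. m x = R j x" and ext: "\<And>j x. j \<in> E \<Longrightarrow> \<sigma> * R j x \<le> \<sigma> * m x"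
  shows "\<exists>s y i. 0 \<le> s \<and> filterlim y at_top sequentially \<and> i \<in> E \<and> (\<lambda>n. R i (y n)) \<longlonglongrightarrow> s
    \<and> (\<forall>j\<in>E. \<forall>v. (\<lambda>n. max 0 (\<sigma> * (R j (y n + v) * (G (y n + v) / G (y n)) - s))) \<longlonglongrightarrow> 0)
    \<and> (\<forall>j\<in>E. \<forall>e>0. eventually (\<lambda>x. \<sigma> * R j x < \<sigma> * s + e) at_top)"
proof -
  obtain C where C: "\<And>j x. j \<in> E \<Longrightarrow> R j x \<le> C" using ratio_bounded by blast
  have "\<bar>\<sigma> * m x\<bar> \<le> C" for x
  proof -
    obtain j where "j \<in> E" "m x = R j x" using att[of x] by blast
    then show ?thesis using C[of j x] R_nonneg[of j x] \<sigma> by auto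
  qed
  from sup_along_sequence[of "\<lambda>x. \<sigma> * m x", OF this]
  obtain s' x where x: "filterlim x at_top sequentially" "(\<lambda>n. \<sigma> * m (x n)) \<longlonglongrightarrow> s'"
    "\<And>e. 0 < e \<Longrightarrow> eventually (\<lambda>x. \<sigma> * m x < s' + e) at_top" by blast
  define s where "s = \<sigma> * s'"
  have ss: "\<sigma> * \<sigma> = 1" using \<sigma> by auto
  have s's: "s' = \<sigma> * s" using ss by (simp add: s_def flip: mult.assoc)
  have "\<forall>n. \<exists>j. j \<in> E \<and> m (x n) = R j (x n)" using att by blast
  then obtain j where j: "\<And>n. j n \<in> E" "\<And>n. m (x n) = R (j n) (x n)" by metis
  obtain i where i: "i \<in> E" and ex\<rho>: "\<exists>\<rho>::nat\<Rightarrow>nat. strict_mono \<rho> \<and> (\<forall>n. j (\<rho> n) = i)"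
    using constant_subsequence[of E j, OF finite_atLeastAtMost j(1)] by blast
  obtain \<rho> :: "nat \<Rightarrow> nat" where "strict_mono \<rho> \<and> (\<forall>n. j (\<rho> n) = i)" using ex\<rho> ..
  then have \<rho>: "strict_mono \<rho>" "\<And>n. j (\<rho> n) = i" by simp_all
  define y where "y = x \<circ> \<rho>"
  have y: "filterlim y at_top sequentially"
    unfolding y_def o_def by (rule filterlim_compose[OF x(1) filterlim_subseq[OF \<rho>(1)]])
  have "(\<lambda>n. \<sigma> * (\<sigma> * m (x n))) \<longlonglongrightarrow> \<sigma> * s'" by (intro tendsto_intros x)
  then have "(\<lambda>n. m (x n)) \<longlonglongrightarrow> s" by (simp add: s_def ss flip: mult.assoc)
  from LIMSEQ_subseq_LIMSEQ[OF this \<rho>(1)] have lim: "(\<lambda>n. R i (y n)) \<longlonglongrightarrow> s"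
    using j(2) \<rho>(2) by (simp add: y_def o_def)
  have s0: "0 \<le> s" by (rule LIMSEQ_le_const[OF lim]) (use R_nonneg[OF i] in auto)
  have ev: "eventually (\<lambda>x. \<sigma> * R k x < \<sigma> * s + e) at_top" if "k \<in> E" "0 < e" for k e
    using x(3)[OF that(2)]
  proof eventually_elim
    case (elim x) then show ?case using ext[OF that(1), of x] s's by simp
  qed
  have "(\<lambda>n. max 0 (\<sigma> * (R k (y n + v) * (G (y n + v) / G (y n)) - s))) \<longlonglongrightarrow> 0" if k: "k \<in> E" for k v
  proof -
    have yv: "filterlim (\<lambda>n. y n + v) at_top sequentially"
      using filterlim_tendsto_add_at_top[OF tendsto_const[of v] y] by (simp add: add.commute)
    define e where "e n = max 0 (\<sigma> * R k (y n + v) - \<sigma> * s)" for n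
    define q where "q n = G (y n + v) / G (y n)" for n
    have q: "q \<longlonglongrightarrow> 1" unfolding q_def by (rule filterlim_compose[OF G_long_tailed y])
    have q0: "0 \<le> q n" for n by (simp add: q_def G_nonneg)
    have e: "e \<longlonglongrightarrow> 0"
    proof (rule order_tendstoI)
      fix a :: real assume "a < 0"
      then show "eventually (\<lambda>n. a < e n) sequentially" by (intro always_eventually) (auto simp: e_def)
    next
      fix a :: real assume a: "0 < a"
      have "eventually (\<lambda>n. \<sigma> * R k (y n + v) < \<sigma> * s + a) sequentially"
        using filterlim_iff[THEN iffD1, OF yv, rule_format, OF ev[OF k a]] .
      then show "eventually (\<lambda>n. e n < a) sequentially"
        by eventually_elim (use a in \<open>simp add: e_def\<close>)
    qed
    have "(\<lambda>n. max 0 ((\<sigma> * s + e n) * q n - \<sigma> * s)) \<longlonglongrightarrow> max 0 ((\<sigma> * s + 0) * 1 - \<sigma> * s)"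
      by (intro tendsto_intros e q)
    then have l: "(\<lambda>n. max 0 ((\<sigma> * s + e n) * q n - \<sigma> * s)) \<longlonglongrightarrow> 0" by simp
    show ?thesis
    proof (rule Lim_null_comparison[OF always_eventually l], rule allI)
      fix n
      have "\<sigma> * R k (y n + v) * q n \<le> (\<sigma> * s + e n) * q n"
        by (rule mult_right_mono[OF _ q0]) (simp add: e_def)
      then show "norm (max 0 (\<sigma> * (R k (y n + v) * (G (y n + v) / G (y n)) - s))) \<le> max 0 ((\<sigma> * s + e n) * q n - \<sigma> * s)"
        by (simp add: q_def right_diff_distrib mult.assoc)
    qed
  qed
  then show ?thesis using s0 y i lim ev by blast
qed

text \<open>With constant weight 1, hence \<open>om = 1\<close>, the upper limit of the largest
  ratio and the lower limit of the smallest are squeezed onto the same constant. So every state has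
  this limit, including those of stationary weight 0.\<close>

theorem walk_maximum_asymptotics:
  assumes k: "k \<in> E"
  shows "((\<lambda>x. Psi k x / G x) \<longlongrightarrow> CS / abar) at_top"
proof (rule order_tendstoI)
  note one = tendsto_const[of "1::real" sequentially]
  have r1: "Psi j (y n + v) / (1 * G (y n)) = R j (y n + v) * (G (y n + v) / G (y n))" for j y and n :: nat and v
    using G_pos[of "y n + v"] by (simp add: R_def)
  obtain C where C: "\<And>j x. j \<in> E \<Longrightarrow> R j x \<le> C" using ratio_bounded by blast
  have bound: "Psi j z \<le> C * 1 * G z" if "j \<in> E" for j z
    using C[OF that, of z] G_pos[of z] by (simp add: R_def pos_divide_le_eq)
  fix a assume a: "CS / abar < a"
  obtain s y i where s: "0 \<le> s" and y: "filterlim y at_top sequentially" and i: "i \<in> E" and lim: "(\<lambda>n. R i (y n)) \<longlonglongrightarrow> s"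
    and ex: "\<And>j v. j \<in> E \<Longrightarrow> (\<lambda>n. max 0 (1 * (R j (y n + v) * (G (y n + v) / G (y n)) - s))) \<longlonglongrightarrow> 0"
    and ev: "\<And>j e. j \<in> E \<Longrightarrow> 0 < e \<Longrightarrow> eventually (\<lambda>x. 1 * R j x < 1 * s + e) at_top"
    using ratio_sequence[of 1 "\<lambda>x. Max ((\<lambda>j. R j x) ` E)"] Max_ratio_attained by (auto simp: Max_ge_iff)
  have o: "(\<lambda>n::nat. 1 / (1::real)) \<longlonglongrightarrow> 1" by simp
  note rr = r_def[OF y zero_less_one o s]
  have "abar * s \<le> 1 * CS"
  proof (rule upper_conclusion[OF y zero_less_one o s bound _ i])
    show "(\<lambda>n. max 0 (r y (\<lambda>_. 1) j n v - s)) \<longlonglongrightarrow> 0" if "j \<in> E" for j v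
      using ex[OF that, of v] unfolding rr r1 by (simp only: mult_1_left)
    show "(\<lambda>n. r y (\<lambda>_. 1) i n 0) \<longlonglongrightarrow> s" using lim by (simp add: rr R_def)
  qed
  then have "s \<le> CS / abar" using abar_pos by (simp add: pos_le_divide_eq mult.commute)
  then have "0 < a - s" using a by simp
  from ev[OF k this] show "eventually (\<lambda>x. Psi k x / G x < a) at_top" by (simp add: R_def)
next
  have r1: "Psi j (y n + v) / (1 * G (y n)) = R j (y n + v) * (G (y n + v) / G (y n))" for j y and n :: nat and v
    using G_pos[of "y n + v"] by (simp add: R_def)
  fix a assume a: "a < CS / abar"
  obtain s y i where s: "0 \<le> s" and y: "filterlim y at_top sequentially" and i: "i \<in> E" and lim: "(\<lambda>n. R i (y n)) \<longlonglongrightarrow> s"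
    and ex: "\<And>j v. j \<in> E \<Longrightarrow> (\<lambda>n. max 0 (- 1 * (R j (y n + v) * (G (y n + v) / G (y n)) - s))) \<longlonglongrightarrow> 0"
    and ev: "\<And>j e. j \<in> E \<Longrightarrow> 0 < e \<Longrightarrow> eventually (\<lambda>x. - 1 * R j x < - 1 * s + e) at_top"
    using ratio_sequence[of "-1" "\<lambda>x. Min ((\<lambda>j. R j x) ` E)"] Min_ratio_attained by auto
  have o: "(\<lambda>n::nat. 1 / (1::real)) \<longlonglongrightarrow> 1" by simp
  note rr = r_def[OF y zero_less_one o s]
  have "1 * CS \<le> abar * s"
  proof (rule lower_conclusion[OF y zero_less_one o s _ i])
    show "(\<lambda>n. max 0 (s - r y (\<lambda>_. 1) j n v)) \<longlonglongrightarrow> 0" if "j \<in> E" for j v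
    proof -
      have "- 1 * (t - s) = s - t" for t :: real by simp
      then show ?thesis using ex[OF that, of v] unfolding rr r1 by (simp only:)
    qed
    show "(\<lambda>n. r y (\<lambda>_. 1) i n 0) \<longlonglongrightarrow> s" using lim by (simp add: rr R_def)
  qed
  then have "CS / abar \<le> s" using abar_pos by (simp add: pos_divide_le_eq mult.commute)
  then have "0 < s - a" using a by simp
  from ev[OF k this] show "eventually (\<lambda>x. a < Psi k x / G x) at_top"
    by eventually_elim (simp add: R_def)
qed

end


section \<open>The skeleton of the risk process\<close>

locale mmrp =
  fixes N :: nat
    and q :: "nat \<Rightarrow> nat \<Rightarrow> real" and lam :: "nat \<Rightarrow> real" and p :: "nat \<Rightarrow> real"
    and FC :: "nat \<Rightarrow> real measure" and FCJ :: "nat \<Rightarrow> nat \<Rightarrow> real measure"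
    and Pr :: "nat \<Rightarrow> 'w measure"
    and Jc :: "nat \<Rightarrow> 'w \<Rightarrow> nat" and S :: "nat \<Rightarrow> 'w \<Rightarrow> real" and U :: "nat \<Rightarrow> 'w \<Rightarrow> real"
  assumes rates_q: "\<forall>j\<in>{1..N}. \<forall>k\<in>{1..N}. j \<noteq> k \<longrightarrow> 0 \<le> q j k"
    and rates_lam: "\<forall>j\<in>{1..N}. 0 \<le> lam j"
    and rates_pos: "\<forall>j\<in>{1..N}. 0 < totrate N q lam j"
    and premium: "\<forall>j\<in>{1..N}. 0 < p j"
    and claims_C: "\<forall>j\<in>{1..N}. real_distribution (FC j) \<and> measure (FC j) {..<0} = 0"
    and claims_CJ: "\<forall>j\<in>{1..N}. \<forall>k\<in>{1..N}. j \<noteq> k \<longrightarrow>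
                       real_distribution (FCJ j k) \<and> measure (FCJ j k) {..<0} = 0"
    and prob: "\<forall>j\<in>{1..N}. prob_space (Pr j)"
    and meas: "\<forall>j\<in>{1..N}. \<forall>k. Jc k \<in> measurable (Pr j) (count_space UNIV) \<and>
                  S k \<in> borel_measurable (Pr j) \<and> U k \<in> borel_measurable (Pr j)"
    and law: "mmrp_law N q lam FC FCJ Pr Jc S U"
begin

abbreviation "St \<equiv> {1..N}"
abbreviation "rate \<equiv> totrate N q lam"
abbreviation "P \<equiv> emb_prob N q lam"
abbreviation "Hold i \<equiv> density lborel (\<lambda>x. ennreal (exponential_density (rate i) x))"
abbreviation "Cl \<equiv> claim_dist FC FCJ"

lemma P_nonneg: "i \<in> St \<Longrightarrow> j \<in> St \<Longrightarrow> 0 \<le> P i j"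
  using rates_q rates_lam rates_pos by (auto simp: emb_prob_def jrate_def less_imp_le intro!: divide_nonneg_pos)

lemma P_sum: "i \<in> St \<Longrightarrow> (\<Sum>j\<in>St. P i j) = 1"
proof -
  assume "i \<in> St"
  then have "rate i \<noteq> 0" using rates_pos by force
  then show ?thesis unfolding emb_prob_def sum_divide_distrib[symmetric] totrate_def[symmetric] by simp
qed

lemma Hold_prob: "i \<in> St \<Longrightarrow> prob_space (Hold i)"
  using rates_pos by (intro prob_space_exponential_density) auto

lemma Cl_dist: "i \<in> St \<Longrightarrow> j \<in> St \<Longrightarrow> real_distribution (Cl i j)"
  and Cl_nonneg: "i \<in> St \<Longrightarrow> j \<in> St \<Longrightarrow> measure (Cl i j) {..<0} = 0"
  using claims_C claims_CJ by (auto simp: claim_dist_def)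

lemma law_path:
  assumes i: "i \<in> St" and js: "\<And>k. k \<in> {1..n} \<Longrightarrow> js k \<in> St" and js0: "js 0 = i"
    and AB: "\<And>k. A k \<in> sets borel" "\<And>k. B k \<in> sets borel"
  shows "measure (Pr i) {\<omega> \<in> space (Pr i). Jc 0 \<omega> = i \<and> (\<forall>k\<in>{1..n}. Jc k \<omega> = js k \<and> S k \<omega> \<in> A k \<and> U k \<omega> \<in> B k)}
    = (\<Prod>k\<in>{1..n}. P (js (k - 1)) (js k) * measure (Hold (js (k - 1))) (A k) * measure (Cl (js (k - 1)) (js k)) (B k))"
proof -
  have "js(0 := i) = js" using js0 by auto
  then show ?thesis using law[unfolded mmrp_law_def, rule_format, OF i, of A B n js] js AB by (simp add: Let_def)
qed

end

locale mmrp_start = mmrp + fixes i :: nat assumes i: "i \<in> {1..N}"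
begin

sublocale prob_space "Pr i" using prob i by blast

lemma Jc_measurable[measurable]: "Jc k \<in> measurable (Pr i) (count_space UNIV)"
  and S_measurable[measurable]: "S k \<in> borel_measurable (Pr i)"
  and U_measurable[measurable]: "U k \<in> borel_measurable (Pr i)"
  using meas i by auto

abbreviation "\<Omega> \<equiv> space (Pr i)"

text \<open>\<open>law\<close> prescribes only events whose states lie in \<open>St\<close>. Their
  total mass is found by summing over state paths, each step contributing a row sum 1.\<close>

lemma prob_good: "prob {\<omega>\<in>\<Omega>. Jc 0 \<omega> = i \<and> (\<forall>k\<in>{1..n}. Jc k \<omega> \<in> St)} = 1"
proof (induction n)
  case 0
  have "prob {\<omega>\<in>\<Omega>. Jc 0 \<omega> = i \<and> (\<forall>k\<in>{1..0}. Jc k \<omega> = i \<and> S k \<omega> \<in> UNIV \<and> U k \<omega> \<in> UNIV)} = 1"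
    using law_path[OF i, of 0 "\<lambda>_. i" "\<lambda>_. UNIV" "\<lambda>_. UNIV"] by simp
  then show ?case by simp
next
  case (Suc n)
  define pt where "pt n js = {\<omega>\<in>\<Omega>. Jc 0 \<omega> = i \<and> (\<forall>k\<in>{1..n}. Jc k \<omega> = js k)}" for n and js :: "nat \<Rightarrow> nat"
  have pt_meas[measurable]: "pt n js \<in> events" for n js unfolding pt_def by measurable
  have pt: "prob (pt n js) = (\<Prod>k\<in>{1..n}. P ((js(0:=i)) (k - 1)) (js k))"
    if "\<And>k. k \<in> {1..n} \<Longrightarrow> js k \<in> St" for n js
  proof -
    have c: "measure (Hold ((js(0:=i)) (k - 1))) UNIV = 1" "measure (Cl ((js(0:=i)) (k - 1)) (js k)) UNIV = 1" if k: "k \<in> {1..n}" for k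
    proof -
      obtain m where m: "k = Suc m" using k by (cases k) auto
      have "(js(0:=i)) (k - 1) \<in> St"
      proof (cases "m = 0")
        case False
        then have "m \<in> {1..n}" using k m by auto
        then show ?thesis using False m \<open>\<And>k. k \<in> {1..n} \<Longrightarrow> js k \<in> St\<close>[of m] by simp
      qed (use i m in simp)
      then show "measure (Hold ((js(0:=i)) (k - 1))) UNIV = 1" "measure (Cl ((js(0:=i)) (k - 1)) (js k)) UNIV = 1"
        using prob_space.prob_space[OF Hold_prob] Cl_dist \<open>\<And>k. k \<in> {1..n} \<Longrightarrow> js k \<in> St\<close>[OF k]
          real_distribution.axioms(1)[THEN prob_space.prob_space] real_distribution.space_eq_univ by (fastforce, metis)
    qed
    have "prob (pt n js) = prob {\<omega>\<in>\<Omega>. Jc 0 \<omega> = i \<and> (\<forall>k\<in>{1..n}. Jc k \<omega> = (js(0:=i)) k \<and> S k \<omega> \<in> UNIV \<and> U k \<omega> \<in> UNIV)}"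
      by (rule arg_cong[where f=prob]) (auto simp: pt_def)
    also have "\<dots> = (\<Prod>k\<in>{1..n}. P ((js(0:=i)) (k - 1)) ((js(0:=i)) k) * measure (Hold ((js(0:=i)) (k - 1))) UNIV * measure (Cl ((js(0:=i)) (k - 1)) ((js(0:=i)) k)) UNIV)"
      by (rule law_path[OF i]) (use that in auto)
    also have "\<dots> = (\<Prod>k\<in>{1..n}. P ((js(0:=i)) (k - 1)) (js k))"
      by (intro prod.cong refl) (use c in auto)
    finally show ?thesis .
  qed
  \<comment> \<open>Extensional functions make the index set finite and the path events
    disjoint.\<close>
  define Pa where "Pa = PiE {1..n} (\<lambda>_. St)"
  have fin: "finite Pa" unfolding Pa_def by (intro finite_PiE) auto
  have un: "{\<omega>\<in>\<Omega>. Jc 0 \<omega> = i \<and> (\<forall>k\<in>{1..n}. Jc k \<omega> \<in> St)} = (\<Union>js\<in>Pa. pt n js)"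
  proof (intro equalityI subsetI)
    fix \<omega> assume "\<omega> \<in> {\<omega>\<in>\<Omega>. Jc 0 \<omega> = i \<and> (\<forall>k\<in>{1..n}. Jc k \<omega> \<in> St)}"
    then have "restrict (\<lambda>k. Jc k \<omega>) {1..n} \<in> Pa" "\<omega> \<in> pt n (restrict (\<lambda>k. Jc k \<omega>) {1..n})"
      by (auto simp: Pa_def pt_def)
    then show "\<omega> \<in> (\<Union>js\<in>Pa. pt n js)" by blast
  qed (auto simp: Pa_def pt_def PiE_def Pi_def)
  have un': "{\<omega>\<in>\<Omega>. Jc 0 \<omega> = i \<and> (\<forall>k\<in>{1..Suc n}. Jc k \<omega> \<in> St)} = (\<Union>z\<in>Pa \<times> St. pt (Suc n) ((fst z)(Suc n := snd z)))"
  proof (intro equalityI subsetI)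
    fix \<omega> assume "\<omega> \<in> {\<omega>\<in>\<Omega>. Jc 0 \<omega> = i \<and> (\<forall>k\<in>{1..Suc n}. Jc k \<omega> \<in> St)}"
    then have "(restrict (\<lambda>k. Jc k \<omega>) {1..n}, Jc (Suc n) \<omega>) \<in> Pa \<times> St"
       "\<omega> \<in> pt (Suc n) ((restrict (\<lambda>k. Jc k \<omega>) {1..n})(Suc n := Jc (Suc n) \<omega>))"
      by (auto simp: Pa_def pt_def)
    then show "\<omega> \<in> (\<Union>z\<in>Pa \<times> St. pt (Suc n) ((fst z)(Suc n := snd z)))" by (metis (no_types, lifting) UN_I fst_conv snd_conv)
  next
    fix \<omega> assume "\<omega> \<in> (\<Union>z\<in>Pa \<times> St. pt (Suc n) ((fst z)(Suc n := snd z)))"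
    then obtain js j where js: "js \<in> Pa" "j \<in> St" "\<omega> \<in> pt (Suc n) (js(Suc n := j))" by force
    have "Jc k \<omega> \<in> St" if "k \<in> {1..Suc n}" for k
    proof (cases "k = Suc n")
      case True
      then show ?thesis using js that by (auto simp: pt_def)
    next
      case False
      then have "k \<in> {1..n}" using that by auto
      then show ?thesis using js False that PiE_mem[of js "{1..n}" "\<lambda>_. St" k] by (auto simp: Pa_def pt_def)
    qed
    then show "\<omega> \<in> {\<omega>\<in>\<Omega>. Jc 0 \<omega> = i \<and> (\<forall>k\<in>{1..Suc n}. Jc k \<omega> \<in> St)}" using js by (simp add: pt_def)
  qed
  have "disjoint_family_on (pt n) Pa"
    unfolding disjoint_family_on_def
  proof (intro ballI impI equals0I)
    fix js js' \<omega> assume "js \<in> Pa" "js' \<in> Pa" "js \<noteq> js'" and "\<omega> \<in> pt n js \<inter> pt n js'"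
    then have \<omega>: "\<omega> \<in> pt n js" "\<omega> \<in> pt n js'" by auto
    have "js = js'" by (rule PiE_ext[of js "{1..n}" "\<lambda>_. St" js']) (use \<open>js \<in> Pa\<close> \<open>js' \<in> Pa\<close> \<omega> in \<open>auto simp: Pa_def pt_def\<close>)
    then show False using \<open>js \<noteq> js'\<close> by simp
  qed
  then have s1: "prob (\<Union>js\<in>Pa. pt n js) = (\<Sum>js\<in>Pa. prob (pt n js))"
    by (intro finite_measure_finite_Union fin) auto
  have "disjoint_family_on (\<lambda>z. pt (Suc n) ((fst z)(Suc n := snd z))) (Pa \<times> St)"
    unfolding disjoint_family_on_def
  proof (intro ballI impI equals0I)
    fix z z' \<omega> assume zz: "z \<in> Pa \<times> St" "z' \<in> Pa \<times> St" "z \<noteq> z'"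
      and "\<omega> \<in> pt (Suc n) ((fst z)(Suc n := snd z)) \<inter> pt (Suc n) ((fst z')(Suc n := snd z'))"
    moreover obtain js j js' j' where z: "z = (js, j)" "z' = (js', j')" by (cases z, cases z') auto
    ultimately have a: "js \<in> Pa" "js' \<in> Pa" "(js, j) \<noteq> (js', j')"
      and \<omega>: "\<omega> \<in> pt (Suc n) (js(Suc n := j))" "\<omega> \<in> pt (Suc n) (js'(Suc n := j'))" by auto
    have "Jc k \<omega> = (js(Suc n := j)) k" "Jc k \<omega> = (js'(Suc n := j')) k" if "k \<in> {1..Suc n}" for k
      using \<omega> that by (auto simp: pt_def simp del: fun_upd_apply)
    then have e: "(js(Suc n := j)) k = (js'(Suc n := j')) k" if "k \<in> {1..Suc n}" for k using that by metis
    have "js k = js' k" if "k \<in> {1..n}" for k using e[of k] that by auto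
    then have "js = js'" using a by (intro PiE_ext[of js "{1..n}" "\<lambda>_. St" js']) (auto simp: Pa_def)
    moreover have "j = j'" using e[of "Suc n"] by simp
    ultimately show False using a by simp
  qed
  then have s2: "prob (\<Union>z\<in>Pa \<times> St. pt (Suc n) ((fst z)(Suc n := snd z))) = (\<Sum>z\<in>Pa \<times> St. prob (pt (Suc n) ((fst z)(Suc n := snd z))))"
    by (intro finite_measure_finite_Union) (auto intro: fin)
  have "prob (pt (Suc n) (js(Suc n := j))) = prob (pt n js) * P ((js(0:=i)) n) j" if "js \<in> Pa" "j \<in> St" for js j
  proof -
    have jsS: "js k \<in> St" if "k \<in> {1..n}" for k using that \<open>js \<in> Pa\<close> by (auto simp: Pa_def)
    have "prob (pt (Suc n) (js(Suc n := j))) = (\<Prod>k\<in>{1..Suc n}. P (((js(Suc n := j))(0:=i)) (k - 1)) ((js(Suc n := j)) k))"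
      by (rule pt) (use jsS that in auto)
    also have "\<dots> = (\<Prod>k\<in>{1..n}. P (((js(Suc n := j))(0:=i)) (k - 1)) ((js(Suc n := j)) k)) * P ((js(0:=i)) n) j"
      by (simp add: prod.nat_ivl_Suc')
    also have "(\<Prod>k\<in>{1..n}. P (((js(Suc n := j))(0:=i)) (k - 1)) ((js(Suc n := j)) k)) = (\<Prod>k\<in>{1..n}. P ((js(0:=i)) (k - 1)) (js k))"
      by (intro prod.cong refl) auto
    also have "(\<Prod>k\<in>{1..n}. P ((js(0:=i)) (k - 1)) (js k)) = prob (pt n js)"
      by (rule pt[symmetric]) (rule jsS)
    finally show ?thesis .
  qed
  then have "(\<Sum>z\<in>Pa \<times> St. prob (pt (Suc n) ((fst z)(Suc n := snd z)))) = (\<Sum>z\<in>Pa \<times> St. prob (pt n (fst z)) * P (((fst z)(0:=i)) n) (snd z))"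
    by (intro sum.cong) auto
  also have "\<dots> = (\<Sum>js\<in>Pa. \<Sum>j\<in>St. prob (pt n js) * P ((js(0:=i)) n) j)"
    by (simp add: sum.cartesian_product case_prod_unfold)
  also have "\<dots> = (\<Sum>js\<in>Pa. prob (pt n js))"
  proof (intro sum.cong refl)
    fix js assume "js \<in> Pa"
    then have "(js(0:=i)) n \<in> St" using i by (cases "n = 0") (auto simp: Pa_def)
    then show "(\<Sum>j\<in>St. prob (pt n js) * P ((js(0:=i)) n) j) = prob (pt n js)"
      by (simp only: P_sum mult_1_right flip: sum_distrib_left)
  qed
  finally show ?case using Suc unfolding un un' s1 s2 by simp
qed

lemma AE_states: "AE \<omega> in Pr i. Jc 0 \<omega> = i \<and> (\<forall>k. Jc k \<omega> \<in> St)"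
proof -
  have "AE \<omega> in Pr i. \<forall>n. Jc 0 \<omega> = i \<and> (\<forall>k\<in>{1..n}. Jc k \<omega> \<in> St)"
    unfolding AE_all_countable
  proof
    fix n
    have [measurable]: "Measurable.pred (Pr i) (\<lambda>\<omega>. Jc k \<omega> \<in> St)" for k
      by (rule measurable_compose[OF Jc_measurable]) simp
    have "{\<omega>\<in>\<Omega>. Jc 0 \<omega> = i \<and> (\<forall>k\<in>{1..n}. Jc k \<omega> \<in> St)} \<in> events" by measurable
    from prob_Collect_eq_1[OF this] show "AE \<omega> in Pr i. Jc 0 \<omega> = i \<and> (\<forall>k\<in>{1..n}. Jc k \<omega> \<in> St)"
      using prob_good[of n] by simp
  qed
  then show ?thesis
  proof eventually_elim
    case (elim \<omega>)
    have "Jc k \<omega> \<in> St" for k using elim[rule_format, of k] i by (cases "k = 0") auto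
    then show ?case using elim by blast
  qed
qed

section \<open>The history of the skeleton and its Markov property\<close>

text \<open>Index 0 carries no condition on \<open>S\<close> and \<open>U\<close>, because
  \<open>law\<close> says nothing about them there.\<close>

definition cyl where
  "cyl n js A B = {\<omega>\<in>\<Omega>. \<forall>m\<le>n. Jc m \<omega> = js m \<and> (1 \<le> m \<longrightarrow> S m \<omega> \<in> A m \<and> U m \<omega> \<in> B m)}"

definition gen where
  "gen n = {{}} \<union> {cyl n js A B | js A B. (\<forall>k. A k \<in> sets borel) \<and> (\<forall>k. B k \<in> sets borel)}"

lemma cyl_sets:
  assumes [measurable]: "\<And>k. A k \<in> sets borel" "\<And>k. B k \<in> sets borel"
  shows "cyl n js A B \<in> events"
  unfolding cyl_def by measurable

lemma gen_sets: "gen n \<subseteq> events" unfolding gen_def using cyl_sets by auto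

lemma gen_Pow: "gen n \<subseteq> Pow \<Omega>" unfolding gen_def cyl_def by auto

text \<open>The history up to the \<open>n\<close>-th epoch, generated by the events whose
  probabilities follow from \<open>law\<close>.\<close>

definition Fn where "Fn n = sigma \<Omega> (gen n)"

lemma space_Fn[simp]: "space (Fn n) = \<Omega>" unfolding Fn_def by (rule space_measure_of[OF gen_Pow])

lemma sets_Fn: "sets (Fn n) = sigma_sets \<Omega> (gen n)" unfolding Fn_def by (rule sets_measure_of[OF gen_Pow])

lemma Fn_sub: "sets (Fn n) \<subseteq> events"
  unfolding sets_Fn by (rule sets.sigma_sets_subset[OF gen_sets])

lemma Fn_id: "(\<lambda>\<omega>. \<omega>) \<in> measurable (Pr i) (Fn n)"
  by (rule measurableI) (use Fn_sub in \<open>auto intro!: sets.Int sets.top\<close>)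

lemma Fn_measurableI: "f \<in> measurable (Fn n) M \<Longrightarrow> f \<in> measurable (Pr i) M"
  by (rule measurable_compose[OF Fn_id])

lemma cyl_gen: "(\<And>k. A k \<in> sets borel) \<Longrightarrow> (\<And>k. B k \<in> sets borel) \<Longrightarrow> cyl n js A B \<in> gen n"
  unfolding gen_def by blast

lemma cyl_Int: "cyl n js A B \<inter> cyl n js' A' B' = (if \<forall>m\<le>n. js m = js' m then cyl n js (\<lambda>k. A k \<inter> A' k) (\<lambda>k. B k \<inter> B' k) else {})"
  unfolding cyl_def by auto

lemma gen_Int_stable: "Int_stable (gen n)"
proof (rule Int_stableI)
  fix X Y assume X: "X \<in> gen n" and Y: "Y \<in> gen n"
  show "X \<inter> Y \<in> gen n"
  proof (cases "X = {} \<or> Y = {}")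
    case True then show ?thesis by (auto simp: gen_def)
  next
    case False
    then obtain js A B js' A' B' where e: "X = cyl n js A B" "Y = cyl n js' A' B'"
      and b: "\<forall>k. A k \<in> sets borel" "\<forall>k. B k \<in> sets borel" "\<forall>k. A' k \<in> sets borel" "\<forall>k. B' k \<in> sets borel"
      using X Y unfolding gen_def by blast
    show ?thesis
    proof (cases "\<forall>m\<le>n. js m = js' m")
      case True
      have "cyl n js (\<lambda>k. A k \<inter> A' k) (\<lambda>k. B k \<inter> B' k) \<in> gen n" unfolding gen_def using b by blast
      then show ?thesis unfolding e cyl_Int using True by simp
    next
      case False
      then show ?thesis unfolding e cyl_Int if_not_P[OF False] by (simp add: gen_def)
    qed
  qed
qed

text \<open>A cylinder fixes the whole state path, so \<open>\<Omega>\<close> is in general not a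
  generator; uniqueness of measures uses this countable cover by path events instead.\<close>

definition covers where "covers n = (\<lambda>js. cyl n js (\<lambda>_. UNIV) (\<lambda>_. UNIV)) ` PiE {..n} (\<lambda>_. UNIV)"

lemma countable_paths: "countable (PiE {..n::nat} (\<lambda>_. UNIV :: nat set))"
  by (rule countable_PiE) auto

lemma covers: "covers n \<subseteq> gen n" "countable (covers n)" "\<Union>(covers n) = \<Omega>"
proof -
  show "covers n \<subseteq> gen n" unfolding covers_def by (auto intro!: cyl_gen)
  show "countable (covers n)" unfolding covers_def by (intro countable_image countable_paths)
  have "\<omega> \<in> cyl n (restrict (\<lambda>k. Jc k \<omega>) {..n}) (\<lambda>_. UNIV) (\<lambda>_. UNIV)" if "\<omega> \<in> \<Omega>" for \<omega>
    using that by (auto simp: cyl_def)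
  moreover have "cyl n (restrict (\<lambda>k. Jc k \<omega>) {..n}) (\<lambda>_. UNIV) (\<lambda>_. UNIV) \<in> covers n" for \<omega>
    unfolding covers_def by (rule imageI) (simp only: restrict_PiE_iff, simp)
  moreover have "\<Union>(covers n) \<subseteq> \<Omega>" unfolding covers_def by (auto simp: cyl_def)
  ultimately show "\<Union>(covers n) = \<Omega>" by blast
qed

lemma Fn_cylinder:
  assumes "\<And>k. A k \<in> sets borel" "\<And>k. B k \<in> sets borel"
  shows "cyl n js A B \<in> sets (Fn n)"
proof -
  have "cyl n js A B \<in> gen n" unfolding gen_def using assms by blast
  then show ?thesis unfolding sets_Fn by (rule sigma_sets.Basic)
qed

lemma Fn_event:
  assumes m: "m \<le> n" and A: "A \<in> sets borel" "B \<in> sets borel"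
  shows "{\<omega>\<in>\<Omega>. Jc m \<omega> \<in> K \<and> (1 \<le> m \<longrightarrow> S m \<omega> \<in> A \<and> U m \<omega> \<in> B)} \<in> sets (Fn n)"
proof -
  have eq: "{\<omega>\<in>\<Omega>. Jc m \<omega> \<in> K \<and> (1 \<le> m \<longrightarrow> S m \<omega> \<in> A \<and> U m \<omega> \<in> B)}
     = (\<Union>js\<in>{js\<in>PiE {..n} (\<lambda>_. UNIV). js m \<in> K}. cyl n js (\<lambda>k. if k = m then A else UNIV) (\<lambda>k. if k = m then B else UNIV))"
  proof (intro equalityI subsetI)
    fix \<omega> assume "\<omega> \<in> {\<omega>\<in>\<Omega>. Jc m \<omega> \<in> K \<and> (1 \<le> m \<longrightarrow> S m \<omega> \<in> A \<and> U m \<omega> \<in> B)}"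
    then have \<omega>: "\<omega> \<in> \<Omega>" "Jc m \<omega> \<in> K" "1 \<le> m \<longrightarrow> S m \<omega> \<in> A \<and> U m \<omega> \<in> B" by auto
    let ?js = "restrict (\<lambda>k. Jc k \<omega>) {..n}"
    have "?js \<in> {js\<in>PiE {..n} (\<lambda>_. UNIV). js m \<in> K}" using \<omega> m by auto
    moreover have "\<omega> \<in> cyl n ?js (\<lambda>k. if k = m then A else UNIV) (\<lambda>k. if k = m then B else UNIV)"
      using \<omega> by (auto simp: cyl_def)
    ultimately show "\<omega> \<in> (\<Union>js\<in>{js\<in>PiE {..n} (\<lambda>_. UNIV). js m \<in> K}. cyl n js (\<lambda>k. if k = m then A else UNIV) (\<lambda>k. if k = m then B else UNIV))"
      by blast
  next
    fix \<omega> assume "\<omega> \<in> (\<Union>js\<in>{js\<in>PiE {..n} (\<lambda>_. UNIV). js m \<in> K}. cyl n js (\<lambda>k. if k = m then A else UNIV) (\<lambda>k. if k = m then B else UNIV))"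
    then obtain js where js: "js m \<in> K" "\<omega> \<in> cyl n js (\<lambda>k. if k = m then A else UNIV) (\<lambda>k. if k = m then B else UNIV)" by blast
    from js(2) have "\<omega> \<in> \<Omega>" "Jc m \<omega> = js m" "1 \<le> m \<longrightarrow> S m \<omega> \<in> A \<and> U m \<omega> \<in> B"
      using m unfolding cyl_def by (force, force, force)
    then show "\<omega> \<in> {\<omega>\<in>\<Omega>. Jc m \<omega> \<in> K \<and> (1 \<le> m \<longrightarrow> S m \<omega> \<in> A \<and> U m \<omega> \<in> B)}" using js(1) by simp
  qed
  show ?thesis unfolding eq
  proof (rule sets.countable_UN'')
    show "countable {js\<in>PiE {..n} (\<lambda>_. UNIV :: nat set). js m \<in> K}" by (rule countable_Collect[OF countable_paths])
    show "cyl n js (\<lambda>k. if k = m then A else UNIV) (\<lambda>k. if k = m then B else UNIV) \<in> sets (Fn n)" for js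
      by (rule Fn_cylinder) (simp_all add: A)
  qed
qed

lemma Fn_J: assumes "m \<le> n" shows "Jc m \<in> measurable (Fn n) (count_space UNIV)"
proof (rule measurableI)
  fix K :: "nat set"
  have eq: "Jc m -` K \<inter> space (Fn n) = {\<omega>\<in>\<Omega>. Jc m \<omega> \<in> K \<and> (1 \<le> m \<longrightarrow> S m \<omega> \<in> UNIV \<and> U m \<omega> \<in> UNIV)}" by auto
  show "Jc m -` K \<inter> space (Fn n) \<in> sets (Fn n)" unfolding eq by (intro Fn_event assms) auto
qed simp

lemma Fn_S: assumes "1 \<le> m" "m \<le> n" shows "S m \<in> borel_measurable (Fn n)"
proof (rule measurableI)
  fix A :: "real set" assume A: "A \<in> sets borel"
  have eq: "S m -` A \<inter> space (Fn n) = {\<omega>\<in>\<Omega>. Jc m \<omega> \<in> UNIV \<and> (1 \<le> m \<longrightarrow> S m \<omega> \<in> A \<and> U m \<omega> \<in> UNIV)}"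
    using assms by auto
  show "S m -` A \<inter> space (Fn n) \<in> sets (Fn n)" unfolding eq by (rule Fn_event[OF assms(2) A]) simp
qed simp

lemma Fn_U: assumes "1 \<le> m" "m \<le> n" shows "U m \<in> borel_measurable (Fn n)"
proof (rule measurableI)
  fix A :: "real set" assume A: "A \<in> sets borel"
  have eq: "U m -` A \<inter> space (Fn n) = {\<omega>\<in>\<Omega>. Jc m \<omega> \<in> UNIV \<and> (1 \<le> m \<longrightarrow> S m \<omega> \<in> UNIV \<and> U m \<omega> \<in> A)}"
    using assms by auto
  show "U m -` A \<inter> space (Fn n) \<in> sets (Fn n)" unfolding eq by (rule Fn_event[OF assms(2) _ A]) simp
qed simp

text \<open>For a path compatible with the start and with \<open>St\<close> both sides are products
  from \<open>law\<close> that differ by the last factor; for any other path both sides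
  vanish.\<close>

lemma cylinder_step:
  assumes AB: "\<And>k. A k \<in> sets borel" "\<And>k. B k \<in> sets borel" and A': "A' \<in> sets borel" "B' \<in> sets borel"
    and j: "j \<in> St" and k: "k \<in> St"
  shows "prob ({\<omega>\<in>\<Omega>. Jc n \<omega> = j \<and> Jc (Suc n) \<omega> = k \<and> S (Suc n) \<omega> \<in> A' \<and> U (Suc n) \<omega> \<in> B'} \<inter> cyl n js A B)
    = P j k * measure (Hold j) A' * measure (Cl j k) B' * prob ({\<omega>\<in>\<Omega>. Jc n \<omega> = j} \<inter> cyl n js A B)" (is "prob (?X \<inter> _) = ?c * prob (?Y \<inter> _)")
proof -
  note [measurable] = cyl_sets[OF AB] AB A'
  consider "js n \<noteq> j" | "js n = j" "\<not> (js 0 = i \<and> (\<forall>m\<le>n. js m \<in> St))" | "js n = j" "js 0 = i" "\<forall>m\<le>n. js m \<in> St" by blast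
  then show ?thesis
  proof cases
    case 1
    then have "?X \<inter> cyl n js A B = {}" "?Y \<inter> cyl n js A B = {}" by (auto simp: cyl_def)
    then show ?thesis by simp
  next
    case 2
    have z: "prob (Z \<inter> cyl n js A B) = 0" if [measurable]: "Z \<in> events" for Z
    proof -
      have "AE \<omega> in Pr i. \<omega> \<notin> Z \<inter> cyl n js A B"
        using AE_states
      proof eventually_elim
        case (elim \<omega>)
        show ?case
        proof
          assume "\<omega> \<in> Z \<inter> cyl n js A B"
          then have e: "js m = Jc m \<omega>" if "m \<le> n" for m using that by (simp add: cyl_def)
          then have "js 0 = i \<and> (\<forall>m\<le>n. js m \<in> St)" using elim e[of 0] by simp
          then show False using 2 by blast
        qed
      qed
      then show ?thesis by (simp add: prob_eq_0)
    qed
    have "prob (?X \<inter> cyl n js A B) = 0" "prob (?Y \<inter> cyl n js A B) = 0" by (rule z, measurable)+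
    then show ?thesis by simp
  next
    case 3
    have jsS: "js m \<in> St" if "m \<in> {1..n}" for m using 3 that by auto
    have Y: "?Y \<inter> cyl n js A B = {\<omega>\<in>\<Omega>. Jc 0 \<omega> = i \<and> (\<forall>k\<in>{1..n}. Jc k \<omega> = js k \<and> S k \<omega> \<in> A k \<and> U k \<omega> \<in> B k)}"
    proof (intro set_eqI iffI)
      fix \<omega> assume "\<omega> \<in> {\<omega>\<in>\<Omega>. Jc 0 \<omega> = i \<and> (\<forall>k\<in>{1..n}. Jc k \<omega> = js k \<and> S k \<omega> \<in> A k \<and> U k \<omega> \<in> B k)}"
      then have w: "\<omega> \<in> \<Omega>" "Jc 0 \<omega> = i" "\<And>k. k \<in> {1..n} \<Longrightarrow> Jc k \<omega> = js k \<and> S k \<omega> \<in> A k \<and> U k \<omega> \<in> B k" by auto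
      have "Jc m \<omega> = js m" if "m \<le> n" for m using w(2) w(3)[of m] 3 that by (cases "m = 0") auto
      then show "\<omega> \<in> ?Y \<inter> cyl n js A B" using w 3 by (auto simp: cyl_def)
    qed (use 3 in \<open>auto simp: cyl_def\<close>)
    let ?js = "js(Suc n := k)" and ?A = "A(Suc n := A')" and ?B = "B(Suc n := B')"
    have X: "?X \<inter> cyl n js A B = {\<omega>\<in>\<Omega>. Jc 0 \<omega> = i \<and> (\<forall>k\<in>{1..Suc n}. Jc k \<omega> = ?js k \<and> S k \<omega> \<in> ?A k \<and> U k \<omega> \<in> ?B k)}"
    proof -
      have "?X \<inter> cyl n js A B = {\<omega>\<in>\<Omega>. Jc (Suc n) \<omega> = k \<and> S (Suc n) \<omega> \<in> A' \<and> U (Suc n) \<omega> \<in> B'} \<inter> (?Y \<inter> cyl n js A B)" by auto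
      also have "\<dots> = {\<omega>\<in>\<Omega>. Jc 0 \<omega> = i \<and> (\<forall>k\<in>{1..Suc n}. Jc k \<omega> = ?js k \<and> S k \<omega> \<in> ?A k \<and> U k \<omega> \<in> ?B k)}"
        unfolding Y by (auto simp: atLeastAtMostSuc_conv)
      finally show ?thesis .
    qed
    have "prob (?X \<inter> cyl n js A B) = (\<Prod>m\<in>{1..Suc n}. P (?js (m - 1)) (?js m) * measure (Hold (?js (m - 1))) (?A m) * measure (Cl (?js (m - 1)) (?js m)) (?B m))"
      unfolding X by (rule law_path[OF i]) (use 3 jsS k AB A' in auto)
    also have "\<dots> = (\<Prod>m\<in>{1..n}. P (?js (m - 1)) (?js m) * measure (Hold (?js (m - 1))) (?A m) * measure (Cl (?js (m - 1)) (?js m)) (?B m)) * ?c"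
      using 3 by (simp add: prod.nat_ivl_Suc')
    also have "(\<Prod>m\<in>{1..n}. P (?js (m - 1)) (?js m) * measure (Hold (?js (m - 1))) (?A m) * measure (Cl (?js (m - 1)) (?js m)) (?B m))
        = (\<Prod>m\<in>{1..n}. P (js (m - 1)) (js m) * measure (Hold (js (m - 1))) (A m) * measure (Cl (js (m - 1)) (js m)) (B m))"
      by (intro prod.cong refl) auto
    also have "\<dots> = prob (?Y \<inter> cyl n js A B)"
      unfolding Y by (rule law_path[OF i, symmetric]) (use 3 jsS AB in auto)
    finally show ?thesis by (simp add: mult_ac)
  qed
qed

text \<open>Both sides are finite measures in \<open>A\<close> that agree on the intersection-stable
  family of cylinders, hence on the whole history.\<close>

lemma Fn_step:
  assumes A: "A \<in> sets (Fn n)" and A': "A' \<in> sets borel" "B' \<in> sets borel" and j: "j \<in> St" and k: "k \<in> St"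
  shows "emeasure (Pr i) ({\<omega>\<in>\<Omega>. Jc n \<omega> = j \<and> Jc (Suc n) \<omega> = k \<and> S (Suc n) \<omega> \<in> A' \<and> U (Suc n) \<omega> \<in> B'} \<inter> A)
    = ennreal (P j k * measure (Hold j) A' * measure (Cl j k) B') * emeasure (Pr i) ({\<omega>\<in>\<Omega>. Jc n \<omega> = j} \<inter> A)" (is "emeasure _ (?X \<inter> _) = ennreal ?c * emeasure _ (?Y \<inter> _)")
proof -
  note [measurable] = A'
  have [measurable]: "?X \<in> events" "?Y \<in> events" by measurable
  have c0: "0 \<le> ?c" using P_nonneg[OF j k] by simp
  define M1 where "M1 = distr (density (Pr i) (indicator ?X)) (Fn n) (\<lambda>\<omega>. \<omega>)"
  define M2 where "M2 = scale_measure (ennreal ?c) (distr (density (Pr i) (indicator ?Y)) (Fn n) (\<lambda>\<omega>. \<omega>))"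
  have id: "(\<lambda>\<omega>. \<omega>) \<in> measurable (density (Pr i) f) (Fn n)" for f using Fn_id by simp
  have e: "emeasure (distr (density (Pr i) (indicator Z)) (Fn n) (\<lambda>\<omega>. \<omega>)) B = emeasure (Pr i) (Z \<inter> B)"
    if "Z \<in> events" "B \<in> sets (Fn n)" for Z B
  proof -
    have B: "B \<in> events" using that Fn_sub by blast
    have "emeasure (distr (density (Pr i) (indicator Z)) (Fn n) (\<lambda>\<omega>. \<omega>)) B = emeasure (density (Pr i) (indicator Z)) (B \<inter> \<Omega>)"
      by (subst emeasure_distr[OF id that(2)]) (simp add: vimage_def Int_def conj_commute)
    also have "B \<inter> \<Omega> = B" using sets.sets_into_space[OF B] by blast
    also have "emeasure (density (Pr i) (indicator Z)) B = emeasure (Pr i) (Z \<inter> B)"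
      using emeasure_restricted[OF that(1) B] by simp
    finally show ?thesis .
  qed
  have eq: "emeasure M1 B = emeasure M2 B" if B: "B \<in> gen n" for B
  proof -
    have BF: "B \<in> sets (Fn n)" using B unfolding sets_Fn by (rule sigma_sets.Basic)
    show ?thesis
    proof (cases "B = {}")
      case False
      then obtain js A'' B'' where b: "B = cyl n js A'' B''" "\<And>k. A'' k \<in> sets borel" "\<And>k. B'' k \<in> sets borel"
        using B unfolding gen_def by blast
      have "emeasure M1 B = ennreal (prob (?X \<inter> B))" unfolding M1_def using e[OF _ BF, of ?X] by (simp add: emeasure_eq_measure)
      also have "\<dots> = ennreal (?c * prob (?Y \<inter> B))" using cylinder_step[OF b(2,3) A' j k, of n js] b(1) by simp
      also have "\<dots> = emeasure M2 B" unfolding M2_def using e[OF _ BF, of ?Y] c0 by (simp add: emeasure_eq_measure ennreal_mult)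
      finally show ?thesis .
    qed simp
  qed
  have "M1 = M2"
  proof (rule measure_eqI_generator_eq_countable[OF gen_Int_stable gen_Pow eq])
    show "sets M1 = sigma_sets \<Omega> (gen n)" "sets M2 = sigma_sets \<Omega> (gen n)" by (simp_all add: M1_def M2_def sets_Fn)
    show "covers n \<subseteq> gen n" "\<Union>(covers n) = \<Omega>" "countable (covers n)" using covers by auto
    show "emeasure M1 a \<noteq> \<infinity>" if "a \<in> covers n" for a
    proof -
      have "a \<in> sets (Fn n)" using that covers(1) unfolding sets_Fn by (auto intro: sigma_sets.Basic)
      then show ?thesis unfolding M1_def using e[of ?X a] by simp
    qed
  qed
  then have "emeasure M1 A = emeasure M2 A" by simp
  then show ?thesis unfolding M1_def M2_def using e[OF _ A, of ?X] e[OF _ A, of ?Y] by simp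
qed

text \<open>On the event of a given transition the joint law of history, holding time and claim is a
  product measure up to a factor. Uniqueness of product measures enters in two layers: for the pair
  of holding time and claim with the history event fixed, then for the history against that
  pair.\<close>

lemma Markov_step:
  assumes j: "j \<in> St" and k: "k \<in> St"
    and f[measurable]: "f \<in> borel_measurable (Fn n \<Otimes>\<^sub>M (borel \<Otimes>\<^sub>M borel))"
  shows "(\<integral>\<^sup>+\<omega>. indicator {\<omega>\<in>\<Omega>. Jc n \<omega> = j \<and> Jc (Suc n) \<omega> = k} \<omega> * f (\<omega>, (S (Suc n) \<omega>, U (Suc n) \<omega>)) \<partial>Pr i)
    = ennreal (P j k) * (\<integral>\<^sup>+\<omega>. indicator {\<omega>\<in>\<Omega>. Jc n \<omega> = j} \<omega> * (\<integral>\<^sup>+z. f (\<omega>, z) \<partial>(Hold j \<Otimes>\<^sub>M Cl j k)) \<partial>Pr i)"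
proof -
  interpret Hold: prob_space "Hold j" by (rule Hold_prob[OF j])
  interpret Cl: real_distribution "Cl j k" by (rule Cl_dist[OF j k])
  interpret EC: pair_prob_space "Hold j" "Cl j k" ..
  note Cl.M_is_borel[measurable_cong]
  define K where "K = Hold j \<Otimes>\<^sub>M Cl j k"
  have sK: "sets K = sets (borel \<Otimes>\<^sub>M borel)" unfolding K_def by (rule sets_pair_measure_cong) (auto simp: Cl.M_is_borel)
  interpret K: prob_space K unfolding K_def by (rule EC.P.prob_space_axioms)
  let ?X = "{\<omega>\<in>\<Omega>. Jc n \<omega> = j \<and> Jc (Suc n) \<omega> = k}" and ?Y = "{\<omega>\<in>\<Omega>. Jc n \<omega> = j}"
  let ?SU = "\<lambda>\<omega>. (S (Suc n) \<omega>, U (Suc n) \<omega>)"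
  have [measurable]: "?X \<in> events" "?Y \<in> events" by measurable
  have rect: "emeasure (Pr i) (?X \<inter> A \<inter> (?SU -` B \<inter> \<Omega>)) = ennreal (P j k) * emeasure (Pr i) (?Y \<inter> A) * emeasure K B"
    if A: "A \<in> sets (Fn n)" and B: "B \<in> sets (borel \<Otimes>\<^sub>M borel)" for A B
  proof -
    have [measurable]: "A \<in> events" using A Fn_sub by blast
    define a where "a = ennreal (P j k) * emeasure (Pr i) (?Y \<inter> A)"
    have a: "a \<noteq> \<infinity>" unfolding a_def by (simp add: ennreal_mult_eq_top_iff)
    define L where "L = distr (density (Pr i) (indicator (?X \<inter> A))) (borel \<Otimes>\<^sub>M borel) ?SU"
    have eL: "emeasure L B = emeasure (Pr i) (?X \<inter> A \<inter> (?SU -` B \<inter> \<Omega>))" if "B \<in> sets (borel \<Otimes>\<^sub>M borel)" for B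
    proof -
      have [measurable]: "?SU \<in> measurable (Pr i) (borel \<Otimes>\<^sub>M borel)" by measurable
      have "?SU -` B \<inter> \<Omega> \<in> events" using that by measurable
      note SB = this
      have "emeasure L B = emeasure (density (Pr i) (indicator (?X \<inter> A))) (?SU -` B \<inter> space (density (Pr i) (indicator (?X \<inter> A))))"
        unfolding L_def by (rule emeasure_distr[OF _ that]) simp
      also have "\<dots> = emeasure (Pr i) (?X \<inter> A \<inter> (?SU -` B \<inter> \<Omega>))"
        unfolding space_density by (rule emeasure_restricted[OF _ SB]) measurable
      finally show ?thesis .
    qed
    have "scale_measure a (Hold j) \<Otimes>\<^sub>M Cl j k = L"
    proof (rule pair_measure_eqI)
      show "sigma_finite_measure (scale_measure a (Hold j))"
      proof (rule finite_measure.axioms(1), rule finite_measureI)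
        show "emeasure (scale_measure a (Hold j)) (space (scale_measure a (Hold j))) \<noteq> \<infinity>"
          using a Hold.emeasure_space_1 by (simp add: space_scale_measure)
      qed
      show "sigma_finite_measure (Cl j k)" by (rule Cl.sigma_finite_measure)
      show "sets (scale_measure a (Hold j) \<Otimes>\<^sub>M Cl j k) = sets L"
        unfolding L_def sets_distr by (rule sets_pair_measure_cong) (auto simp: Cl.M_is_borel)
      fix A1 B1 assume "A1 \<in> sets (scale_measure a (Hold j))" "B1 \<in> sets (Cl j k)"
      then have [measurable]: "A1 \<in> sets borel" "B1 \<in> sets borel" by (auto simp: Cl.M_is_borel)
      have "emeasure L (A1 \<times> B1) = emeasure (Pr i) (?X \<inter> A \<inter> (?SU -` (A1 \<times> B1) \<inter> \<Omega>))"
        by (rule eL) auto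
      also have "?X \<inter> A \<inter> (?SU -` (A1 \<times> B1) \<inter> \<Omega>) = {\<omega>\<in>\<Omega>. Jc n \<omega> = j \<and> Jc (Suc n) \<omega> = k \<and> S (Suc n) \<omega> \<in> A1 \<and> U (Suc n) \<omega> \<in> B1} \<inter> A" by auto
      also have "emeasure (Pr i) \<dots> = ennreal (P j k * measure (Hold j) A1 * measure (Cl j k) B1) * emeasure (Pr i) (?Y \<inter> A)"
        by (rule Fn_step[OF A _ _ j k]) measurable
      also have "\<dots> = emeasure (scale_measure a (Hold j)) A1 * emeasure (Cl j k) B1"
        using P_nonneg[OF j k] by (simp add: a_def Hold.emeasure_eq_measure Cl.emeasure_eq_measure ennreal_mult mult_ac)
      finally show "emeasure (scale_measure a (Hold j)) A1 * emeasure (Cl j k) B1 = emeasure L (A1 \<times> B1)" by simp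
    qed
    moreover have "scale_measure a (Hold j) \<Otimes>\<^sub>M Cl j k = scale_measure a K"
    proof (rule pair_measure_eqI)
      show "sigma_finite_measure (scale_measure a (Hold j))"
      proof (rule finite_measure.axioms(1), rule finite_measureI)
        show "emeasure (scale_measure a (Hold j)) (space (scale_measure a (Hold j))) \<noteq> \<infinity>"
          using a Hold.emeasure_space_1 by (simp add: space_scale_measure)
      qed
      show "sigma_finite_measure (Cl j k)" by (rule Cl.sigma_finite_measure)
      show "sets (scale_measure a (Hold j) \<Otimes>\<^sub>M Cl j k) = sets (scale_measure a K)"
        unfolding K_def sets_scale_measure by (rule sets_pair_measure_cong) auto
      fix A1 B1 assume "A1 \<in> sets (scale_measure a (Hold j))" "B1 \<in> sets (Cl j k)"
      then show "emeasure (scale_measure a (Hold j)) A1 * emeasure (Cl j k) B1 = emeasure (scale_measure a K) (A1 \<times> B1)"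
        unfolding K_def by (simp add: Cl.emeasure_pair_measure_Times mult_ac)
    qed
    ultimately have "L = scale_measure a K" by simp
    then have "emeasure L B = a * emeasure K B" by simp
    then show ?thesis using eL[OF B] by (simp add: a_def)
  qed
  define MY where "MY = distr (density (Pr i) (indicator ?Y)) (Fn n) (\<lambda>\<omega>. \<omega>)"
  have id: "(\<lambda>\<omega>. \<omega>) \<in> measurable (density (Pr i) f) (Fn n)" for f using Fn_id by simp
  have eMY: "emeasure MY A = emeasure (Pr i) (?Y \<inter> A)" if A: "A \<in> sets (Fn n)" for A
  proof -
    have B: "A \<in> events" using that Fn_sub by blast
    have "emeasure MY A = emeasure (density (Pr i) (indicator ?Y)) (A \<inter> \<Omega>)"
      unfolding MY_def by (subst emeasure_distr[OF id A]) (simp add: vimage_def Int_def conj_commute)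
    also have "A \<inter> \<Omega> = A" using sets.sets_into_space[OF B] by blast
    finally show ?thesis using emeasure_restricted[of ?Y "Pr i" A] B by simp
  qed
  interpret MY: finite_measure MY
    by (rule finite_measureI) (use eMY[of \<Omega>] sets.top[of "Fn n"] in \<open>simp add: MY_def\<close>)
  have mp: "(\<lambda>\<omega>. (\<omega>, ?SU \<omega>)) \<in> measurable (Pr i) (Fn n \<Otimes>\<^sub>M (borel \<Otimes>\<^sub>M borel))"
    using Fn_id by measurable
  define L where "L = distr (density (Pr i) (indicator ?X)) (Fn n \<Otimes>\<^sub>M (borel \<Otimes>\<^sub>M borel)) (\<lambda>\<omega>. (\<omega>, ?SU \<omega>))"
  have "scale_measure (ennreal (P j k)) MY \<Otimes>\<^sub>M K = L"
  proof (rule pair_measure_eqI)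
    show "sigma_finite_measure (scale_measure (ennreal (P j k)) MY)"
    proof (rule finite_measure.axioms(1), rule finite_measureI)
      show "emeasure (scale_measure (ennreal (P j k)) MY) (space (scale_measure (ennreal (P j k)) MY)) \<noteq> \<infinity>"
        by (simp add: space_scale_measure ennreal_mult_eq_top_iff MY.emeasure_eq_measure)
    qed
    show "sigma_finite_measure K" by (rule K.sigma_finite_measure)
    show "sets (scale_measure (ennreal (P j k)) MY \<Otimes>\<^sub>M K) = sets L"
      unfolding L_def sets_distr by (rule sets_pair_measure_cong) (auto simp: MY_def sK)
    fix A B assume "A \<in> sets (scale_measure (ennreal (P j k)) MY)" "B \<in> sets K"
    then have AB: "A \<in> sets (Fn n)" "B \<in> sets (borel \<Otimes>\<^sub>M borel)" by (auto simp: MY_def sK)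
    have [measurable]: "A \<in> events" using AB Fn_sub by blast
    have vim: "(\<lambda>\<omega>. (\<omega>, ?SU \<omega>)) -` (A \<times> B) \<inter> \<Omega> = A \<inter> (?SU -` B \<inter> \<Omega>)" by auto
    have SB: "?SU -` B \<inter> \<Omega> \<in> events" using AB(2) by measurable
    have "emeasure L (A \<times> B) = emeasure (density (Pr i) (indicator ?X)) (A \<inter> (?SU -` B \<inter> \<Omega>))"
      unfolding L_def using mp AB by (subst emeasure_distr) (auto simp: vim)
    also have "\<dots> = emeasure (Pr i) (?X \<inter> (A \<inter> (?SU -` B \<inter> \<Omega>)))"
      by (rule emeasure_restricted) (use SB in auto)
    also have "\<dots> = ennreal (P j k) * emeasure (Pr i) (?Y \<inter> A) * emeasure K B"
      using rect[OF AB] by (simp add: Int_assoc)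
    finally show "emeasure (scale_measure (ennreal (P j k)) MY) A * emeasure K B = emeasure L (A \<times> B)"
      using eMY[OF AB(1)] by simp
  qed
  then have main: "(\<integral>\<^sup>+z. f z \<partial>L) = (\<integral>\<^sup>+z. f z \<partial>(scale_measure (ennreal (P j k)) MY \<Otimes>\<^sub>M K))" by simp
  have f': "f \<in> borel_measurable (scale_measure (ennreal (P j k)) MY \<Otimes>\<^sub>M K)"
    using f by (subst measurable_cong_sets[OF sets_pair_measure_cong refl, of _ "Fn n" _ "borel \<Otimes>\<^sub>M borel"]) (auto simp: MY_def sK)
  have "(\<integral>\<^sup>+\<omega>. indicator ?X \<omega> * f (\<omega>, ?SU \<omega>) \<partial>Pr i) = (\<integral>\<^sup>+z. f z \<partial>L)"
  proof -
    have fm: "(\<lambda>\<omega>. f (\<omega>, ?SU \<omega>)) \<in> borel_measurable (Pr i)" by (rule measurable_compose[OF mp f])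
    have "(\<integral>\<^sup>+z. f z \<partial>L) = (\<integral>\<^sup>+\<omega>. f (\<omega>, ?SU \<omega>) \<partial>density (Pr i) (indicator ?X))"
      unfolding L_def by (rule nn_integral_distr) (use mp f in simp_all)
    also have "\<dots> = (\<integral>\<^sup>+\<omega>. indicator ?X \<omega> * f (\<omega>, ?SU \<omega>) \<partial>Pr i)"
      by (rule nn_integral_density) (use fm in simp_all)
    finally show ?thesis by simp
  qed
  also have "\<dots> = (\<integral>\<^sup>+\<omega>. (\<integral>\<^sup>+z. f (\<omega>, z) \<partial>K) \<partial>(scale_measure (ennreal (P j k)) MY))"
    unfolding main by (rule K.nn_integral_fst[symmetric, OF f'])
  also have "\<dots> = ennreal (P j k) * (\<integral>\<^sup>+\<omega>. (\<integral>\<^sup>+z. f (\<omega>, z) \<partial>K) \<partial>MY)"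
    by (rule nn_integral_scale_measure) (use K.borel_measurable_nn_integral_fst[OF f'] in simp)
  also have "(\<integral>\<^sup>+\<omega>. (\<integral>\<^sup>+z. f (\<omega>, z) \<partial>K) \<partial>MY) = (\<integral>\<^sup>+\<omega>. indicator ?Y \<omega> * (\<integral>\<^sup>+z. f (\<omega>, z) \<partial>K) \<partial>Pr i)"
  proof -
    have m1: "(\<lambda>\<omega>. \<integral>\<^sup>+z. f (\<omega>, z) \<partial>K) \<in> borel_measurable (Fn n)"
      using K.borel_measurable_nn_integral_fst[OF f'] by (simp add: MY_def)
    have m2: "(\<lambda>\<omega>. \<integral>\<^sup>+z. f (\<omega>, z) \<partial>K) \<in> borel_measurable (Pr i)" by (rule Fn_measurableI[OF m1])
    have "(\<integral>\<^sup>+\<omega>. (\<integral>\<^sup>+z. f (\<omega>, z) \<partial>K) \<partial>MY) = (\<integral>\<^sup>+\<omega>. (\<integral>\<^sup>+z. f (\<omega>, z) \<partial>K) \<partial>density (Pr i) (indicator ?Y))"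
      unfolding MY_def by (rule nn_integral_distr) (use id m1 in simp_all)
    also have "\<dots> = (\<integral>\<^sup>+\<omega>. indicator ?Y \<omega> * (\<integral>\<^sup>+z. f (\<omega>, z) \<partial>K) \<partial>Pr i)"
      by (rule nn_integral_density) (use m2 in simp_all)
    finally show ?thesis .
  qed
  finally show ?thesis unfolding K_def .
qed

end


section \<open>One-step expectations and absence of explosion\<close>

context mmrp_start
begin

text \<open>The Markov property as an identity of expectations: the next step is integrated out with
  the kernel of the present state. Almost surely only transitions inside \<open>St\<close> occur, so
  the integrand can be resolved into finite sums to which \<open>Markov_step\<close>
  applies.\<close>

lemma one_step:
  assumes f: "\<And>j k. j \<in> St \<Longrightarrow> k \<in> St \<Longrightarrow> f j k \<in> borel_measurable (Fn n \<Otimes>\<^sub>M (borel \<Otimes>\<^sub>M borel))"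
  shows "(\<integral>\<^sup>+\<omega>. f (Jc n \<omega>) (Jc (Suc n) \<omega>) (\<omega>, (S (Suc n) \<omega>, U (Suc n) \<omega>)) \<partial>Pr i)
    = (\<integral>\<^sup>+\<omega>. (\<Sum>k\<in>St. ennreal (P (Jc n \<omega>) k) * (\<integral>\<^sup>+z. f (Jc n \<omega>) k (\<omega>, z) \<partial>(Hold (Jc n \<omega>) \<Otimes>\<^sub>M Cl (Jc n \<omega>) k))) \<partial>Pr i)"
proof -
  let ?SU = "\<lambda>\<omega>. (S (Suc n) \<omega>, U (Suc n) \<omega>)"
  let ?X = "\<lambda>j k. {\<omega>\<in>\<Omega>. Jc n \<omega> = j \<and> Jc (Suc n) \<omega> = k}" and ?Y = "\<lambda>j. {\<omega>\<in>\<Omega>. Jc n \<omega> = j}"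
  have [measurable]: "?X j k \<in> events" "?Y j \<in> events" for j k by measurable
  have mp: "(\<lambda>\<omega>. (\<omega>, ?SU \<omega>)) \<in> measurable (Pr i) (Fn n \<Otimes>\<^sub>M (borel \<Otimes>\<^sub>M borel))"
    using Fn_id by measurable
  have fm: "(\<lambda>\<omega>. f j k (\<omega>, ?SU \<omega>)) \<in> borel_measurable (Pr i)" if "j \<in> St" "k \<in> St" for j k
    by (rule measurable_compose[OF mp f[OF that]])
  have gm: "(\<lambda>\<omega>. \<integral>\<^sup>+z. f j k (\<omega>, z) \<partial>(Hold j \<Otimes>\<^sub>M Cl j k)) \<in> borel_measurable (Pr i)" if j: "j \<in> St" and k: "k \<in> St" for j k
  proof (rule Fn_measurableI[of _ n])
    interpret Hold: prob_space "Hold j" by (rule Hold_prob[OF j])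
    interpret Cl: real_distribution "Cl j k" by (rule Cl_dist[OF j k])
    interpret EC: pair_prob_space "Hold j" "Cl j k" ..
    have sK: "sets (Hold j \<Otimes>\<^sub>M Cl j k) = sets (borel \<Otimes>\<^sub>M borel)"
      by (rule sets_pair_measure_cong) (auto simp: Cl.M_is_borel)
    have "f j k \<in> borel_measurable (Fn n \<Otimes>\<^sub>M (Hold j \<Otimes>\<^sub>M Cl j k))"
      using f[OF j k] by (subst measurable_cong_sets[OF sets_pair_measure_cong[OF refl sK] refl])
    then show "(\<lambda>\<omega>. \<integral>\<^sup>+z. f j k (\<omega>, z) \<partial>(Hold j \<Otimes>\<^sub>M Cl j k)) \<in> borel_measurable (Fn n)"
      by (rule EC.P.borel_measurable_nn_integral_fst)
  qed
  have ind: "(\<Sum>j\<in>St. indicator (?Y j) \<omega> * h j) = (h (Jc n \<omega>) :: ennreal)" if "\<omega> \<in> \<Omega>" "Jc n \<omega> \<in> St" for \<omega> h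
  proof -
    have "(\<Sum>j\<in>St. indicator (?Y j) \<omega> * h j) = (\<Sum>j\<in>St. if j = Jc n \<omega> then h j else 0)"
      by (intro sum.cong refl) (use that in \<open>auto simp: indicator_def\<close>)
    then show ?thesis using that by simp
  qed
  have ind2: "(\<Sum>j\<in>St. \<Sum>k\<in>St. indicator (?X j k) \<omega> * h j k) = (h (Jc n \<omega>) (Jc (Suc n) \<omega>) :: ennreal)"
    if "\<omega> \<in> \<Omega>" "Jc n \<omega> \<in> St" "Jc (Suc n) \<omega> \<in> St" for \<omega> h
  proof -
    have "(\<Sum>j\<in>St. \<Sum>k\<in>St. indicator (?X j k) \<omega> * h j k) = (\<Sum>j\<in>St. if j = Jc n \<omega> then h j (Jc (Suc n) \<omega>) else 0)"
    proof (intro sum.cong refl)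
      fix j assume "j \<in> St"
      have "(\<Sum>k\<in>St. indicator (?X j k) \<omega> * h j k) = (\<Sum>k\<in>St. if k = Jc (Suc n) \<omega> then (if j = Jc n \<omega> then h j k else 0) else 0)"
        by (intro sum.cong refl) (use that in \<open>auto simp: indicator_def\<close>)
      then show "(\<Sum>k\<in>St. indicator (?X j k) \<omega> * h j k) = (if j = Jc n \<omega> then h j (Jc (Suc n) \<omega>) else 0)"
        using that by simp
    qed
    then show ?thesis using that by simp
  qed
  have "(\<integral>\<^sup>+\<omega>. f (Jc n \<omega>) (Jc (Suc n) \<omega>) (\<omega>, ?SU \<omega>) \<partial>Pr i)
    = (\<integral>\<^sup>+\<omega>. (\<Sum>j\<in>St. \<Sum>k\<in>St. indicator (?X j k) \<omega> * f j k (\<omega>, ?SU \<omega>)) \<partial>Pr i)"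
  proof (rule nn_integral_cong_AE)
    show "AE \<omega> in Pr i. f (Jc n \<omega>) (Jc (Suc n) \<omega>) (\<omega>, ?SU \<omega>) = (\<Sum>j\<in>St. \<Sum>k\<in>St. indicator (?X j k) \<omega> * f j k (\<omega>, ?SU \<omega>))"
      using AE_states AE_space
    proof eventually_elim
      case (elim \<omega>)
      then show ?case using ind2[of \<omega> "\<lambda>j k. f j k (\<omega>, ?SU \<omega>)"] by simp
    qed
  qed
  also have "\<dots> = (\<Sum>j\<in>St. \<Sum>k\<in>St. (\<integral>\<^sup>+\<omega>. indicator (?X j k) \<omega> * f j k (\<omega>, ?SU \<omega>) \<partial>Pr i))"
    using fm by (subst nn_integral_sum, measurable, intro sum.cong refl nn_integral_sum, measurable)
  also have "\<dots> = (\<Sum>j\<in>St. \<Sum>k\<in>St. ennreal (P j k) * (\<integral>\<^sup>+\<omega>. indicator (?Y j) \<omega> * (\<integral>\<^sup>+z. f j k (\<omega>, z) \<partial>(Hold j \<Otimes>\<^sub>M Cl j k)) \<partial>Pr i))"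
    by (intro sum.cong refl Markov_step f)
  also have "\<dots> = (\<Sum>j\<in>St. (\<integral>\<^sup>+\<omega>. indicator (?Y j) \<omega> * (\<Sum>k\<in>St. ennreal (P j k) * (\<integral>\<^sup>+z. f j k (\<omega>, z) \<partial>(Hold j \<Otimes>\<^sub>M Cl j k))) \<partial>Pr i))"
  proof (intro sum.cong refl)
    fix j assume j: "j \<in> St"
    have "(\<integral>\<^sup>+\<omega>. indicator (?Y j) \<omega> * (\<Sum>k\<in>St. ennreal (P j k) * (\<integral>\<^sup>+z. f j k (\<omega>, z) \<partial>(Hold j \<Otimes>\<^sub>M Cl j k))) \<partial>Pr i)
       = (\<integral>\<^sup>+\<omega>. (\<Sum>k\<in>St. ennreal (P j k) * (indicator (?Y j) \<omega> * (\<integral>\<^sup>+z. f j k (\<omega>, z) \<partial>(Hold j \<Otimes>\<^sub>M Cl j k)))) \<partial>Pr i)"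
      by (intro nn_integral_cong) (simp add: sum_distrib_left mult_ac)
    also have "\<dots> = (\<Sum>k\<in>St. (\<integral>\<^sup>+\<omega>. ennreal (P j k) * (indicator (?Y j) \<omega> * (\<integral>\<^sup>+z. f j k (\<omega>, z) \<partial>(Hold j \<Otimes>\<^sub>M Cl j k))) \<partial>Pr i))"
      by (rule nn_integral_sum) (use gm[OF j] in measurable)
    also have "\<dots> = (\<Sum>k\<in>St. ennreal (P j k) * (\<integral>\<^sup>+\<omega>. indicator (?Y j) \<omega> * (\<integral>\<^sup>+z. f j k (\<omega>, z) \<partial>(Hold j \<Otimes>\<^sub>M Cl j k)) \<partial>Pr i))"
      by (intro sum.cong refl nn_integral_cmult) (use gm[OF j] in measurable)
    finally show "(\<Sum>k\<in>St. ennreal (P j k) * (\<integral>\<^sup>+\<omega>. indicator (?Y j) \<omega> * (\<integral>\<^sup>+z. f j k (\<omega>, z) \<partial>(Hold j \<Otimes>\<^sub>M Cl j k)) \<partial>Pr i))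
       = (\<integral>\<^sup>+\<omega>. indicator (?Y j) \<omega> * (\<Sum>k\<in>St. ennreal (P j k) * (\<integral>\<^sup>+z. f j k (\<omega>, z) \<partial>(Hold j \<Otimes>\<^sub>M Cl j k))) \<partial>Pr i)" by simp
  qed
  also have "\<dots> = (\<integral>\<^sup>+\<omega>. (\<Sum>j\<in>St. indicator (?Y j) \<omega> * (\<Sum>k\<in>St. ennreal (P j k) * (\<integral>\<^sup>+z. f j k (\<omega>, z) \<partial>(Hold j \<Otimes>\<^sub>M Cl j k)))) \<partial>Pr i)"
    by (rule nn_integral_sum[symmetric]) (use gm in \<open>auto intro!: borel_measurable_times borel_measurable_sum\<close>)
  also have "\<dots> = (\<integral>\<^sup>+\<omega>. (\<Sum>k\<in>St. ennreal (P (Jc n \<omega>) k) * (\<integral>\<^sup>+z. f (Jc n \<omega>) k (\<omega>, z) \<partial>(Hold (Jc n \<omega>) \<Otimes>\<^sub>M Cl (Jc n \<omega>) k))) \<partial>Pr i)"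
  proof (rule nn_integral_cong_AE)
    show "AE \<omega> in Pr i. (\<Sum>j\<in>St. indicator (?Y j) \<omega> * (\<Sum>k\<in>St. ennreal (P j k) * (\<integral>\<^sup>+z. f j k (\<omega>, z) \<partial>(Hold j \<Otimes>\<^sub>M Cl j k))))
        = (\<Sum>k\<in>St. ennreal (P (Jc n \<omega>) k) * (\<integral>\<^sup>+z. f (Jc n \<omega>) k (\<omega>, z) \<partial>(Hold (Jc n \<omega>) \<Otimes>\<^sub>M Cl (Jc n \<omega>) k)))"
      using AE_states AE_space
    proof eventually_elim
      case (elim \<omega>)
      then show ?case using ind[of \<omega> "\<lambda>j. \<Sum>k\<in>St. ennreal (P j k) * (\<integral>\<^sup>+z. f j k (\<omega>, z) \<partial>(Hold j \<Otimes>\<^sub>M Cl j k))"] by simp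
    qed
  qed
  finally show ?thesis .
qed

lemma AE_step:
  assumes A: "A \<in> sets borel" "B \<in> sets borel"
    and z: "\<And>j k. j \<in> St \<Longrightarrow> k \<in> St \<Longrightarrow> measure (Hold j) A * measure (Cl j k) B = 0"
  shows "AE \<omega> in Pr i. \<not> (S (Suc n) \<omega> \<in> A \<and> U (Suc n) \<omega> \<in> B)"
proof -
  note [measurable] = A
  have "AE \<omega> in Pr i. \<not> (Jc n \<omega> = j \<and> Jc (Suc n) \<omega> = k \<and> S (Suc n) \<omega> \<in> A \<and> U (Suc n) \<omega> \<in> B)" if j: "j \<in> St" and k: "k \<in> St" for j k
  proof -
    have "emeasure (Pr i) ({\<omega>\<in>\<Omega>. Jc n \<omega> = j \<and> Jc (Suc n) \<omega> = k \<and> S (Suc n) \<omega> \<in> A \<and> U (Suc n) \<omega> \<in> B} \<inter> \<Omega>) = 0"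
      using Fn_step[of \<Omega> n A B j k] sets.top[of "Fn n"] z[OF j k] A j k by (simp add: mult.assoc)
    moreover have "{\<omega>\<in>\<Omega>. Jc n \<omega> = j \<and> Jc (Suc n) \<omega> = k \<and> S (Suc n) \<omega> \<in> A \<and> U (Suc n) \<omega> \<in> B} \<inter> \<Omega>
       = {\<omega>\<in>\<Omega>. Jc n \<omega> = j \<and> Jc (Suc n) \<omega> = k \<and> S (Suc n) \<omega> \<in> A \<and> U (Suc n) \<omega> \<in> B}" by auto
    ultimately show ?thesis
      by (intro AE_I[where N="{\<omega>\<in>\<Omega>. Jc n \<omega> = j \<and> Jc (Suc n) \<omega> = k \<and> S (Suc n) \<omega> \<in> A \<and> U (Suc n) \<omega> \<in> B}"]) auto
  qed
  then have "AE \<omega> in Pr i. \<forall>j\<in>St. \<forall>k\<in>St. \<not> (Jc n \<omega> = j \<and> Jc (Suc n) \<omega> = k \<and> S (Suc n) \<omega> \<in> A \<and> U (Suc n) \<omega> \<in> B)"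
    by (intro AE_finite_allI) auto
  then show ?thesis using AE_states
  proof eventually_elim
    case (elim \<omega>)
    then show ?case by blast
  qed
qed

lemma AE_S_pos: "AE \<omega> in Pr i. 0 < S (Suc n) \<omega>"
proof -
  have "measure (Hold j) {..0} = 0" for j
  proof -
    have "emeasure (Hold j) {..0} = (\<integral>\<^sup>+x. ennreal (exponential_density (rate j) x) * indicator {..0} x \<partial>lborel)"
      by (rule emeasure_density) auto
    also have "\<dots> = (\<integral>\<^sup>+x. 0 \<partial>(lborel :: real measure))"
    proof (rule nn_integral_cong_AE)
      show "AE x in lborel. ennreal (exponential_density (rate j) x) * indicator {..0} x = 0"
        using AE_lborel_singleton[of "0::real"] by eventually_elim (auto simp: exponential_density_def indicator_def)
    qed
    finally show ?thesis by (simp add: measure_def)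
  qed
  then have "AE \<omega> in Pr i. \<not> (S (Suc n) \<omega> \<in> {..0} \<and> U (Suc n) \<omega> \<in> UNIV)" by (intro AE_step) auto
  then show ?thesis by eventually_elim auto
qed

lemma AE_U_nonneg: "AE \<omega> in Pr i. 0 \<le> U (Suc n) \<omega>"
proof -
  have "AE \<omega> in Pr i. \<not> (S (Suc n) \<omega> \<in> UNIV \<and> U (Suc n) \<omega> \<in> {..<0})" using Cl_nonneg by (intro AE_step) auto
  then show ?thesis by eventually_elim auto
qed

abbreviation "T n \<omega> \<equiv> jump_time S n \<omega>"

lemma T_0: "T 0 \<omega> = 0" by (simp add: jump_time_def)

lemma T_Suc: "T (Suc n) \<omega> = T n \<omega> + S (Suc n) \<omega>"
  by (simp add: jump_time_def sum.nat_ivl_Suc' add.commute)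

lemma T_Fn: "(\<lambda>\<omega>. T n \<omega>) \<in> borel_measurable (Fn n)"
  unfolding jump_time_def by (intro borel_measurable_sum Fn_S) auto

lemma T_measurable[measurable]: "(\<lambda>\<omega>. T n \<omega>) \<in> borel_measurable (Pr i)"
  by (rule Fn_measurableI[OF T_Fn])

lemma K_prob:
  assumes j: "j \<in> St" and k: "k \<in> St"
  shows "prob_space (Hold j \<Otimes>\<^sub>M Cl j k)" and K_sets: "sets (Hold j \<Otimes>\<^sub>M Cl j k) = sets (borel \<Otimes>\<^sub>M borel)"
proof -
  interpret Hold: prob_space "Hold j" by (rule Hold_prob[OF j])
  interpret Cl: real_distribution "Cl j k" by (rule Cl_dist[OF j k])
  interpret EC: pair_prob_space "Hold j" "Cl j k" ..
  show "prob_space (Hold j \<Otimes>\<^sub>M Cl j k)" by (rule EC.P.prob_space_axioms)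
  show "sets (Hold j \<Otimes>\<^sub>M Cl j k) = sets (borel \<Otimes>\<^sub>M borel)"
    by (rule sets_pair_measure_cong) (auto simp: Cl.M_is_borel)
qed

lemma K_integral_prod:
  assumes j: "j \<in> St" and k: "k \<in> St" and [measurable]: "f \<in> borel_measurable borel" "g \<in> borel_measurable borel"
  shows "(\<integral>\<^sup>+z. f (fst z) * g (snd z) \<partial>(Hold j \<Otimes>\<^sub>M Cl j k)) = (\<integral>\<^sup>+s. f s \<partial>Hold j) * (\<integral>\<^sup>+u. g u \<partial>Cl j k)"
proof -
  interpret Hold: prob_space "Hold j" by (rule Hold_prob[OF j])
  interpret Cl: real_distribution "Cl j k" by (rule Cl_dist[OF j k])
  note Cl.M_is_borel[measurable_cong]
  have "(\<integral>\<^sup>+z. f (fst z) * g (snd z) \<partial>(Hold j \<Otimes>\<^sub>M Cl j k)) = (\<integral>\<^sup>+s. (\<integral>\<^sup>+u. f s * g u \<partial>Cl j k) \<partial>Hold j)"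
    by (subst Cl.nn_integral_fst[symmetric]) auto
  also have "\<dots> = (\<integral>\<^sup>+s. f s * (\<integral>\<^sup>+u. g u \<partial>Cl j k) \<partial>Hold j)"
    by (intro nn_integral_cong nn_integral_cmult) measurable
  also have "\<dots> = (\<integral>\<^sup>+s. f s \<partial>Hold j) * (\<integral>\<^sup>+u. g u \<partial>Cl j k)"
    by (rule nn_integral_multc) simp
  finally show ?thesis .
qed

lemma K_integral_fst:
  assumes j: "j \<in> St" and k: "k \<in> St" and f: "f \<in> borel_measurable borel"
  shows "(\<integral>\<^sup>+z. f (fst z) \<partial>(Hold j \<Otimes>\<^sub>M Cl j k)) = (\<integral>\<^sup>+s. f s \<partial>Hold j)"
proof -
  interpret Cl: real_distribution "Cl j k" by (rule Cl_dist[OF j k])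
  show ?thesis using K_integral_prod[OF j k f, of "\<lambda>_. 1"] Cl.emeasure_space_1 by simp
qed

lemma P_sum_ennreal: assumes "j \<in> St" shows "(\<Sum>k\<in>St. ennreal (P j k)) = 1"
  using P_sum[OF assms] P_nonneg[OF assms] by (subst sum_ennreal) auto

lemma Hold_exp: assumes j: "j \<in> St" shows "(\<integral>\<^sup>+s. ennreal (exp (- s)) \<partial>Hold j) = ennreal (rate j / (rate j + 1))"
proof -
  have r: "0 < rate j" using rates_pos j by auto
  interpret X: prob_space "density lborel (exponential_density (rate j + 1))"
    by (rule prob_space_exponential_density) (use r in simp)
  have "(\<integral>\<^sup>+s. ennreal (exp (- s)) \<partial>Hold j) = (\<integral>\<^sup>+s. ennreal (exponential_density (rate j) s) * ennreal (exp (- s)) \<partial>lborel)"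
    by (rule nn_integral_density) auto
  also have "\<dots> = (\<integral>\<^sup>+s. ennreal (rate j / (rate j + 1)) * ennreal (exponential_density (rate j + 1) s) \<partial>lborel)"
  proof (rule nn_integral_cong)
    fix s
    have "exponential_density (rate j) s * exp (- s) = rate j / (rate j + 1) * exponential_density (rate j + 1) s"
    proof -
      have "exp (- s * rate j) * exp (- s) = exp (- s * (rate j + 1))" by (simp add: algebra_simps flip: exp_add)
      then show ?thesis using r by (simp add: exponential_density_def mult.assoc)
    qed
    then show "ennreal (exponential_density (rate j) s) * ennreal (exp (- s)) = ennreal (rate j / (rate j + 1)) * ennreal (exponential_density (rate j + 1) s)"
      using r by (simp add: exponential_density_nonneg flip: ennreal_mult)
  qed
  also have "\<dots> = ennreal (rate j / (rate j + 1)) * (\<integral>\<^sup>+s. ennreal (exponential_density (rate j + 1) s) \<partial>lborel)"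
    by (rule nn_integral_cmult) simp
  also have "(\<integral>\<^sup>+s. ennreal (exponential_density (rate j + 1) s) \<partial>lborel) = 1"
    using X.emeasure_space_1 by (simp add: emeasure_density)
  finally show ?thesis by simp
qed

text \<open>The largest Laplace transform at 1 of a holding time, less than 1 because there are
  finitely many states.\<close>

definition rho where "rho = Max ((\<lambda>j. rate j / (rate j + 1)) ` St)"

lemma rho: "0 \<le> rho" "rho < 1" "j \<in> St \<Longrightarrow> rate j / (rate j + 1) \<le> rho"
proof -
  have "rho \<in> (\<lambda>j. rate j / (rate j + 1)) ` St" unfolding rho_def using i by (intro Max_in) auto
  then obtain j0 where "j0 \<in> St" "rho = rate j0 / (rate j0 + 1)" by blast
  then show "0 \<le> rho" "rho < 1" using bspec[OF rates_pos, of j0] by auto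
  show "j \<in> St \<Longrightarrow> rate j / (rate j + 1) \<le> rho" unfolding rho_def by (intro Max_ge) auto
qed

lemma exp_T_bound: "(\<integral>\<^sup>+\<omega>. ennreal (exp (- T n \<omega>)) \<partial>Pr i) \<le> ennreal (rho ^ n)"
proof (induction n)
  case 0 then show ?case by (simp add: T_0 emeasure_space_1)
next
  case (Suc n)
  have [measurable]: "(\<lambda>\<omega>. T n \<omega>) \<in> borel_measurable (Fn n)" by (rule T_Fn)
  have "(\<integral>\<^sup>+\<omega>. ennreal (exp (- T (Suc n) \<omega>)) \<partial>Pr i)
     = (\<integral>\<^sup>+\<omega>. (\<lambda>j k (\<omega>, s, u). ennreal (exp (- T n \<omega>)) * ennreal (exp (- s))) (Jc n \<omega>) (Jc (Suc n) \<omega>) (\<omega>, (S (Suc n) \<omega>, U (Suc n) \<omega>)) \<partial>Pr i)"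
    by (simp add: T_Suc exp_add[symmetric] flip: ennreal_mult exp_add)
  also have "\<dots> = (\<integral>\<^sup>+\<omega>. (\<Sum>k\<in>St. ennreal (P (Jc n \<omega>) k) * (\<integral>\<^sup>+z. (\<lambda>(\<omega>, s, u). ennreal (exp (- T n \<omega>)) * ennreal (exp (- s))) (\<omega>, z) \<partial>(Hold (Jc n \<omega>) \<Otimes>\<^sub>M Cl (Jc n \<omega>) k))) \<partial>Pr i)"
    by (rule one_step) measurable
  also have "\<dots> \<le> (\<integral>\<^sup>+\<omega>. ennreal rho * ennreal (exp (- T n \<omega>)) \<partial>Pr i)"
  proof (rule nn_integral_mono_AE)
    show "AE \<omega> in Pr i. (\<Sum>k\<in>St. ennreal (P (Jc n \<omega>) k) * (\<integral>\<^sup>+z. (\<lambda>(\<omega>, s, u). ennreal (exp (- T n \<omega>)) * ennreal (exp (- s))) (\<omega>, z) \<partial>(Hold (Jc n \<omega>) \<Otimes>\<^sub>M Cl (Jc n \<omega>) k)))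
        \<le> ennreal rho * ennreal (exp (- T n \<omega>))"
      using AE_states
    proof eventually_elim
      case (elim \<omega>)
      let ?j = "Jc n \<omega>"
      have j: "?j \<in> St" using elim by blast
      have "(\<integral>\<^sup>+z. (\<lambda>(\<omega>, s, u). ennreal (exp (- T n \<omega>)) * ennreal (exp (- s))) (\<omega>, z) \<partial>(Hold ?j \<Otimes>\<^sub>M Cl ?j k)) = ennreal (exp (- T n \<omega>)) * ennreal (rate ?j / (rate ?j + 1))"
        if k: "k \<in> St" for k
      proof -
        have "(\<integral>\<^sup>+z. (\<lambda>(\<omega>, s, u). ennreal (exp (- T n \<omega>)) * ennreal (exp (- s))) (\<omega>, z) \<partial>(Hold ?j \<Otimes>\<^sub>M Cl ?j k))
           = (\<integral>\<^sup>+z. (\<lambda>s. ennreal (exp (- T n \<omega>)) * ennreal (exp (- s))) (fst z) \<partial>(Hold ?j \<Otimes>\<^sub>M Cl ?j k))"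
          by (intro nn_integral_cong) (auto simp: case_prod_unfold)
        also have "\<dots> = (\<integral>\<^sup>+s. ennreal (exp (- T n \<omega>)) * ennreal (exp (- s)) \<partial>Hold ?j)"
          by (rule K_integral_fst[OF j k]) measurable
        also have "\<dots> = ennreal (exp (- T n \<omega>)) * ennreal (rate ?j / (rate ?j + 1))"
          using Hold_exp[OF j] by (subst nn_integral_cmult) auto
        finally show ?thesis .
      qed
      then have "(\<Sum>k\<in>St. ennreal (P ?j k) * (\<integral>\<^sup>+z. (\<lambda>(\<omega>, s, u). ennreal (exp (- T n \<omega>)) * ennreal (exp (- s))) (\<omega>, z) \<partial>(Hold ?j \<Otimes>\<^sub>M Cl ?j k)))
          = (\<Sum>k\<in>St. ennreal (P ?j k) * (ennreal (exp (- T n \<omega>)) * ennreal (rate ?j / (rate ?j + 1))))"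
        by (intro sum.cong refl) simp
      also have "\<dots> = ennreal (exp (- T n \<omega>)) * ennreal (rate ?j / (rate ?j + 1))"
        using P_sum_ennreal[OF j] by (simp flip: sum_distrib_right)
      also have "\<dots> \<le> ennreal (exp (- T n \<omega>)) * ennreal rho"
        by (intro mult_left_mono ennreal_leI rho(3) j) simp
      finally show ?case by (simp add: mult.commute)
    qed
  qed
  also have "\<dots> = ennreal rho * (\<integral>\<^sup>+\<omega>. ennreal (exp (- T n \<omega>)) \<partial>Pr i)" by (rule nn_integral_cmult) measurable
  also have "\<dots> \<le> ennreal rho * ennreal (rho ^ n)" by (intro mult_left_mono Suc) simp
  also have "\<dots> = ennreal (rho ^ Suc n)" using rho by (simp flip: ennreal_mult)
  finally show ?case .
qed

text \<open>The geometric bound gives the series of \<open>exp (- T n \<omega>)\<close> a finite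
  expectation, so its terms tend to 0 almost surely.\<close>

lemma AE_no_explosion: "AE \<omega> in Pr i. filterlim (\<lambda>n. T n \<omega>) at_top sequentially"
proof -
  have "(\<integral>\<^sup>+\<omega>. (\<Sum>n. ennreal (exp (- T n \<omega>))) \<partial>Pr i) = (\<Sum>n. \<integral>\<^sup>+\<omega>. ennreal (exp (- T n \<omega>)) \<partial>Pr i)"
    by (rule nn_integral_suminf) measurable
  also have "\<dots> \<le> (\<Sum>n. ennreal (rho ^ n))" by (intro suminf_le exp_T_bound) auto
  also have "\<dots> = ennreal (\<Sum>n. rho ^ n)" using rho by (intro suminf_ennreal2) (auto intro: summable_geometric)
  also have "\<dots> < \<infinity>" by simp
  finally have "AE \<omega> in Pr i. (\<Sum>n. ennreal (exp (- T n \<omega>))) \<noteq> \<infinity>"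
    by (intro nn_integral_PInf_AE) auto
  then show ?thesis
  proof eventually_elim
    case (elim \<omega>)
    then have "summable (\<lambda>n. exp (- T n \<omega>))" by (intro summable_suminf_not_top) auto
    then have l: "(\<lambda>n. exp (- T n \<omega>)) \<longlonglongrightarrow> 0" by (rule summable_LIMSEQ_zero)
    show ?case unfolding filterlim_at_top
    proof
      fix B
      have "eventually (\<lambda>n. exp (- T n \<omega>) < exp (- B)) sequentially" by (rule order_tendstoD(2)[OF l]) simp
      then show "eventually (\<lambda>n. B \<le> T n \<omega>) sequentially" by eventually_elim simp
    qed
  qed
qed

text \<open>An almost sure property on which the later path arguments are deterministic.\<close>

definition good where "good \<omega> \<longleftrightarrow> Jc 0 \<omega> = i \<and> (\<forall>k. Jc k \<omega> \<in> St) \<and> (\<forall>k\<ge>1. 0 < S k \<omega> \<and> 0 \<le> U k \<omega>)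
  \<and> filterlim (\<lambda>n. T n \<omega>) at_top sequentially"

lemma AE_good: "AE \<omega> in Pr i. good \<omega>"
proof -
  have "AE \<omega> in Pr i. \<forall>n. 0 < S (Suc n) \<omega>" "AE \<omega> in Pr i. \<forall>n. 0 \<le> U (Suc n) \<omega>"
    unfolding AE_all_countable using AE_S_pos AE_U_nonneg by auto
  then show ?thesis using AE_states AE_no_explosion
  proof eventually_elim
    case (elim \<omega>)
    have "0 < S k \<omega> \<and> 0 \<le> U k \<omega>" if "1 \<le> k" for k using elim(1,2) that by (cases k) auto
    then show ?case using elim by (simp add: good_def)
  qed
qed

subsection \<open>The embedded random walk\<close>

text \<open>On good paths \<open>x - W n \<omega>\<close> is the surplus at the \<open>n\<close>-th
  epoch. Defining it through the skeleton keeps it measurable with respect to the history.\<close>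

definition W where "W n \<omega> = (\<Sum>m\<in>{1..n}. U m \<omega> - p (Jc (m - 1) \<omega>) * S m \<omega>)"

lemma W_0: "W 0 \<omega> = 0" by (simp add: W_def)

lemma W_Suc: "W (Suc n) \<omega> = W n \<omega> + (U (Suc n) \<omega> - p (Jc n \<omega>) * S (Suc n) \<omega>)"
  by (simp add: W_def sum.nat_ivl_Suc' add.commute)

lemma W_Fn: assumes "m \<le> n" shows "W m \<in> borel_measurable (Fn n)"
  unfolding W_def
proof (intro borel_measurable_sum borel_measurable_diff borel_measurable_times)
  fix k assume k: "k \<in> {1..m}"
  show "U k \<in> borel_measurable (Fn n)" "S k \<in> borel_measurable (Fn n)" using k assms by (auto intro: Fn_U Fn_S)
  show "(\<lambda>\<omega>. p (Jc (k - 1) \<omega>)) \<in> borel_measurable (Fn n)"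
    by (rule measurable_compose[OF Fn_J]) (use k assms in auto)
qed

lemma W_measurable[measurable]: "W n \<in> borel_measurable (Pr i)"
  by (rule Fn_measurableI[OF W_Fn[OF order_refl]])

end

context mmrp
begin

definition Hd where "Hd j k = distr (Hold j \<Otimes>\<^sub>M Cl j k) borel (\<lambda>(s, u). u - p j * s)"

text \<open>Transitions of probability zero carry no law of the increment; a point mass keeps the kernel total.\<close>

definition HH where "HH j k = (if P j k = 0 then return borel 0 else Hd j k)"

text \<open>The operator \<open>step\<close> of the modulated walk, restated because that locale is
  entered only in the final proof, once the drift is known to be positive.\<close>

definition stp where "stp \<phi> j x = (if x < 0 then 1 else \<Sum>k\<in>St. P j k * (\<integral>u. \<phi> k (x - u) \<partial>HH j k))"

end

context mmrp_start
begin

lemma Hd_dist: assumes "j \<in> St" "k \<in> St" shows "real_distribution (Hd j k)"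
proof -
  interpret K: prob_space "Hold j \<Otimes>\<^sub>M Cl j k" by (rule K_prob[OF assms])
  have "(\<lambda>(s, u). u - p j * s) \<in> borel_measurable (borel \<Otimes>\<^sub>M borel)" by measurable
  then have "(\<lambda>(s, u). u - p j * s) \<in> borel_measurable (Hold j \<Otimes>\<^sub>M Cl j k)"
    by (subst measurable_cong_sets[OF K_sets[OF assms] refl])
  then show ?thesis unfolding Hd_def by (rule K.real_distribution_distr)
qed

lemma HH_dist: assumes "j \<in> St" "k \<in> St" shows "real_distribution (HH j k)"
proof (cases "P j k = 0")
  case True
  have "prob_space (return borel (0::real))" by (rule prob_space_return) simp
  then show ?thesis unfolding HH_def using True by (simp add: real_distribution_def real_distribution_axioms_def)
qed (use Hd_dist[OF assms] in \<open>simp add: HH_def\<close>)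

lemma Hd_nn_integral:
  assumes "j \<in> St" "k \<in> St" "f \<in> borel_measurable borel"
  shows "(\<integral>\<^sup>+z. f (snd z - p j * fst z) \<partial>(Hold j \<Otimes>\<^sub>M Cl j k)) = (\<integral>\<^sup>+v. f v \<partial>Hd j k)"
proof -
  have "(\<lambda>(s, u). u - p j * s) \<in> borel_measurable (borel \<Otimes>\<^sub>M borel)" by measurable
  then have "(\<lambda>(s, u). u - p j * s) \<in> borel_measurable (Hold j \<Otimes>\<^sub>M Cl j k)"
    by (subst measurable_cong_sets[OF K_sets[OF assms(1,2)] refl])
  then show ?thesis unfolding Hd_def by (subst nn_integral_distr) (use assms in \<open>auto simp: case_prod_unfold\<close>)
qed

text \<open>Value of the exceedance problem at time \<open>n\<close>: settled if the level was
  passed before \<open>n\<close>, otherwise \<open>\<phi>\<close> at the present state and the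
  remaining distance. Passing at time \<open>n\<close> itself is left to \<open>\<phi>\<close>,
  which in the iteration is 1 below 0.\<close>

definition VV where "VV x n \<phi> \<omega> = (if \<exists>k<n. x < W k \<omega> then 1 else \<phi> (Jc n \<omega>) (x - W n \<omega>))"

text \<open>Conditioning on the history up to \<open>n\<close> replaces \<open>\<phi>\<close> by
  \<open>stp \<phi>\<close>; the value 1 of \<open>stp\<close> below 0 absorbs exceedance at time
  \<open>n\<close>.\<close>

lemma walk_step:
  assumes ua: "\<And>j. j \<in> St \<Longrightarrow> unit_antimono (\<phi> j)"
  shows "(\<integral>\<^sup>+\<omega>. ennreal (VV x (Suc n) \<phi> \<omega>) \<partial>Pr i) = (\<integral>\<^sup>+\<omega>. ennreal (VV x n (stp \<phi>) \<omega>) \<partial>Pr i)"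
proof -
  define f where "f j k z = ennreal (if \<exists>m<Suc n. x < W m (fst z) then 1 else \<phi> k (x - W n (fst z) - (snd (snd z) - p j * fst (snd z))))" for j k and z :: "'a \<times> real \<times> real"
  have [measurable]: "W m \<in> borel_measurable (Fn n)" if "m \<le> n" for m by (rule W_Fn[OF that])
  have Wn[measurable]: "W n \<in> borel_measurable (Fn n)" by (rule W_Fn) simp
  have bad: "Measurable.pred (Fn n) (\<lambda>\<omega>. \<exists>m<Suc n. x < W m \<omega>)"
  proof -
    have "Measurable.pred (Fn n) (\<lambda>\<omega>. x < W m \<omega>)" if "m \<le> n" for m
      using W_Fn[OF that] by measurable
    then have "Measurable.pred (Fn n) (\<lambda>\<omega>. \<exists>m\<in>{..n}. x < W m \<omega>)"
      by (intro pred_intros_finite) auto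
    then show ?thesis by (simp add: Bex_def less_Suc_eq_le)
  qed
  have fm: "f j k \<in> borel_measurable (Fn n \<Otimes>\<^sub>M (borel \<Otimes>\<^sub>M borel))" if "k \<in> St" for j k
  proof -
    have [measurable]: "\<phi> k \<in> borel_measurable borel" by (rule ua_measurable[OF ua[OF that]])
    note bad[measurable]
    show ?thesis unfolding f_def by measurable
  qed
  have "(\<integral>\<^sup>+\<omega>. ennreal (VV x (Suc n) \<phi> \<omega>) \<partial>Pr i) = (\<integral>\<^sup>+\<omega>. f (Jc n \<omega>) (Jc (Suc n) \<omega>) (\<omega>, (S (Suc n) \<omega>, U (Suc n) \<omega>)) \<partial>Pr i)"
    by (intro nn_integral_cong) (simp only: VV_def f_def fst_conv snd_conv W_Suc diff_diff_eq)
  also have "\<dots> = (\<integral>\<^sup>+\<omega>. (\<Sum>k\<in>St. ennreal (P (Jc n \<omega>) k) * (\<integral>\<^sup>+z. f (Jc n \<omega>) k (\<omega>, z) \<partial>(Hold (Jc n \<omega>) \<Otimes>\<^sub>M Cl (Jc n \<omega>) k))) \<partial>Pr i)"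
    by (rule one_step) (rule fm)
  also have "\<dots> = (\<integral>\<^sup>+\<omega>. ennreal (VV x n (stp \<phi>) \<omega>) \<partial>Pr i)"
  proof (rule nn_integral_cong_AE)
    show "AE \<omega> in Pr i. (\<Sum>k\<in>St. ennreal (P (Jc n \<omega>) k) * (\<integral>\<^sup>+z. f (Jc n \<omega>) k (\<omega>, z) \<partial>(Hold (Jc n \<omega>) \<Otimes>\<^sub>M Cl (Jc n \<omega>) k)))
       = ennreal (VV x n (stp \<phi>) \<omega>)"
      using AE_states
    proof eventually_elim
      case (elim \<omega>)
      let ?j = "Jc n \<omega>"
      have j: "?j \<in> St" using elim by blast
      show ?case
      proof (cases "\<exists>m<Suc n. x < W m \<omega>")
        case True
        have "(\<integral>\<^sup>+z. f ?j k (\<omega>, z) \<partial>(Hold ?j \<Otimes>\<^sub>M Cl ?j k)) = 1" if k: "k \<in> St" for k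
        proof -
          interpret K: prob_space "Hold ?j \<Otimes>\<^sub>M Cl ?j k" by (rule K_prob[OF j k])
          show ?thesis using True K.emeasure_space_1 by (simp add: f_def)
        qed
        then have "(\<Sum>k\<in>St. ennreal (P ?j k) * (\<integral>\<^sup>+z. f ?j k (\<omega>, z) \<partial>(Hold ?j \<Otimes>\<^sub>M Cl ?j k))) = 1"
          using P_sum_ennreal[OF j] by simp
        moreover have "VV x n (stp \<phi>) \<omega> = 1"
        proof (cases "\<exists>m<n. x < W m \<omega>")
          case False
          then have "x < W n \<omega>" using True by (auto simp: less_Suc_eq)
          then show ?thesis using False by (simp add: VV_def stp_def)
        qed (simp add: VV_def)
        ultimately show ?thesis by simp
      next
        case False
        then have F: "\<not> (\<exists>m<n. x < W m \<omega>)" "0 \<le> x - W n \<omega>" by auto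
        have t: "ennreal (P ?j k) * (\<integral>\<^sup>+z. f ?j k (\<omega>, z) \<partial>(Hold ?j \<Otimes>\<^sub>M Cl ?j k)) = ennreal (P ?j k * (\<integral>u. \<phi> k (x - W n \<omega> - u) \<partial>HH ?j k))" if k: "k \<in> St" for k
        proof (cases "P ?j k = 0")
          case False
          interpret Hd: real_distribution "Hd ?j k" by (rule Hd_dist[OF j k])
          have [measurable]: "\<phi> k \<in> borel_measurable borel" by (rule ua_measurable[OF ua[OF k]])
          have "(\<integral>\<^sup>+z. f ?j k (\<omega>, z) \<partial>(Hold ?j \<Otimes>\<^sub>M Cl ?j k)) = (\<integral>\<^sup>+z. (\<lambda>v. ennreal (\<phi> k (x - W n \<omega> - v))) (snd z - p ?j * fst z) \<partial>(Hold ?j \<Otimes>\<^sub>M Cl ?j k))"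
            by (intro nn_integral_cong) (simp only: f_def fst_conv snd_conv if_not_P[OF \<open>\<not> (\<exists>m<Suc n. x < W m \<omega>)\<close>])
          also have "\<dots> = (\<integral>\<^sup>+v. ennreal (\<phi> k (x - W n \<omega> - v)) \<partial>Hd ?j k)" by (rule Hd_nn_integral[OF j k]) measurable
          also have "\<dots> = ennreal (\<integral>v. \<phi> k (x - W n \<omega> - v) \<partial>Hd ?j k)"
            by (rule nn_integral_eq_integral[OF ua_shift_integrable[OF ua[OF k] Hd_dist[OF j k]]]) (simp add: ua_bounds[OF ua[OF k]])
          finally have "(\<integral>\<^sup>+z. f ?j k (\<omega>, z) \<partial>(Hold ?j \<Otimes>\<^sub>M Cl ?j k)) = ennreal (\<integral>v. \<phi> k (x - W n \<omega> - v) \<partial>Hd ?j k)" .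
          then show ?thesis using False P_nonneg[OF j k] by (simp add: HH_def ennreal_mult')
        qed simp
        have "(\<Sum>k\<in>St. ennreal (P ?j k) * (\<integral>\<^sup>+z. f ?j k (\<omega>, z) \<partial>(Hold ?j \<Otimes>\<^sub>M Cl ?j k))) = (\<Sum>k\<in>St. ennreal (P ?j k * (\<integral>u. \<phi> k (x - W n \<omega> - u) \<partial>HH ?j k)))"
          by (intro sum.cong refl t)
        also have "\<dots> = ennreal (\<Sum>k\<in>St. P ?j k * (\<integral>u. \<phi> k (x - W n \<omega> - u) \<partial>HH ?j k))"
        proof (rule sum_ennreal)
          fix k assume k: "k \<in> St"
          have "0 \<le> (\<integral>u. \<phi> k (x - W n \<omega> - u) \<partial>HH ?j k)"
            by (rule Bochner_Integration.integral_nonneg) (rule ua_bounds(1)[OF ua[OF k]])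
          then show "0 \<le> P ?j k * (\<integral>u. \<phi> k (x - W n \<omega> - u) \<partial>HH ?j k)" using P_nonneg[OF j k] by simp
        qed
        also have "\<dots> = ennreal (VV x n (stp \<phi>) \<omega>)" using F(2) by (simp only: VV_def if_not_P[OF F(1)] stp_def) simp
        finally show ?thesis .
      qed
    qed
  qed
  finally show ?thesis .
qed

lemma VV_zero: "(\<integral>\<^sup>+\<omega>. ennreal (VV x 0 \<phi> \<omega>) \<partial>Pr i) = ennreal (\<phi> i x)"
proof -
  have "(\<integral>\<^sup>+\<omega>. ennreal (VV x 0 \<phi> \<omega>) \<partial>Pr i) = (\<integral>\<^sup>+\<omega>. ennreal (\<phi> i x) \<partial>Pr i)"
  proof (rule nn_integral_cong_AE)
    show "AE \<omega> in Pr i. ennreal (VV x 0 \<phi> \<omega>) = ennreal (\<phi> i x)"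
      using AE_states by eventually_elim (simp add: VV_def W_0)
  qed
  then show ?thesis by (simp add: emeasure_space_1)
qed

subsection \<open>Drift up to time one\<close>

text \<open>The epoch \<open>Suc k\<close> ends the sojourn of index \<open>k\<close>, so sums over
  \<open>k\<close> count expected sojourns in \<open>j\<close> that are completed by time 1, not
  merely begun.\<close>

definition \<nu> where "\<nu> k j = prob {\<omega>\<in>\<Omega>. Jc k \<omega> = j \<and> T (Suc k) \<omega> \<le> 1}"

lemma count_integral:
  "(\<integral>\<^sup>+\<omega>. c (Jc k \<omega>) * indicator {..1} (T (Suc k) \<omega>) \<partial>Pr i) = (\<Sum>j\<in>St. c j * ennreal (\<nu> k j))"
proof -
  have "(\<integral>\<^sup>+\<omega>. c (Jc k \<omega>) * indicator {..1} (T (Suc k) \<omega>) \<partial>Pr i)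
     = (\<integral>\<^sup>+\<omega>. (\<Sum>j\<in>St. c j * indicator {\<omega>\<in>\<Omega>. Jc k \<omega> = j \<and> T (Suc k) \<omega> \<le> 1} \<omega>) \<partial>Pr i)"
  proof (rule nn_integral_cong_AE)
    show "AE \<omega> in Pr i. c (Jc k \<omega>) * indicator {..1} (T (Suc k) \<omega>) = (\<Sum>j\<in>St. c j * indicator {\<omega>\<in>\<Omega>. Jc k \<omega> = j \<and> T (Suc k) \<omega> \<le> 1} \<omega>)"
      using AE_states AE_space
    proof eventually_elim
      case (elim \<omega>)
      have "(\<Sum>j\<in>St. c j * indicator {\<omega>\<in>\<Omega>. Jc k \<omega> = j \<and> T (Suc k) \<omega> \<le> 1} \<omega>) = (\<Sum>j\<in>St. if j = Jc k \<omega> then c j * indicator {..1} (T (Suc k) \<omega>) else 0)"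
        by (intro sum.cong refl) (use elim in \<open>auto simp: indicator_def\<close>)
      then show ?case using elim by simp
    qed
  qed
  also have "\<dots> = (\<Sum>j\<in>St. (\<integral>\<^sup>+\<omega>. c j * indicator {\<omega>\<in>\<Omega>. Jc k \<omega> = j \<and> T (Suc k) \<omega> \<le> 1} \<omega> \<partial>Pr i))"
    by (rule nn_integral_sum) measurable
  also have "\<dots> = (\<Sum>j\<in>St. c j * ennreal (\<nu> k j))"
    by (intro sum.cong refl) (subst nn_integral_cmult_indicator, measurable, simp add: \<nu>_def emeasure_eq_measure)
  finally show ?thesis .
qed

text \<open>Transitions, premiums and claims before time 1 all have a conditional mean proportional
  to the chance that the running sojourn ends by time 1. This reduces each of them to the counts
  \<open>\<nu>\<close> through \<open>count_expand\<close>.\<close>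

lemma step_functional:
  assumes a: "\<And>j k. j \<in> St \<Longrightarrow> k \<in> St \<Longrightarrow> (\<lambda>(t, s, u). a j k t s u) \<in> borel_measurable (borel \<Otimes>\<^sub>M borel \<Otimes>\<^sub>M borel)"
    and e: "\<And>j t. j \<in> St \<Longrightarrow> (\<Sum>k\<in>St. ennreal (P j k) * (\<integral>\<^sup>+z. a j k t (fst z) (snd z) \<partial>(Hold j \<Otimes>\<^sub>M Cl j k))) = c j * emeasure (Hold j) {..1 - t}"
  shows "(\<integral>\<^sup>+\<omega>. a (Jc n \<omega>) (Jc (Suc n) \<omega>) (T n \<omega>) (S (Suc n) \<omega>) (U (Suc n) \<omega>) \<partial>Pr i) = (\<integral>\<^sup>+\<omega>. c (Jc n \<omega>) * emeasure (Hold (Jc n \<omega>)) {..1 - T n \<omega>} \<partial>Pr i)"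
proof -
  define f where "f j k z = a j k (T n (fst z)) (fst (snd z)) (snd (snd z))" for j k and z :: "'a \<times> real \<times> real"
  have fm: "f j k \<in> borel_measurable (Fn n \<Otimes>\<^sub>M (borel \<Otimes>\<^sub>M borel))" if "j \<in> St" "k \<in> St" for j k
  proof -
    have [measurable]: "(\<lambda>\<omega>. T n \<omega>) \<in> borel_measurable (Fn n)" by (rule T_Fn)
    have "(\<lambda>z. (T n (fst z), fst (snd z), snd (snd z))) \<in> measurable (Fn n \<Otimes>\<^sub>M (borel \<Otimes>\<^sub>M borel)) (borel \<Otimes>\<^sub>M borel \<Otimes>\<^sub>M borel)" by measurable
    from measurable_compose[OF this a[OF that]] show ?thesis by (simp add: f_def[abs_def] case_prod_unfold)
  qed
  have "(\<integral>\<^sup>+\<omega>. a (Jc n \<omega>) (Jc (Suc n) \<omega>) (T n \<omega>) (S (Suc n) \<omega>) (U (Suc n) \<omega>) \<partial>Pr i)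
     = (\<integral>\<^sup>+\<omega>. f (Jc n \<omega>) (Jc (Suc n) \<omega>) (\<omega>, (S (Suc n) \<omega>, U (Suc n) \<omega>)) \<partial>Pr i)" by (simp add: f_def)
  also have "\<dots> = (\<integral>\<^sup>+\<omega>. (\<Sum>k\<in>St. ennreal (P (Jc n \<omega>) k) * (\<integral>\<^sup>+z. f (Jc n \<omega>) k (\<omega>, z) \<partial>(Hold (Jc n \<omega>) \<Otimes>\<^sub>M Cl (Jc n \<omega>) k))) \<partial>Pr i)"
    by (rule one_step) (rule fm)
  also have "\<dots> = (\<integral>\<^sup>+\<omega>. c (Jc n \<omega>) * emeasure (Hold (Jc n \<omega>)) {..1 - T n \<omega>} \<partial>Pr i)"
  proof (rule nn_integral_cong_AE)
    show "AE \<omega> in Pr i. (\<Sum>k\<in>St. ennreal (P (Jc n \<omega>) k) * (\<integral>\<^sup>+z. f (Jc n \<omega>) k (\<omega>, z) \<partial>(Hold (Jc n \<omega>) \<Otimes>\<^sub>M Cl (Jc n \<omega>) k)))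
        = c (Jc n \<omega>) * emeasure (Hold (Jc n \<omega>)) {..1 - T n \<omega>}"
      using AE_states
    proof eventually_elim
      case (elim \<omega>)
      then show ?case using e[of "Jc n \<omega>" "T n \<omega>"] by (simp add: f_def)
    qed
  qed
  finally show ?thesis .
qed

lemma Hold_indicator: "(\<integral>\<^sup>+s. indicator {..1} (t + s) \<partial>Hold j) = emeasure (Hold j) {..1 - t}"
proof -
  have "(\<integral>\<^sup>+s. indicator {..1} (t + s) \<partial>Hold j) = (\<integral>\<^sup>+s. indicator {..1 - t} s \<partial>Hold j)"
    by (intro nn_integral_cong) (auto simp: indicator_def)
  then show ?thesis by simp
qed

lemma indicator_sum_measurable:
  "(\<lambda>z. indicator {..1::real} (fst z + fst (snd z)) :: ennreal) \<in> borel_measurable (borel \<Otimes>\<^sub>M borel \<Otimes>\<^sub>M (borel :: real measure))"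
  by (rule measurable_compose[OF _ borel_measurable_indicator[of "{..1}" borel]]) measurable

lemma \<nu>_scale: "ennreal c * ennreal (\<nu> n j) = ennreal (\<nu> n j * c)"
  using ennreal_mult'[of "\<nu> n j" c] by (simp add: \<nu>_def mult.commute)

lemma count_expand:
  "(\<integral>\<^sup>+\<omega>. c (Jc n \<omega>) * emeasure (Hold (Jc n \<omega>)) {..1 - T n \<omega>} \<partial>Pr i) = (\<Sum>j\<in>St. c j * ennreal (\<nu> n j))"
proof -
  have "(\<integral>\<^sup>+\<omega>. c (Jc n \<omega>) * emeasure (Hold (Jc n \<omega>)) {..1 - T n \<omega>} \<partial>Pr i)
      = (\<integral>\<^sup>+\<omega>. c (Jc n \<omega>) * indicator {..1} (T n \<omega> + S (Suc n) \<omega>) \<partial>Pr i)"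
  proof (rule step_functional[where a="\<lambda>j k t s u. c j * indicator {..1} (t + s)", symmetric])
    show "(\<lambda>(t, s, u). c j * indicator {..1::real} (t + s)) \<in> borel_measurable (borel \<Otimes>\<^sub>M borel \<Otimes>\<^sub>M (borel :: real measure))" for j
      unfolding case_prod_unfold by (intro borel_measurable_times_ennreal borel_measurable_const indicator_sum_measurable)
    fix j t assume j: "j \<in> St"
    have "(\<integral>\<^sup>+z. c j * indicator {..1} (t + fst z) \<partial>(Hold j \<Otimes>\<^sub>M Cl j k)) = c j * emeasure (Hold j) {..1 - t}" if k: "k \<in> St" for k
    proof -
      have "(\<integral>\<^sup>+z. c j * indicator {..1} (t + fst z) \<partial>(Hold j \<Otimes>\<^sub>M Cl j k)) = (\<integral>\<^sup>+s. c j * indicator {..1} (t + s) \<partial>Hold j)"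
        by (rule K_integral_fst[OF j k, of "\<lambda>s. c j * indicator {..1} (t + s)"]) measurable
      then show ?thesis by (subst (asm) nn_integral_cmult) (auto simp: Hold_indicator)
    qed
    then have "(\<Sum>k\<in>St. ennreal (P j k) * (\<integral>\<^sup>+z. c j * indicator {..1} (t + fst z) \<partial>(Hold j \<Otimes>\<^sub>M Cl j k))) = (\<Sum>k\<in>St. ennreal (P j k) * (c j * emeasure (Hold j) {..1 - t}))"
      by (intro sum.cong refl) simp
    then show "(\<Sum>k\<in>St. ennreal (P j k) * (\<integral>\<^sup>+z. c j * indicator {..1} (t + fst z) \<partial>(Hold j \<Otimes>\<^sub>M Cl j k))) = c j * emeasure (Hold j) {..1 - t}"
      using P_sum_ennreal[OF j] by (simp flip: sum_distrib_right)
  qed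
  then show ?thesis using count_integral[of c n] by (simp add: T_Suc)
qed

lemma transition_count:
  assumes l: "l \<in> St"
  shows "prob {\<omega>\<in>\<Omega>. Jc (Suc n) \<omega> = l \<and> T (Suc n) \<omega> \<le> 1} = (\<Sum>j\<in>St. \<nu> n j * P j l)"
proof -
  have "ennreal (prob {\<omega>\<in>\<Omega>. Jc (Suc n) \<omega> = l \<and> T (Suc n) \<omega> \<le> 1}) = (\<integral>\<^sup>+\<omega>. indicator {\<omega>\<in>\<Omega>. Jc (Suc n) \<omega> = l \<and> T (Suc n) \<omega> \<le> 1} \<omega> \<partial>Pr i)"
    by (subst nn_integral_indicator) (auto simp: emeasure_eq_measure)
  also have "\<dots> = (\<integral>\<^sup>+\<omega>. (if Jc (Suc n) \<omega> = l then 1 else 0) * indicator {..1} (T n \<omega> + S (Suc n) \<omega>) \<partial>Pr i)"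
    by (intro nn_integral_cong) (auto simp: indicator_def T_Suc)
  also have "\<dots> = (\<integral>\<^sup>+\<omega>. ennreal (P (Jc n \<omega>) l) * emeasure (Hold (Jc n \<omega>)) {..1 - T n \<omega>} \<partial>Pr i)"
  proof (rule step_functional[where a="\<lambda>j k t s u. (if k = l then 1 else 0) * indicator {..1} (t + s)"])
    show "(\<lambda>(t, s, u). (if k = l then 1 else 0 :: ennreal) * indicator {..1::real} (t + s)) \<in> borel_measurable (borel \<Otimes>\<^sub>M borel \<Otimes>\<^sub>M (borel :: real measure))" for k :: nat
      unfolding case_prod_unfold by (intro borel_measurable_times_ennreal borel_measurable_const indicator_sum_measurable)
    fix j t assume j: "j \<in> St"
    have "(\<integral>\<^sup>+z. (if k = l then 1 else 0) * indicator {..1} (t + fst z) \<partial>(Hold j \<Otimes>\<^sub>M Cl j k)) = (if k = l then emeasure (Hold j) {..1 - t} else 0)" if k: "k \<in> St" for k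
      using K_integral_fst[OF j k, of "\<lambda>s. indicator {..1} (t + s)"] by (cases "k = l") (simp_all add: Hold_indicator)
    then have "(\<Sum>k\<in>St. ennreal (P j k) * (\<integral>\<^sup>+z. (if k = l then 1 else 0) * indicator {..1} (t + fst z) \<partial>(Hold j \<Otimes>\<^sub>M Cl j k)))
        = (\<Sum>k\<in>St. if k = l then ennreal (P j k) * emeasure (Hold j) {..1 - t} else 0)"
      by (intro sum.cong refl) simp
    then show "(\<Sum>k\<in>St. ennreal (P j k) * (\<integral>\<^sup>+z. (if k = l then 1 else 0) * indicator {..1} (t + fst z) \<partial>(Hold j \<Otimes>\<^sub>M Cl j k))) = ennreal (P j l) * emeasure (Hold j) {..1 - t}"
      using l by simp
  qed
  also have "\<dots> = (\<Sum>j\<in>St. ennreal (P j l) * ennreal (\<nu> n j))" by (rule count_expand)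
  also have "\<dots> = (\<Sum>j\<in>St. ennreal (\<nu> n j * P j l))"
    by (intro sum.cong refl) (rule \<nu>_scale)
  also have "\<dots> = ennreal (\<Sum>j\<in>St. \<nu> n j * P j l)"
    by (rule sum_ennreal) (intro mult_nonneg_nonneg P_nonneg l, simp_all add: \<nu>_def)
  finally have "ennreal (prob {\<omega>\<in>\<Omega>. Jc (Suc n) \<omega> = l \<and> T (Suc n) \<omega> \<le> 1}) = ennreal (\<Sum>j\<in>St. \<nu> n j * P j l)" .
  moreover have "0 \<le> (\<Sum>j\<in>St. \<nu> n j * P j l)"
    by (intro sum_nonneg mult_nonneg_nonneg P_nonneg l) (simp_all add: \<nu>_def)
  ultimately show ?thesis using ennreal_inj[OF measure_nonneg] by blast
qed

lemma Hold_tail: assumes j: "j \<in> St" and x: "0 \<le> x" shows "emeasure (Hold j) {x<..} = ennreal (exp (- x * rate j))"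
proof -
  interpret Hold: prob_space "Hold j" by (rule Hold_prob[OF j])
  have r: "0 < rate j" using rates_pos j by auto
  have "distributed (Hold j) lborel (\<lambda>x. x) (exponential_density (rate j))"
    unfolding distributed_def by (auto simp: distr_id2)
  from Hold.exponential_distributedD_gt[OF this x r] show ?thesis
    by (simp add: Hold.emeasure_eq_measure greaterThan_def)
qed

text \<open>For the exponential law the tail is the density divided by the rate, so integrating the
  tail from 0 to \<open>1 - t\<close> gives the probability of ending by then, times the mean. If
  \<open>t > 1\<close> both sides vanish.\<close>

lemma Hold_truncated_mean:
  assumes j: "j \<in> St"
  shows "(\<integral>\<^sup>+s. ennreal (min 1 (t + s) - min 1 t) \<partial>Hold j) = ennreal (1 / rate j) * emeasure (Hold j) {..1 - t}"
proof -
  interpret Hold: prob_space "Hold j" by (rule Hold_prob[OF j])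
  interpret pair_sigma_finite "Hold j" lborel ..
  have r: "0 < rate j" using rates_pos j by auto
  define k :: "real \<Rightarrow> real \<Rightarrow> ennreal" where "k s x = (if 0 \<le> x \<and> x \<le> 1 - t \<and> x < s then 1 else 0)" for s x
  have [measurable]: "(\<lambda>(s, x). k s x) \<in> borel_measurable (Hold j \<Otimes>\<^sub>M lborel)" unfolding k_def by measurable
  have "(\<integral>\<^sup>+s. ennreal (min 1 (t + s) - min 1 t) \<partial>Hold j) = (\<integral>\<^sup>+s. (\<integral>\<^sup>+x. k s x \<partial>lborel) \<partial>Hold j)"
  proof (rule nn_integral_cong_AE)
    have "AE s in Hold j. 0 \<le> s"
      by (subst AE_density) (auto simp: exponential_density_def)
    then show "AE s in Hold j. ennreal (min 1 (t + s) - min 1 t) = (\<integral>\<^sup>+x. k s x \<partial>lborel)"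
    proof eventually_elim
      case (elim s)
      have "(\<integral>\<^sup>+x. k s x \<partial>lborel) = (\<integral>\<^sup>+x. indicator {0..min s (1 - t)} x \<partial>lborel)"
      proof (rule nn_integral_cong_AE)
        show "AE x in lborel. k s x = indicator {0..min s (1 - t)} x"
          using AE_lborel_singleton[of s] by eventually_elim (auto simp: k_def indicator_def)
      qed
      also have "\<dots> = ennreal (min 1 (t + s) - min 1 t)"
        using elim by (auto simp: emeasure_lborel_Icc_eq min_def intro!: arg_cong[where f=ennreal])
      finally show ?case by simp
    qed
  qed
  also have "\<dots> = (\<integral>\<^sup>+x. (\<integral>\<^sup>+s. k s x \<partial>Hold j) \<partial>lborel)" by (rule Fubini'[symmetric]) measurable
  also have "\<dots> = (\<integral>\<^sup>+x. ennreal (1 / rate j) * (ennreal (exponential_density (rate j) x) * indicator {..1 - t} x) \<partial>lborel)"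
  proof (rule nn_integral_cong)
    fix x
    show "(\<integral>\<^sup>+s. k s x \<partial>Hold j) = ennreal (1 / rate j) * (ennreal (exponential_density (rate j) x) * indicator {..1 - t} x)"
    proof (cases "0 \<le> x \<and> x \<le> 1 - t")
      case True
      have "(\<integral>\<^sup>+s. k s x \<partial>Hold j) = (\<integral>\<^sup>+s. indicator {x<..} s \<partial>Hold j)"
        by (intro nn_integral_cong) (use True in \<open>simp add: k_def indicator_def\<close>)
      also have "\<dots> = ennreal (exp (- x * rate j))" using Hold_tail[OF j] True by simp
      also have "\<dots> = ennreal (1 / rate j) * (ennreal (exponential_density (rate j) x) * indicator {..1 - t} x)"
        using True r by (simp add: exponential_density_def flip: ennreal_mult)
      finally show ?thesis .
    next
      case False
      then have "(\<integral>\<^sup>+s. k s x \<partial>Hold j) = (\<integral>\<^sup>+s. 0 \<partial>Hold j)" by (intro nn_integral_cong) (auto simp: k_def)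
      then show ?thesis using False by (auto simp: exponential_density_def indicator_def)
    qed
  qed
  also have "\<dots> = ennreal (1 / rate j) * (\<integral>\<^sup>+x. ennreal (exponential_density (rate j) x) * indicator {..1 - t} x \<partial>lborel)"
    by (rule nn_integral_cmult) measurable
  also have "\<dots> = ennreal (1 / rate j) * emeasure (Hold j) {..1 - t}" by (subst emeasure_density) auto
  finally show ?thesis .
qed

text \<open>The left side includes premiums of a sojourn interrupted at time 1, while the right side
  counts only completed sojourns, each with its full mean premium; by
  \<open>Hold_truncated_mean\<close> the two effects balance exactly.\<close>

lemma premium_count:
  "(\<integral>\<^sup>+\<omega>. ennreal (p (Jc n \<omega>) * (min 1 (T (Suc n) \<omega>) - min 1 (T n \<omega>))) \<partial>Pr i) = ennreal (\<Sum>j\<in>St. \<nu> n j * (p j / rate j))"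
proof -
  have pr: "0 < p j" "0 < rate j" if "j \<in> St" for j using premium rates_pos that by auto
  have "(\<integral>\<^sup>+\<omega>. ennreal (p (Jc n \<omega>) * (min 1 (T n \<omega> + S (Suc n) \<omega>) - min 1 (T n \<omega>))) \<partial>Pr i)
    = (\<integral>\<^sup>+\<omega>. ennreal (p (Jc n \<omega>) / rate (Jc n \<omega>)) * emeasure (Hold (Jc n \<omega>)) {..1 - T n \<omega>} \<partial>Pr i)"
  proof (rule step_functional[where a="\<lambda>j k t s u. ennreal (p j * (min 1 (t + s) - min 1 t))"])
    show "(\<lambda>(t, s, u). ennreal (p j * (min 1 (t + s) - min 1 t))) \<in> borel_measurable (borel \<Otimes>\<^sub>M borel \<Otimes>\<^sub>M (borel :: real measure))" for j by measurable
    fix j t assume j: "j \<in> St"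
    have "(\<integral>\<^sup>+z. ennreal (p j * (min 1 (t + fst z) - min 1 t)) \<partial>(Hold j \<Otimes>\<^sub>M Cl j k)) = ennreal (p j / rate j) * emeasure (Hold j) {..1 - t}" if k: "k \<in> St" for k
    proof -
      have "(\<integral>\<^sup>+z. ennreal (p j * (min 1 (t + fst z) - min 1 t)) \<partial>(Hold j \<Otimes>\<^sub>M Cl j k)) = (\<integral>\<^sup>+s. ennreal (p j * (min 1 (t + s) - min 1 t)) \<partial>Hold j)"
        by (rule K_integral_fst[OF j k, of "\<lambda>s. ennreal (p j * (min 1 (t + s) - min 1 t))"]) measurable
      also have "\<dots> = (\<integral>\<^sup>+s. ennreal (p j) * ennreal (min 1 (t + s) - min 1 t) \<partial>Hold j)"
        using pr[OF j] by (simp add: ennreal_mult')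
      also have "\<dots> = ennreal (p j) * (ennreal (1 / rate j) * emeasure (Hold j) {..1 - t})"
        by (subst nn_integral_cmult) (auto simp: Hold_truncated_mean[OF j])
      also have "\<dots> = ennreal (p j / rate j) * emeasure (Hold j) {..1 - t}"
        using pr[OF j] by (simp add: mult.assoc[symmetric] flip: ennreal_mult)
      finally show ?thesis .
    qed
    then have "(\<Sum>k\<in>St. ennreal (P j k) * (\<integral>\<^sup>+z. ennreal (p j * (min 1 (t + fst z) - min 1 t)) \<partial>(Hold j \<Otimes>\<^sub>M Cl j k))) = (\<Sum>k\<in>St. ennreal (P j k) * (ennreal (p j / rate j) * emeasure (Hold j) {..1 - t}))"
      by (intro sum.cong refl) simp
    then show "(\<Sum>k\<in>St. ennreal (P j k) * (\<integral>\<^sup>+z. ennreal (p j * (min 1 (t + fst z) - min 1 t)) \<partial>(Hold j \<Otimes>\<^sub>M Cl j k))) = ennreal (p j / rate j) * emeasure (Hold j) {..1 - t}"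
      using P_sum_ennreal[OF j] by (simp flip: sum_distrib_right)
  qed
  also have "\<dots> = (\<Sum>j\<in>St. ennreal (p j / rate j) * ennreal (\<nu> n j))" by (rule count_expand)
  also have "\<dots> = (\<Sum>j\<in>St. ennreal (\<nu> n j * (p j / rate j)))"
    by (intro sum.cong refl) (rule \<nu>_scale)
  also have "\<dots> = ennreal (\<Sum>j\<in>St. \<nu> n j * (p j / rate j))"
  proof (rule sum_ennreal)
    show "0 \<le> \<nu> n j * (p j / rate j)" if "j \<in> St" for j
      using pr[OF that] by (intro mult_nonneg_nonneg divide_nonneg_nonneg) (auto simp: \<nu>_def)
  qed
  finally show ?thesis by (simp add: T_Suc)
qed

text \<open>The mean claim depends only on the transition, and the claim is independent of the
  holding time given the transition. Transitions of probability 0, for which a claim mean need not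
  exist, drop out with weight 0.\<close>

lemma claim_count:
  assumes Cl_int: "\<And>j k. j \<in> St \<Longrightarrow> k \<in> St \<Longrightarrow> 0 < P j k \<Longrightarrow> integrable (Cl j k) (\<lambda>u. u)"
  shows "(\<integral>\<^sup>+\<omega>. ennreal (U (Suc n) \<omega>) * indicator {..1} (T (Suc n) \<omega>) \<partial>Pr i)
    = ennreal (\<Sum>j\<in>St. \<nu> n j * (\<Sum>k\<in>St. P j k * (\<integral>u. u \<partial>Cl j k)))"
proof -
  have Cl0: "AE u in Cl j k. 0 \<le> u" if "j \<in> St" "k \<in> St" for j k
  proof -
    interpret Cl: real_distribution "Cl j k" by (rule Cl_dist[OF that])
    have "emeasure (Cl j k) {..<0} = 0" using Cl_nonneg[OF that] by (simp add: Cl.emeasure_eq_measure)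
    then show ?thesis by (intro AE_I[where N="{..<0}"]) auto
  qed
  have m0: "0 \<le> (\<integral>u. u \<partial>Cl j k)" if "j \<in> St" "k \<in> St" for j k
    by (rule integral_nonneg_AE[OF Cl0[OF that]])
  have "(\<integral>\<^sup>+\<omega>. ennreal (U (Suc n) \<omega>) * indicator {..1} (T n \<omega> + S (Suc n) \<omega>) \<partial>Pr i)
    = (\<integral>\<^sup>+\<omega>. ennreal (\<Sum>k\<in>St. P (Jc n \<omega>) k * (\<integral>u. u \<partial>Cl (Jc n \<omega>) k)) * emeasure (Hold (Jc n \<omega>)) {..1 - T n \<omega>} \<partial>Pr i)"
  proof (rule step_functional[where a="\<lambda>j k t s u. ennreal u * indicator {..1} (t + s)" and c="\<lambda>j. ennreal (\<Sum>k\<in>St. P j k * (\<integral>u. u \<partial>Cl j k))"])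
    show "(\<lambda>(t, s, u). ennreal u * indicator {..1::real} (t + s)) \<in> borel_measurable (borel \<Otimes>\<^sub>M borel \<Otimes>\<^sub>M borel)"
      unfolding case_prod_unfold by (intro borel_measurable_times_ennreal indicator_sum_measurable) measurable
    fix j t assume j: "j \<in> St"
    have "ennreal (P j k) * (\<integral>\<^sup>+z. ennreal (snd z) * indicator {..1} (t + fst z) \<partial>(Hold j \<Otimes>\<^sub>M Cl j k)) = ennreal (P j k * (\<integral>u. u \<partial>Cl j k)) * emeasure (Hold j) {..1 - t}" if k: "k \<in> St" for k
    proof (cases "P j k = 0")
      case False
      then have Pp: "0 < P j k" using P_nonneg[OF j k] by simp
      have "(\<integral>\<^sup>+z. ennreal (snd z) * indicator {..1} (t + fst z) \<partial>(Hold j \<Otimes>\<^sub>M Cl j k)) = (\<integral>\<^sup>+z. indicator {..1} (t + fst z) * ennreal (snd z) \<partial>(Hold j \<Otimes>\<^sub>M Cl j k))"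
        by (simp add: mult.commute)
      also have "\<dots> = (\<integral>\<^sup>+s. indicator {..1} (t + s) \<partial>Hold j) * (\<integral>\<^sup>+u. ennreal u \<partial>Cl j k)"
        by (rule K_integral_prod[OF j k, of "\<lambda>s. indicator {..1} (t + s)" ennreal]) measurable
      also have "(\<integral>\<^sup>+u. ennreal u \<partial>Cl j k) = ennreal (\<integral>u. u \<partial>Cl j k)"
        by (rule nn_integral_eq_integral[OF Cl_int[OF j k Pp] Cl0[OF j k]])
      finally show ?thesis using Pp m0[OF j k] by (simp add: Hold_indicator ennreal_mult mult_ac)
    qed simp
    then have "(\<Sum>k\<in>St. ennreal (P j k) * (\<integral>\<^sup>+z. ennreal (snd z) * indicator {..1} (t + fst z) \<partial>(Hold j \<Otimes>\<^sub>M Cl j k)))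
      = (\<Sum>k\<in>St. ennreal (P j k * (\<integral>u. u \<partial>Cl j k)) * emeasure (Hold j) {..1 - t})"
      by (intro sum.cong refl)
    also have "\<dots> = ennreal (\<Sum>k\<in>St. P j k * (\<integral>u. u \<partial>Cl j k)) * emeasure (Hold j) {..1 - t}"
      using P_nonneg[OF j] m0[OF j] by (subst sum_distrib_right[symmetric], subst sum_ennreal) auto
    finally show "(\<Sum>k\<in>St. ennreal (P j k) * (\<integral>\<^sup>+z. ennreal (snd z) * indicator {..1} (t + fst z) \<partial>(Hold j \<Otimes>\<^sub>M Cl j k)))
      = ennreal (\<Sum>k\<in>St. P j k * (\<integral>u. u \<partial>Cl j k)) * emeasure (Hold j) {..1 - t}" .
  qed
  also have "\<dots> = (\<Sum>j\<in>St. ennreal (\<Sum>k\<in>St. P j k * (\<integral>u. u \<partial>Cl j k)) * ennreal (\<nu> n j))" by (rule count_expand)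
  also have "\<dots> = (\<Sum>j\<in>St. ennreal (\<nu> n j * (\<Sum>k\<in>St. P j k * (\<integral>u. u \<partial>Cl j k))))"
    by (intro sum.cong refl) (rule \<nu>_scale)
  also have "\<dots> = ennreal (\<Sum>j\<in>St. \<nu> n j * (\<Sum>k\<in>St. P j k * (\<integral>u. u \<partial>Cl j k)))"
    by (rule sum_ennreal) (auto intro!: mult_nonneg_nonneg sum_nonneg P_nonneg m0 simp: \<nu>_def)
  finally show ?thesis by (simp add: T_Suc)
qed

end


section \<open>Paths of the risk process\<close>

text \<open>The ruin event and the first increment have to be measurable on the null set of paths with accumulating
  epochs as well. There the premium rate can be unbounded, so that its integral up to the accumulation point
  exists only as a gauge integral, and whether it exists is decided by Hake's theorem.\<close>

lemma hake_zero_end: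
  fixes f :: "real \<Rightarrow> real"
  assumes ab: "a < b" and int: "\<And>v. a \<le> v \<Longrightarrow> v < b \<Longrightarrow> f integrable_on {a..v}"
    and lim: "((\<lambda>v. integral {a..v} f) \<longlongrightarrow> L) (at_left b)" and fb: "f b = 0"
  shows "(f has_integral L) {a..b}"
proof -
  \<comment> \<open>Dyadic points increasing to \<open>b\<close>; on each \<open>{a..c n}\<close>
    the function is integrable, so Henstock's lemma applies there.\<close>
  define c where "c n = b - (b - a) / 2 ^ n" for n :: nat
  have cb: "c n < b" for n using ab by (simp add: c_def)
  have c0: "a \<le> c n" for n
  proof -
    have "(b - a) / 2 ^ n \<le> (b - a) / 1" using ab by (intro divide_left_mono) auto
    then show ?thesis by (simp add: c_def)
  qed
  have cex: "\<exists>n. x < c n" if "x < b" for x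
  proof -
    obtain n where "(b - a) / (b - x) < 2 ^ n" using real_arch_pow[of 2 "(b - a) / (b - x)"] by auto
    then have "(b - a) / 2 ^ n < b - x" using that by (simp add: field_simps)
    then show ?thesis by (intro exI[of _ n]) (simp add: c_def)
  qed
  define Gf where "Gf v = (if v < b then integral {a..v} f else L)" for v
  have incr: "integral {u..v} f = Gf v - Gf u" if "a \<le> u" "u \<le> v" "v < b" for u v
    using Henstock_Kurzweil_Integration.integral_combine[OF that(1,2) int[of v]] that by (simp add: Gf_def)
  show ?thesis unfolding has_integral box_real[symmetric]
  proof (intro allI impI)
    fix e :: real assume e: "0 < e"
    \<comment> \<open>The Henstock errors \<open>e / 2 ^ (n + 2)\<close> sum to at most
      \<open>e / 2\<close>, leaving room for the contribution at the end \<open>b\<close>.\<close>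
    define Q where "Q n \<gamma> \<longleftrightarrow> gauge \<gamma> \<and> (\<forall>p. p tagged_partial_division_of cbox a (c n) \<longrightarrow> \<gamma> fine p \<longrightarrow>
        (\<Sum>(x,k)\<in>p. norm (measure lborel k *\<^sub>R f x - integral k f)) < e / 2 ^ (n + 2))" for n and \<gamma> :: "real \<Rightarrow> real set"
    have "\<exists>\<gamma>. Q n \<gamma>" for n
    proof -
      have fi: "f integrable_on cbox a (c n)" using int[of "c n"] c0 cb by simp
      have pos: "0 < e / 2 ^ (n + 2)" using e by simp
      obtain \<gamma> where "gauge \<gamma>" "\<And>p. p tagged_partial_division_of cbox a (c n) \<Longrightarrow> \<gamma> fine p \<Longrightarrow>
        (\<Sum>(x,k)\<in>p. norm (measure lborel k *\<^sub>R f x - integral k f)) < e / 2 ^ (n + 2)"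
        by (rule Henstock_lemma[OF fi pos], rule that)
      then have "Q n \<gamma>" unfolding Q_def by blast
      then show ?thesis by blast
    qed
    then have "\<forall>n. \<exists>\<gamma>. Q n \<gamma>" by blast
    from choice[OF this] obtain \<gamma> where \<gamma>: "\<And>n. Q n (\<gamma> n)" by blast
    have g: "gauge (\<gamma> n)" for n using \<gamma>[of n] unfolding Q_def by blast
    have gH: "(\<Sum>(x,k)\<in>p. norm (measure lborel k *\<^sub>R f x - integral k f)) < e / 2 ^ (n + 2)"
      if "p tagged_partial_division_of cbox a (c n)" "\<gamma> n fine p" for n p
      using \<gamma>[of n] that unfolding Q_def by blast
    have "eventually (\<lambda>v. dist (integral {a..v} f) L < e / 4) (at_left b)" by (rule tendstoD[OF lim]) (use e in simp)
    then obtain d where d: "d < b" "\<And>v. d < v \<Longrightarrow> v < b \<Longrightarrow> \<bar>integral {a..v} f - L\<bar> < e / 4"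
      unfolding eventually_at_left_field dist_real_def by blast
    define N where "N x = (LEAST n. x < c n)" for x
    have N: "x < c (N x)" if "x < b" for x unfolding N_def using cex[OF that] by (rule LeastI_ex)
    \<comment> \<open>An interval tagged by \<open>x < b\<close> is kept left of
      \<open>c (N x)\<close>, so intervals with the same \<open>N\<close> form a partial division of
      \<open>{a..c n}\<close>. None of them reaches \<open>b\<close>; the part next to
      \<open>b\<close> is tagged by \<open>b\<close> itself and lies right of
      \<open>d\<close>.\<close>
    define \<Gamma> where "\<Gamma> x = (if x < b then \<gamma> (N x) x \<inter> {..<c (N x)} else {d<..} \<inter> (if x = b then UNIV else ball x 1))" for x
    have "gauge \<Gamma>"
    proof (rule gauge_def[THEN iffD2], intro allI conjI)
      fix x
      have "x \<in> \<gamma> (N x) x" "open (\<gamma> (N x) x)" using g by (auto simp: gauge_def)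
      then show "x \<in> \<Gamma> x" "open (\<Gamma> x)" using N[of x] d by (auto simp: \<Gamma>_def)
    qed
    show "\<exists>\<gamma>. gauge \<gamma> \<and> (\<forall>D. D tagged_division_of cbox a b \<and> \<gamma> fine D \<longrightarrow> norm ((\<Sum>(x,k)\<in>D. measure lborel k *\<^sub>R f x) - L) < e)"
    proof (intro exI conjI allI impI)
      show "gauge \<Gamma>" by fact
      fix D assume D: "D tagged_division_of cbox a b \<and> \<Gamma> fine D"
      then have td: "D tagged_division_of {a..b}" by simp
      have fin: "finite D" using D by blast
      have mem: "x \<in> k" "k \<subseteq> {a..b}" "\<exists>u v. k = {u..v} \<and> u \<le> v" "k \<subseteq> \<Gamma> x" if xk: "(x, k) \<in> D" for x k
      proof -
        show 1: "x \<in> k" "k \<subseteq> {a..b}" using tagged_division_ofD[OF td] xk by auto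
        obtain u v where "k = cbox u v" using tagged_division_ofD(4)[OF td xk] by blast
        then show "\<exists>u v. k = {u..v} \<and> u \<le> v" using 1 by (intro exI[of _ u] exI[of _ v]) auto
        show "k \<subseteq> \<Gamma> x" using D xk by (auto simp: fine_def)
      qed
      define h where "h z = measure lborel (snd z) *\<^sub>R f (fst z) - (Gf (Sup (snd z)) - Gf (Inf (snd z)))" for z :: "real \<times> real set"
      have tot: "(\<Sum>z\<in>D. Gf (Sup (snd z)) - Gf (Inf (snd z))) = L"
        using additive_tagged_division_1[OF less_imp_le[OF ab] td, of Gf] ab by (simp add: case_prod_unfold Gf_def)
      define A where "A n = {z\<in>D. fst z < b \<and> N (fst z) = n}" for n
      define B where "B = {z\<in>D. \<not> fst z < b}"
      have hA: "(\<Sum>z\<in>A n. \<bar>h z\<bar>) < e / 2 ^ (n + 2)" for n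
      proof -
        have sub: "A n \<subseteq> D" by (auto simp: A_def)
        have kc: "k \<subseteq> {a..c n}" if "(x, k) \<in> A n" for x k
          using mem[of x k] that by (force simp: A_def \<Gamma>_def)
        have "A n tagged_partial_division_of cbox a (c n)"
          unfolding tagged_partial_division_of_def
        proof (intro conjI allI impI)
          show "finite (A n)" using fin sub finite_subset by blast
          fix x k assume xk: "(x, k) \<in> A n"
          then have "(x, k) \<in> D" using sub by blast
          then show "x \<in> k" "\<exists>a b. k = cbox a b" using tagged_division_ofD(2,4)[OF td] by blast+
          show "k \<subseteq> cbox a (c n)" using kc[OF xk] by simp
        next
          fix x k x' k' assume "(x, k) \<in> A n \<and> (x', k') \<in> A n \<and> (x, k) \<noteq> (x', k')"
          then show "interior k \<inter> interior k' = {}" using tagged_division_ofD(5)[OF td] sub by blast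
        qed
        moreover have "\<gamma> n fine A n" using mem(4) by (fastforce simp: fine_def A_def \<Gamma>_def)
        ultimately have "(\<Sum>(x,k)\<in>A n. norm (measure lborel k *\<^sub>R f x - integral k f)) < e / 2 ^ (n + 2)" by (rule gH)
        moreover have "(\<Sum>z\<in>A n. \<bar>h z\<bar>) = (\<Sum>(x,k)\<in>A n. norm (measure lborel k *\<^sub>R f x - integral k f))"
        proof (rule sum.cong[OF refl])
          fix z assume z: "z \<in> A n"
          obtain x k where xk: "z = (x, k)" by (cases z)
          obtain u v where uv: "k = {u..v}" "u \<le> v" using mem(3)[of x k] z xk by (auto simp: A_def)
          have "a \<le> u" "v < b" using kc[of x k] z xk uv cb[of n] by auto
          then show "\<bar>h z\<bar> = (case z of (x, k) \<Rightarrow> norm (measure lborel k *\<^sub>R f x - integral k f))"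
            using uv incr[of u v] by (simp add: xk h_def)
        qed
        ultimately show ?thesis by simp
      qed
      \<comment> \<open>At most one interval tagged by \<open>b\<close> has positive length, and
        \<open>f b = 0\<close> removes its Riemann term; its error is the part of the limit
        \<open>L\<close> still missing at a point beyond \<open>d\<close>.\<close>
      have hB: "(\<Sum>z\<in>B. \<bar>h z\<bar>) \<le> e / 4"
      proof -
        define B' where "B' = {z\<in>B. Inf (snd z) < b}"
        have shape: "\<exists>u. z = (b, {u..b}) \<and> d < u \<and> u \<le> b \<and> a \<le> u" if zB: "z \<in> B" for z
        proof -
          obtain x k where xk: "z = (x, k)" by (cases z)
          have D': "(x, k) \<in> D" "\<not> x < b" using zB by (auto simp: B_def xk)
          obtain u v where uv: "k = {u..v}" "u \<le> v" using mem(3)[OF D'(1)] by blast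
          have "x = b" using mem(1,2)[OF D'(1)] D' by force
          moreover have "v = b" using mem(1,2)[OF D'(1)] uv \<open>x = b\<close> by auto
          moreover have "d < u" using mem(4)[OF D'(1)] uv \<open>x = b\<close> by (auto simp: \<Gamma>_def)
          moreover have "a \<le> u" using mem(2)[OF D'(1)] uv by auto
          ultimately show ?thesis using uv xk by auto
        qed
        have "(\<Sum>z\<in>B. \<bar>h z\<bar>) = (\<Sum>z\<in>B'. \<bar>h z\<bar>)"
        proof (rule sum.mono_neutral_right)
          show "finite B" using fin by (simp add: B_def)
          show "\<forall>z\<in>B - B'. \<bar>h z\<bar> = 0"
          proof
            fix z assume z: "z \<in> B - B'"
            obtain u where u: "z = (b, {u..b})" "u \<le> b" using shape z by blast
            then have "u = b" using z by (auto simp: B'_def)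
            then show "\<bar>h z\<bar> = 0" using u fb by (simp add: h_def)
          qed
        qed (auto simp: B'_def)
        also have "\<dots> \<le> (\<Sum>z\<in>B'. e / 4)"
        proof (rule sum_mono)
          fix z assume z: "z \<in> B'"
          obtain u where u: "z = (b, {u..b})" "d < u" "u \<le> b" "a \<le> u" using shape[of z] z by (auto simp: B'_def)
          have "u < b" using z u by (auto simp: B'_def)
          then show "\<bar>h z\<bar> \<le> e / 4" using u fb d(2)[of u] by (simp add: h_def Gf_def)
        qed
        also have "\<dots> \<le> e / 4"
        proof -
          have "z = z'" if z: "z \<in> B'" and z': "z' \<in> B'" for z z'
          proof (rule ccontr)
            assume ne: "z \<noteq> z'"
            obtain u where u: "z = (b, {u..b})" using shape[of z] z by (auto simp: B'_def)
            obtain u' where u': "z' = (b, {u'..b})" using shape[of z'] z' by (auto simp: B'_def)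
            have lt: "u < b" "u' < b" using z z' shape[of z] shape[of z'] u u' by (auto simp: B'_def)
            have "interior {u..b} \<inter> interior {u'..b} = {}"
              using tagged_division_ofD(5)[OF td, of b "{u..b}" b "{u'..b}"] z z' u u' ne by (auto simp: B'_def B_def)
            moreover have "(max u u' + b) / 2 \<in> interior {u..b} \<inter> interior {u'..b}" using lt by (auto simp: interior_atLeastAtMost_real)
            ultimately show False by blast
          qed
          then have "card B' \<le> 1" using fin by (intro card_le_Suc0_iff_eq[THEN iffD2, unfolded One_nat_def[symmetric]]) (auto simp: B'_def B_def)
          then have "real (card B') * (e / 4) \<le> 1 * (e / 4)" using e by (intro mult_right_mono) auto
          then show ?thesis by simp
        qed
        finally show ?thesis .
      qed
      define m where "m = Suc (Max (insert 0 ((\<lambda>z. N (fst z)) ` D)))"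
      have un: "D = (\<Union>n<m. A n) \<union> B"
      proof -
        have "N (fst z) < m" if "z \<in> D" for z
          unfolding m_def less_Suc_eq_le using fin that by (intro Max_ge) auto
        then show ?thesis by (auto simp: A_def B_def)
      qed
      have "(\<Sum>z\<in>D. \<bar>h z\<bar>) = (\<Sum>z\<in>(\<Union>n<m. A n). \<bar>h z\<bar>) + (\<Sum>z\<in>B. \<bar>h z\<bar>)"
        by (subst un, rule sum.union_disjoint) (use fin in \<open>auto simp: A_def B_def\<close>)
      also have "(\<Sum>z\<in>(\<Union>n<m. A n). \<bar>h z\<bar>) = (\<Sum>n<m. \<Sum>z\<in>A n. \<bar>h z\<bar>)"
        by (rule sum.UNION_disjoint) (use fin in \<open>auto simp: A_def\<close>)
      also have "\<dots> \<le> (\<Sum>n<m. e / 2 ^ (n + 2))" by (intro sum_mono less_imp_le hA)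
      also have "\<dots> \<le> e / 2"
      proof -
        have "(\<Sum>n<m. e / 2 ^ (n + 2)) = e / 4 * (\<Sum>n<m. (1 / 2) ^ n)"
          by (simp add: sum_distrib_left power_divide power_add field_simps)
        also have "(\<Sum>n<m. (1 / 2 :: real) ^ n) \<le> 2"
          unfolding sum_gp_strict by simp
        finally show ?thesis using e by simp
      qed
      finally have "(\<Sum>z\<in>D. \<bar>h z\<bar>) < e" using hB e by linarith
      moreover have "(\<Sum>(x,k)\<in>D. measure lborel k *\<^sub>R f x) - L = (\<Sum>z\<in>D. h z)"
        using tot by (simp add: h_def sum_subtractf case_prod_unfold)
      ultimately show "norm ((\<Sum>(x,k)\<in>D. measure lborel k *\<^sub>R f x) - L) < e"
        using le_less_trans[OF sum_abs[of h D], of e] by simp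
    qed
  qed
qed

text \<open>Changing \<open>f\<close> at the single point \<open>b\<close> alters neither the
  integrals nor their limit, so the value at the end can be taken to be 0.\<close>

lemma hake:
  fixes f :: "real \<Rightarrow> real"
  assumes ab: "a < b" and int: "\<And>v. a \<le> v \<Longrightarrow> v < b \<Longrightarrow> f integrable_on {a..v}"
    and lim: "((\<lambda>v. integral {a..v} f) \<longlongrightarrow> L) (at_left b)"
  shows "(f has_integral L) {a..b}"
proof -
  let ?g = "f(b := 0)"
  have eq: "integral {a..v} ?g = integral {a..v} f" "?g integrable_on {a..v}" if "a \<le> v" "v < b" for v
  proof -
    show "integral {a..v} ?g = integral {a..v} f" by (rule integral_cong) (use that in auto)
    show "?g integrable_on {a..v}" using int[OF that] by (rule integrable_eq) (use that in auto)
  qed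
  have "(?g has_integral L) {a..b}"
  proof (rule hake_zero_end[OF ab])
    have "eventually (\<lambda>v. integral {a..v} f = integral {a..v} ?g) (at_left b)"
      using eventually_at_left_real[OF ab] by eventually_elim (simp add: eq)
    then show "((\<lambda>v. integral {a..v} ?g) \<longlongrightarrow> L) (at_left b)" using lim by (rule Lim_transform_eventually[rotated])
  qed (use eq in auto)
  then show ?thesis by (rule has_integral_spike_finite[of "{b}", rotated 2]) auto
qed

subsection \<open>Local structure of the jump counter\<close>

text \<open>Left of the lower limit of the epochs only finitely many epochs occur, and
  \<open>\<eta>\<close> keeps clear of those different from \<open>s\<close>. The lower limit is the
  right notion because on exceptional paths the epochs need not increase.\<close>

lemma njumps_locally_constant:
  assumes "ereal s < liminf (\<lambda>k. ereal (jump_time S k \<omega>))"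
  shows "\<exists>\<eta>>0. (\<forall>v. s \<le> v \<and> v < s + \<eta> \<longrightarrow> njumps S v \<omega> = njumps S s \<omega>)
    \<and> (s \<notin> range (\<lambda>k. jump_time S k \<omega>) \<longrightarrow> (\<forall>v. \<bar>v - s\<bar> < \<eta> \<longrightarrow> njumps S v \<omega> = njumps S s \<omega>))"
    and finite_jumps: "\<exists>r>s. finite {k. jump_time S k \<omega> \<le> r}"
proof -
  obtain r where r: "ereal s < ereal r" "ereal r < liminf (\<lambda>k. ereal (jump_time S k \<omega>))"
    using ereal_dense2[OF assms] by (metis ereal_dense2 assms)
  have "eventually (\<lambda>k. ereal r < ereal (jump_time S k \<omega>)) sequentially" by (rule less_LiminfD[OF r(2)])
  then obtain n where n: "\<And>k. n \<le> k \<Longrightarrow> r < jump_time S k \<omega>" unfolding eventually_sequentially by auto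
  have "{k. jump_time S k \<omega> \<le> r} \<subseteq> {..<n}"
  proof
    fix k assume k: "k \<in> {k. jump_time S k \<omega> \<le> r}"
    then show "k \<in> {..<n}" using n[of k] by (cases "n \<le> k") auto
  qed
  then have fin: "finite {k. jump_time S k \<omega> \<le> r}" using finite_subset by blast
  then show "\<exists>r>s. finite {k. jump_time S k \<omega> \<le> r}" using r by auto
  obtain d where d: "0 < d" "\<forall>x\<in>(\<lambda>k. jump_time S k \<omega>) ` {k. jump_time S k \<omega> \<le> r}. x \<noteq> s \<longrightarrow> d \<le> dist s x"
    using finite_set_avoid[where a=s, OF finite_imageI[OF fin]] by blast
  define \<eta> where "\<eta> = min d (r - s)"
  have \<eta>: "0 < \<eta>" using d r by (simp add: \<eta>_def)
  have far: "\<eta> \<le> \<bar>jump_time S k \<omega> - s\<bar>" if "jump_time S k \<omega> \<noteq> s" for k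
  proof (cases "jump_time S k \<omega> \<le> r")
    case True
    then have "d \<le> dist s (jump_time S k \<omega>)" using d that by blast
    then show ?thesis by (simp add: \<eta>_def dist_real_def abs_minus_commute)
  qed (auto simp: \<eta>_def)
  show "\<exists>\<eta>>0. (\<forall>v. s \<le> v \<and> v < s + \<eta> \<longrightarrow> njumps S v \<omega> = njumps S s \<omega>)
    \<and> (s \<notin> range (\<lambda>k. jump_time S k \<omega>) \<longrightarrow> (\<forall>v. \<bar>v - s\<bar> < \<eta> \<longrightarrow> njumps S v \<omega> = njumps S s \<omega>))"
  proof (intro exI[of _ \<eta>] conjI impI allI)
    fix v assume v: "s \<le> v \<and> v < s + \<eta>"
    have "jump_time S k \<omega> \<le> v \<longleftrightarrow> jump_time S k \<omega> \<le> s" for k using far[of k] v by (cases "jump_time S k \<omega> = s") auto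
    then show "njumps S v \<omega> = njumps S s \<omega>" unfolding njumps_def by simp
  next
    fix v assume "s \<notin> range (\<lambda>k. jump_time S k \<omega>)" and v: "\<bar>v - s\<bar> < \<eta>"
    then have ne: "jump_time S k \<omega> \<noteq> s" for k by auto
    have "jump_time S k \<omega> \<le> v \<longleftrightarrow> jump_time S k \<omega> \<le> s" for k using far[OF ne[of k]] v by auto
    then show "njumps S v \<omega> = njumps S s \<omega>" unfolding njumps_def by simp
  qed (rule \<eta>)
qed

text \<open>Beyond the lower limit infinitely many epochs have passed, and the cardinality of an
  infinite set is 0 by convention.\<close>

lemma njumps_zero_beyond:
  assumes "liminf (\<lambda>k. ereal (jump_time S k \<omega>)) < ereal s"
  shows "njumps S s \<omega> = 0"
proof -
  have "\<not> eventually (\<lambda>k. ereal s < ereal (jump_time S k \<omega>)) sequentially"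
  proof
    assume "eventually (\<lambda>k. ereal s < ereal (jump_time S k \<omega>)) sequentially"
    then have "eventually (\<lambda>k. ereal s \<le> ereal (jump_time S k \<omega>)) sequentially" by eventually_elim simp
    then have "ereal s \<le> liminf (\<lambda>k. ereal (jump_time S k \<omega>))" by (rule Liminf_bounded)
    then show False using assms by simp
  qed
  then have "frequently (\<lambda>k. jump_time S k \<omega> \<le> s) sequentially" by (simp add: frequently_def not_le)
  then have "infinite {k. jump_time S k \<omega> \<le> s}" by (simp add: frequently_cofinite cofinite_eq_sequentially[symmetric])
  then have "infinite ({k. jump_time S k \<omega> \<le> s} - {0})" by (subst infinite_remove) auto
  moreover have "{k. jump_time S k \<omega> \<le> s} - {0} = {k. 1 \<le> k \<and> jump_time S k \<omega> \<le> s}" by auto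
  ultimately show ?thesis unfolding njumps_def by simp
qed

lemma njumps_two_sided:
  assumes s: "ereal s \<noteq> liminf (\<lambda>k. ereal (jump_time S k \<omega>))"
  shows "\<exists>\<eta>>0. (\<forall>v. s \<le> v \<and> v < s + \<eta> \<longrightarrow> njumps S v \<omega> = njumps S s \<omega>)
    \<and> (s \<notin> range (\<lambda>k. jump_time S k \<omega>) \<longrightarrow> (\<forall>v. \<bar>v - s\<bar> < \<eta> \<longrightarrow> njumps S v \<omega> = njumps S s \<omega>))"
proof (cases "ereal s < liminf (\<lambda>k. ereal (jump_time S k \<omega>))")
  case False
  then have lt: "liminf (\<lambda>k. ereal (jump_time S k \<omega>)) < ereal s" using s by simp
  then obtain r where r: "liminf (\<lambda>k. ereal (jump_time S k \<omega>)) < ereal r" "ereal r < ereal s" using ereal_dense2 by blast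
  have "njumps S v \<omega> = 0" if "r \<le> v" for v
    by (rule njumps_zero_beyond) (use r that in \<open>auto intro: less_le_trans\<close>)
  then show ?thesis using r by (intro exI[of _ "s - r"]) auto
qed (rule njumps_locally_constant)

text \<open>If the integral up to \<open>a\<close> does not exist, neither does any later one, and
  all of them are 0 by convention; then the slope 0 works.\<close>

lemma integral_const_extension:
  fixes f :: "real \<Rightarrow> real"
  assumes "0 \<le> a" "a \<le> b" and f: "\<And>u. a \<le> u \<Longrightarrow> u \<le> b \<Longrightarrow> f u = \<alpha>"
  shows "\<exists>\<beta>. \<forall>v. a \<le> v \<and> v \<le> b \<longrightarrow> integral {0..v} f = integral {0..a} f + \<beta> * (v - a)"
proof -
  have i: "(f has_integral \<alpha> * (w - v)) {v..w}" if "a \<le> v" "v \<le> w" "w \<le> b" for v w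
  proof -
    have "((\<lambda>_. \<alpha>) has_integral (w - v) *\<^sub>R \<alpha>) {v..w}" using has_integral_const_real[of \<alpha> v w] that by simp
    then have "((\<lambda>_. \<alpha>) has_integral \<alpha> * (w - v)) {v..w}" by (simp add: mult.commute)
    then show ?thesis by (rule has_integral_eq[rotated]) (use f that in auto)
  qed
  show ?thesis
  proof (cases "f integrable_on {0..a}")
    case True
    have "integral {0..v} f = integral {0..a} f + \<alpha> * (v - a)" if "a \<le> v" "v \<le> b" for v
    proof -
      have "(f has_integral integral {0..a} f + \<alpha> * (v - a)) {0..v}"
        by (rule has_integral_combine[OF assms(1) that(1) integrable_integral[OF True] i]) (use that in auto)
      then show ?thesis by (rule integral_unique)
    qed
    then show ?thesis by blast
  next
    case False
    have "\<not> f integrable_on {0..v}" if "a \<le> v" for v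
    proof
      assume "f integrable_on {0..v}"
      then have "f integrable_on {0..a}" by (rule integrable_on_subinterval) (use that in auto)
      then show False using False by simp
    qed
    then have "integral {0..v} f = 0" if "a \<le> v" for v using that by (simp add: not_integrable_integral)
    then show ?thesis by (intro exI[of _ 0]) auto
  qed
qed

text \<open>The counter is locally constant, so premiums accrue at a constant rate and no claim is
  paid: the path is affine to the right of every point and on both sides of points that are not
  epochs. The lower limit of the epochs is the single exception.\<close>

lemma Xproc_affine:
  assumes s0: "0 \<le> s" and s: "ereal s \<noteq> liminf (\<lambda>k. ereal (jump_time S k \<omega>))"
  shows "\<exists>\<eta>>0. \<exists>\<beta>. (\<forall>v. s \<le> v \<and> v < s + \<eta> \<longrightarrow> Xproc p Jc S U x v \<omega> = Xproc p Jc S U x s \<omega> + \<beta> * (v - s))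
    \<and> (0 < s \<and> s \<notin> range (\<lambda>k. jump_time S k \<omega>) \<longrightarrow>
        (\<forall>v. \<bar>v - s\<bar> < \<eta> \<longrightarrow> Xproc p Jc S U x v \<omega> = Xproc p Jc S U x s \<omega> + \<beta> * (v - s)))"
proof -
  let ?f = "\<lambda>u. p (Jproc Jc S u \<omega>)" and ?X = "\<lambda>v. Xproc p Jc S U x v \<omega>"
  obtain \<eta> where \<eta>: "0 < \<eta>" and r: "\<And>v. s \<le> v \<Longrightarrow> v < s + \<eta> \<Longrightarrow> njumps S v \<omega> = njumps S s \<omega>"
    and t: "\<And>v. s \<notin> range (\<lambda>k. jump_time S k \<omega>) \<Longrightarrow> \<bar>v - s\<bar> < \<eta> \<Longrightarrow> njumps S v \<omega> = njumps S s \<omega>"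
    using njumps_two_sided[OF s] by blast
  have X: "?X v = x + integral {0..v} ?f - (\<Sum>k\<in>{1..njumps S s \<omega>}. U k \<omega>)" if "njumps S v \<omega> = njumps S s \<omega>" for v
    using that by (simp add: Xproc_def)
  show ?thesis
  proof (cases "0 < s \<and> s \<notin> range (\<lambda>k. jump_time S k \<omega>)")
    case True
    define \<epsilon> where "\<epsilon> = min \<eta> s / 2"
    have \<epsilon>: "0 < \<epsilon>" "\<epsilon> < \<eta>" "\<epsilon> < s" using \<eta> True by (auto simp: \<epsilon>_def)
    have nv: "njumps S v \<omega> = njumps S s \<omega>" if "\<bar>v - s\<bar> \<le> \<epsilon>" for v using t[of v] True that \<epsilon> by auto
    have c: "?f u = p (Jc (njumps S s \<omega>) \<omega>)" if "s - \<epsilon> \<le> u" "u \<le> s + \<epsilon>" for u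
      using nv[of u] that by (simp add: Jproc_def abs_le_iff)
    have "0 \<le> s - \<epsilon>" "s - \<epsilon> \<le> s + \<epsilon>" using \<epsilon> by auto
    from integral_const_extension[of "s - \<epsilon>" "s + \<epsilon>" ?f "p (Jc (njumps S s \<omega>) \<omega>)", OF this c] obtain \<beta> where
      \<beta>: "\<And>v. s - \<epsilon> \<le> v \<Longrightarrow> v \<le> s + \<epsilon> \<Longrightarrow> integral {0..v} ?f = integral {0..s - \<epsilon>} ?f + \<beta> * (v - (s - \<epsilon>))"
      by blast
    have m: "?X v = ?X s + \<beta> * (v - s)" if "\<bar>v - s\<bar> < \<epsilon>" for v
      using X[OF nv[of v]] X[OF nv[of s]] \<beta>[of v] \<beta>[of s] \<epsilon> that by (auto simp: algebra_simps abs_less_iff)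
    have "?X v = ?X s + \<beta> * (v - s)" if "s \<le> v" "v < s + \<epsilon>" for v by (rule m) (use that in auto)
    then show ?thesis using \<epsilon>(1) m by blast
  next
    case False
    define \<epsilon> where "\<epsilon> = \<eta> / 2"
    have \<epsilon>: "0 < \<epsilon>" "\<epsilon> < \<eta>" using \<eta> by (auto simp: \<epsilon>_def)
    have nv: "njumps S v \<omega> = njumps S s \<omega>" if "s \<le> v" "v \<le> s + \<epsilon>" for v using r[of v] that \<epsilon> by auto
    have c: "?f u = p (Jc (njumps S s \<omega>) \<omega>)" if "s \<le> u" "u \<le> s + \<epsilon>" for u
      using nv[of u] that by (simp add: Jproc_def)
    have "s \<le> s + \<epsilon>" using \<epsilon> by simp
    from integral_const_extension[of s "s + \<epsilon>" ?f "p (Jc (njumps S s \<omega>) \<omega>)", OF s0 this c] obtain \<beta> where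
      \<beta>: "\<And>v. s \<le> v \<Longrightarrow> v \<le> s + \<epsilon> \<Longrightarrow> integral {0..v} ?f = integral {0..s} ?f + \<beta> * (v - s)"
      by blast
    have "?X v = ?X s + \<beta> * (v - s)" if "s \<le> v" "v < s + \<epsilon>" for v
      using X[OF nv[of v]] X[OF nv[of s]] \<beta>[of v] \<beta>[of s] \<epsilon> that by (auto simp: algebra_simps)
    then show ?thesis using \<epsilon>(1) False by blast
  qed
qed

subsection \<open>Long excursions below zero\<close>

text \<open>Both the ruin time and the times before it range over \<open>D\<close>: with
  \<open>D = UNIV\<close> this is finiteness of \<open>tau_zeta\<close>, with countably many
  measurable times it is a measurable condition.\<close>

definition excursion :: "(real \<Rightarrow> real) \<Rightarrow> real \<Rightarrow> real set \<Rightarrow> bool" where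
  "excursion X \<zeta> D \<longleftrightarrow> (\<exists>t\<in>D. 0 < t \<and> X t < 0 \<and> (\<forall>s\<in>D. 0 \<le> s \<and> t - \<zeta> < s \<and> s < t \<longrightarrow> X s < 0))"

text \<open>An infimum in \<open>ereal\<close> is below infinity iff its set of real times is
  nonempty, and the bound on the supremum is a bound on each element, which also covers the empty
  set.\<close>

lemma tau_zeta_finite_iff:
  "tau_zeta p Jc S U \<zeta> x \<omega> < \<infinity> \<longleftrightarrow> excursion (\<lambda>t. Xproc p Jc S U x t \<omega>) \<zeta> UNIV"
proof -
  let ?X = "\<lambda>t. Xproc p Jc S U x t \<omega>"
  have sup: "ereal \<zeta> \<le> ereal t - (SUP s\<in>A. ereal s) \<longleftrightarrow> (\<forall>s\<in>A. s \<le> t - \<zeta>)" for t and A :: "real set"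
  proof -
    have "ereal \<zeta> \<le> ereal t - y \<longleftrightarrow> y \<le> ereal (t - \<zeta>)" for y by (cases y) auto
    then show ?thesis by (simp add: SUP_le_iff)
  qed
  have "tau_zeta p Jc S U \<zeta> x \<omega> < \<infinity> \<longleftrightarrow> (\<exists>t. 0 < t \<and> ereal t - (SUP s\<in>{s. 0 \<le> s \<and> s < t \<and> 0 \<le> ?X s}. ereal s) \<ge> ereal \<zeta> \<and> ?X t < 0)"
    unfolding tau_zeta_def Inf_less_iff by auto
  also have "\<dots> \<longleftrightarrow> (\<exists>t. 0 < t \<and> ?X t < 0 \<and> (\<forall>s. 0 \<le> s \<and> t - \<zeta> < s \<and> s < t \<longrightarrow> ?X s < 0))"
    unfolding sup by (intro ex_cong) (auto simp: not_le not_less)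
  finally show ?thesis by (simp add: excursion_def)
qed

text \<open>A negative value persists on a short affine piece to the right, so the time can be moved
  to a rational one and the times gained are negative too; the exceptional point \<open>g\<close>
  belongs to \<open>D\<close> anyway. Conversely, a nonnegative value at a time outside
  \<open>D\<close> persists on one side, chosen by the sign of the slope, and shows up at a rational
  time.\<close>

lemma excursion_countable:
  assumes right: "\<And>s. 0 \<le> s \<Longrightarrow> s \<noteq> g \<Longrightarrow> \<exists>\<eta>>0. \<exists>\<beta>. \<forall>v. s \<le> v \<and> v < s + \<eta> \<longrightarrow> X v = X s + \<beta> * (v - s)"
    and both: "\<And>s. 0 < s \<Longrightarrow> s \<notin> D \<Longrightarrow> \<exists>\<eta>>0. \<exists>\<beta>. \<forall>v. \<bar>v - s\<bar> < \<eta> \<longrightarrow> X v = X s + \<beta> * (v - s)"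
    and D: "\<rat> \<subseteq> D" "g \<in> D"
  shows "excursion X \<zeta> UNIV \<longleftrightarrow> excursion X \<zeta> D"
proof
  assume "excursion X \<zeta> UNIV"
  then obtain t where t: "0 < t" "X t < 0" "\<And>s. 0 \<le> s \<Longrightarrow> t - \<zeta> < s \<Longrightarrow> s < t \<Longrightarrow> X s < 0"
    by (auto simp: excursion_def)
  show "excursion X \<zeta> D"
  proof (cases "t = g")
    case True
    then show ?thesis using t D by (auto simp: excursion_def)
  next
    case False
    have "\<exists>\<eta>>0. \<exists>\<beta>. \<forall>v. t \<le> v \<and> v < t + \<eta> \<longrightarrow> X v = X t + \<beta> * (v - t)" by (rule right) (use t False in auto)
    then obtain \<eta> \<beta> where e: "0 < \<eta>" "\<And>v. t \<le> v \<Longrightarrow> v < t + \<eta> \<Longrightarrow> X v = X t + \<beta> * (v - t)" by blast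
    \<comment> \<open>Short enough that an affine piece of slope \<open>\<beta>\<close> cannot climb
      from \<open>X t\<close> to 0; adding 1 avoids a vanishing denominator.\<close>
    define \<epsilon> where "\<epsilon> = min \<eta> (- X t / (\<bar>\<beta>\<bar> + 1))"
    have "0 < - X t / (\<bar>\<beta>\<bar> + 1)" using t by (intro divide_pos_pos) auto
    then have \<epsilon>: "0 < \<epsilon>" using e(1) unfolding \<epsilon>_def by (rule min_less_iff_conj[THEN iffD2, OF conjI, rotated])
    have neg: "X v < 0" if "t \<le> v" "v < t + \<epsilon>" for v
    proof -
      have "\<beta> * (v - t) \<le> (\<bar>\<beta>\<bar> + 1) * (v - t)" using that by (intro mult_right_mono) auto
      also have "\<dots> < (\<bar>\<beta>\<bar> + 1) * (- X t / (\<bar>\<beta>\<bar> + 1))" using that by (intro mult_strict_left_mono) (auto simp: \<epsilon>_def)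
      also have "\<dots> = - X t" by simp
      finally show ?thesis using e(2)[of v] that by (simp add: \<epsilon>_def)
    qed
    obtain t' where t': "t' \<in> \<rat>" "t < t'" "t' < t + \<epsilon>" using Rats_dense_in_real[of t "t + \<epsilon>"] \<epsilon> by auto
    have "X s < 0" if "0 \<le> s" "t' - \<zeta> < s" "s < t'" for s
      using t(3)[of s] neg[of s] that t' by (cases "s < t") auto
    then show ?thesis unfolding excursion_def using t' t neg[of t'] D by (intro bexI[of _ t']) auto
  qed
next
  assume "excursion X \<zeta> D"
  then obtain t where t: "t \<in> D" "0 < t" "X t < 0" "\<And>s. s \<in> D \<Longrightarrow> 0 \<le> s \<Longrightarrow> t - \<zeta> < s \<Longrightarrow> s < t \<Longrightarrow> X s < 0"
    by (auto simp: excursion_def)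
  have "X s < 0" if s: "0 \<le> s" "t - \<zeta> < s" "s < t" for s
  proof (rule ccontr)
    assume X: "\<not> X s < 0"
    then have sD: "s \<notin> D" using t(4) s by blast
    then have s0: "0 < s" using s D(1) Rats_0 by (metis less_eq_real_def subsetD)
    obtain \<eta> \<beta> where e: "0 < \<eta>" "\<And>v. \<bar>v - s\<bar> < \<eta> \<Longrightarrow> X v = X s + \<beta> * (v - s)" using both[OF s0 sD] by blast
    show False
    proof (cases "0 \<le> \<beta>")
      case True
      obtain v where v: "v \<in> \<rat>" "s < v" "v < min (s + \<eta>) t" using Rats_dense_in_real[of s "min (s + \<eta>) t"] e s by auto
      have "0 \<le> X v" using e(2)[of v] v X True by auto
      then show False using t(4)[of v] v s D by auto
    next
      case False
      obtain v where v: "v \<in> \<rat>" "max (max (s - \<eta>) (t - \<zeta>)) 0 < v" "v < s"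
        using Rats_dense_in_real[of "max (max (s - \<eta>) (t - \<zeta>)) 0" s] e s s0 by auto
      have "0 \<le> \<beta> * (v - s)" using v False by (simp add: mult_nonpos_nonpos)
      then have "0 \<le> X v" using e(2)[of v] v X by auto
      then show False using t(4)[of v] v s D by auto
    qed
  qed
  then show "excursion X \<zeta> UNIV" unfolding excursion_def using t by auto
qed


text \<open>A left limit exists iff the Cauchy condition holds, and by continuity rational points
  suffice. All quantifiers become countable, which makes the condition measurable when
  \<open>h\<close> depends on the path.\<close>

lemma rational_Cauchy_at_left:
  fixes h :: "real \<Rightarrow> real"
  assumes cont: "continuous_on {0..<1} h"
  shows "(\<exists>L. (h \<longlongrightarrow> L) (at_left 1)) \<longleftrightarrow>
    (\<forall>k::nat. \<exists>n::nat. \<forall>r\<in>\<rat>. \<forall>r'\<in>\<rat>. 0 < r \<and> 0 < r' \<and> 1 - 1 / (real n + 1) < r \<and> 1 - 1 / (real n + 1) < r' \<and> r < 1 \<and> r' < 1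
       \<longrightarrow> \<bar>h r - h r'\<bar> \<le> 1 / (real k + 1))" (is "_ \<longleftrightarrow> ?C")
proof
  assume "\<exists>L. (h \<longlongrightarrow> L) (at_left 1)"
  then obtain L where L: "(h \<longlongrightarrow> L) (at_left 1)" by blast
  show ?C
  proof
    fix k :: nat
    define e where "e = 1 / (real k + 1)"
    have "0 < e / 2" by (simp add: e_def)
    from tendstoD[OF L this] obtain d where d: "d < 1" "\<And>v. d < v \<Longrightarrow> v < 1 \<Longrightarrow> \<bar>h v - L\<bar> < e / 2"
      unfolding eventually_at_left_field dist_real_def by blast
    obtain n where n: "1 / (1 - d) < real n" using reals_Archimedean2 by blast
    have "1 / (real n + 1) < 1 - d" using n d(1) by (simp add: field_simps)
    then have "\<bar>h r - h r'\<bar> \<le> e" if "1 - 1 / (real n + 1) < r" "1 - 1 / (real n + 1) < r'" "r < 1" "r' < 1" for r r'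
      using d(2)[of r] d(2)[of r'] that by linarith
    then show "\<exists>n::nat. \<forall>r\<in>\<rat>. \<forall>r'\<in>\<rat>. 0 < r \<and> 0 < r' \<and> 1 - 1 / (real n + 1) < r \<and> 1 - 1 / (real n + 1) < r' \<and> r < 1 \<and> r' < 1
       \<longrightarrow> \<bar>h r - h r'\<bar> \<le> 1 / (real k + 1)" unfolding e_def by blast
  qed
next
  assume C: ?C
  have C': "\<exists>d<1. 0 \<le> d \<and> (\<forall>r r'. d < r \<and> d < r' \<and> r < 1 \<and> r' < 1 \<longrightarrow> \<bar>h r - h r'\<bar> < e)" if e: "0 < e" for e
  proof -
    obtain k :: nat where k: "2 / e < real k" using reals_Archimedean2 by blast
    have k': "1 / (real k + 1) < e / 2" using k e by (simp add: field_simps)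
    obtain n :: nat where n: "\<And>r r'. r \<in> \<rat> \<Longrightarrow> r' \<in> \<rat> \<Longrightarrow> 0 < r \<and> 0 < r' \<and> 1 - 1 / (real n + 1) < r \<and> 1 - 1 / (real n + 1) < r' \<and> r < 1 \<and> r' < 1
       \<Longrightarrow> \<bar>h r - h r'\<bar> \<le> 1 / (real k + 1)" using C by blast
    define d where "d = 1 - 1 / (real n + 1)"
    have d: "d < 1" "0 \<le> d" by (auto simp: d_def field_simps)
    \<comment> \<open>Each passage from a real point to a rational one costs \<open>e / 4\<close>,
      and the rational points differ by less than \<open>e / 2\<close>.\<close>
    have near: "\<exists>q\<in>\<rat>. d < q \<and> q < 1 \<and> \<bar>h r - h q\<bar> < e / 4" if r: "d < r" "r < 1" for r
    proof -
      have "isCont h r"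
        by (rule continuous_on_interior[OF cont]) (use r d in auto)
      then obtain s where s: "0 < s" "\<And>y. \<bar>y - r\<bar> < s \<Longrightarrow> \<bar>h y - h r\<bar> < e / 4"
        using e unfolding continuous_at_eps_delta dist_real_def by (metis zero_less_divide_iff zero_less_numeral)
      obtain q where q: "q \<in> \<rat>" "r < q" "q < min (r + s) 1" using Rats_dense_in_real[of r "min (r + s) 1"] s r by auto
      then show ?thesis using s(2)[of q] r by (intro bexI[of _ q]) (auto simp: abs_minus_commute)
    qed
    have "\<bar>h r - h r'\<bar> < e" if r: "d < r" "d < r'" "r < 1" "r' < 1" for r r'
    proof -
      obtain q where q: "q \<in> \<rat>" "d < q" "q < 1" "\<bar>h r - h q\<bar> < e / 4" using near[of r] r by blast
      obtain q' where q': "q' \<in> \<rat>" "d < q'" "q' < 1" "\<bar>h r' - h q'\<bar> < e / 4" using near[of r'] r by blast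
      have "\<bar>h q - h q'\<bar> \<le> 1 / (real k + 1)" by (rule n) (use q q' d in \<open>auto simp: d_def[symmetric]\<close>)
      then show ?thesis using q(4) q'(4) k' by linarith
    qed
    then show ?thesis using d by blast
  qed
  have "\<exists>L. filterlim h (nhds L) (at_left 1)"
  proof (rule ccontr)
    define v where "v n = 1 - 1 / (real n + 2)" for n :: nat
    have vlim: "v \<longlonglongrightarrow> 1" unfolding v_def by real_asymp
    have v1: "v n < 1" for n by (simp add: v_def)
    have "Cauchy (\<lambda>n. h (v n))"
    proof (rule metric_CauchyI)
      fix e :: real assume "0 < e"
      from C'[OF this] obtain d where d: "d < 1" "\<And>r r'. d < r \<Longrightarrow> d < r' \<Longrightarrow> r < 1 \<Longrightarrow> r' < 1 \<Longrightarrow> \<bar>h r - h r'\<bar> < e" by blast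
      have "eventually (\<lambda>n. d < v n) sequentially" using order_tendstoD(1)[OF vlim d(1)] .
      then obtain n0 where "\<And>n. n0 \<le> n \<Longrightarrow> d < v n" unfolding eventually_sequentially by blast
      then show "\<exists>M. \<forall>m\<ge>M. \<forall>n\<ge>M. dist (h (v m)) (h (v n)) < e"
        using d(2) v1 by (intro exI[of _ n0]) (auto simp: dist_real_def)
    qed
    then obtain L where L: "(\<lambda>n. h (v n)) \<longlonglongrightarrow> L" using real_Cauchy_convergent convergent_def by blast
    have "(h \<longlongrightarrow> L) (at_left 1)"
    proof (rule tendstoI)
      fix e :: real assume e: "0 < e"
      then have "0 < e / 2" by simp
      from C'[OF this] obtain d where d: "d < 1" "\<And>r r'. d < r \<Longrightarrow> d < r' \<Longrightarrow> r < 1 \<Longrightarrow> r' < 1 \<Longrightarrow> \<bar>h r - h r'\<bar> < e / 2" by blast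
      have "eventually (\<lambda>n. d < v n \<and> dist (h (v n)) L < e / 2) sequentially"
        using order_tendstoD(1)[OF vlim d(1)] tendstoD[OF L \<open>0 < e / 2\<close>] by (rule eventually_conj)
      then obtain n where n: "d < v n" "dist (h (v n)) L < e / 2" unfolding eventually_sequentially by blast
      have "dist (h r) L < e" if "d < r" "r < 1" for r
        using d(2)[OF that(1) n(1) that(2) v1] n(2) unfolding dist_real_def by linarith
      then show "eventually (\<lambda>r. dist (h r) L < e) (at_left 1)"
        unfolding eventually_at_left_field using d(1) by blast
    qed
    moreover assume "\<nexists>L. filterlim h (nhds L) (at_left 1)"
    ultimately show False by blast
  qed
  then show "\<exists>L. (h \<longlongrightarrow> L) (at_left 1)" .
qed

lemma njumps_measurable:
  assumes S: "\<And>k. S k \<in> borel_measurable M" and a: "a \<in> borel_measurable N'" and b: "b \<in> measurable N' M"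
  shows "(\<lambda>z. njumps S (a z) (b z)) \<in> measurable N' (count_space UNIV)"
proof -
  have T: "(\<lambda>z. jump_time S k (b z)) \<in> borel_measurable N'" for k
    unfolding jump_time_def by (intro borel_measurable_sum measurable_compose[OF b S])
  show ?thesis unfolding njumps_def
  proof (rule measurable_card)
    fix k
    have "{z \<in> space N'. k \<in> {k. 1 \<le> k \<and> jump_time S k (b z) \<le> a z}} = (if 1 \<le> k then {z \<in> space N'. jump_time S k (b z) \<le> a z} else {})"
      by auto
    then show "{z \<in> space N'. k \<in> {k. 1 \<le> k \<and> jump_time S k (b z) \<le> a z}} \<in> sets N'"
      using borel_measurable_le[OF T[of k] a] by simp
  qed
qed

section \<open>Measurability of the paths up to and beyond a possible explosion\<close>

locale skeleton =
  fixes M :: "'w measure" and Jc :: "nat \<Rightarrow> 'w \<Rightarrow> nat" and S U :: "nat \<Rightarrow> 'w \<Rightarrow> real"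
  assumes J_meas: "\<And>k. Jc k \<in> measurable M (count_space UNIV)"
    and S_meas [measurable]: "\<And>k. S k \<in> borel_measurable M"
    and U_meas [measurable]: "\<And>k. U k \<in> borel_measurable M"
begin

text \<open>The explosion time; almost surely infinite, but measurability has to be settled on all
  paths.\<close>

definition ui :: "'w \<Rightarrow> ereal" where "ui \<omega> = liminf (\<lambda>k. ereal (jump_time S k \<omega>))"

lemma T_meas [measurable]: "jump_time S k \<in> borel_measurable M"
  unfolding jump_time_def[abs_def] by measurable

lemma ui_meas [measurable]: "ui \<in> borel_measurable M"
  unfolding ui_def[abs_def] by measurable

lemma Jproc_measurable:
  assumes a: "a \<in> borel_measurable N'" and b: "b \<in> measurable N' M"
  shows "(\<lambda>z. Jproc Jc S (a z) (b z)) \<in> measurable N' (count_space UNIV)"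
  unfolding Jproc_def
  by (rule measurable_compose_countable[OF measurable_compose[OF b J_meas] njumps_measurable[OF S_meas a b]])

lemma premium_measurable: "(\<lambda>z. p (Jproc Jc S (snd z) (fst z)) :: real) \<in> borel_measurable (M \<Otimes>\<^sub>M lborel)"
  by (rule measurable_compose[OF Jproc_measurable]) auto

text \<open>The Lebesgue counterpart of the gauge integral in \<open>Xproc\<close>. It is measurable
  in the path by Fubini and agrees with the gauge integral before the explosion time.\<close>

definition V :: "(nat \<Rightarrow> real) \<Rightarrow> real \<Rightarrow> 'w \<Rightarrow> real" where
  "V p t \<omega> = (\<integral>u. indicator {0..t} u * p (Jproc Jc S u \<omega>) \<partial>lborel)"

lemma V_measurable:
  assumes [measurable]: "\<theta> \<in> borel_measurable M"
  shows "(\<lambda>\<omega>. V p (\<theta> \<omega>) \<omega>) \<in> borel_measurable M"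
proof -
  note premium_measurable[of p, measurable]
  have ind: "(\<lambda>z. indicator {0..\<theta> (fst z)} (snd z) :: real) \<in> borel_measurable (M \<Otimes>\<^sub>M lborel)"
  proof -
    have "(\<lambda>z. if 0 \<le> snd z \<and> snd z \<le> \<theta> (fst z) then 1 else 0 :: real) \<in> borel_measurable (M \<Otimes>\<^sub>M lborel)" by measurable
    also have "(\<lambda>z. if 0 \<le> snd z \<and> snd z \<le> \<theta> (fst z) then 1 else 0 :: real) = (\<lambda>z. indicator {0..\<theta> (fst z)} (snd z))"
      by (auto simp: indicator_def)
    finally show ?thesis .
  qed
  have "(\<lambda>z. indicator {0..\<theta> (fst z)} (snd z) * p (Jproc Jc S (snd z) (fst z))) \<in> borel_measurable (M \<Otimes>\<^sub>M lborel)"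
    using ind premium_measurable[of p] by (rule borel_measurable_times)
  then show ?thesis unfolding V_def
    by (intro lborel.borel_measurable_lebesgue_integral) (simp add: case_prod_unfold)
qed

text \<open>Before explosion only finitely many values of the counter occur, so the premium rate is
  bounded and both integrals exist and agree.\<close>

lemma premium_integrable:
  assumes t: "ereal t < ui \<omega>" and w: "\<omega> \<in> space M"
  shows "(\<lambda>u. p (Jproc Jc S u \<omega>)) integrable_on {0..t}" "V p t \<omega> = integral {0..t} (\<lambda>u. p (Jproc Jc S u \<omega>))"
proof -
  let ?f = "\<lambda>u. p (Jproc Jc S u \<omega>)"
  obtain r where r: "t < r" "finite {k. jump_time S k \<omega> \<le> r}" using finite_jumps[of t S \<omega>] t by (auto simp: ui_def)
  define K where "K = {k. 1 \<le> k \<and> jump_time S k \<omega> \<le> t}"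
  have fK: "finite K" by (rule finite_subset[OF _ r(2)]) (use r in \<open>auto simp: K_def\<close>)
  define B where "B = Max ((\<lambda>n. \<bar>p (Jc n \<omega>)\<bar>) ` {..card K})"
  have bd: "norm (?f u) \<le> B" if "u \<in> {0..t}" for u
  proof -
    have "njumps S u \<omega> \<le> card K" unfolding njumps_def by (rule card_mono[OF fK]) (use that in \<open>auto simp: K_def\<close>)
    then show ?thesis unfolding B_def Jproc_def by (intro Max_ge) auto
  qed
  have fm: "?f \<in> borel_measurable lborel"
    using measurable_compose[OF Jproc_measurable[of "\<lambda>u. u" lborel "\<lambda>_. \<omega>"], of p borel] w by simp
  have si: "set_integrable lborel {0..t} ?f" unfolding set_integrable_def
    by (rule integrableI_bounded_set_indicator[OF _ fm]) (use bd in \<open>auto simp: emeasure_lborel_Icc_eq\<close>)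
  show "?f integrable_on {0..t}" using set_borel_integral_eq_integral(1)[OF si] .
  show "V p t \<omega> = integral {0..t} ?f" using set_borel_integral_eq_integral(2)[OF si] by (simp add: V_def set_lebesgue_integral_def)
qed

lemma Jproc_beyond: "ui \<omega> < ereal u \<Longrightarrow> Jproc Jc S u \<omega> = Jc 0 \<omega>"
  by (simp add: Jproc_def njumps_zero_beyond ui_def)

text \<open>The condition of \<open>rational_Cauchy_at_left\<close> for the premium integral near
  the explosion time; rescaling by that time moves the random endpoint to 1.\<close>

definition cauchy_end :: "(nat \<Rightarrow> real) \<Rightarrow> 'w \<Rightarrow> bool" where
  "cauchy_end p \<omega> \<longleftrightarrow> (\<forall>k::nat. \<exists>n::nat. \<forall>r\<in>\<rat>. \<forall>r'\<in>\<rat>. 0 < r \<and> 0 < r' \<and> 1 - 1 / (real n + 1) < r \<and> 1 - 1 / (real n + 1) < r' \<and> r < 1 \<and> r' < 1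
       \<longrightarrow> \<bar>V p (r * real_of_ereal (ui \<omega>)) \<omega> - V p (r' * real_of_ereal (ui \<omega>)) \<omega>\<bar> \<le> 1 / (real k + 1))"

lemma cauchy_end_measurable: "Measurable.pred M (cauchy_end p)"
proof -
  have [measurable]: "(\<lambda>\<omega>. V p (r * real_of_ereal (ui \<omega>)) \<omega>) \<in> borel_measurable M" for r
    by (rule V_measurable) measurable
  have rat: "(\<forall>r\<in>\<rat>. Q r) \<longleftrightarrow> (\<forall>r. Q (real_of_rat r))" for Q :: "real \<Rightarrow> bool" by (auto simp: Rats_def)
  show ?thesis unfolding cauchy_end_def[abs_def] rat by measurable
qed

text \<open>Hake's theorem together with continuity of the indefinite integral: the integral up to
  the explosion time exists iff the integrals before it converge, which is decided by countably many
  values of \<open>V\<close>.\<close>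

lemma integral_to_explosion:
  assumes g: "ui \<omega> = ereal g" "0 < g" and w: "\<omega> \<in> space M"
  shows "(\<lambda>u. p (Jproc Jc S u \<omega>)) integrable_on {0..g} \<longleftrightarrow> cauchy_end p \<omega>"
    and "cauchy_end p \<omega> \<Longrightarrow> integral {0..g} (\<lambda>u. p (Jproc Jc S u \<omega>)) = lim (\<lambda>n. V p ((1 - 1 / (real n + 1)) * g) \<omega>)"
proof -
  let ?f = "\<lambda>u. p (Jproc Jc S u \<omega>)"
  define h where "h r = integral {0..r * g} ?f" for r
  have fi: "?f integrable_on {0..v}" if "v < g" for v by (rule premium_integrable(1)[OF _ w]) (use that g in auto)
  have hV: "V p (r * g) \<omega> = h r" if "r < 1" for r
    unfolding h_def by (rule premium_integrable(2)[OF _ w]) (use that g in \<open>simp add: mult_less_cancel_right1\<close>)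
  have cont: "continuous_on {0..<1} h"
    unfolding continuous_on_eq_continuous_within
  proof
      fix r :: real assume r: "r \<in> {0..<1}"
      define r1 where "r1 = (r + 1) / 2"
      have r1: "r < r1" "r1 < 1" "0 < r1" using r by (auto simp: r1_def)
      have "continuous_on {0..r1 * g} (\<lambda>v. integral {0..v} ?f)"
        by (rule indefinite_integral_continuous_1[OF fi]) (use r1 g in \<open>simp add: mult_less_cancel_right1\<close>)
      then have "continuous_on {0..r1} h" unfolding h_def
        by (rule continuous_on_compose2) (use g in \<open>auto intro!: continuous_intros mult_right_mono\<close>)
      then have "continuous (at r within {0..r1}) h" using r r1 by (simp add: continuous_on_eq_continuous_within)
      moreover have "at r within {0..<1} = at r within {0..r1}"
        by (rule at_within_nhd[of r "{..<r1}"]) (use r r1 in auto)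
      ultimately show "continuous (at r within {0..<1}) h" by (simp add: continuous_within)
  qed
  have C: "cauchy_end p \<omega> \<longleftrightarrow> (\<exists>L. (h \<longlongrightarrow> L) (at_left 1))"
    unfolding rational_Cauchy_at_left[OF cont] cauchy_end_def using g by (simp add: hV cong: conj_cong imp_cong)
  have fl: "filterlim (\<lambda>v. v / g) (at_left 1) (at_left g)" "filterlim (\<lambda>v. v * g) (at_left g) (at_left 1)"
  proof -
    have "((\<lambda>v. v / g) \<longlongrightarrow> g / g) (at_left g)" by (intro tendsto_intros) (use g in simp)
    moreover have "((\<lambda>v. v * g) \<longlongrightarrow> 1 * g) (at_left 1)" by (intro tendsto_intros)
    moreover have "eventually (\<lambda>v. v / g \<in> {..<1} \<and> v / g \<noteq> 1) (at_left g)"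
      using eventually_at_left_real[of 0 g] g by (auto elim!: eventually_mono)
    moreover have "eventually (\<lambda>v. v * g \<in> {..<g} \<and> v * g \<noteq> g) (at_left 1)"
      using eventually_at_left_real[of 0 1] g by (auto elim!: eventually_mono simp: mult_less_cancel_right1)
    ultimately show "filterlim (\<lambda>v. v / g) (at_left 1) (at_left g)" "filterlim (\<lambda>v. v * g) (at_left g) (at_left 1)"
      using g by (simp_all add: filterlim_at)
  qed
  have toh: "(h \<longlongrightarrow> integral {0..g} ?f) (at_left 1)" if "?f integrable_on {0..g}"
  proof -
    have "continuous_on {0..g} (\<lambda>v. integral {0..v} ?f)" by (rule indefinite_integral_continuous_1[OF that])
    then have "((\<lambda>v. integral {0..v} ?f) \<longlongrightarrow> integral {0..g} ?f) (at g within {0..g})"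
      using g by (simp add: continuous_on_def)
    moreover have "at g within {0..g} = at_left g"
      by (rule at_within_nhd[of g "{0<..}"]) (use g in auto)
    ultimately have "((\<lambda>v. integral {0..v} ?f) \<longlongrightarrow> integral {0..g} ?f) (at_left g)" by simp
    from filterlim_compose[OF this fl(2)] show ?thesis unfolding h_def .
  qed
  show iff: "?f integrable_on {0..g} \<longleftrightarrow> cauchy_end p \<omega>"
  proof
    assume "cauchy_end p \<omega>"
    then obtain L where "(h \<longlongrightarrow> L) (at_left 1)" using C by blast
    from filterlim_compose[OF this fl(1)] have "((\<lambda>v. integral {0..v} ?f) \<longlongrightarrow> L) (at_left g)"
      using g by (simp add: h_def)
    then show "?f integrable_on {0..g}" using hake[OF g(2), of ?f L] fi by blast
  qed (use toh C in blast)
  assume "cauchy_end p \<omega>"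
  then have *: "(h \<longlongrightarrow> integral {0..g} ?f) (at_left 1)" using iff toh by blast
  have "filterlim (\<lambda>n. 1 - 1 / (real n + 1)) (at_left 1) sequentially" by real_asymp
  from filterlim_compose[OF * this] have "(\<lambda>n. V p ((1 - 1 / (real n + 1)) * g) \<omega>) \<longlonglongrightarrow> integral {0..g} ?f"
    by (simp add: hV)
  then show "integral {0..g} ?f = lim (\<lambda>n. V p ((1 - 1 / (real n + 1)) * g) \<omega>)" by (rule limI[symmetric])
qed

text \<open>Past the explosion time the counter is 0, so the environment is frozen at
  \<open>Jc 0 \<omega>\<close>; if the integral up to that time does not exist, all later ones are 0
  by convention.\<close>

lemma integral_beyond_explosion:
  assumes g: "ui \<omega> = ereal g" "0 < g" "g \<le> t"
  shows "integral {0..t} (\<lambda>u. p (Jproc Jc S u \<omega>)) =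
    (if (\<lambda>u. p (Jproc Jc S u \<omega>)) integrable_on {0..g} then integral {0..g} (\<lambda>u. p (Jproc Jc S u \<omega>)) + p (Jc 0 \<omega>) * (t - g) else 0)"
proof -
  let ?f = "\<lambda>u. p (Jproc Jc S u \<omega>)"
  have "((\<lambda>_. p (Jc 0 \<omega>)) has_integral (t - g) *\<^sub>R p (Jc 0 \<omega>)) {g..t}" using has_integral_const_real[of "p (Jc 0 \<omega>)" g t] g by simp
  then have "(?f has_integral (t - g) *\<^sub>R p (Jc 0 \<omega>)) {g..t}"
    by (rule has_integral_spike_finite[of "{g}", rotated 2]) (auto simp: Jproc_beyond g)
  then have i2: "(?f has_integral p (Jc 0 \<omega>) * (t - g)) {g..t}" by (simp add: mult.commute)
  show ?thesis
  proof (cases "?f integrable_on {0..g}")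
    case True
    have "(?f has_integral integral {0..g} ?f + p (Jc 0 \<omega>) * (t - g)) {0..t}"
      by (rule has_integral_combine[OF _ g(3) integrable_integral[OF True] i2]) (use g in auto)
    then show ?thesis using True by (simp add: integral_unique)
  next
    case False
    have "\<not> ?f integrable_on {0..t}"
    proof
      assume "?f integrable_on {0..t}"
      then have "?f integrable_on {0..g}" by (rule integrable_on_subinterval) (use g in auto)
      then show False using False by simp
    qed
    then show ?thesis using False by (simp add: not_integrable_integral)
  qed
qed

lemma integral_after_explosion:
  assumes g: "ui \<omega> \<le> 0" "0 < t"
  shows "integral {0..t} (\<lambda>u. p (Jproc Jc S u \<omega>)) = p (Jc 0 \<omega>) * t"
proof -
  have "((\<lambda>_. p (Jc 0 \<omega>)) has_integral t *\<^sub>R p (Jc 0 \<omega>)) {0..t}" using has_integral_const_real[of "p (Jc 0 \<omega>)" 0 t] g by simp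
  then have "((\<lambda>u. p (Jproc Jc S u \<omega>)) has_integral t *\<^sub>R p (Jc 0 \<omega>)) {0..t}"
  proof (rule has_integral_spike_finite[of "{0}", rotated 2])
    fix u assume "u \<in> {0..t} - {0}"
    then have "ui \<omega> < ereal u" using g(1) by (auto intro: le_less_trans)
    then show "p (Jproc Jc S u \<omega>) = p (Jc 0 \<omega>)" by (simp add: Jproc_beyond)
  qed simp
  then show ?thesis by (simp add: integral_unique mult.commute)
qed

text \<open>According to the position of \<open>\<theta>\<close> relative to 0 and to the explosion
  time, the integral is one of finitely many expressions, each measurable by means of
  \<open>V\<close> and \<open>cauchy_end\<close>.\<close>

lemma premium_integral_measurable:
  fixes p :: "nat \<Rightarrow> real"
  assumes \<theta> [measurable]: "\<theta> \<in> borel_measurable M"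
  shows "(\<lambda>\<omega>. integral {0..\<theta> \<omega>} (\<lambda>u. p (Jproc Jc S u \<omega>))) \<in> borel_measurable M"
proof -
  have [measurable]: "(\<lambda>\<omega>. p (Jc 0 \<omega>)) \<in> borel_measurable M" by (rule measurable_compose[OF J_meas]) simp
  have [measurable]: "(\<lambda>\<omega>. V p (\<theta> \<omega>) \<omega>) \<in> borel_measurable M" by (rule V_measurable) fact
  have [measurable]: "(\<lambda>\<omega>. lim (\<lambda>n. V p ((1 - 1 / (real n + 1)) * real_of_ereal (ui \<omega>)) \<omega>)) \<in> borel_measurable M"
    by (intro borel_measurable_lim_metric V_measurable) measurable
  note cauchy_end_measurable[of p, measurable]
  have "integral {0..\<theta> \<omega>} (\<lambda>u. p (Jproc Jc S u \<omega>)) =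
    (if \<theta> \<omega> \<le> 0 then 0 else if ereal (\<theta> \<omega>) < ui \<omega> then V p (\<theta> \<omega>) \<omega> else if ui \<omega> \<le> 0 then p (Jc 0 \<omega>) * \<theta> \<omega>
     else if cauchy_end p \<omega> then lim (\<lambda>n. V p ((1 - 1 / (real n + 1)) * real_of_ereal (ui \<omega>)) \<omega>) + p (Jc 0 \<omega>) * (\<theta> \<omega> - real_of_ereal (ui \<omega>)) else 0)"
    if w: "\<omega> \<in> space M" for \<omega>
  proof -
    consider "\<theta> \<omega> \<le> 0" | "0 < \<theta> \<omega>" "ereal (\<theta> \<omega>) < ui \<omega>" | "0 < \<theta> \<omega>" "ui \<omega> \<le> 0"
      | "0 < \<theta> \<omega>" "ui \<omega> \<le> ereal (\<theta> \<omega>)" "0 < ui \<omega>" by fastforce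
    then show ?thesis
    proof cases
      case 1
      then show ?thesis by (cases "\<theta> \<omega> = 0") auto
    next
      case 2
      then show ?thesis using premium_integrable(2)[OF 2(2) w] by simp
    next
      case 3
      then have "\<not> ereal (\<theta> \<omega>) < ui \<omega>" by (auto simp: not_less intro: order.trans)
      then show ?thesis using 3 integral_after_explosion[OF 3(2,1)] by simp
    next
      case 4
      then obtain g where g: "ui \<omega> = ereal g" "0 < g" "g \<le> \<theta> \<omega>" by (cases "ui \<omega>") auto
      then show ?thesis using 4 integral_beyond_explosion[OF g, of p] integral_to_explosion[OF g(1,2) w, of p] by auto
    qed
  qed
  then show ?thesis by (subst measurable_cong) measurable
qed

lemma Xproc_measurable:
  assumes \<theta>: "\<theta> \<in> borel_measurable M"
  shows "(\<lambda>\<omega>. Xproc p Jc S U x (\<theta> \<omega>) \<omega>) \<in> borel_measurable M"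
proof -
  have n: "(\<lambda>\<omega>. njumps S (\<theta> \<omega>) \<omega>) \<in> measurable M (count_space UNIV)" by (rule njumps_measurable[OF S_meas \<theta>]) simp
  have [measurable]: "(\<lambda>\<omega>. \<Sum>k\<in>{1..njumps S (\<theta> \<omega>) \<omega>}. U k \<omega>) \<in> borel_measurable M"
    by (rule measurable_compose_countable[OF _ n]) measurable
  note premium_integral_measurable[OF \<theta>, of p, measurable]
  show ?thesis unfolding Xproc_def by measurable
qed

lemma xi_measurable: "xi p Jc S U k \<in> borel_measurable M"
  unfolding xi_def[abs_def] by (intro borel_measurable_diff Xproc_measurable T_meas)

text \<open>Test times for the ruin event, indexed by a countable type: epochs, rationals and the
  explosion time. An infinite explosion time is represented by the real number 0.\<close>

definition tms :: "nat + rat + unit \<Rightarrow> 'w \<Rightarrow> real" where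
  "tms z \<omega> = (case z of Inl k \<Rightarrow> jump_time S k \<omega> | Inr (Inl r) \<Rightarrow> of_rat r | Inr (Inr _) \<Rightarrow> real_of_ereal (ui \<omega>))"

lemma tms_measurable [measurable]: "tms z \<in> borel_measurable M"
  unfolding tms_def[abs_def] by (cases z; cases "projr z") auto

lemma excursion_tms:
  "excursion (\<lambda>t. Xproc p Jc S U x t \<omega>) \<zeta> UNIV \<longleftrightarrow> excursion (\<lambda>t. Xproc p Jc S U x t \<omega>) \<zeta> (range (\<lambda>z. tms z \<omega>))"
proof (rule excursion_countable[of "real_of_ereal (ui \<omega>)"])
  have ne: "ereal s \<noteq> liminf (\<lambda>k. ereal (jump_time S k \<omega>))" if "s \<noteq> real_of_ereal (ui \<omega>)" for s
    using that unfolding ui_def by (metis real_of_ereal.simps(1))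
  have R: "real_of_ereal (ui \<omega>) = tms (Inr (Inr ())) \<omega>" "jump_time S k \<omega> = tms (Inl k) \<omega>" for k by (auto simp: tms_def)
  show "real_of_ereal (ui \<omega>) \<in> range (\<lambda>z. tms z \<omega>)" using R by blast
  show "\<rat> \<subseteq> range (\<lambda>z. tms z \<omega>)"
  proof
    fix x :: real assume "x \<in> \<rat>"
    then obtain r where "x = of_rat r" by (rule Rats_cases)
    then have "x = tms (Inr (Inl r)) \<omega>" by (simp add: tms_def)
    then show "x \<in> range (\<lambda>z. tms z \<omega>)" by blast
  qed
  show "\<exists>\<eta>>0. \<exists>\<beta>. \<forall>v. s \<le> v \<and> v < s + \<eta> \<longrightarrow> Xproc p Jc S U x v \<omega> = Xproc p Jc S U x s \<omega> + \<beta> * (v - s)"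
    if "0 \<le> s" "s \<noteq> real_of_ereal (ui \<omega>)" for s
    using Xproc_affine[OF that(1) ne[OF that(2)], of p Jc U x] by blast
  fix s assume s: "0 < s" "s \<notin> range (\<lambda>z. tms z \<omega>)"
  then have "s \<noteq> real_of_ereal (ui \<omega>)" "s \<notin> range (\<lambda>k. jump_time S k \<omega>)" using R by auto
  then show "\<exists>\<eta>>0. \<exists>\<beta>. \<forall>v. \<bar>v - s\<bar> < \<eta> \<longrightarrow> Xproc p Jc S U x v \<omega> = Xproc p Jc S U x s \<omega> + \<beta> * (v - s)"
    using Xproc_affine[OF less_imp_le[OF s(1)] ne, of p Jc U x] s by blast
qed

lemma ruin_event_measurable: "{\<omega> \<in> space M. tau_zeta p Jc S U \<zeta> x \<omega> < \<infinity>} \<in> sets M"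
proof -
  have [measurable]: "(\<lambda>\<omega>. Xproc p Jc S U x (tms z \<omega>) \<omega>) \<in> borel_measurable M" for z
    by (rule Xproc_measurable) measurable
  have "{\<omega> \<in> space M. tau_zeta p Jc S U \<zeta> x \<omega> < \<infinity>} = {\<omega> \<in> space M. \<exists>z. 0 < tms z \<omega> \<and> Xproc p Jc S U x (tms z \<omega>) \<omega> < 0 \<and>
      (\<forall>y. 0 \<le> tms y \<omega> \<and> tms z \<omega> - \<zeta> < tms y \<omega> \<and> tms y \<omega> < tms z \<omega> \<longrightarrow> Xproc p Jc S U x (tms y \<omega>) \<omega> < 0)}"
    unfolding tau_zeta_finite_iff excursion_tms unfolding excursion_def by auto
  also have "\<dots> \<in> sets M" by measurable
  finally show ?thesis .
qed

end


section \<open>Pathwise comparison of ruin with the embedded walk\<close>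

context mmrp
begin

definition pmax where "pmax = Max (p ` St)"

lemma p_le_pmax: "j \<in> St \<Longrightarrow> p j \<le> pmax"
  unfolding pmax_def by (intro Max_ge) auto

end

context mmrp_start
begin

sublocale skeleton "Pr i" Jc S U by unfold_locales measurable

lemma pmax_pos: "0 < pmax" using p_le_pmax[OF i] premium i by force

context
  fixes \<omega> assumes good: "good \<omega>"
begin

lemma T_less: "m < n \<Longrightarrow> T m \<omega> < T n \<omega>"
proof (rule lift_Suc_mono_less[of "\<lambda>n. T n \<omega>"])
  show "T n \<omega> < T (Suc n) \<omega>" for n using good by (auto simp: T_Suc good_def)
qed

lemma T_le: "m \<le> n \<Longrightarrow> T m \<omega> \<le> T n \<omega>"
  using T_less[of m n] by (cases "m = n") auto

lemma njumps_good: assumes "T m \<omega> \<le> t" "t < T (Suc m) \<omega>" shows "njumps S t \<omega> = m"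
proof -
  have "{k. 1 \<le> k \<and> T k \<omega> \<le> t} = {1..m}"
  proof (intro equalityI subsetI)
    fix k assume k: "k \<in> {k. 1 \<le> k \<and> T k \<omega> \<le> t}"
    show "k \<in> {1..m}"
    proof (rule ccontr)
      assume "k \<notin> {1..m}"
      then have "Suc m \<le> k" using k by auto
      then show False using T_le[of "Suc m" k] k assms by auto
    qed
  next
    fix k assume "k \<in> {1..m}"
    then show "k \<in> {k. 1 \<le> k \<and> T k \<omega> \<le> t}" using T_le[of k m] assms by simp
  qed
  then show ?thesis by (simp add: njumps_def)
qed

lemma interval_exists: assumes "0 \<le> t" shows "\<exists>m. T m \<omega> \<le> t \<and> t < T (Suc m) \<omega>"
proof -
  have "eventually (\<lambda>n. t < T n \<omega>) sequentially"
    using good unfolding good_def filterlim_at_top_dense by blast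
  then have ex: "\<exists>n. t < T n \<omega>" unfolding eventually_sequentially by blast
  define n where "n = (LEAST n. t < T n \<omega>)"
  have n: "t < T n \<omega>" unfolding n_def using ex by (rule LeastI_ex)
  have "n \<noteq> 0"
  proof
    assume "n = 0"
    then show False using n assms by (simp add: T_0)
  qed
  then obtain m where m: "n = Suc m" by (cases n) auto
  have "\<not> t < T m \<omega>" using not_less_Least[of m "\<lambda>n. t < T n \<omega>"] m by (auto simp: n_def)
  then show ?thesis using n m by (intro exI[of _ m]) auto
qed

definition prem where "prem m = (\<Sum>l\<in>{1..m}. p (Jc (l - 1) \<omega>) * S l \<omega>)"

lemma prem_Suc: "prem (Suc m) = prem m + p (Jc m \<omega>) * S (Suc m) \<omega>"
  by (simp add: prem_def sum.nat_ivl_Suc' add.commute)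

lemma premium_integral_good:
  "T m \<omega> \<le> t \<Longrightarrow> t \<le> T (Suc m) \<omega> \<Longrightarrow> ((\<lambda>u. p (Jproc Jc S u \<omega>)) has_integral prem m + p (Jc m \<omega>) * (t - T m \<omega>)) {0..t}"
proof (induction m arbitrary: t)
  have piece: "((\<lambda>u. p (Jproc Jc S u \<omega>)) has_integral p (Jc m \<omega>) * (t - T m \<omega>)) {T m \<omega>..t}" if "T m \<omega> \<le> t" "t \<le> T (Suc m) \<omega>" for m t
  proof -
    have "((\<lambda>_. p (Jc m \<omega>)) has_integral (t - T m \<omega>) *\<^sub>R p (Jc m \<omega>)) {T m \<omega>..t}"
      using has_integral_const_real[of "p (Jc m \<omega>)" "T m \<omega>" t] that by simp
    then have "((\<lambda>u. p (Jproc Jc S u \<omega>)) has_integral (t - T m \<omega>) *\<^sub>R p (Jc m \<omega>)) {T m \<omega>..t}"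
    proof (rule has_integral_spike_finite[of "{t}", rotated 2])
      fix u assume "u \<in> {T m \<omega>..t} - {t}"
      then have "njumps S u \<omega> = m" using that by (intro njumps_good) auto
      then show "p (Jproc Jc S u \<omega>) = p (Jc m \<omega>)" by (simp add: Jproc_def)
    qed simp
    then show ?thesis by (simp add: mult.commute)
  qed
  { case 0 then show ?case using piece[of 0 t] by (simp add: T_0 prem_def) }
  { case (Suc m)
    have a: "((\<lambda>u. p (Jproc Jc S u \<omega>)) has_integral prem (Suc m)) {0..T (Suc m) \<omega>}"
      using Suc.IH[of "T (Suc m) \<omega>"] T_le[of m "Suc m"] by (simp add: T_Suc prem_Suc)
    show ?case
      by (rule has_integral_combine[OF _ Suc.prems(1) a piece[OF Suc.prems]]) (use T_le[of 0 "Suc m"] in \<open>simp add: T_0\<close>) }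
qed

lemma W_prem: "W m \<omega> = (\<Sum>k\<in>{1..m}. U k \<omega>) - prem m"
  by (simp add: W_def prem_def sum_subtractf)

lemma Xproc_good:
  assumes "T m \<omega> \<le> t" "t < T (Suc m) \<omega>"
  shows "Xproc p Jc S U x t \<omega> = x - W m \<omega> + p (Jc m \<omega>) * (t - T m \<omega>)"
  unfolding Xproc_def njumps_good[OF assms] integral_unique[OF premium_integral_good[OF assms(1) less_imp_le[OF assms(2)]]] W_prem
  by simp

lemma xi_good: "xi p Jc S U (Suc m) \<omega> = W (Suc m) \<omega> - W m \<omega>"
  using Xproc_good[of m "T m \<omega>" 0] Xproc_good[of "Suc m" "T (Suc m) \<omega>" 0] T_less[of m "Suc m"] T_less[of "Suc m" "Suc (Suc m)"]
  by (simp add: xi_def)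

text \<open>Claims only raise \<open>W\<close>, and premiums lower it by at most \<open>pmax\<close>
  per unit of time.\<close>

lemma W_growth: "m \<le> n \<Longrightarrow> W m \<omega> - pmax * (T n \<omega> - T m \<omega>) \<le> W n \<omega>"
proof (induction n rule: dec_induct)
  case (step n)
  have g: "Jc n \<omega> \<in> St" "0 < S (Suc n) \<omega>" "0 \<le> U (Suc n) \<omega>" using good by (auto simp: good_def)
  have "p (Jc n \<omega>) * S (Suc n) \<omega> \<le> pmax * S (Suc n) \<omega>" using p_le_pmax[OF g(1)] g by (intro mult_right_mono) auto
  moreover have "pmax * (T (Suc n) \<omega> - T m \<omega>) = pmax * (T n \<omega> - T m \<omega>) + pmax * S (Suc n) \<omega>" by (simp add: T_Suc algebra_simps)
  ultimately show ?case using step.IH g(3) W_Suc[of n \<omega>] by linarith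
qed simp

lemma Xproc_bound:
  assumes "T m \<omega> \<le> t" shows "Xproc p Jc S U x t \<omega> \<le> x - W m \<omega> + pmax * (t - T m \<omega>)"
proof -
  have "0 \<le> T m \<omega>" using T_le[of 0 m] by (simp add: T_0)
  then obtain n where n: "T n \<omega> \<le> t" "t < T (Suc n) \<omega>" using interval_exists[of t] assms by auto
  have mn: "m \<le> n"
  proof (rule ccontr)
    assume "\<not> m \<le> n"
    then show False using T_le[of "Suc n" m] n assms by auto
  qed
  have "p (Jc n \<omega>) * (t - T n \<omega>) \<le> pmax * (t - T n \<omega>)"
    using good n by (intro mult_right_mono p_le_pmax) (auto simp: good_def)
  then show ?thesis using W_growth[OF mn] Xproc_good[OF n, of x] by (simp add: algebra_simps)
qed

text \<open>Between epochs the surplus increases, so a surplus that is negative at \<open>t\<close>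
  was already negative at the last epoch.\<close>

lemma ruin_upper: assumes "tau_zeta p Jc S U \<zeta> x \<omega> < \<infinity>" shows "\<exists>m. x < W m \<omega>"
proof -
  obtain t where t: "0 < t" "Xproc p Jc S U x t \<omega> < 0" using assms unfolding tau_zeta_finite_iff excursion_def by blast
  obtain m where m: "T m \<omega> \<le> t" "t < T (Suc m) \<omega>" using interval_exists[of t] t by auto
  have "0 < p (Jc m \<omega>)" using good premium by (auto simp: good_def)
  then have "0 \<le> p (Jc m \<omega>) * (t - T m \<omega>)" using m by simp
  then show ?thesis using Xproc_good[OF m, of x] t by (intro exI[of _ m]) simp
qed

text \<open>A deficit exceeding \<open>pmax * \<zeta>\<close> at an epoch cannot be repaired within
  time \<open>\<zeta>\<close>, so the surplus stays negative long enough.\<close>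

lemma ruin_lower: assumes W: "x + pmax * \<zeta> < W m \<omega>" and \<zeta>: "0 < \<zeta>" shows "tau_zeta p Jc S U \<zeta> x \<omega> < \<infinity>"
  unfolding tau_zeta_finite_iff excursion_def
proof (intro bexI[of _ "T m \<omega> + \<zeta>"] conjI ballI impI)
  have neg: "Xproc p Jc S U x t \<omega> < 0" if "T m \<omega> \<le> t" "t \<le> T m \<omega> + \<zeta>" for t
  proof -
    have "pmax * (t - T m \<omega>) \<le> pmax * \<zeta>" using that pmax_pos by (intro mult_left_mono) auto
    then show ?thesis using Xproc_bound[OF that(1), of x] W by simp
  qed
  show "0 < T m \<omega> + \<zeta>" using T_le[of 0 m] \<zeta> by (simp add: T_0)
  show "Xproc p Jc S U x (T m \<omega> + \<zeta>) \<omega> < 0" using neg \<zeta> by simp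
  show "Xproc p Jc S U x s \<omega> < 0" if "0 \<le> s \<and> T m \<omega> + \<zeta> - \<zeta> < s \<and> s < T m \<omega> + \<zeta>" for s
    using neg[of s] that by simp
qed simp

text \<open>Both sums telescope to the value of the surplus at the minimum of 1 and the n-th epoch.\<close>
lemma surplus_stopped:
  "Xproc p Jc S U 0 1 \<omega> \<le> (\<Sum>k<n. p (Jc k \<omega>) * (min 1 (T (Suc k) \<omega>) - min 1 (T k \<omega>)))
     - (\<Sum>k<n. U (Suc k) \<omega> * indicator {..1} (T (Suc k) \<omega>)) + pmax * indicator {..1} (T n \<omega>)"
proof -
  let ?A = "\<lambda>n. \<Sum>k<n. p (Jc k \<omega>) * (min 1 (T (Suc k) \<omega>) - min 1 (T k \<omega>))"
  let ?B = "\<lambda>n. \<Sum>k<n. U (Suc k) \<omega> * indicator {..1} (T (Suc k) \<omega>)"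
  have before: "?A n - ?B n = - W n \<omega>" if "T n \<omega> \<le> 1" for n
    using that
  proof (induction n)
    case (Suc n)
    have "T n \<omega> \<le> 1" using Suc.prems T_le[of n "Suc n"] by simp
    then show ?case using Suc by (simp add: W_Suc T_Suc algebra_simps)
  qed (simp add: W_0)
  obtain m where m: "T m \<omega> \<le> 1" "1 < T (Suc m) \<omega>" using interval_exists[of 1] by auto
  have X1: "Xproc p Jc S U 0 1 \<omega> = - W m \<omega> + p (Jc m \<omega>) * (1 - T m \<omega>)" using Xproc_good[OF m, of 0] by simp
  show ?thesis
  proof (cases "T n \<omega> \<le> 1")
    case True
    have "pmax * (1 - T n \<omega>) \<le> pmax * 1" using pmax_pos T_le[of 0 n] by (intro mult_left_mono) (auto simp: T_0)
    then show ?thesis using before[OF True] Xproc_bound[OF True, of 0] True by simp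
  next
    case False
    have mn: "Suc m \<le> n"
    proof (rule ccontr)
      assume "\<not> Suc m \<le> n"
      then show False using T_le[of n m] m False by auto
    qed
    have after: "?A n - ?B n = ?A (Suc m) - ?B (Suc m)" using mn
    proof (induction n rule: dec_induct)
      case (step n)
      have "1 < T n \<omega>" "1 < T (Suc n) \<omega>" using T_le[of "Suc m" n] T_le[of "Suc m" "Suc n"] step.hyps m by auto
      then show ?case using step.IH by simp
    qed simp
    have "?A (Suc m) - ?B (Suc m) = ?A m - ?B m + p (Jc m \<omega>) * (1 - T m \<omega>)" using m by simp
    then show ?thesis using before[OF m(1)] after X1 False by simp
  qed
qed

end

subsection \<open>The maximum of the embedded walk\<close>

definition \<phi>0 :: "nat \<Rightarrow> real \<Rightarrow> real" where "\<phi>0 = (\<lambda>j y. if y < 0 then 1 else 0)"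

text \<open>Each use of \<open>walk_step\<close> trades one unit of time for one application of
  \<open>stp\<close>; the induction therefore runs for all \<open>m\<close> at once, down to
  \<open>VV_zero\<close>.\<close>

lemma walk_maximum_finite:
  assumes ua: "\<And>n j. j \<in> St \<Longrightarrow> unit_antimono ((stp ^^ n) \<phi>0 j)"
  shows "prob {\<omega>\<in>\<Omega>. \<exists>k\<le>n. x < W k \<omega>} = (stp ^^ n) \<phi>0 i x"
proof -
  have "(\<integral>\<^sup>+\<omega>. ennreal (VV x n ((stp ^^ m) \<phi>0) \<omega>) \<partial>Pr i) = ennreal ((stp ^^ (n + m)) \<phi>0 i x)" for m
  proof (induction n arbitrary: m)
    case 0 show ?case using VV_zero by simp
  next
    case (Suc n)
    show ?case using walk_step[of "(stp ^^ m) \<phi>0" x n, OF ua] Suc.IH[of "Suc m"] by simp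
  qed
  from this[of 0] have "(\<integral>\<^sup>+\<omega>. ennreal (VV x n \<phi>0 \<omega>) \<partial>Pr i) = ennreal ((stp ^^ n) \<phi>0 i x)" by simp
  also have "(\<integral>\<^sup>+\<omega>. ennreal (VV x n \<phi>0 \<omega>) \<partial>Pr i) = (\<integral>\<^sup>+\<omega>. indicator {\<omega>\<in>\<Omega>. \<exists>k\<le>n. x < W k \<omega>} \<omega> \<partial>Pr i)"
    by (intro nn_integral_cong) (auto simp: VV_def \<phi>0_def indicator_def le_less)
  also have "\<dots> = ennreal (prob {\<omega>\<in>\<Omega>. \<exists>k\<le>n. x < W k \<omega>})" by (simp add: emeasure_eq_measure)
  finally show ?thesis using ua_bounds(1)[OF ua[OF i]] by simp
qed

lemma walk_maximum_tendsto: "(\<lambda>n. prob {\<omega>\<in>\<Omega>. \<exists>k\<le>n. x < W k \<omega>}) \<longlonglongrightarrow> prob {\<omega>\<in>\<Omega>. \<exists>k. x < W k \<omega>}"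
proof -
  have "(\<lambda>n. prob {\<omega>\<in>\<Omega>. \<exists>k\<le>n. x < W k \<omega>}) \<longlonglongrightarrow> prob (\<Union>n. {\<omega>\<in>\<Omega>. \<exists>k\<le>n. x < W k \<omega>})"
    by (rule finite_Lim_measure_incseq) (auto simp: incseq_def intro: order_trans)
  also have "(\<Union>n. {\<omega>\<in>\<Omega>. \<exists>k\<le>n. x < W k \<omega>}) = {\<omega>\<in>\<Omega>. \<exists>k. x < W k \<omega>}" by auto
  finally show ?thesis .
qed

lemma ruin_sandwich:
  assumes "0 < \<zeta>"
  shows "prob {\<omega>\<in>\<Omega>. tau_zeta p Jc S U \<zeta> x \<omega> < \<infinity>} \<le> prob {\<omega>\<in>\<Omega>. \<exists>k. x < W k \<omega>}"
    and "prob {\<omega>\<in>\<Omega>. \<exists>k. x + pmax * \<zeta> < W k \<omega>} \<le> prob {\<omega>\<in>\<Omega>. tau_zeta p Jc S U \<zeta> x \<omega> < \<infinity>}"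
proof -
  show "prob {\<omega>\<in>\<Omega>. tau_zeta p Jc S U \<zeta> x \<omega> < \<infinity>} \<le> prob {\<omega>\<in>\<Omega>. \<exists>k. x < W k \<omega>}"
    by (rule finite_measure_mono_AE) (use AE_good ruin_upper in \<open>auto elim!: eventually_mono\<close>)
  \<comment> \<open>Here the ruin event is the larger set, so its measurability is required.\<close>
  show "prob {\<omega>\<in>\<Omega>. \<exists>k. x + pmax * \<zeta> < W k \<omega>} \<le> prob {\<omega>\<in>\<Omega>. tau_zeta p Jc S U \<zeta> x \<omega> < \<infinity>}"
    by (rule finite_measure_mono_AE[OF _ ruin_event_measurable]) (use AE_good ruin_lower assms in \<open>auto elim!: eventually_mono\<close>)
qed

subsection \<open>The law of the first increment\<close>

text \<open>Almost sure equality transfers the law once \<open>xi\<close> is known to be measurable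
  on exceptional paths too.\<close>

lemma xi_dist_W: "xi_dist Pr p Jc S U i = distr (Pr i) borel (W 1)"
  unfolding xi_dist_def
proof (rule distr_cong_AE)
  show "AE \<omega> in Pr i. xi p Jc S U 1 \<omega> = W 1 \<omega>"
    using AE_good by eventually_elim (use xi_good[of _ 0] in \<open>simp add: W_0 One_nat_def\<close>)
  show "xi p Jc S U 1 \<in> borel_measurable (Pr i)" by (rule xi_measurable)
qed auto

lemma xi_dist_real: "real_distribution (xi_dist Pr p Jc S U i)"
  unfolding xi_dist_W by (rule real_distribution_distr) measurable

lemma xi_nn_integral:
  assumes f [measurable]: "f \<in> borel_measurable borel"
  shows "(\<integral>\<^sup>+u. f u \<partial>xi_dist Pr p Jc S U i) = (\<Sum>k\<in>St. ennreal (P i k) * (\<integral>\<^sup>+u. f u \<partial>HH i k))"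
proof -
  have "(\<integral>\<^sup>+u. f u \<partial>xi_dist Pr p Jc S U i) = (\<integral>\<^sup>+\<omega>. f (U (Suc 0) \<omega> - p (Jc 0 \<omega>) * S (Suc 0) \<omega>) \<partial>Pr i)"
    unfolding xi_dist_W by (subst nn_integral_distr) (auto simp: One_nat_def W_Suc W_0)
  also have "\<dots> = (\<integral>\<^sup>+\<omega>. (\<Sum>k\<in>St. ennreal (P (Jc 0 \<omega>) k) * (\<integral>\<^sup>+z. f (snd z - p (Jc 0 \<omega>) * fst z) \<partial>(Hold (Jc 0 \<omega>) \<Otimes>\<^sub>M Cl (Jc 0 \<omega>) k))) \<partial>Pr i)"
    using one_step[of "\<lambda>j k z. f (snd (snd z) - p j * fst (snd z))" 0] by simp
  also have "\<dots> = (\<integral>\<^sup>+\<omega>. (\<Sum>k\<in>St. ennreal (P i k) * (\<integral>\<^sup>+z. f (snd z - p i * fst z) \<partial>(Hold i \<Otimes>\<^sub>M Cl i k))) \<partial>Pr i)"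
    by (rule nn_integral_cong_AE) (use AE_states in eventually_elim, simp)
  also have "\<dots> = (\<Sum>k\<in>St. ennreal (P i k) * (\<integral>\<^sup>+z. f (snd z - p i * fst z) \<partial>(Hold i \<Otimes>\<^sub>M Cl i k)))"
    by (simp add: emeasure_space_1)
  also have "\<dots> = (\<Sum>k\<in>St. ennreal (P i k) * (\<integral>\<^sup>+u. f u \<partial>HH i k))"
    by (intro sum.cong refl) (use Hd_nn_integral[OF i] in \<open>auto simp: HH_def\<close>)
  finally show ?thesis .
qed

text \<open>For a nonnegative integrand every component of positive weight inherits finiteness from
  the mixture. Signed integrands are treated afterwards through their positive and negative
  parts.\<close>

lemma xi_integral_nonneg:
  assumes g [measurable]: "g \<in> borel_measurable borel" and g0: "\<And>u. 0 \<le> g u"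
    and int: "integrable (xi_dist Pr p Jc S U i) g"
  shows "k \<in> St \<Longrightarrow> 0 < P i k \<Longrightarrow> integrable (HH i k) g"
    and "(\<integral>u. g u \<partial>xi_dist Pr p Jc S U i) = (\<Sum>k\<in>St. P i k * (\<integral>u. g u \<partial>HH i k))"
proof -
  let ?xi = "xi_dist Pr p Jc S U i"
  have eq: "ennreal (\<integral>u. g u \<partial>?xi) = (\<Sum>k\<in>St. ennreal (P i k) * (\<integral>\<^sup>+u. ennreal (g u) \<partial>HH i k))"
    using xi_nn_integral[of "\<lambda>u. ennreal (g u)"] nn_integral_eq_integral[OF int] g0 by simp
  have I: "integrable (HH i k) g" if k: "k \<in> St" "0 < P i k" for k
  proof -
    interpret HH: real_distribution "HH i k" by (rule HH_dist[OF i k(1)])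
    have "ennreal (P i k) * (\<integral>\<^sup>+u. ennreal (g u) \<partial>HH i k) < \<infinity>"
    proof (rule le_less_trans)
      show "ennreal (P i k) * (\<integral>\<^sup>+u. ennreal (g u) \<partial>HH i k) \<le> ennreal (\<integral>u. g u \<partial>?xi)"
        unfolding eq by (rule member_le_sum) (use k in auto)
    qed simp
    then have "(\<integral>\<^sup>+u. ennreal (g u) \<partial>HH i k) < \<infinity>" using k by (auto simp: ennreal_mult_less_top)
    then show ?thesis using g0 by (intro integrableI_bounded) auto
  qed
  then show "k \<in> St \<Longrightarrow> 0 < P i k \<Longrightarrow> integrable (HH i k) g" .
  have n0: "0 \<le> (\<integral>u. g u \<partial>HH i k)" for k by (rule integral_nonneg_AE) (use g0 in simp)
  have "ennreal (P i k) * (\<integral>\<^sup>+u. ennreal (g u) \<partial>HH i k) = ennreal (P i k * (\<integral>u. g u \<partial>HH i k))" if k: "k \<in> St" for k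
  proof (cases "P i k = 0")
    case False
    then have "0 < P i k" using P_nonneg[OF i k] by simp
    then show ?thesis using nn_integral_eq_integral[OF I[OF k]] g0 by (simp add: ennreal_mult)
  qed simp
  then have "ennreal (\<integral>u. g u \<partial>?xi) = (\<Sum>k\<in>St. ennreal (P i k * (\<integral>u. g u \<partial>HH i k)))"
    unfolding eq by (intro sum.cong refl)
  also have "\<dots> = ennreal (\<Sum>k\<in>St. P i k * (\<integral>u. g u \<partial>HH i k))"
    by (rule sum_ennreal) (auto intro!: mult_nonneg_nonneg P_nonneg i n0)
  finally have "ennreal (\<integral>u. g u \<partial>?xi) = ennreal (\<Sum>k\<in>St. P i k * (\<integral>u. g u \<partial>HH i k))" .
  moreover have "0 \<le> (\<integral>u. g u \<partial>?xi)" by (rule integral_nonneg_AE) (use g0 in simp)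
  ultimately show "(\<integral>u. g u \<partial>?xi) = (\<Sum>k\<in>St. P i k * (\<integral>u. g u \<partial>HH i k))"
    using ennreal_inj sum_nonneg[of St "\<lambda>k. P i k * (\<integral>u. g u \<partial>HH i k)"] P_nonneg[OF i] n0 by simp
qed

lemma xi_ccdf: "ccdf (xi_dist Pr p Jc S U i) x = (\<Sum>k\<in>St. P i k * ccdf (HH i k) x)"
proof -
  interpret xi: real_distribution "xi_dist Pr p Jc S U i" by (rule xi_dist_real)
  have c: "ccdf M x = (\<integral>u. indicator {x<..} u \<partial>M)" if "real_distribution M" for M
  proof -
    interpret M: real_distribution M by fact
    show ?thesis by (simp add: ccdf_def M.M_is_borel)
  qed
  have "integrable (xi_dist Pr p Jc S U i) (indicator {x<..} :: real \<Rightarrow> real)"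
    by (rule xi.integrable_const_bound[where B=1]) (auto simp: indicator_def)
  from xi_integral_nonneg(2)[OF _ _ this] show ?thesis
    using c[OF xi_dist_real] c[OF HH_dist[OF i]] by simp
qed

context
  assumes xi_int: "integrable (xi_dist Pr p Jc S U i) (\<lambda>u. u)"
begin

lemma HH_mean: assumes k: "k \<in> St" shows "integrable (HH i k) (\<lambda>u. u)"
proof (cases "P i k = 0")
  case True
  then show ?thesis unfolding HH_def by (intro integrableI_bounded) (auto simp: nn_integral_return)
next
  case False
  then have "0 < P i k" using P_nonneg[OF i k] by simp
  have "integrable (xi_dist Pr p Jc S U i) (\<lambda>u. \<bar>u\<bar>)" using xi_int by (rule integrable_abs)
  from xi_integral_nonneg(1)[OF _ _ this k \<open>0 < P i k\<close>] have "integrable (HH i k) (\<lambda>u. \<bar>u\<bar>)" by simp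
  moreover have "(\<lambda>u. u) \<in> borel_measurable (HH i k)" using real_distribution.events_eq_borel[OF HH_dist[OF i k]] by (simp cong: measurable_cong_sets)
  ultimately show ?thesis by (subst integrable_abs_iff[symmetric]) auto
qed

lemma xi_tail_integral: "tail_integral (xi_dist Pr p Jc S U i) x = (\<Sum>k\<in>St. P i k * tail_integral (HH i k) x)"
  using xi_integral_nonneg(2)[OF _ _ integrable_positive_part[OF xi_dist_real xi_int], of x]
    tail_integral_eq[OF xi_dist_real xi_int] tail_integral_eq[OF HH_dist[OF i] HH_mean] by simp

lemma xi_mean: "(\<integral>u. u \<partial>xi_dist Pr p Jc S U i) = (\<Sum>k\<in>St. P i k * (\<integral>u. u \<partial>HH i k))"
proof -
  have split: "(\<integral>u. u \<partial>M) = (\<integral>u. max 0 u \<partial>M) - (\<integral>u. max 0 (- u) \<partial>M)" if "integrable M (\<lambda>u. u)" for M :: "real measure"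
  proof -
    have "(\<integral>u. u \<partial>M) = (\<integral>u. max 0 u - max 0 (- u) \<partial>M)" by (intro Bochner_Integration.integral_cong) auto
    then show ?thesis using that by (subst (asm) Bochner_Integration.integral_diff) (auto intro!: Bochner_Integration.integrable_max)
  qed
  have "integrable (xi_dist Pr p Jc S U i) (\<lambda>u. max 0 u)" "integrable (xi_dist Pr p Jc S U i) (\<lambda>u. max 0 (- u))"
    using xi_int by (auto intro!: Bochner_Integration.integrable_max)
  from xi_integral_nonneg(2)[OF _ _ this(1)] xi_integral_nonneg(2)[OF _ _ this(2)] show ?thesis
    using split[OF xi_int] split[OF HH_mean] by (simp add: sum_subtractf right_diff_distrib)
qed

text \<open>Far out the cut at 1 is inactive, so there \<open>int_tail\<close> inherits the
  linearity of \<open>tail_integral\<close>.\<close>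

lemma xi_int_tail: "eventually (\<lambda>x. int_tail (xi_dist Pr p Jc S U i) x = (\<Sum>k\<in>St. P i k * tail_integral (HH i k) x)) at_top"
proof -
  have "eventually (\<lambda>x. tail_integral (xi_dist Pr p Jc S U i) x < 1) at_top"
    by (rule order_tendstoD(2)[OF tail_integral_at_top[OF xi_dist_real xi_int]]) simp
  then show ?thesis by eventually_elim (simp add: int_tail_eq_min xi_tail_integral[symmetric])
qed

lemma Hold_mean: "j \<in> St \<Longrightarrow> integrable (Hold j) (\<lambda>s. s)" "j \<in> St \<Longrightarrow> (\<integral>s. s \<partial>Hold j) = 1 / rate j"
proof -
  assume j: "j \<in> St"
  then have r: "0 < rate j" using rates_pos by auto
  interpret Hold: prob_space "Hold j" by (rule Hold_prob[OF j])
  have D: "distributed (Hold j) lborel (\<lambda>s. s) (exponential_density (rate j))"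
    unfolding distributed_def using distr_id2[of lborel "Hold j"] by simp
  show "(\<integral>s. s \<partial>Hold j) = 1 / rate j" using Hold.exponential_distributed_expectation[OF r D] by simp
  \<comment> \<open>A nonintegrable function has integral 0, so a nonzero mean certifies
    integrability.\<close>
  have "(\<integral>s. s \<partial>Hold j) \<noteq> 0" using \<open>(\<integral>s. s \<partial>Hold j) = 1 / rate j\<close> r by simp
  then show "integrable (Hold j) (\<lambda>s. s)" using not_integrable_integral_eq by blast
qed

text \<open>The claim is the increment plus the premium earned; the increment is integrable along a
  transition of positive probability, and the premium because a holding time has finite
  mean.\<close>

lemma Cl_mean:
  assumes k: "k \<in> St" and P: "0 < P i k"
  shows "integrable (Cl i k) (\<lambda>u. u)" and "(\<integral>u. u \<partial>HH i k) = (\<integral>u. u \<partial>Cl i k) - p i / rate i"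
proof -
  let ?K = "Hold i \<Otimes>\<^sub>M Cl i k"
  interpret Hold: prob_space "Hold i" by (rule Hold_prob[OF i])
  interpret Cl: real_distribution "Cl i k" by (rule Cl_dist[OF i k])
  interpret K: pair_prob_space "Hold i" "Cl i k" ..
  note Cl.M_is_borel[measurable_cong]
  have HH: "HH i k = distr ?K borel (\<lambda>z. snd z - p i * fst z)" using P by (simp add: HH_def Hd_def case_prod_unfold)
  have m: "(\<lambda>z. snd z - p i * fst z) \<in> borel_measurable ?K" by measurable
  have 1: "integrable ?K (\<lambda>z. snd z - p i * fst z)" using HH_mean[OF k] unfolding HH by (subst (asm) integrable_distr_eq[OF m]) auto
  have df: "distr ?K (Hold i) fst = Hold i" "distr ?K (Cl i k) snd = Cl i k"
  proof -
    show "distr ?K (Hold i) fst = Hold i"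
    proof (rule measure_eqI)
      fix A assume "A \<in> sets (distr ?K (Hold i) fst)"
      then have A: "A \<in> sets (Hold i)" by simp
      have "fst -` A \<inter> space ?K = A \<times> space (Cl i k)" using sets.sets_into_space[OF A] by (auto simp: space_pair_measure)
      then show "emeasure (distr ?K (Hold i) fst) A = emeasure (Hold i) A"
        using A by (simp only: emeasure_distr[OF measurable_fst A] Cl.emeasure_pair_measure_Times sets.top Cl.emeasure_space_1 mult_1_right)
    qed simp
    show "distr ?K (Cl i k) snd = Cl i k"
    proof (rule measure_eqI)
      fix A assume "A \<in> sets (distr ?K (Cl i k) snd)"
      then have A: "A \<in> sets (Cl i k)" by simp
      have "snd -` A \<inter> space ?K = space (Hold i) \<times> A" using sets.sets_into_space[OF A] by (auto simp: space_pair_measure)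
      then show "emeasure (distr ?K (Cl i k) snd) A = emeasure (Cl i k) A"
        using A by (simp only: emeasure_distr[OF measurable_snd A] Cl.emeasure_pair_measure_Times sets.top Hold.emeasure_space_1 mult_1_left)
    qed simp
  qed
  have 2: "integrable ?K fst" "(\<integral>z. fst z \<partial>?K) = (\<integral>s. s \<partial>Hold i)"
  proof -
    have f: "fst \<in> measurable ?K (Hold i)" and g: "(\<lambda>s. s) \<in> borel_measurable (Hold i)" by simp_all
    show "integrable ?K fst" using integrable_distr_eq[OF f g, unfolded df(1)] Hold_mean(1)[OF i] by blast
    show "(\<integral>z. fst z \<partial>?K) = (\<integral>s. s \<partial>Hold i)" using integral_distr[OF f g, unfolded df(1)] by (rule sym)
  qed
  have 3: "integrable ?K snd" using Bochner_Integration.integrable_add[OF 1 integrable_mult_right[OF 2(1), of "p i"]] by simp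
  have 4: "snd \<in> measurable ?K (Cl i k)" "(\<lambda>s. s) \<in> borel_measurable (Cl i k)" by simp_all
  show "integrable (Cl i k) (\<lambda>u. u)" using integrable_distr_eq[OF 4, unfolded df(2)] 3 by blast
  have 5: "(\<integral>z. snd z \<partial>?K) = (\<integral>u. u \<partial>Cl i k)" using integral_distr[OF 4, unfolded df(2)] by (rule sym)
  have "(\<integral>u. u \<partial>HH i k) = (\<integral>z. snd z - p i * fst z \<partial>?K)" unfolding HH by (rule integral_distr[OF m]) simp
  also have "\<dots> = (\<integral>u. u \<partial>Cl i k) - p i / rate i"
    using 2 3 5 Hold_mean(2)[OF i] by (simp add: Bochner_Integration.integral_diff)
  finally show "(\<integral>u. u \<partial>HH i k) = (\<integral>u. u \<partial>Cl i k) - p i / rate i" .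
qed

lemma xi_mean_claims: "(\<integral>u. u \<partial>xi_dist Pr p Jc S U i) = (\<Sum>k\<in>St. P i k * (\<integral>u. u \<partial>Cl i k)) - p i / rate i"
proof -
  have "(\<integral>u. u \<partial>xi_dist Pr p Jc S U i) = (\<Sum>k\<in>St. P i k * ((\<integral>u. u \<partial>Cl i k) - p i / rate i))"
    unfolding xi_mean
  proof (rule sum.cong[OF refl])
    fix k assume k: "k \<in> St"
    show "P i k * (\<integral>u. u \<partial>HH i k) = P i k * ((\<integral>u. u \<partial>Cl i k) - p i / rate i)"
      using Cl_mean(2)[OF k] P_nonneg[OF i k] by (cases "P i k = 0") auto
  qed
  also have "\<dots> = (\<Sum>k\<in>St. P i k * (\<integral>u. u \<partial>Cl i k)) - (\<Sum>k\<in>St. P i k) * (p i / rate i)"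
    unfolding right_diff_distrib sum_subtractf sum_distrib_right ..
  finally show ?thesis using P_sum[OF i] by simp
qed

end

end


subsection \<open>Positive drift of the embedded walk\<close>

context mmrp_start
begin

lemma p_J_measurable [measurable]: "(\<lambda>\<omega>. p (Jc k \<omega>)) \<in> borel_measurable (Pr i)"
  by (rule measurable_compose[OF Jc_measurable]) simp

lemma prob_T_le_1: "prob {\<omega>\<in>\<Omega>. T n \<omega> \<le> 1} \<le> exp 1 * rho ^ n"
proof -
  have "ennreal (prob {\<omega>\<in>\<Omega>. T n \<omega> \<le> 1}) = (\<integral>\<^sup>+\<omega>. indicator {\<omega>\<in>\<Omega>. T n \<omega> \<le> 1} \<omega> \<partial>Pr i)"
    by (simp add: emeasure_eq_measure)
  also have "\<dots> \<le> (\<integral>\<^sup>+\<omega>. ennreal (exp 1) * ennreal (exp (- T n \<omega>)) \<partial>Pr i)"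
    by (intro nn_integral_mono) (auto simp: indicator_def simp flip: ennreal_mult exp_add)
  also have "\<dots> = ennreal (exp 1) * (\<integral>\<^sup>+\<omega>. ennreal (exp (- T n \<omega>)) \<partial>Pr i)" by (rule nn_integral_cmult) measurable
  also have "\<dots> \<le> ennreal (exp 1) * ennreal (rho ^ n)" by (intro mult_left_mono exp_T_bound) simp
  also have "\<dots> = ennreal (exp 1 * rho ^ n)" using rho(1) by (simp add: ennreal_mult)
  finally show ?thesis using rho(1) by (simp add: ennreal_le_iff)
qed

text \<open>Taking expectations in \<open>surplus_stopped\<close>, premiums and claims combine, for
  each completed sojourn in \<open>j\<close>, to minus the mean increment from \<open>j\<close>; the
  remaining term is geometric in \<open>n\<close> by \<open>prob_T_le_1\<close>.\<close>

lemma mean_surplus_bound: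
  assumes xi_int: "\<And>j. j \<in> St \<Longrightarrow> integrable (xi_dist Pr p Jc S U j) (\<lambda>u. u)"
    and X_int: "integrable (Pr i) (Xproc p Jc S U 0 1)"
  shows "(\<integral>\<omega>. Xproc p Jc S U 0 1 \<omega> \<partial>Pr i)
    \<le> - (\<Sum>j\<in>St. (\<Sum>k<n. \<nu> k j) * (\<integral>u. u \<partial>xi_dist Pr p Jc S U j)) + pmax * (exp 1 * rho ^ n)"
proof -
  have start: "mmrp_start N q lam p FC FCJ Pr Jc S U j" if "j \<in> St" for j by unfold_locales fact
  have Cl_int: "integrable (Cl j k) (\<lambda>u. u)" if "j \<in> St" "k \<in> St" "0 < P j k" for j k
    by (rule mmrp_start.Cl_mean(1)[OF start xi_int]) (use that in auto)
  let ?c = "\<lambda>j. \<Sum>k\<in>St. P j k * (\<integral>u. u \<partial>Cl j k)"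
  have a: "(\<integral>u. u \<partial>xi_dist Pr p Jc S U j) = ?c j - p j / rate j" if "j \<in> St" for j
    by (rule mmrp_start.xi_mean_claims[OF start xi_int]) (use that in auto)
  have \<nu>0: "0 \<le> \<nu> k j" for k j by (simp add: \<nu>_def)
  have c0: "0 \<le> ?c j" if "j \<in> St" for j
  proof (intro sum_nonneg mult_nonneg_nonneg P_nonneg that)
    fix k assume k: "k \<in> St"
    interpret Cl: real_distribution "Cl j k" by (rule Cl_dist[OF that k])
    have "emeasure (Cl j k) {..<0} = 0" using Cl_nonneg[OF that k] by (simp add: Cl.emeasure_eq_measure)
    then have "AE u in Cl j k. 0 \<le> u" by (intro AE_I[where N="{..<0}"]) auto
    then show "0 \<le> (\<integral>u. u \<partial>Cl j k)" by (rule integral_nonneg_AE)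
  qed
  let ?A = "\<lambda>k \<omega>. p (Jc k \<omega>) * (min 1 (T (Suc k) \<omega>) - min 1 (T k \<omega>))"
  let ?B = "\<lambda>k \<omega>. U (Suc k) \<omega> * indicator {..1} (T (Suc k) \<omega>)"
  have A: "has_bochner_integral (Pr i) (?A k) (\<Sum>j\<in>St. \<nu> k j * (p j / rate j))" for k
  proof (rule has_bochner_integral_nn_integral[OF _ _ _ premium_count])
    show "?A k \<in> borel_measurable (Pr i)" by measurable
    show "AE \<omega> in Pr i. 0 \<le> ?A k \<omega>" using AE_good
    proof eventually_elim
      case (elim \<omega>)
      then have "0 < p (Jc k \<omega>)" using premium by (auto simp: good_def)
      then show ?case using T_le[OF elim, of k "Suc k"] by (intro mult_nonneg_nonneg) auto
    qed
    show "0 \<le> (\<Sum>j\<in>St. \<nu> k j * (p j / rate j))"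
      using premium rates_pos \<nu>0 by (intro sum_nonneg mult_nonneg_nonneg divide_nonneg_pos) (auto intro: less_imp_le)
  qed
  have B: "has_bochner_integral (Pr i) (?B k) (\<Sum>j\<in>St. \<nu> k j * ?c j)" for k
  proof (rule has_bochner_integral_nn_integral)
    show "?B k \<in> borel_measurable (Pr i)" by measurable
    have nonneg: "AE \<omega> in Pr i. 0 \<le> U (Suc k) \<omega>" by (rule AE_U_nonneg)
    then show "AE \<omega> in Pr i. 0 \<le> ?B k \<omega>" by eventually_elim (simp add: indicator_def)
    show "0 \<le> (\<Sum>j\<in>St. \<nu> k j * ?c j)" by (rule sum_nonneg) (rule mult_nonneg_nonneg[OF \<nu>0 c0])
    have "(\<integral>\<^sup>+\<omega>. ennreal (?B k \<omega>) \<partial>Pr i) = (\<integral>\<^sup>+\<omega>. ennreal (U (Suc k) \<omega>) * indicator {..1} (T (Suc k) \<omega>) \<partial>Pr i)"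
      by (intro nn_integral_cong) (simp add: indicator_def)
    then show "(\<integral>\<^sup>+\<omega>. ennreal (?B k \<omega>) \<partial>Pr i) = ennreal (\<Sum>j\<in>St. \<nu> k j * ?c j)"
      using claim_count[OF Cl_int] by simp
  qed
  have I: "has_bochner_integral (Pr i) (\<lambda>\<omega>. indicator {..1} (T n \<omega>)) (prob {\<omega>\<in>\<Omega>. T n \<omega> \<le> 1})"
  proof -
    have "has_bochner_integral (Pr i) (indicator {\<omega>\<in>\<Omega>. T n \<omega> \<le> 1}) (prob {\<omega>\<in>\<Omega>. T n \<omega> \<le> 1})"
      by (rule has_bochner_integral_real_indicator) (auto simp: emeasure_eq_measure)
    then show ?thesis by (rule has_bochner_integral_cong[THEN iffD1, rotated 3]) (auto simp: indicator_def)
  qed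
  have tot: "has_bochner_integral (Pr i) (\<lambda>\<omega>. (\<Sum>k<n. ?A k \<omega>) - (\<Sum>k<n. ?B k \<omega>) + pmax * indicator {..1} (T n \<omega>))
    ((\<Sum>k<n. \<Sum>j\<in>St. \<nu> k j * (p j / rate j)) - (\<Sum>k<n. \<Sum>j\<in>St. \<nu> k j * ?c j) + pmax * prob {\<omega>\<in>\<Omega>. T n \<omega> \<le> 1})"
    by (intro has_bochner_integral_add has_bochner_integral_diff has_bochner_integral_sum has_bochner_integral_mult_right A B I)
  have "(\<integral>\<omega>. Xproc p Jc S U 0 1 \<omega> \<partial>Pr i) \<le> (\<integral>\<omega>. (\<Sum>k<n. ?A k \<omega>) - (\<Sum>k<n. ?B k \<omega>) + pmax * indicator {..1} (T n \<omega>) \<partial>Pr i)"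
    by (rule integral_mono_AE[OF X_int integrable.intros[OF tot]])
      (use AE_good in eventually_elim, rule surplus_stopped)
  also have "\<dots> = (\<Sum>k<n. \<Sum>j\<in>St. \<nu> k j * (p j / rate j)) - (\<Sum>k<n. \<Sum>j\<in>St. \<nu> k j * ?c j) + pmax * prob {\<omega>\<in>\<Omega>. T n \<omega> \<le> 1}"
    by (rule has_bochner_integral_integral_eq[OF tot])
  also have "(\<Sum>k<n. \<Sum>j\<in>St. \<nu> k j * (p j / rate j)) - (\<Sum>k<n. \<Sum>j\<in>St. \<nu> k j * ?c j) = - (\<Sum>k<n. \<Sum>j\<in>St. \<nu> k j * (\<integral>u. u \<partial>xi_dist Pr p Jc S U j))"
    by (simp add: a right_diff_distrib sum_subtractf)
  also have "(\<Sum>k<n. \<Sum>j\<in>St. \<nu> k j * (\<integral>u. u \<partial>xi_dist Pr p Jc S U j)) = (\<Sum>j\<in>St. (\<Sum>k<n. \<nu> k j) * (\<integral>u. u \<partial>xi_dist Pr p Jc S U j))"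
    by (subst sum.swap) (simp add: sum_distrib_right)
  also have "pmax * prob {\<omega>\<in>\<Omega>. T n \<omega> \<le> 1} \<le> pmax * (exp 1 * rho ^ n)" using prob_T_le_1 pmax_pos by (intro mult_left_mono) auto
  finally show ?thesis by simp
qed

text \<open>The start together with the completed sojourns followed by a transition to
  \<open>l\<close> accounts for all arrivals at \<open>l\<close> by time 1 among the epochs 0 to
  \<open>n\<close>, while completed sojourns in \<open>l\<close> are no more than the arrivals
  before epoch \<open>n\<close>. The difference is at least the probability of being in
  \<open>l\<close> at epoch \<open>n\<close> by time 1.\<close>

lemma count_kernel_nonneg:
  assumes l: "l \<in> St"
  shows "0 \<le> (if i = l then 1 else 0) - (\<Sum>k<n. \<nu> k l) + (\<Sum>j\<in>St. (\<Sum>k<n. \<nu> k j) * P j l)"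
proof -
  define r where "r k = prob {\<omega>\<in>\<Omega>. Jc k \<omega> = l \<and> T k \<omega> \<le> 1}" for k
  have r0: "r 0 = (if i = l then 1 else 0)"
  proof -
    have "r 0 = prob (if i = l then \<Omega> else {})" unfolding r_def
      proof (rule measure_eq_AE)
      show "AE \<omega> in Pr i. (\<omega> \<in> {\<omega>\<in>\<Omega>. Jc 0 \<omega> = l \<and> T 0 \<omega> \<le> 1}) = (\<omega> \<in> (if i = l then \<Omega> else {}))"
        using AE_states AE_space by eventually_elim (auto simp: T_0)
    qed simp_all
    then show ?thesis using prob_space by auto
  qed
  have mono: "\<nu> k l \<le> r k" for k
    unfolding r_def \<nu>_def
  proof (rule finite_measure_mono_AE)
    show "AE \<omega> in Pr i. \<omega> \<in> {\<omega>\<in>\<Omega>. Jc k \<omega> = l \<and> T (Suc k) \<omega> \<le> 1} \<longrightarrow> \<omega> \<in> {\<omega>\<in>\<Omega>. Jc k \<omega> = l \<and> T k \<omega> \<le> 1}"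
      using AE_good
    proof eventually_elim
      case (elim \<omega>)
      then show ?case using T_le[OF elim, of k "Suc k"] by auto
    qed
  qed measurable
  have "(\<Sum>j\<in>St. (\<Sum>k<n. \<nu> k j) * P j l) = (\<Sum>k<n. \<Sum>j\<in>St. \<nu> k j * P j l)"
    by (subst sum.swap) (simp add: sum_distrib_right)
  also have "\<dots> = (\<Sum>k<n. r (Suc k))" unfolding r_def by (simp add: transition_count[OF l])
  finally have "(if i = l then 1 else 0) + (\<Sum>j\<in>St. (\<Sum>k<n. \<nu> k j) * P j l) = (\<Sum>k<n. r k) + r n"
    using sum.lessThan_Suc_shift[of r n] r0 by simp
  moreover have "(\<Sum>k<n. \<nu> k l) \<le> (\<Sum>k<n. r k)" by (intro sum_mono mono)
  moreover have "0 \<le> r n" by (simp add: r_def)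
  ultimately show ?thesis by linarith
qed

end

text \<open>Stopping the surplus at the minimum of 1 and the n-th epoch turns the net profit condition into a statement about
  expected visit counts \<open>m\<close>. The kernel \<open>1 - m + m P\<close> moves the embedded chain to its state at that
  time, and \<open>\<mu> m\<close> is invariant under \<open>P\<close> whenever \<open>\<mu>\<close> is invariant under this kernel.\<close>
lemma (in mmrp) positive_drift:
  assumes xi_int: "\<And>j. j \<in> St \<Longrightarrow> integrable (xi_dist Pr p Jc S U j) (\<lambda>u. u)"
    and net: "\<And>j. j \<in> St \<Longrightarrow> 0 < (\<integral>\<omega>. Xproc p Jc S U 0 1 \<omega> \<partial>Pr j)"
    and uniq: "\<And>\<nu>. stationary_dist N P \<nu> \<Longrightarrow> (\<forall>j\<in>St. \<nu> j = \<pi> j)"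
    and ne: "St \<noteq> {}"
  shows "0 < - (\<Sum>j\<in>St. \<pi> j * (\<integral>u. u \<partial>xi_dist Pr p Jc S U j))"
proof -
  let ?a = "\<lambda>j. \<integral>u. u \<partial>xi_dist Pr p Jc S U j"
  define m where "m n j l = (\<Sum>k<n. measure (Pr j) {\<omega>\<in>space (Pr j). Jc k \<omega> = l \<and> jump_time S (Suc k) \<omega> \<le> 1})" for n j l
  \<comment> \<open>One \<open>n\<close> serves all starting states, since there are finitely many
    of them and the remainder in the surplus bound tends to 0 for each.\<close>
  obtain n where pos: "\<And>j. j \<in> St \<Longrightarrow> 0 < - (\<Sum>l\<in>St. m n j l * ?a l)"
    and Q0: "\<And>j l. j \<in> St \<Longrightarrow> l \<in> St \<Longrightarrow> 0 \<le> (if j = l then 1 else 0) - m n j l + (\<Sum>k\<in>St. m n j k * P k l)"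
  proof -
    have "\<forall>j\<in>St. eventually (\<lambda>n. 0 < - (\<Sum>l\<in>St. m n j l * ?a l)) sequentially"
    proof
      fix j assume j: "j \<in> St"
      interpret j: mmrp_start N q lam p FC FCJ Pr Jc S U j by unfold_locales fact
      have "(\<lambda>n. pmax * (exp 1 * j.rho ^ n)) \<longlonglongrightarrow> pmax * (exp 1 * 0)"
        by (intro tendsto_intros LIMSEQ_power_zero) (use j.rho in simp)
      then have "eventually (\<lambda>n. pmax * (exp 1 * j.rho ^ n) < (\<integral>\<omega>. Xproc p Jc S U 0 1 \<omega> \<partial>Pr j)) sequentially"
        by (rule order_tendstoD(2)) (use net[OF j] in simp)
      then show "eventually (\<lambda>n. 0 < - (\<Sum>l\<in>St. m n j l * ?a l)) sequentially"
      proof eventually_elim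
        case (elim n)
        \<comment> \<open>A positive integral can only come from an integrable function, so the net
          profit condition contains integrability of the surplus at time 1.\<close>
        have "integrable (Pr j) (Xproc p Jc S U 0 1)" using net[OF j] not_integrable_integral_eq by force
        from j.mean_surplus_bound[OF xi_int this, of n] show ?case using elim by (simp add: m_def j.\<nu>_def)
      qed
    qed
    then have "eventually (\<lambda>n. \<forall>j\<in>St. 0 < - (\<Sum>l\<in>St. m n j l * ?a l)) sequentially"
      by (intro eventually_ball_finite) auto
    then obtain n where n: "\<And>j. j \<in> St \<Longrightarrow> 0 < - (\<Sum>l\<in>St. m n j l * ?a l)" unfolding eventually_sequentially by blast
    have "0 \<le> (if j = l then 1 else 0) - m n j l + (\<Sum>k\<in>St. m n j k * P k l)" if j: "j \<in> St" and l: "l \<in> St" for j l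
    proof -
      interpret j: mmrp_start N q lam p FC FCJ Pr Jc S U j by unfold_locales fact
      show ?thesis using j.count_kernel_nonneg[OF l, of n] by (simp add: m_def j.\<nu>_def)
    qed
    then show thesis using that n by blast
  qed
  let ?Q = "\<lambda>j l. (if j = l then 1 else 0) - m n j l + (\<Sum>k\<in>St. m n j k * P k l)"
  have Q1: "(\<Sum>l\<in>St. ?Q j l) = 1" if j: "j \<in> St" for j
  proof -
    have "(\<Sum>l\<in>St. \<Sum>k\<in>St. m n j k * P k l) = (\<Sum>k\<in>St. m n j k * (\<Sum>l\<in>St. P k l))"
      by (subst sum.swap) (simp add: sum_distrib_left)
    also have "\<dots> = (\<Sum>k\<in>St. m n j k)" by (simp add: P_sum)
    finally show ?thesis using j by (simp add: sum.distrib sum_subtractf)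
  qed
  obtain \<mu> where \<mu>: "\<And>j. j \<in> St \<Longrightarrow> 0 \<le> \<mu> j" "(\<Sum>j\<in>St. \<mu> j) = 1" "\<And>l. l \<in> St \<Longrightarrow> (\<Sum>j\<in>St. \<mu> j * ?Q j l) = \<mu> l"
    using stochastic_matrix_stationary[OF _ ne, of ?Q] Q0 Q1 by blast
  define w where "w l = (\<Sum>j\<in>St. \<mu> j * m n j l)" for l
  have m0: "0 \<le> m n j l" for j l unfolding m_def by (intro sum_nonneg measure_nonneg)
  have w0: "0 \<le> w l" for l unfolding w_def using \<mu>(1) m0 by (intro sum_nonneg mult_nonneg_nonneg)
  have winv: "(\<Sum>k\<in>St. w k * P k l) = w l" if l: "l \<in> St" for l
  proof -
    have t: "\<mu> j * ?Q j l = (if j = l then \<mu> j else 0) - \<mu> j * m n j l + \<mu> j * (\<Sum>k\<in>St. m n j k * P k l)" for j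
      by (cases "j = l") (simp_all add: distrib_left right_diff_distrib)
    have "(\<Sum>j\<in>St. \<mu> j * ?Q j l) = (\<Sum>j\<in>St. (if j = l then \<mu> j else 0)) - w l + (\<Sum>j\<in>St. \<mu> j * (\<Sum>k\<in>St. m n j k * P k l))"
      unfolding w_def t by (simp only: sum.distrib sum_subtractf)
    moreover have "(\<Sum>j\<in>St. (if j = l then \<mu> j else 0)) = \<mu> l" using l by simp
    moreover have "(\<Sum>j\<in>St. \<mu> j * (\<Sum>k\<in>St. m n j k * P k l)) = (\<Sum>k\<in>St. w k * P k l)"
      unfolding w_def sum_distrib_left sum_distrib_right by (subst sum.swap) (simp add: mult.assoc)
    ultimately show ?thesis using \<mu>(3)[OF l] by simp
  qed
  have wpos: "0 < - (\<Sum>l\<in>St. w l * ?a l)"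
  proof -
    have "- (\<Sum>l\<in>St. w l * ?a l) = (\<Sum>j\<in>St. \<mu> j * - (\<Sum>l\<in>St. m n j l * ?a l))"
      unfolding w_def sum_distrib_right sum_negf[symmetric] sum_distrib_left by (subst sum.swap) (simp add: mult.assoc)
    moreover obtain j where j: "j \<in> St" "0 < \<mu> j"
    proof -
      have "\<exists>j\<in>St. 0 < \<mu> j"
      proof (rule ccontr)
        assume "\<not> (\<exists>j\<in>St. 0 < \<mu> j)"
        then have "\<mu> j = 0" if "j \<in> St" for j using \<mu>(1)[OF that] that by force
        then show False using \<mu>(2) by simp
      qed
      then show thesis using that by blast
    qed
    moreover have "0 < (\<Sum>j\<in>St. \<mu> j * - (\<Sum>l\<in>St. m n j l * ?a l))"
    proof (rule sum_pos2[OF _ j(1)])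
      show "0 < \<mu> j * - (\<Sum>l\<in>St. m n j l * ?a l)" by (rule mult_pos_pos[OF j(2) pos[OF j(1)]])
      show "0 \<le> \<mu> k * - (\<Sum>l\<in>St. m n k l * ?a l)" if "k \<in> St" for k
        by (rule mult_nonneg_nonneg[OF \<mu>(1)[OF that] less_imp_le[OF pos[OF that]]])
    qed simp
    ultimately show ?thesis by simp
  qed
  define Z where "Z = (\<Sum>l\<in>St. w l)"
  \<comment> \<open>The visit weights cannot all vanish, for the weighted drift just shown to be
    positive would then be 0. After normalisation uniqueness identifies them with
    \<open>\<pi>\<close>.\<close>
  have "Z \<noteq> 0"
  proof
    assume "Z = 0"
    then have "w l = 0" if "l \<in> St" for l using that w0 by (subst (asm) Z_def, subst (asm) sum_nonneg_eq_0_iff) auto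
    then show False using wpos by simp
  qed
  then have Z: "0 < Z" using w0 by (simp add: Z_def sum_nonneg less_le)
  have "stationary_dist N P (\<lambda>l. w l / Z)"
    unfolding stationary_dist_def using w0 Z winv
    by (auto simp: sum_divide_distrib[symmetric] Z_def[symmetric] divide_nonneg_pos)
  then have eq: "w l = Z * \<pi> l" if "l \<in> St" for l using uniq[of "\<lambda>l. w l / Z"] that Z by (auto simp: field_simps)
  have "- (\<Sum>l\<in>St. w l * ?a l) = Z * - (\<Sum>j\<in>St. \<pi> j * ?a j)"
    by (simp add: eq sum_distrib_left mult.assoc)
  then have "0 < Z * - (\<Sum>j\<in>St. \<pi> j * ?a j)" using wpos by simp
  then show ?thesis using Z by (simp only: zero_less_mult_iff) auto
qed

section \<open>Ruin asymptotics of the Markov modulated risk process\<close>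

theorem theorem16:
  fixes N :: nat
    and q :: "nat \<Rightarrow> nat \<Rightarrow> real" and lam :: "nat \<Rightarrow> real" and p :: "nat \<Rightarrow> real"
    and FC :: "nat \<Rightarrow> real measure" and FCJ :: "nat \<Rightarrow> nat \<Rightarrow> real measure"
    and Pr :: "nat \<Rightarrow> 'w measure"
    and Jc :: "nat \<Rightarrow> 'w \<Rightarrow> nat" and S :: "nat \<Rightarrow> 'w \<Rightarrow> real" and U :: "nat \<Rightarrow> 'w \<Rightarrow> real"
    and \<pi> :: "nat \<Rightarrow> real" and F :: "real measure" and c :: "nat \<Rightarrow> real"
    and \<zeta> :: real and i :: nat
  assumes rates_q: "\<forall>j\<in>{1..N}. \<forall>k\<in>{1..N}. j \<noteq> k \<longrightarrow> 0 \<le> q j k"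
    and rates_lam: "\<forall>j\<in>{1..N}. 0 \<le> lam j"
    and rates_pos: "\<forall>j\<in>{1..N}. 0 < totrate N q lam j"
    and premium: "\<forall>j\<in>{1..N}. 0 < p j"
    and claims_C: "\<forall>j\<in>{1..N}. real_distribution (FC j) \<and> measure (FC j) {..<0} = 0"
    and claims_CJ: "\<forall>j\<in>{1..N}. \<forall>k\<in>{1..N}. j \<noteq> k \<longrightarrow>
                       real_distribution (FCJ j k) \<and> measure (FCJ j k) {..<0} = 0"
    and prob: "\<forall>j\<in>{1..N}. prob_space (Pr j)"
    and meas: "\<forall>j\<in>{1..N}. \<forall>k. Jc k \<in> measurable (Pr j) (count_space UNIV) \<and>
                  S k \<in> borel_measurable (Pr j) \<and> U k \<in> borel_measurable (Pr j)"
    and law: "mmrp_law N q lam FC FCJ Pr Jc S U"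
    and net_profit: "\<forall>j\<in>{1..N}. 0 < (\<integral>\<omega>. Xproc p Jc S U 0 1 \<omega> \<partial>Pr j)"
    and stat: "stationary_dist N (emb_prob N q lam) \<pi>"
    and stat_unique: "\<forall>\<nu>. stationary_dist N (emb_prob N q lam) \<nu> \<longrightarrow> (\<forall>j\<in>{1..N}. \<nu> j = \<pi> j)"
    and xi_mean: "\<forall>j\<in>{1..N}. integrable (xi_dist Pr p Jc S U j) (\<lambda>x. x)"
    and F_dist: "real_distribution F" and F_mean: "integrable F (\<lambda>x. x)"
    and c_nonneg: "\<forall>j\<in>{1..N}. 0 \<le> c j"
    and D1: "\<forall>j\<in>{1..N}. \<forall>x. ccdf (xi_dist Pr p Jc S U j) x \<le> ccdf F x"
    and D2: "\<forall>j\<in>{1..N}.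
               ((\<lambda>x. int_tail (xi_dist Pr p Jc S U j) x / int_tail F x) \<longlongrightarrow> c j) at_top"
    and D3: "subexponential (int_tail_dist F)"
    and zeta_pos: "0 < \<zeta>"
    and i_in: "i \<in> {1..N}"
  shows "((\<lambda>x. prob_space.prob (Pr i) {\<omega> \<in> space (Pr i). tau_zeta p Jc S U \<zeta> x \<omega> < \<infinity>}
                / int_tail F x)
          \<longlongrightarrow> (\<Sum>j\<in>{1..N}. c j * \<pi> j)
                / (- (\<Sum>j\<in>{1..N}. \<pi> j * (\<integral>y. y \<partial>xi_dist Pr p Jc S U j)))) at_top"
proof -
  interpret R: mmrp N q lam p FC FCJ Pr Jc S U
    by (unfold_locales; fact rates_q rates_lam rates_pos premium claims_C claims_CJ prob meas law)
  have start: "mmrp_start N q lam p FC FCJ Pr Jc S U j" if "j \<in> {1..N}" for j by unfold_locales fact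
  have xi_int: "integrable (xi_dist Pr p Jc S U j) (\<lambda>u. u)" if "j \<in> {1..N}" for j using xi_mean that by blast
  have mean: "(\<integral>u. u \<partial>xi_dist Pr p Jc S U j) = (\<Sum>k\<in>{1..N}. R.P j k * (\<integral>u. u \<partial>R.HH j k))" if "j \<in> {1..N}" for j
    by (rule mmrp_start.xi_mean[OF start xi_int]) (use that in auto)
  \<comment> \<open>Positivity of the limiting denominator is derived here from the net profit
    condition at time 1.\<close>
  have drift: "0 < - (\<Sum>j\<in>{1..N}. \<pi> j * (\<integral>u. u \<partial>xi_dist Pr p Jc S U j))"
    by (rule R.positive_drift) (use xi_int net_profit stat_unique i_in in auto)
  interpret mw: modulated_walk F N "R.P" "R.HH" \<pi> c
  proof (intro modulated_walk.intro modulated_walk_axioms.intro)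
    show "subexponential_tail F" by (intro subexponential_tail.intro) fact+
  next
    fix j k assume j: "j \<in> {1..N}"
    show "(\<Sum>k\<in>{1..N}. R.P j k) = 1" by (rule R.P_sum[OF j])
    show "(\<Sum>k\<in>{1..N}. R.P j k * ccdf (R.HH j k) x) \<le> ccdf F x" for x
      unfolding mmrp_start.xi_ccdf[OF start[OF j], symmetric] using D1 j by blast
    show "((\<lambda>x. (\<Sum>k\<in>{1..N}. R.P j k * tail_integral (R.HH j k) x) / int_tail F x) \<longlongrightarrow> c j) at_top"
    proof (rule Lim_transform_eventually)
      show "((\<lambda>x. int_tail (xi_dist Pr p Jc S U j) x / int_tail F x) \<longlongrightarrow> c j) at_top" using D2 j by blast
      show "eventually (\<lambda>x. int_tail (xi_dist Pr p Jc S U j) x / int_tail F x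
        = (\<Sum>k\<in>{1..N}. R.P j k * tail_integral (R.HH j k) x) / int_tail F x) at_top"
        using mmrp_start.xi_int_tail[OF start[OF j] xi_int[OF j]] by eventually_elim simp
    qed
    assume k: "k \<in> {1..N}"
    show "0 \<le> R.P j k" by (rule R.P_nonneg[OF j k])
    show "real_distribution (R.HH j k)" by (rule mmrp_start.HH_dist[OF start[OF j] j k])
    show "integrable (R.HH j k) (\<lambda>u. u)" by (rule mmrp_start.HH_mean[OF start[OF j] xi_int[OF j] k])
  next
    show "stationary_dist N R.P \<pi>" by fact
    show "\<forall>j\<in>{1..N}. \<nu> j = \<pi> j" if "stationary_dist N R.P \<nu>" for \<nu> using stat_unique that by blast
    show "0 < - (\<Sum>j\<in>{1..N}. \<pi> j * (\<Sum>k\<in>{1..N}. R.P j k * (\<integral>u. u \<partial>R.HH j k)))"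
      using drift by (simp add: mean)
  qed
  interpret R: mmrp_start N q lam p FC FCJ Pr Jc S U i by (rule start[OF i_in])
  \<comment> \<open>The analytic recursion and the recursion for the skeleton coincide, so
    \<open>mw.Psi i x\<close> is the probability that the embedded walk ever exceeds
    \<open>x\<close>.\<close>
  have "mw.step = R.stp" by (intro ext) (simp add: mw.step_def R.stp_def)
  then have psi: "mw.psi n = (R.stp ^^ n) R.\<phi>0" for n by (induction n) (simp_all add: R.\<phi>0_def)
  have Psi: "R.prob {\<omega>\<in>space (Pr i). \<exists>k. x < R.W k \<omega>} = mw.Psi i x" for x
  proof (rule LIMSEQ_unique[OF R.walk_maximum_tendsto])
    have "R.prob {\<omega>\<in>space (Pr i). \<exists>k\<le>n. x < R.W k \<omega>} = mw.psi n i x" for n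
      unfolding psi by (rule R.walk_maximum_finite) (rule mw.ua_psi[unfolded psi])
    then show "(\<lambda>n. R.prob {\<omega>\<in>space (Pr i). \<exists>k\<le>n. x < R.W k \<omega>}) \<longlonglongrightarrow> mw.Psi i x"
      using mw.psi_tendsto[OF i_in] by simp
  qed
  have lim: "((\<lambda>x. mw.Psi i x / int_tail F x) \<longlongrightarrow> mw.CS / mw.abar) at_top"
    by (rule mw.walk_maximum_asymptotics[OF i_in])
  define h where "h = R.pmax * \<zeta>"
  have low: "((\<lambda>x. mw.Psi i (x + h) / int_tail F (x + h) * (int_tail F (x + h) / int_tail F x)) \<longlongrightarrow> mw.CS / mw.abar * 1) at_top"
  proof (rule tendsto_mult)
    have "filterlim (\<lambda>x::real. x + h) at_top at_top" by real_asymp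
    from filterlim_compose[OF lim this] show "((\<lambda>x. mw.Psi i (x + h) / int_tail F (x + h)) \<longlongrightarrow> mw.CS / mw.abar) at_top" .
    show "((\<lambda>x. int_tail F (x + h) / int_tail F x) \<longlongrightarrow> 1) at_top" by (rule mw.G_long_tailed)
  qed
  have "((\<lambda>x. R.prob {\<omega> \<in> space (Pr i). tau_zeta p Jc S U \<zeta> x \<omega> < \<infinity>} / int_tail F x) \<longlongrightarrow> mw.CS / mw.abar) at_top"
  proof (rule tendsto_sandwich[OF _ _ _ lim])
    show "((\<lambda>x. mw.Psi i (x + h) / int_tail F x) \<longlongrightarrow> mw.CS / mw.abar) at_top"
      using low mw.G_pos by (simp add: less_imp_neq[symmetric])
    show "eventually (\<lambda>x. mw.Psi i (x + h) / int_tail F x \<le> R.prob {\<omega> \<in> space (Pr i). tau_zeta p Jc S U \<zeta> x \<omega> < \<infinity>} / int_tail F x) at_top"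
      unfolding Psi[symmetric] h_def by (intro always_eventually allI divide_right_mono R.ruin_sandwich(2) zeta_pos mw.G_nonneg)
    show "eventually (\<lambda>x. R.prob {\<omega> \<in> space (Pr i). tau_zeta p Jc S U \<zeta> x \<omega> < \<infinity>} / int_tail F x \<le> mw.Psi i x / int_tail F x) at_top"
      unfolding Psi[symmetric] by (intro always_eventually allI divide_right_mono R.ruin_sandwich(1) zeta_pos mw.G_nonneg)
  qed
  then show ?thesis by (simp add: mw.CS_def mw.abar_def mean)
qed

end
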